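(* Assume the regularity and growth conditions (A1)–(A5) and the convexity condition (B) listed in the context. Suppose that there exists at most one solution to the mean-field control (MFC) problem (i.e. at most one minimizer of $J$ over $\mathcal B$, up to indistinguishability). Then there exists at most one solution $(\xi^*,\mu^* )$ to the potential mean-field game.
   Context: **Measures.** $\mathcal P_2(\mathbb R^n)$ is the set of probability measures on $\mathbb R^n$ with finite second moment, with the 2-Wasserstein topology. $\mathcal M([0,T];\mathcal P_2(\mathbb R^n))$ is the set of measurable maps $\mu:[0,T]\to\mathcal P_2(\mathbb R^n)$. A continuous $\phi:\mathcal P_2(\mathbb R^n)\to\mathbb R$ is *linearly differentiable* if there is $\delta_\mu\phi:\mathcal P_2(\mathbb R^n)\times\mathbb R^n\to\mathbb R$, jointly continuous and of at most quadratic growth in $y$ uniformly for $\mu$ in bounded subsets of $\mathcal P_2(\mathbb R^n)$, with $$\phi(\mu)-\phi(\nu)=\int_0^1\int_{\mathbb R^n}\delta_\mu\phi(t\mu+(1-t)\nu)(y)\,(\mu-\nu)(dy)\,dt .$$ $\phi$ is *L-differentiable* at $\mu_0$ if there is a measurable $\partial_\mu\phi(\mu_0):\mathbb R^n\to\mathbb R^n$ such that for all $\mu\in\mathcal P_2(\mathbb R^n)$, any atomless Polish probability space $(\tilde\Omega,\tilde{\mathcal F},\tilde{\mathbb P})$ and random variables $\tilde X_0\sim\mu_0$, $\tilde X\sim\mu$ on it, $\phi(\mu)-\phi(\mu_0)=\tilde{\mathbb E}[\partial_\mu\phi(\mu_0)(\tilde X_0)\cdot(\tilde X-\tilde X_0)]+o(\|\tilde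 X-\tilde X_0\|_{L^2})$. Under (A5) below, $C$ and $G$ are L-differentiable in $\mu$ with $\partial_\mu C(t,x,\mu)(y)=\partial_y\delta_\mu C(t,x,\mu)(y)$ and $\partial_\mu G(x,\mu)(y)=\partial_y\delta_\mu G(x,\mu)(y)$. A function $\phi:\mathbb R^n\times\mathcal P_2(\mathbb R^n)\to\mathbb R$ is *L-jointly convex* if for all $(x,\mu),(x',\mu')$, $$\phi(x,\mu)-\phi(x',\mu')\le\partial_x\phi(x,\mu)(x-x')+\tilde{\mathbb E}\big[\partial_\mu\phi(x,\mu)(\tilde X)\cdot(\tilde X-\tilde X')\big]$$ for any atomless Polish probability space and random variables $\tilde X\sim\mu$, $\tilde X'\sim\mu'$ on it. **Setting.** $T>0$; $n,d,m\ge1$ integers; $(\Omega,\mathcal F,\mathbb F,\mathbb P)$ is a complete filtered probability space satisfying the usual conditions, carrying a $d$-dimensional $\mathbb F$-Brownian motion $W$. $\mathcal B$ is the set of admissible controls: processes $\xi:[0,T]\times\Omega\to[0,\infty)^m$ whose components are $\mathbb F$-adapted, non-decreasing, càdlàg, with $\xi_{0-}=0$ a.s., and $\mathbb E[|\xi_T|^2]<\infty$. $b:[0,T]\times\mathbb R^n\to\mathbb R^n$, $\sigma:[0,T]\times\mathbb R^n\to\mathbb R^{n\times d}$, $\zeta:[0,T]\to\mathbb R^{n\times m}$, $C:[0,T]\times\mathbb R^n\times\mathcal P_2(\mathbb R^n)\to\mathbb R$, $G:\mathbb R^n\times\mathcal P_2(\mathbb R^n)\to\mathbb R$ are measurable,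 and $K:[0,T]\to[0,\infty)^m$ is continuous. For $\xi\in\mathcal B$, $X^\xi$ solves $$dX^\xi_t=b(t,X^\xi_t)\,dt+\sigma(t,X^\xi_t)\,dW_t+\zeta(t)\,d\xi_t,\qquad X^\xi_{0-}=x_0\in\mathbb R^n .$$ Integrals $\int_0^T\cdot\,d\xi_t$ are over the closed interval $[0,T]$ (jumps at $0$ and $T$ are included); $\mathcal L(\cdot)$ denotes law. **MFC problem:** minimize over $\xi\in\mathcal B$ $$J(\xi)=\mathbb E\Big[\int_0^TC(t,X^\xi_t,\mathcal L(X^\xi_t))\,dt+G(X^\xi_T,\mathcal L(X^\xi_T))+\int_0^TK(t)\,d\xi_t\Big].$$ **Potential MFG:** put $c(t,x,\mu)=C(t,x,\mu)+\int_{\mathbb R^n}\delta_\mu C(t,\tilde x,\mu)(x)\,\mu(d\tilde x)$, $g(x,\mu)=G(x,\mu)+\int_{\mathbb R^n}\delta_\mu G(\tilde x,\mu)(x)\,\mu(d\tilde x)$, and for $\mu\in\mathcal M([0,T];\mathcal P_2(\mathbb R^n))$ $$J_g(\xi,\mu)=\mathbb E\Big[\int_0^Tc(t,X^\xi_t,\mu_t)\,dt+g(X^\xi_T,\mu_T)+\int_0^TK(t)\,d\xi_t\Big].$$ A *solution to the potential MFG* is a pair $(\xi^*,\mu^* )\in\mathcal B\times\mathcal M([0,T];\mathcal P_2(\mathbb R^n))$ with (i) $J_g(\xi^*,\mu^* )\le J_g(\xi,\mu^* )$ for all $\xi\in\mathcal B$, and (ii) $\mu^*_t=\mathcal L(X^{\xi^*}_t)$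 for $t\in[0,T]$. Controls are identified when indistinguishable. **Hamiltonian:** $H(t,x,\mu,p,q)=b(t,x)\cdot p+\operatorname{Tr}(\sigma(t,x)^\top q)+C(t,x,\mu)$ for $p\in\mathbb R^n$, $q\in\mathbb R^{n\times d}$. **Assumptions.** (A1) $b,\sigma$ are Lipschitz in $x$ uniformly in $t\in[0,T]$. (A2) $\zeta$ is continuous. (A3) $\mu\mapsto C(t,x,\mu)$ and $\mu\mapsto G(x,\mu)$ are linearly differentiable with jointly continuous linear derivatives. (A4) $C,G,\delta_\mu C,\delta_\mu G$ are jointly continuous and, for some $\kappa>0$, $|C(t,x,\mu)|+|G(x,\mu)|+|\delta_\mu C(t,x,\mu)(y)|+|\delta_\mu G(x,\mu)(y)|\le\kappa\big(1+|x|^2+\int|z|^2\mu(dz)+|y|^2\big)$. (A5) $\partial_xC,\partial_xG,\partial_y\delta_\mu C,\partial_y\delta_\mu G$ exist, are jointly continuous, and $|\partial_xC(t,x,\mu)|+|\partial_xG(x,\mu)|+|\partial_y\delta_\mu C(t,x,\mu)(y)|+|\partial_y\delta_\mu G(x,\mu)(y)|\le\kappa\big(1+|x|+(\int|z|^2\mu(dz))^{1/2}+|y|\big)$. (B) For every $(t,p,q)\in[0,T]\times\mathbb R^n\times\mathbb R^{n\times d}$, the maps $(x,\mu)\mapsto G(x,\mu)$ and $(x,\mu)\mapsto H(t,x,\mu,p,q)$ are L-jointly convex. *)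

theory Defs
  imports "HOL-Probability.Probability"
begin

section \<open>The Wasserstein space of order two\<close>

definition P2 :: "(real^'n) measure set" where
  "P2 = {\<mu>. prob_space \<mu> \<and> sets \<mu> = sets borel \<and> integrable \<mu> (\<lambda>x. (norm x)\<^sup>2)}"

definition couplings ::
  "(real^'n) measure \<Rightarrow> (real^'n) measure \<Rightarrow> ((real^'n) \<times> (real^'n)) measure set" where
  "couplings \<mu> \<nu> = {\<pi>. prob_space \<pi> \<and> sets \<pi> = sets borel \<and>
     distr \<pi> borel fst = \<mu> \<and> distr \<pi> borel snd = \<nu>}"

definition w2 :: "(real^'n) measure \<Rightarrow> (real^'n) measure \<Rightarrow> real" where
  "w2 \<mu> \<nu> = sqrt (INF \<pi>\<in>couplings \<mu> \<nu>. LINT z|\<pi>. (norm (fst z - snd z))\<^sup>2)"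

text \<open>The metric topology of \<open>w2\<close>, written out so that it is available without the
  triangle inequality for \<open>w2\<close>.\<close>

definition P2_open :: "(real^'n) measure set \<Rightarrow> bool" where
  "P2_open U \<longleftrightarrow> U \<subseteq> P2 \<and> (\<forall>\<mu>\<in>U. \<exists>r>0. \<forall>\<nu>\<in>P2. w2 \<mu> \<nu> < r \<longrightarrow> \<nu> \<in> U)"

definition P2_topology :: "(real^'n) measure topology" where
  "P2_topology = topology P2_open"

lemma istopology_P2_open: "istopology P2_open"
  unfolding istopology_def
proof (intro conjI allI impI)
  fix S T :: "(real^'n) measure set"
  assume S: "P2_open S" and T: "P2_open T"
  show "P2_open (S \<inter> T)"
    unfolding P2_open_def
  proof (intro conjI ballI)
    show "S \<inter> T \<subseteq> P2" using S by (auto simp: P2_open_def)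
    fix \<mu> assume "\<mu> \<in> S \<inter> T"
    then obtain r s where "r > 0" "\<forall>\<nu>\<in>P2. w2 \<mu> \<nu> < r \<longrightarrow> \<nu> \<in> S"
      "s > 0" "\<forall>\<nu>\<in>P2. w2 \<mu> \<nu> < s \<longrightarrow> \<nu> \<in> T"
      using S T unfolding P2_open_def by (metis IntE)
    then show "\<exists>r>0. \<forall>\<nu>\<in>P2. w2 \<mu> \<nu> < r \<longrightarrow> \<nu> \<in> S \<inter> T"
      by (intro exI[of _ "min r s"]) auto
  qed
next
  fix \<K> :: "(real^'n) measure set set"
  assume *: "\<forall>K\<in>\<K>. P2_open K"
  show "P2_open (\<Union>\<K>)"
    unfolding P2_open_def
  proof (intro conjI ballI)
    show "\<Union>\<K> \<subseteq> P2" using * by (auto simp: P2_open_def)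
    fix \<mu> assume "\<mu> \<in> \<Union>\<K>"
    then obtain K where K: "K \<in> \<K>" "\<mu> \<in> K" by blast
    then obtain r where "r > 0" "\<forall>\<nu>\<in>P2. w2 \<mu> \<nu> < r \<longrightarrow> \<nu> \<in> K"
      using * unfolding P2_open_def by blast
    then show "\<exists>r>0. \<forall>\<nu>\<in>P2. w2 \<mu> \<nu> < r \<longrightarrow> \<nu> \<in> \<Union>\<K>"
      using K by blast
  qed
qed

lemma openin_P2_topology: "openin P2_topology U \<longleftrightarrow> P2_open U"
  by (simp add: P2_topology_def istopology_P2_open topology_inverse')

lemma topspace_P2_topology: "topspace P2_topology = P2"
proof -
  have "P2_open (P2 :: (real^'n) measure set)"
    unfolding P2_open_def using zero_less_one by blast
  then show "topspace P2_topology = (P2 :: (real^'n) measure set)"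
    unfolding topspace_def openin_P2_topology by (auto simp: P2_open_def)
qed

definition P2_borel :: "(real^'n) measure measure" where
  "P2_borel = sigma P2 {U. openin P2_topology U}"

definition measure_flows :: "real \<Rightarrow> (real \<Rightarrow> (real^'n) measure) set" where
  "measure_flows T = restrict_space borel {0..T} \<rightarrow>\<^sub>M P2_borel"

section \<open>Differentiability and convexity on the Wasserstein space\<close>

definition mixture ::
  "real \<Rightarrow> (real^'n) measure \<Rightarrow> (real^'n) measure \<Rightarrow> (real^'n) measure" where
  "mixture t \<mu> \<nu> = measure_of UNIV (sets borel)
     (\<lambda>A. ennreal t * emeasure \<mu> A + ennreal (1 - t) * emeasure \<nu> A)"

definition linear_derivative ::
  "((real^'n) measure \<Rightarrow> real) \<Rightarrow> ((real^'n) measure \<Rightarrow> real^'n \<Rightarrow> real) \<Rightarrow> bool" where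
  "linear_derivative \<phi> d\<phi> \<longleftrightarrow>
     continuous_map P2_topology euclideanreal \<phi> \<and>
     continuous_map (prod_topology P2_topology euclidean) euclideanreal (\<lambda>(\<mu>, y). d\<phi> \<mu> y) \<and>
     (\<forall>B\<subseteq>P2. (\<exists>r. \<forall>\<mu>\<in>B. \<forall>\<nu>\<in>B. w2 \<mu> \<nu> \<le> r) \<longrightarrow>
        (\<exists>k. \<forall>\<mu>\<in>B. \<forall>y. \<bar>d\<phi> \<mu> y\<bar> \<le> k * (1 + (norm y)\<^sup>2))) \<and>
     (\<forall>\<mu>\<in>P2. \<forall>\<nu>\<in>P2. \<phi> \<mu> - \<phi> \<nu> =
        (LINT t:{0..1}|lborel. (LINT y|\<mu>. d\<phi> (mixture t \<mu> \<nu>) y) -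
                               (LINT y|\<nu>. d\<phi> (mixture t \<mu> \<nu>) y)))"

text \<open>Every Polish space is homeomorphic to one whose points are real sequences, so
  the Polish topologies on subsets of \<open>nat \<Rightarrow> real\<close> represent all Polish spaces.\<close>

definition atomless_polish_prob :: "(nat \<Rightarrow> real) measure \<Rightarrow> bool" where
  "atomless_polish_prob P \<longleftrightarrow> prob_space P \<and>
     (\<exists>S. completely_metrizable_space S \<and> second_countable S \<and>
        space P = topspace S \<and> sets P = sigma_sets (topspace S) {U. openin S U}) \<and>
     (\<forall>A\<in>sets P. measure P A > 0 \<longrightarrow>
        (\<exists>B\<in>sets P. B \<subseteq> A \<and> 0 < measure P B \<and> measure P B < measure P A))"

text \<open>The remainder is small uniformly over the probability spaces and the random variables.\<close>

definition L_derivative ::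
  "((real^'n) measure \<Rightarrow> real) \<Rightarrow> (real^'n) measure \<Rightarrow> (real^'n \<Rightarrow> real^'n) \<Rightarrow> bool" where
  "L_derivative \<phi> \<mu>0 D \<longleftrightarrow> D \<in> borel_measurable borel \<and>
     (\<forall>\<epsilon>>0. \<exists>\<delta>>0. \<forall>\<mu>\<in>P2. \<forall>P X0 X.
        atomless_polish_prob P \<longrightarrow>
        X0 \<in> borel_measurable P \<longrightarrow> X \<in> borel_measurable P \<longrightarrow>
        distr P borel X0 = \<mu>0 \<longrightarrow> distr P borel X = \<mu> \<longrightarrow>
        integrable P (\<lambda>\<omega>. D (X0 \<omega>) \<bullet> (X \<omega> - X0 \<omega>)) \<and>
        (sqrt (LINT \<omega>|P. (norm (X \<omega> - X0 \<omega>))\<^sup>2) \<le> \<delta> \<longrightarrow>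
          \<bar>\<phi> \<mu> - \<phi> \<mu>0 - (LINT \<omega>|P. D (X0 \<omega>) \<bullet> (X \<omega> - X0 \<omega>))\<bar>
            \<le> \<epsilon> * sqrt (LINT \<omega>|P. (norm (X \<omega> - X0 \<omega>))\<^sup>2)))"

text \<open>The gradient in \<open>x\<close> is unique and the L-derivative at \<open>\<mu>\<close> is unique \<open>\<mu>\<close>-almost
  everywhere, so the choice of \<open>Dx\<close> and \<open>D\<mu>\<close> is immaterial.\<close>

definition L_jointly_convex :: "(real^'n \<Rightarrow> (real^'n) measure \<Rightarrow> real) \<Rightarrow> bool" where
  "L_jointly_convex \<phi> \<longleftrightarrow> (\<exists>Dx D\<mu>.
     (\<forall>x. \<forall>\<mu>\<in>P2. GDERIV (\<lambda>z. \<phi> z \<mu>) x :> Dx x \<mu> \<and> L_derivative (\<phi> x) \<mu> (D\<mu> x \<mu>)) \<and>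
     (\<forall>x x'. \<forall>\<mu>\<in>P2. \<forall>\<mu>'\<in>P2. \<forall>P X X'.
        atomless_polish_prob P \<longrightarrow>
        X \<in> borel_measurable P \<longrightarrow> X' \<in> borel_measurable P \<longrightarrow>
        distr P borel X = \<mu> \<longrightarrow> distr P borel X' = \<mu>' \<longrightarrow>
        \<phi> x \<mu> - \<phi> x' \<mu>' \<le>
          Dx x \<mu> \<bullet> (x - x') + (LINT \<omega>|P. D\<mu> x \<mu> (X \<omega>) \<bullet> (X \<omega> - X' \<omega>))))"

section \<open>Filtered probability space and stochastic integral\<close>

definition usual_filtered_space :: "'w measure \<Rightarrow> real \<Rightarrow> (real \<Rightarrow> 'w measure) \<Rightarrow> bool" where
  "usual_filtered_space M T F \<longleftrightarrow> prob_space M \<and> complete_measure M \<and>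
     (\<forall>t\<in>{0..T}. subalgebra M (F t)) \<and>
     (\<forall>s\<in>{0..T}. \<forall>t\<in>{s..T}. sets (F s) \<subseteq> sets (F t)) \<and>
     (\<forall>t\<in>{0..<T}. sets (F t) = (\<Inter>u\<in>{t<..T}. sets (F u))) \<and>
     null_sets M \<subseteq> sets (F 0)"

definition adapted :: "real \<Rightarrow> (real \<Rightarrow> 'w measure) \<Rightarrow> (real \<Rightarrow> 'w \<Rightarrow> 'a::topological_space) \<Rightarrow> bool" where
  "adapted T F Y \<longleftrightarrow> (\<forall>t\<in>{0..T}. Y t \<in> borel_measurable (F t))"

definition progressive :: "real \<Rightarrow> (real \<Rightarrow> 'w measure) \<Rightarrow> (real \<Rightarrow> 'w \<Rightarrow> 'a::topological_space) \<Rightarrow> bool" where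
  "progressive T F Y \<longleftrightarrow>
     (\<forall>t\<in>{0..T}. (\<lambda>(s, \<omega>). Y s \<omega>) \<in> borel_measurable (restrict_space borel {0..t} \<Otimes>\<^sub>M F t))"

definition cadlag :: "real \<Rightarrow> (real \<Rightarrow> 'a::topological_space) \<Rightarrow> bool" where
  "cadlag T f \<longleftrightarrow> (\<forall>t\<in>{0..<T}. (f \<longlongrightarrow> f t) (at_right t)) \<and>
     (\<forall>t\<in>{0<..T}. \<exists>l. (f \<longlongrightarrow> l) (at_left t))"

definition indistinguishable ::
  "'w measure \<Rightarrow> real \<Rightarrow> (real \<Rightarrow> 'w \<Rightarrow> 'a) \<Rightarrow> (real \<Rightarrow> 'w \<Rightarrow> 'a) \<Rightarrow> bool" where
  "indistinguishable M T Y Z \<longleftrightarrow> (AE \<omega> in M. \<forall>t\<in>{0..T}. Y t \<omega> = Z t \<omega>)"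

definition brownian_motion ::
  "'w measure \<Rightarrow> real \<Rightarrow> (real \<Rightarrow> 'w measure) \<Rightarrow> (real \<Rightarrow> 'w \<Rightarrow> real^'d) \<Rightarrow> bool" where
  "brownian_motion M T F W \<longleftrightarrow> adapted T F W \<and>
     (AE \<omega> in M. W 0 \<omega> = 0) \<and>
     (AE \<omega> in M. continuous_on {0..T} (\<lambda>t. W t \<omega>)) \<and>
     (\<forall>s t. 0 \<le> s \<and> s < t \<and> t \<le> T \<longrightarrow>
        distributed M lborel (\<lambda>\<omega>. W t \<omega> - W s \<omega>)
          (\<lambda>x. ennreal (\<Prod>i\<in>UNIV. normal_density 0 (sqrt (t - s)) (x $ i))) \<and>
        prob_space.indep_set M (sets (F s))
          {(\<lambda>\<omega>. W t \<omega> - W s \<omega>) -` A \<inter> space M |A. A \<in> sets borel})"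

text \<open>An elementary integrand is \<open>\<Sum>k<N. A k\<close> on the interval \<open>{\<tau> k<..\<tau> (Suc k)}\<close>.\<close>

definition elementary_data ::
  "'w measure \<Rightarrow> real \<Rightarrow> (real \<Rightarrow> 'w measure) \<Rightarrow> nat \<Rightarrow> (nat \<Rightarrow> real) \<Rightarrow>
   (nat \<Rightarrow> 'w \<Rightarrow> real^'d^'n) \<Rightarrow> bool" where
  "elementary_data M T F N \<tau> A \<longleftrightarrow>
     (\<forall>k\<le>N. \<tau> k \<in> {0..T}) \<and> (\<forall>k<N. \<tau> k \<le> \<tau> (Suc k)) \<and>
     (\<forall>k<N. A k \<in> borel_measurable (F (\<tau> k)) \<and> (\<exists>B. \<forall>\<omega>\<in>space M. norm (A k \<omega>) \<le> B))"

definition elementary_integrand ::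
  "nat \<Rightarrow> (nat \<Rightarrow> real) \<Rightarrow> (nat \<Rightarrow> 'w \<Rightarrow> real^'d^'n) \<Rightarrow> real \<Rightarrow> 'w \<Rightarrow> real^'d^'n" where
  "elementary_integrand N \<tau> A s \<omega> = (\<Sum>k<N. indicat_real {\<tau> k<..\<tau> (Suc k)} s *\<^sub>R A k \<omega>)"

definition elementary_integral ::
  "(real \<Rightarrow> 'w \<Rightarrow> real^'d) \<Rightarrow> nat \<Rightarrow> (nat \<Rightarrow> real) \<Rightarrow> (nat \<Rightarrow> 'w \<Rightarrow> real^'d^'n) \<Rightarrow>
   real \<Rightarrow> 'w \<Rightarrow> real^'n" where
  "elementary_integral W N \<tau> A t \<omega> =
     (\<Sum>k<N. A k \<omega> *v (W (min (\<tau> (Suc k)) t) \<omega> - W (min (\<tau> k) t) \<omega>))"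

text \<open>\<open>I\<close> is a continuous version of the Ito integral process of the progressively measurable
  integrand \<open>H\<close>, \<open>E (\<integral>\<^sub>0\<^sup>T |H|\<^sup>2 ds) < \<infinity>\<close>, obtained as the mean-square limit of elementary
  integrals. The norm on matrices is the Frobenius norm.\<close>

definition ito_integral ::
  "'w measure \<Rightarrow> real \<Rightarrow> (real \<Rightarrow> 'w measure) \<Rightarrow> (real \<Rightarrow> 'w \<Rightarrow> real^'d) \<Rightarrow>
   (real \<Rightarrow> 'w \<Rightarrow> real^'d^'n) \<Rightarrow> (real \<Rightarrow> 'w \<Rightarrow> real^'n) \<Rightarrow> bool" where
  "ito_integral M T F W H I \<longleftrightarrow>
     progressive T F H \<and>
     (\<integral>\<^sup>+\<omega>. (\<integral>\<^sup>+s\<in>{0..T}. ennreal ((norm (H s \<omega>))\<^sup>2) \<partial>lborel) \<partial>M) < \<infinity> \<and>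
     adapted T F I \<and> (AE \<omega> in M. continuous_on {0..T} (\<lambda>t. I t \<omega>)) \<and>
     (\<exists>N \<tau> A. (\<forall>j. elementary_data M T F (N j) (\<tau> j) (A j)) \<and>
        (\<lambda>j::nat. \<integral>\<^sup>+\<omega>. (\<integral>\<^sup>+s\<in>{0..T}.
             ennreal ((norm (elementary_integrand (N j) (\<tau> j) (A j) s \<omega> - H s \<omega>))\<^sup>2)
             \<partial>lborel) \<partial>M) \<longlonglongrightarrow> 0 \<and>
        (\<forall>t\<in>{0..T}. (\<lambda>j. \<integral>\<^sup>+\<omega>.
             ennreal ((norm (elementary_integral W (N j) (\<tau> j) (A j) t \<omega> - I t \<omega>))\<^sup>2)
             \<partial>M) \<longlonglongrightarrow> 0))"

section \<open>Singular controls and the state equation\<close>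

text \<open>Processes on \<open>{0..T}\<close> are functions on all reals whose values outside \<open>{0..T}\<close> are
  never used. The convention \<open>\<xi>\<^bsub>0-\<^esub> = 0\<close> enters through the extension by \<open>0\<close> to
  negative times in \<open>control_measure\<close>, which thus has mass \<open>\<xi> 0\<close> at time \<open>0\<close>.\<close>

definition admissible ::
  "'w measure \<Rightarrow> real \<Rightarrow> (real \<Rightarrow> 'w measure) \<Rightarrow> (real \<Rightarrow> 'w \<Rightarrow> real^'m) set" where
  "admissible M T F = {\<xi>. adapted T F \<xi> \<and>
     (\<forall>\<omega>\<in>space M. \<forall>j. (\<forall>t\<in>{0..T}. 0 \<le> \<xi> t \<omega> $ j) \<and>
        mono_on {0..T} (\<lambda>t. \<xi> t \<omega> $ j) \<and> cadlag T (\<lambda>t. \<xi> t \<omega> $ j)) \<and>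
     integrable M (\<lambda>\<omega>. (norm (\<xi> T \<omega>))\<^sup>2)}"

definition control_measure :: "real \<Rightarrow> (real \<Rightarrow> real^'m) \<Rightarrow> 'm \<Rightarrow> real measure" where
  "control_measure T \<eta> j = interval_measure (\<lambda>s. if s < 0 then 0 else \<eta> (min s T) $ j)"

definition control_integral ::
  "real \<Rightarrow> (real \<Rightarrow> real^'m) \<Rightarrow> (real \<Rightarrow> real^'m) \<Rightarrow> real \<Rightarrow> real" where
  "control_integral T f \<eta> t = (\<Sum>j\<in>UNIV. LINT s:{0..t}|control_measure T \<eta> j. f s $ j)"

text \<open>Strong solutions in the mean-square sense. For Lipschitz \<open>b\<close>, \<open>\<sigma>\<close>, continuous \<open>\<zeta>\<close> and admissible
  \<open>\<xi>\<close>, every strong solution has square-integrable \<open>\<sigma> s (X s)\<close>, so the restriction of the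
  stochastic integral to such integrands excludes no solution.\<close>

definition sde_solution ::
  "'w measure \<Rightarrow> real \<Rightarrow> (real \<Rightarrow> 'w measure) \<Rightarrow> (real \<Rightarrow> 'w \<Rightarrow> real^'d) \<Rightarrow>
   (real \<Rightarrow> real^'n \<Rightarrow> real^'n) \<Rightarrow> (real \<Rightarrow> real^'n \<Rightarrow> real^'d^'n) \<Rightarrow> (real \<Rightarrow> real^'m^'n) \<Rightarrow>
   real^'n \<Rightarrow> (real \<Rightarrow> 'w \<Rightarrow> real^'m) \<Rightarrow> (real \<Rightarrow> 'w \<Rightarrow> real^'n) \<Rightarrow> bool" where
  "sde_solution M T F W b \<sigma> \<zeta> x0 \<xi> X \<longleftrightarrow>
     adapted T F X \<and> (\<forall>\<omega>\<in>space M. cadlag T (\<lambda>t. X t \<omega>)) \<and>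
     (AE \<omega> in M. set_integrable lborel {0..T} (\<lambda>s. b s (X s \<omega>))) \<and>
     (\<exists>I. ito_integral M T F W (\<lambda>s \<omega>. \<sigma> s (X s \<omega>)) I \<and>
        (AE \<omega> in M. \<forall>t\<in>{0..T}.
           X t \<omega> = x0 + (LINT s:{0..t}|lborel. b s (X s \<omega>)) + I t \<omega>
             + (\<chi> i. control_integral T (\<lambda>s. \<zeta> s $ i) (\<lambda>s. \<xi> s \<omega>) t)))"

section \<open>The control problem and the game\<close>

definition hamiltonian ::
  "(real \<Rightarrow> real^'n \<Rightarrow> real^'n) \<Rightarrow> (real \<Rightarrow> real^'n \<Rightarrow> real^'d^'n) \<Rightarrow>
   (real \<Rightarrow> real^'n \<Rightarrow> (real^'n) measure \<Rightarrow> real) \<Rightarrow>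
   real \<Rightarrow> real^'n \<Rightarrow> (real^'n) measure \<Rightarrow> real^'n \<Rightarrow> real^'d^'n \<Rightarrow> real" where
  "hamiltonian b \<sigma> C t x \<mu> p q = b t x \<bullet> p + trace (transpose (\<sigma> t x) ** q) + C t x \<mu>"

definition law :: "'w measure \<Rightarrow> ('w \<Rightarrow> real^'n) \<Rightarrow> (real^'n) measure" where
  "law M Y = distr M borel Y"

text \<open>\<open>X \<xi>\<close> is the state process controlled by \<open>\<xi>\<close>.\<close>

definition cost ::
  "'w measure \<Rightarrow> real \<Rightarrow> ((real \<Rightarrow> 'w \<Rightarrow> real^'m) \<Rightarrow> real \<Rightarrow> 'w \<Rightarrow> real^'n) \<Rightarrow>
   (real \<Rightarrow> real^'n \<Rightarrow> (real^'n) measure \<Rightarrow> real) \<Rightarrow> (real^'n \<Rightarrow> (real^'n) measure \<Rightarrow> real) \<Rightarrow>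
   (real \<Rightarrow> real^'m) \<Rightarrow> (real \<Rightarrow> 'w \<Rightarrow> real^'m) \<Rightarrow> (real \<Rightarrow> (real^'n) measure) \<Rightarrow> real" where
  "cost M T X c g K \<xi> \<mu> =
     (LINT \<omega>|M. (LINT t:{0..T}|lborel. c t (X \<xi> t \<omega>) (\<mu> t)) + g (X \<xi> T \<omega>) (\<mu> T)
        + control_integral T K (\<lambda>s. \<xi> s \<omega>) T)"

definition mfc_cost ::
  "'w measure \<Rightarrow> real \<Rightarrow> ((real \<Rightarrow> 'w \<Rightarrow> real^'m) \<Rightarrow> real \<Rightarrow> 'w \<Rightarrow> real^'n) \<Rightarrow>
   (real \<Rightarrow> real^'n \<Rightarrow> (real^'n) measure \<Rightarrow> real) \<Rightarrow> (real^'n \<Rightarrow> (real^'n) measure \<Rightarrow> real) \<Rightarrow>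
   (real \<Rightarrow> real^'m) \<Rightarrow> (real \<Rightarrow> 'w \<Rightarrow> real^'m) \<Rightarrow> real" where
  "mfc_cost M T X C G K \<xi> = cost M T X C G K \<xi> (\<lambda>t. law M (X \<xi> t))"

definition mfc_solution ::
  "'w measure \<Rightarrow> real \<Rightarrow> (real \<Rightarrow> 'w measure) \<Rightarrow>
   ((real \<Rightarrow> 'w \<Rightarrow> real^'m) \<Rightarrow> real \<Rightarrow> 'w \<Rightarrow> real^'n) \<Rightarrow>
   (real \<Rightarrow> real^'n \<Rightarrow> (real^'n) measure \<Rightarrow> real) \<Rightarrow> (real^'n \<Rightarrow> (real^'n) measure \<Rightarrow> real) \<Rightarrow>
   (real \<Rightarrow> real^'m) \<Rightarrow> (real \<Rightarrow> 'w \<Rightarrow> real^'m) \<Rightarrow> bool" where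
  "mfc_solution M T F X C G K \<xi> \<longleftrightarrow> \<xi> \<in> admissible M T F \<and>
     (\<forall>\<eta>\<in>admissible M T F. mfc_cost M T X C G K \<xi> \<le> mfc_cost M T X C G K \<eta>)"

definition potential_cost ::
  "(real^'n \<Rightarrow> (real^'n) measure \<Rightarrow> real) \<Rightarrow> (real^'n \<Rightarrow> (real^'n) measure \<Rightarrow> real^'n \<Rightarrow> real) \<Rightarrow>
   real^'n \<Rightarrow> (real^'n) measure \<Rightarrow> real" where
  "potential_cost \<phi> d\<phi> x \<mu> = \<phi> x \<mu> + (LINT z|\<mu>. d\<phi> z \<mu> x)"

definition potential_mfg_solution ::
  "'w measure \<Rightarrow> real \<Rightarrow> (real \<Rightarrow> 'w measure) \<Rightarrow>
   ((real \<Rightarrow> 'w \<Rightarrow> real^'m) \<Rightarrow> real \<Rightarrow> 'w \<Rightarrow> real^'n) \<Rightarrow>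
   (real \<Rightarrow> real^'n \<Rightarrow> (real^'n) measure \<Rightarrow> real) \<Rightarrow>
   (real \<Rightarrow> real^'n \<Rightarrow> (real^'n) measure \<Rightarrow> real^'n \<Rightarrow> real) \<Rightarrow>
   (real^'n \<Rightarrow> (real^'n) measure \<Rightarrow> real) \<Rightarrow> (real^'n \<Rightarrow> (real^'n) measure \<Rightarrow> real^'n \<Rightarrow> real) \<Rightarrow>
   (real \<Rightarrow> real^'m) \<Rightarrow> (real \<Rightarrow> 'w \<Rightarrow> real^'m) \<Rightarrow> (real \<Rightarrow> (real^'n) measure) \<Rightarrow> bool" where
  "potential_mfg_solution M T F X C dC G dG K \<xi> \<mu> \<longleftrightarrow>
     \<xi> \<in> admissible M T F \<and> \<mu> \<in> measure_flows T \<and>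
     (\<forall>\<eta>\<in>admissible M T F.
        cost M T X (\<lambda>t. potential_cost (C t) (dC t)) (potential_cost G dG) K \<xi> \<mu>
        \<le> cost M T X (\<lambda>t. potential_cost (C t) (dC t)) (potential_cost G dG) K \<eta> \<mu>) \<and>
     (\<forall>t\<in>{0..T}. \<mu> t = law M (X \<xi> t))"

end

theory Submission
  imports Defs
begin

text \<open>Taking large multiples of \<open>p\<close> and \<open>q\<close> in the convexity of the Hamiltonian shows that \<open>b\<close> and
  \<open>\<sigma>\<close> are affine in \<open>x\<close>; by uniqueness for the state equation, the state is then affine in the
  control. The integrand of the game is the first variation of the control problem: the derivative at
  \<open>\<xi>\<close> of the game cost with frozen flow \<open>law M (X \<xi> t)\<close> in the direction of another control is
  the derivative of the expected costs \<open>E C (X\<^sub>t, law X\<^sub>t)\<close> and \<open>E G (X\<^sub>T, law X\<^sub>T)\<close>. Joint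
  convexity turns its nonnegativity at an equilibrium into global optimality for the control problem.
  So the control of an equilibrium is unique, and by uniqueness of the state so is its flow.\<close>

section \<open>A mean-square bound for the Ito integral\<close>

text \<open>The game cost is a first variation because of a symmetry. The derivative of E
  \<open>\<phi>\<close>(X, law X) in a direction Z is E \<open>Dx\<close>(X) . Z plus a mean over
  two independent copies of \<open>Dy\<close>(X')(X) . Z, where X' fills the state argument. The
  summand that \<open>potential_cost\<close> adds to \<open>\<phi>\<close> is the one whose gradient
  yields this second mean; Fubini matches it with the law term of the convexity inequality. Two
  obstacles shape the rest. The convexity condition carries an L-derivative that is only an
  existential witness, tested on atomless Polish spaces, while the states live on \<open>M\<close>:
  joint laws are moved to a space of sequences, and convexity itself compares the witness with
  \<open>Dy\<close>. Moreover the Ito integral is a relation defined by mean-square limits, so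
  integrals of different integrands are combined at the level of elementary sums. The resulting
  estimate carries the moment bounds, the uniqueness of the state and the right-continuity of its
  laws in time, from which the measurability of the costs in time is drawn.\<close>

lemma
  fixes f :: "'d::finite \<Rightarrow> real \<Rightarrow> real"
  assumes int: "\<And>i. integrable lborel (f i)"
  shows integrable_lborel_vec_prod: "integrable lborel (\<lambda>x::real^'d. \<Prod>i\<in>UNIV. f i (x $ i))"
    and integral_lborel_vec_prod:
      "(LINT x|lborel. (\<Prod>i\<in>UNIV. f i ((x::real^'d) $ i))) = (\<Prod>i\<in>UNIV. LINT y|lborel. f i y)"
proof -
  interpret P: product_sigma_finite "\<lambda>b::real^'d. (lborel :: real measure)" ..
  \<comment> \<open>\<open>lborel_eq\<close> presents Lebesgue measure as the image of a product
    indexed by \<open>Basis\<close>, while the factors are indexed by coordinates. The map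
    \<open>e\<close> is the bijection between the two index sets, and \<open>F\<close> is
    \<open>f\<close> read along it.\<close>
  define e where "e = (\<lambda>i::'d. axis i (1::real))"
  have inj: "inj e" by (auto simp: e_def inj_def axis_eq_axis)
  have Basis: "(Basis :: (real^'d) set) = range e" by (auto simp: e_def Basis_vec_def)
  define F where "F = (\<lambda>b. f (the_inv e b))"
  have F: "F (e i) = f i" for i by (simp add: F_def the_inv_f_f inj)
  have meas[measurable]: "f i \<in> borel_measurable borel" for i
    using borel_measurable_integrable[OF int[of i]] by simp
  have comp: "(\<Sum>b\<in>Basis. g b *\<^sub>R b) $ i = g (e i)" for g :: "real^'d \<Rightarrow> real" and i
  proof -
    have "(\<Sum>b\<in>Basis. g b *\<^sub>R b) $ i = (\<Sum>k\<in>UNIV. g (e k) * (e k $ i))"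
      by (simp add: Basis sum.reindex[OF inj])
    also have "\<dots> = (\<Sum>k\<in>UNIV. if k = i then g (e k) else 0)"
      by (intro sum.cong) (auto simp: e_def axis_def)
    finally show ?thesis by simp
  qed
  have prodF: "(\<Prod>b\<in>Basis. F b (g b)) = (\<Prod>i\<in>UNIV. f i (g (e i)))" for g
    by (simp add: Basis prod.reindex[OF inj] F)
  have intF: "integrable lborel (F b)" for b by (simp add: F_def int)
  have m1: "(\<lambda>g. \<Sum>b\<in>Basis. g b *\<^sub>R b) \<in> measurable (\<Pi>\<^sub>M b\<in>(Basis::(real^'d) set). lborel) borel"
    by measurable
  have m2: "(\<lambda>x::real^'d. \<Prod>i\<in>UNIV. f i (x $ i)) \<in> borel_measurable borel"
    by measurable
  have "integrable (\<Pi>\<^sub>M b\<in>(Basis::(real^'d) set). lborel) (\<lambda>g. \<Prod>b\<in>Basis. F b (g b))"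
    by (rule P.product_integrable_prod) (auto simp: intF)
  then show "integrable lborel (\<lambda>x::real^'d. \<Prod>i\<in>UNIV. f i (x $ i))"
    by (subst lborel_eq, subst integrable_distr_eq[OF m1 m2]) (simp only: comp prodF)
  have "(LINT g|(\<Pi>\<^sub>M b\<in>(Basis::(real^'d) set). lborel). (\<Prod>b\<in>Basis. F b (g b)))
      = (\<Prod>b\<in>Basis. LINT y|lborel. F b y)"
    by (rule P.product_integral_prod) (auto simp: intF)
  then show "(LINT x|lborel. (\<Prod>i\<in>UNIV. f i ((x::real^'d) $ i))) = (\<Prod>i\<in>UNIV. LINT y|lborel. f i y)"
    by (subst lborel_eq, subst integral_distr[OF m1 m2]) (simp only: comp prodF, simp add: Basis prod.reindex[OF inj] F)
qed

lemma
  fixes i j :: "'d::finite"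
  assumes s: "s > 0"
  shows normal_vec_mean: "integrable lborel (\<lambda>x::real^'d. (\<Prod>k\<in>UNIV. normal_density 0 s (x $ k)) * x $ i)"
      "(LINT x|lborel. (\<Prod>k\<in>UNIV. normal_density 0 s ((x::real^'d) $ k)) * x $ i) = 0"
    and normal_vec_cov: "integrable lborel (\<lambda>x::real^'d. (\<Prod>k\<in>UNIV. normal_density 0 s (x $ k)) * (x $ i * x $ j))"
      "(LINT x|lborel. (\<Prod>k\<in>UNIV. normal_density 0 s ((x::real^'d) $ k)) * (x $ i * x $ j))
         = (if i = j then s\<^sup>2 else 0)"
proof -
  have i0: "integrable lborel (\<lambda>y. normal_density 0 s y * y ^ k)" for k
    using integrable_normal_moment[OF s, of 0 k] by simp
  have e0: "(LINT y|lborel. normal_density 0 s y) = 1" using s by simp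
  have e1: "(LINT y|lborel. normal_density 0 s y * y) = 0"
    using integral_normal_moment_nz_1[OF s, of 0] by simp
  have e2: "(LINT y|lborel. normal_density 0 s y * y\<^sup>2) = s\<^sup>2"
    using integral_normal_moment_even[OF s, of 0 1] s by (simp add: power_divide)
  \<comment> \<open>Density and monomial are merged into one product over the coordinates: the
    exponent is 1 at \<open>i\<close> and 0 elsewhere. The integral vanishes because its factor at
    \<open>i\<close> does.\<close>
  define f1 where "f1 = (\<lambda>k y. normal_density 0 s y * y ^ (if k = i then 1 else 0))"
  have f1: "(\<Prod>k\<in>UNIV. f1 k (x $ k)) = (\<Prod>k\<in>UNIV. normal_density 0 s (x $ k)) * x $ i" for x :: "real^'d"
    by (simp add: f1_def prod.distrib power_0 if_distrib[of "\<lambda>n. _ ^ n"] cong: if_cong)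
  have if1: "integrable lborel (f1 k)" for k unfolding f1_def by (rule i0)
  from integrable_lborel_vec_prod[of f1, OF if1] integral_lborel_vec_prod[of f1, OF if1]
  show "integrable lborel (\<lambda>x::real^'d. (\<Prod>k\<in>UNIV. normal_density 0 s (x $ k)) * x $ i)"
      "(LINT x|lborel. (\<Prod>k\<in>UNIV. normal_density 0 s ((x::real^'d) $ k)) * x $ i) = 0"
    unfolding f1 by (auto simp: f1_def e1 intro!: exI[of _ i])
  \<comment> \<open>The exponents add up to 2 at \<open>i\<close> if \<open>i = j\<close>; otherwise
    each of the coordinates \<open>i\<close> and \<open>j\<close> contributes a factor with integral
    0.\<close>
  define f2 where "f2 = (\<lambda>k y. normal_density 0 s y * y ^ ((if k = i then 1 else 0) + (if k = j then 1 else 0)))"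
  have f2: "(\<Prod>k\<in>UNIV. f2 k (x $ k)) = (\<Prod>k\<in>UNIV. normal_density 0 s (x $ k)) * (x $ i * x $ j)" for x :: "real^'d"
    by (simp add: f2_def prod.distrib power_add if_distrib[of "\<lambda>n. _ ^ n"] cong: if_cong)
  have if2: "integrable lborel (f2 k)" for k unfolding f2_def by (rule i0)
  have "(\<Prod>k\<in>UNIV. LINT y|lborel. f2 k y) = (if i = j then s\<^sup>2 else 0)"
  proof (cases "i = j")
    case True
    then have "(LINT y|lborel. f2 k y) = (if k = i then s\<^sup>2 else 1)" for k
      by (auto simp: f2_def e0 e2 simp flip: power2_eq_square)
    then show ?thesis using True by simp
  next
    case False
    then have "(LINT y|lborel. f2 i y) = 0" by (simp add: f2_def e1)
    then show ?thesis using False by auto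
  qed
  with integrable_lborel_vec_prod[of f2, OF if2] integral_lborel_vec_prod[of f2, OF if2]
  show "integrable lborel (\<lambda>x::real^'d. (\<Prod>k\<in>UNIV. normal_density 0 s (x $ k)) * (x $ i * x $ j))"
      "(LINT x|lborel. (\<Prod>k\<in>UNIV. normal_density 0 s ((x::real^'d) $ k)) * (x $ i * x $ j))
         = (if i = j then s\<^sup>2 else 0)"
    unfolding f2 by auto
qed

lemma borel_measurable_vec_nth:
  fixes f :: "'a \<Rightarrow> ('b::{second_countable_topology, real_normed_vector})^'n::finite"
  assumes "f \<in> borel_measurable M"
  shows "(\<lambda>x. f x $ i) \<in> borel_measurable M"
  by (rule measurable_compose[OF assms borel_measurable_continuous_onI]) (intro continuous_intros)

lemma usual_filtered_space_measurable:
  assumes "usual_filtered_space M T F" "Y \<in> borel_measurable (F s)" "0 \<le> s" "s \<le> t" "t \<le> T"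
  shows "Y \<in> borel_measurable (F t)" "Y \<in> borel_measurable M"
proof -
  have sub: "subalgebra M (F s)" "subalgebra M (F t)" and "sets (F s) \<subseteq> sets (F t)"
    using assms by (auto simp: usual_filtered_space_def)
  then have "subalgebra (F t) (F s)" by (simp add: subalgebra_def)
  then show "Y \<in> borel_measurable (F t)" "Y \<in> borel_measurable M"
    using measurable_from_subalg[OF _ assms(2)] sub by auto
qed

section \<open>Brownian increments against earlier coefficients\<close>

lemma brownian_increment_independent:
  fixes W :: "real \<Rightarrow> 'w \<Rightarrow> real^'d" and Y :: "'w \<Rightarrow> real" and g :: "real^'d \<Rightarrow> real"
  assumes U: "usual_filtered_space M T F" and B: "brownian_motion M T F W"
    and st: "0 \<le> s" "s < t" "t \<le> T"
    and Y: "Y \<in> borel_measurable (F s)" "integrable M Y"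
    and g: "g \<in> borel_measurable borel"
      "integrable lborel (\<lambda>x. (\<Prod>k\<in>UNIV. normal_density 0 (sqrt (t - s)) (x $ k)) * g x)"
  shows "integrable M (\<lambda>\<omega>. Y \<omega> * g (W t \<omega> - W s \<omega>))"
    and "(LINT \<omega>|M. Y \<omega> * g (W t \<omega> - W s \<omega>))
      = (LINT \<omega>|M. Y \<omega>) * (LINT x|lborel. (\<Prod>k\<in>UNIV. normal_density 0 (sqrt (t - s)) (x $ k)) * g x)"
proof -
  interpret prob_space M using U by (simp add: usual_filtered_space_def)
  let ?D = "\<lambda>\<omega>. W t \<omega> - W s \<omega>"
  have dist: "distributed M lborel ?D (\<lambda>x. ennreal (\<Prod>i\<in>UNIV. normal_density 0 (sqrt (t - s)) (x $ i)))"
    and ind: "indep_set (sets (F s)) {?D -` A \<inter> space M |A. A \<in> sets borel}"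
    using B st unfolding brownian_motion_def by auto
  have D[measurable]: "?D \<in> borel_measurable M"
    using distributed_measurable[OF dist] by simp
  note [measurable] = g(1)
  have igD: "integrable M (\<lambda>\<omega>. g (?D \<omega>))"
    using distributed_integrable[OF dist, of g] g by (simp add: prod_nonneg)
  have egD: "(LINT x|lborel. (\<Prod>k\<in>UNIV. normal_density 0 (sqrt (t - s)) (x $ k)) * g x) = (LINT \<omega>|M. g (?D \<omega>))"
    using distributed_integral[OF dist, of g] g by (simp add: prod_nonneg)
  have sF: "space (F s) = space M" "sets (F s) \<subseteq> sets M"
  proof -
    have "subalgebra M (F s)" using U st by (auto simp: usual_filtered_space_def)
    then show "space (F s) = space M" "sets (F s) \<subseteq> sets M" by (auto simp: subalgebra_def)
  qed
  have "indep_var borel Y borel (\<lambda>\<omega>. g (?D \<omega>))"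
    unfolding indep_var_eq
  proof (intro conjI)
    show "random_variable borel Y" using Y(2) by auto
    show "random_variable borel (\<lambda>\<omega>. g (?D \<omega>))" by measurable
    have sub1: "sigma_sets (space M) {Y -` A \<inter> space M |A. A \<in> sets borel} \<subseteq> sets (F s)"
      unfolding sF(1)[symmetric] using measurable_sets[OF Y(1)]
      by (intro sets.sigma_sets_subset) auto
    \<comment> \<open>The preimages under the increment already form a sigma-algebra, so what
      \<open>g\<close> of the increment generates stays inside the family whose independence of
      \<open>F s\<close> is given.\<close>
    have sig: "sigma_algebra (space M) {?D -` A \<inter> space M |A. A \<in> sets borel}"
      using sets.sigma_algebra_axioms[of "vimage_algebra (space M) ?D borel"]
      by (simp add: sets_vimage_algebra2)
    have sub2: "sigma_sets (space M) {(\<lambda>\<omega>. g (?D \<omega>)) -` A \<inter> space M |A. A \<in> sets borel}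
        \<subseteq> {?D -` A \<inter> space M |A. A \<in> sets borel}"
    proof (rule sigma_algebra.sigma_sets_subset[OF sig], safe)
      fix A :: "real set" assume "A \<in> sets borel"
      then have "g -` A \<in> sets borel" using measurable_sets[OF g(1), of A] by simp
      then show "\<exists>A'. (\<lambda>\<omega>. g (?D \<omega>)) -` A \<inter> space M = ?D -` A' \<inter> space M \<and> A' \<in> sets borel"
        by (intro exI[of _ "g -` A"]) auto
    qed
    show "indep_set (sigma_sets (space M) {Y -` A \<inter> space M |A. A \<in> sets borel})
        (sigma_sets (space M) {(\<lambda>\<omega>. g (?D \<omega>)) -` A \<inter> space M |A. A \<in> sets borel})"
      unfolding indep_set_def
      by (rule indep_sets_mono_sets[OF ind[unfolded indep_set_def]])
        (use sub1 sub2 in \<open>auto split: bool.split\<close>)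
  qed
  from indep_var_integrable[OF this Y(2) igD] indep_var_lebesgue_integral[OF this Y(2) igD]
  show "integrable M (\<lambda>\<omega>. Y \<omega> * g (W t \<omega> - W s \<omega>))"
    "(LINT \<omega>|M. Y \<omega> * g (W t \<omega> - W s \<omega>))
      = (LINT \<omega>|M. Y \<omega>) * (LINT x|lborel. (\<Prod>k\<in>UNIV. normal_density 0 (sqrt (t - s)) (x $ k)) * g x)"
    by (simp_all add: egD)
qed

lemma brownian_increment_mean:
  fixes W :: "real \<Rightarrow> 'w \<Rightarrow> real^'d" and Y :: "'w \<Rightarrow> real"
  assumes U: "usual_filtered_space M T F" and B: "brownian_motion M T F W"
    and st: "0 \<le> s" "s \<le> t" "t \<le> T"
    and Y: "Y \<in> borel_measurable (F s)" "integrable M Y"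
  shows "integrable M (\<lambda>\<omega>. Y \<omega> * (W t \<omega> $ i - W s \<omega> $ i))"
    and "(LINT \<omega>|M. Y \<omega> * (W t \<omega> $ i - W s \<omega> $ i)) = 0"
proof -
  have "integrable M (\<lambda>\<omega>. Y \<omega> * (W t \<omega> $ i - W s \<omega> $ i)) \<and> (LINT \<omega>|M. Y \<omega> * (W t \<omega> $ i - W s \<omega> $ i)) = 0"
  proof (cases "s = t")
    case False
    then have "s < t" using st by simp
    note * = brownian_increment_independent[OF U B st(1) this st(3) Y, of "\<lambda>x. x $ i"]
      normal_vec_mean[of "sqrt (t - s)" i]
    show ?thesis using * \<open>s < t\<close> by simp
  qed simp
  then show "integrable M (\<lambda>\<omega>. Y \<omega> * (W t \<omega> $ i - W s \<omega> $ i))"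
    and "(LINT \<omega>|M. Y \<omega> * (W t \<omega> $ i - W s \<omega> $ i)) = 0" by auto
qed

lemma brownian_increment_cov:
  fixes W :: "real \<Rightarrow> 'w \<Rightarrow> real^'d" and Y :: "'w \<Rightarrow> real"
  assumes U: "usual_filtered_space M T F" and B: "brownian_motion M T F W"
    and st: "0 \<le> s" "s \<le> t" "t \<le> T"
    and Y: "Y \<in> borel_measurable (F s)" "integrable M Y"
  shows "integrable M (\<lambda>\<omega>. Y \<omega> * ((W t \<omega> $ i - W s \<omega> $ i) * (W t \<omega> $ j - W s \<omega> $ j)))"
    and "(LINT \<omega>|M. Y \<omega> * ((W t \<omega> $ i - W s \<omega> $ i) * (W t \<omega> $ j - W s \<omega> $ j)))
      = (if i = j then (LINT \<omega>|M. Y \<omega>) * (t - s) else 0)"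
proof -
  have "integrable M (\<lambda>\<omega>. Y \<omega> * ((W t \<omega> $ i - W s \<omega> $ i) * (W t \<omega> $ j - W s \<omega> $ j)))
    \<and> (LINT \<omega>|M. Y \<omega> * ((W t \<omega> $ i - W s \<omega> $ i) * (W t \<omega> $ j - W s \<omega> $ j)))
      = (if i = j then (LINT \<omega>|M. Y \<omega>) * (t - s) else 0)"
  proof (cases "s = t")
    case False
    then have "s < t" using st by simp
    note * = brownian_increment_independent[OF U B st(1) this st(3) Y, of "\<lambda>x. x $ i * x $ j"]
      normal_vec_cov[of "sqrt (t - s)" i j]
    show ?thesis using * \<open>s < t\<close> by simp
  qed simp
  then show "integrable M (\<lambda>\<omega>. Y \<omega> * ((W t \<omega> $ i - W s \<omega> $ i) * (W t \<omega> $ j - W s \<omega> $ j)))"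
    and "(LINT \<omega>|M. Y \<omega> * ((W t \<omega> $ i - W s \<omega> $ i) * (W t \<omega> $ j - W s \<omega> $ j)))
      = (if i = j then (LINT \<omega>|M. Y \<omega>) * (t - s) else 0)" by auto
qed

text \<open>The intervals may overlap in any way, because the grids of different integrals are
  unrelated. Measurability of a coefficient is asked only when its interval is nonempty: grids are
  later clamped to a smaller time interval, and a cell that collapses to the right end of it may
  carry a coefficient that is measurable only at a later time.\<close>

lemma brownian_increments_cov:
  fixes W :: "real \<Rightarrow> 'w \<Rightarrow> real^'d" and \<alpha> \<beta> :: "'w \<Rightarrow> real"
  assumes U: "usual_filtered_space M T F" and B: "brownian_motion M T F W"
    and ab: "0 \<le> a" "a \<le> b" "b \<le> T" and cd: "0 \<le> c" "c \<le> d" "d \<le> T"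
    and \<alpha>: "a < b \<Longrightarrow> \<alpha> \<in> borel_measurable (F a)" "\<And>\<omega>. \<omega> \<in> space M \<Longrightarrow> \<bar>\<alpha> \<omega>\<bar> \<le> ka"
    and \<beta>: "c < d \<Longrightarrow> \<beta> \<in> borel_measurable (F c)" "\<And>\<omega>. \<omega> \<in> space M \<Longrightarrow> \<bar>\<beta> \<omega>\<bar> \<le> kb"
  shows "integrable M (\<lambda>\<omega>. (\<alpha> \<omega> * (W b \<omega> $ i - W a \<omega> $ i)) * (\<beta> \<omega> * (W d \<omega> $ j - W c \<omega> $ j))) \<and>
    (LINT \<omega>|M. (\<alpha> \<omega> * (W b \<omega> $ i - W a \<omega> $ i)) * (\<beta> \<omega> * (W d \<omega> $ j - W c \<omega> $ j)))
      = (if i = j then (LINT \<omega>|M. \<alpha> \<omega> * \<beta> \<omega>) * measure lborel ({a<..b} \<inter> {c<..d}) else 0)"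
  using ab cd \<alpha> \<beta>
proof (induction a c arbitrary: b d \<alpha> \<beta> i j ka kb rule: linorder_wlog)
  \<comment> \<open>By symmetry the first interval starts no later than the second, and then both
    coefficients are known at time \<open>c\<close>.\<close>
  case (le a c)
  note ab = le(2-4) and cd = le(5-7) and \<alpha> = le(8,9) and \<beta> = le(10,11)
  interpret prob_space M using U by (simp add: usual_filtered_space_def)
  note meas = usual_filtered_space_measurable[OF U]
  have W: "W t \<in> borel_measurable (F t)" if "0 \<le> t" "t \<le> T" for t
    using B that by (auto simp: brownian_motion_def adapted_def)
  have Wi: "(\<lambda>\<omega>. W t \<omega> $ i) \<in> borel_measurable (F u)" if "0 \<le> t" "t \<le> u" "u \<le> T" for t u i
  proof -
    have "W t \<in> borel_measurable (F u)" using meas(1)[OF W] that by auto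
    then show ?thesis by (rule borel_measurable_vec_nth)
  qed
  consider "a = b \<or> c = d" | "a < b" "c < d" using ab cd by force
  then show ?case
  proof cases
    case 1
    then have "measure lborel ({a<..b} \<inter> {c<..d}) = 0" by auto
    then show ?thesis using 1 by auto
  next
    case 2
    note \<alpha>m = \<alpha>(1)[OF 2(1)] and \<beta>m = \<beta>(1)[OF 2(2)]
    have \<alpha>c: "\<alpha> \<in> borel_measurable (F c)" using meas(1)[OF \<alpha>m] ab cd le(1) by auto
    have intb: "integrable M Y" if "Y \<in> borel_measurable M" "\<And>\<omega>. \<omega> \<in> space M \<Longrightarrow> \<bar>Y \<omega>\<bar> \<le> k" for Y :: "'w \<Rightarrow> real" and k
      using that by (intro integrable_const_bound[of _ k]) auto
    have i\<alpha>: "integrable M \<alpha>" using intb[of \<alpha>] meas(2)[OF \<alpha>m] ab \<alpha>(2) by auto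
    have ka: "0 \<le> ka" using \<alpha>(2) not_empty by force
    have \<alpha>\<beta>: "(\<lambda>\<omega>. \<alpha> \<omega> * \<beta> \<omega>) \<in> borel_measurable (F c)" using \<alpha>c \<beta>m by measurable
    have i\<alpha>\<beta>: "integrable M (\<lambda>\<omega>. \<alpha> \<omega> * \<beta> \<omega>)"
      using meas(2)[OF \<alpha>\<beta>] cd \<alpha>(2) \<beta>(2) ka
      by (intro intb[of _ "ka * kb"]) (auto simp: abs_mult intro!: mult_mono)
    have bi: "integrable M (\<lambda>\<omega>. Y \<omega> * Z \<omega>)" if "integrable M Z" "Y \<in> borel_measurable M" "\<And>\<omega>. \<omega> \<in> space M \<Longrightarrow> \<bar>Y \<omega>\<bar> \<le> k"
      for Y Z :: "'w \<Rightarrow> real" and k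
    proof (rule Bochner_Integration.integrable_bound)
      show "integrable M (\<lambda>\<omega>. k * \<bar>Z \<omega>\<bar>)" using that(1) by simp
      show "(\<lambda>\<omega>. Y \<omega> * Z \<omega>) \<in> borel_measurable M" using that(1,2) by measurable
      show "AE \<omega> in M. norm (Y \<omega> * Z \<omega>) \<le> norm (k * \<bar>Z \<omega>\<bar>)"
        using that(3) by (intro AE_I2) (force simp: abs_mult intro!: mult_right_mono)
    qed
    have \<beta>M: "\<beta> \<in> borel_measurable M" and \<alpha>\<beta>M: "(\<lambda>\<omega>. \<alpha> \<omega> * \<beta> \<omega>) \<in> borel_measurable M"
      using meas(2)[OF \<beta>m] meas(2)[OF \<alpha>\<beta>] cd by auto
    have incM: "(\<lambda>\<omega>. W s \<omega> $ i - W r \<omega> $ i) \<in> borel_measurable (F u)" if "0 \<le> r" "0 \<le> s" "s \<le> u" "r \<le> u" "u \<le> T" for r s u i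
      using that by (intro borel_measurable_diff Wi) auto
    \<comment> \<open>An increment over \<open>(u, v]\<close> times a quantity known at time
      \<open>u\<close> has mean 0. This disposes of every pair of disjoint pieces.\<close>
    have zero: "integrable M (\<lambda>\<omega>. (\<alpha> \<omega> * \<beta> \<omega>) * (W s \<omega> $ i - W r \<omega> $ i) * (W v \<omega> $ j - W u \<omega> $ j)) \<and>
      (LINT \<omega>|M. (\<alpha> \<omega> * \<beta> \<omega>) * (W s \<omega> $ i - W r \<omega> $ i) * (W v \<omega> $ j - W u \<omega> $ j)) = 0"
      if "a \<le> r" "c \<le> u" "r \<le> s" "s \<le> u" "u \<le> v" "v \<le> T" for r s u v i j
    proof -
      have \<alpha>r: "\<alpha> \<in> borel_measurable (F r)" using meas(1)[OF \<alpha>m] that ab by auto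
      have ir: "integrable M (\<lambda>\<omega>. \<alpha> \<omega> * (W s \<omega> $ i - W r \<omega> $ i))"
        using that ab by (intro brownian_increment_mean(1)[OF U B _ _ _ \<alpha>r i\<alpha>]) auto
      have \<alpha>u: "(\<lambda>\<omega>. \<alpha> \<omega> * \<beta> \<omega>) \<in> borel_measurable (F u)" using meas(1)[OF \<alpha>\<beta>] that cd by auto
      have m: "(\<lambda>\<omega>. (\<alpha> \<omega> * \<beta> \<omega>) * (W s \<omega> $ i - W r \<omega> $ i)) \<in> borel_measurable (F u)"
        using that ab by (intro borel_measurable_times incM \<alpha>u) auto
      have "integrable M (\<lambda>\<omega>. \<beta> \<omega> * (\<alpha> \<omega> * (W s \<omega> $ i - W r \<omega> $ i)))"
        using bi[OF ir \<beta>M \<beta>(2)] .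
      then have "integrable M (\<lambda>\<omega>. (\<alpha> \<omega> * \<beta> \<omega>) * (W s \<omega> $ i - W r \<omega> $ i))"
        by (simp add: ac_simps)
      from brownian_increment_mean[OF U B _ _ _ m this] that cd show ?thesis by auto
    qed
    define e where "e = min b d"
    show ?thesis
    proof (cases "b \<le> c")
      case True
      then have "{a<..b} \<inter> {c<..d} = {}" by auto
      moreover note zero[of a c b d i j] True ab cd
      ultimately show ?thesis by (simp add: algebra_simps)
    next
      case False
      then have ce: "c < e" "e \<le> b" "e \<le> d" and set: "{a<..b} \<inter> {c<..d} = {c<..e}" using 2 le(1) by (auto simp: e_def)
      note z1 = zero[of a c c d i j] and z2 = zero[of c e e d i j] and z3 = zero[of c e e b j i]
      have cov: "integrable M (\<lambda>\<omega>. (\<alpha> \<omega> * \<beta> \<omega>) * ((W e \<omega> $ i - W c \<omega> $ i) * (W e \<omega> $ j - W c \<omega> $ j)))"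
        "(LINT \<omega>|M. (\<alpha> \<omega> * \<beta> \<omega>) * ((W e \<omega> $ i - W c \<omega> $ i) * (W e \<omega> $ j - W c \<omega> $ j)))
          = (if i = j then (LINT \<omega>|M. (\<alpha> \<omega> * \<beta> \<omega>)) * (e - c) else 0)"
        using ce cd brownian_increment_cov[OF U B _ _ _ \<alpha>\<beta> i\<alpha>\<beta>, of e i j] by auto
      \<comment> \<open>The first interval is cut at \<open>c\<close> and \<open>e\<close>, the
        second at \<open>e\<close>. Since \<open>e\<close> is the smaller of the right ends, one of
        the last two terms is 0; in the mean only the common piece from \<open>c\<close> to
        \<open>e\<close> survives.\<close>
      have split: "(\<alpha> \<omega> * (W b \<omega> $ i - W a \<omega> $ i)) * (\<beta> \<omega> * (W d \<omega> $ j - W c \<omega> $ j)) =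
        (\<alpha> \<omega> * \<beta> \<omega>) * (W c \<omega> $ i - W a \<omega> $ i) * (W d \<omega> $ j - W c \<omega> $ j)
        + (\<alpha> \<omega> * \<beta> \<omega>) * ((W e \<omega> $ i - W c \<omega> $ i) * (W e \<omega> $ j - W c \<omega> $ j))
        + (\<alpha> \<omega> * \<beta> \<omega>) * (W e \<omega> $ i - W c \<omega> $ i) * (W d \<omega> $ j - W e \<omega> $ j)
        + (\<alpha> \<omega> * \<beta> \<omega>) * (W e \<omega> $ j - W c \<omega> $ j) * (W b \<omega> $ i - W e \<omega> $ i)" for \<omega>
        by (cases "b \<le> d") (simp_all add: e_def min_def algebra_simps)
      show ?thesis
        unfolding split set using z1 z2 z3 cov ce ab cd le(1) by simp
    qed
  qed
next
  case (sym a c)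
  show ?case
    using sym(1)[OF sym(5-7) sym(2-4) sym(10,11) sym(8,9), of j i]
    by (simp add: mult.commute Int_commute)
qed

text \<open>Both squares are expanded over pairs \<open>k\<close>, \<open>l\<close>. The left gives
  covariances of weighted increments, the right integrals of products of indicators, and either is
  the overlap length \<open>m k l\<close> times the same mean of coefficients. Pairs of distinct
  indices do contribute, since \<open>J\<close> will merge the grids of several integrals.\<close>

lemma elementary_isometry:
  fixes W :: "real \<Rightarrow> 'w \<Rightarrow> real^'d" and A :: "'i \<Rightarrow> 'w \<Rightarrow> real^'d^'n"
  assumes U: "usual_filtered_space M T F" and B: "brownian_motion M T F W"
    and J: "finite J" and ab: "\<And>k. k \<in> J \<Longrightarrow> 0 \<le> a k \<and> a k \<le> b k \<and> b k \<le> T"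
    and A: "\<And>k. k \<in> J \<Longrightarrow> a k < b k \<Longrightarrow> A k \<in> borel_measurable (F (a k))"
      "\<And>k \<omega>. k \<in> J \<Longrightarrow> \<omega> \<in> space M \<Longrightarrow> norm (A k \<omega>) \<le> B k"
  shows "(\<integral>\<^sup>+\<omega>. ennreal ((norm (\<Sum>k\<in>J. A k \<omega> *v (W (b k) \<omega> - W (a k) \<omega>)))\<^sup>2) \<partial>M)
    = (\<integral>\<^sup>+\<omega>. (\<integral>\<^sup>+r. ennreal ((norm (\<Sum>k\<in>J. indicat_real {a k<..b k} r *\<^sub>R A k \<omega>))\<^sup>2) \<partial>lborel) \<partial>M)"
proof -
  interpret prob_space M using U by (simp add: usual_filtered_space_def)
  define P where "P = (\<lambda>k l i j j' \<omega>. (A k \<omega> $ i $ j * (W (b k) \<omega> $ j - W (a k) \<omega> $ j))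
      * (A l \<omega> $ i $ j' * (W (b l) \<omega> $ j' - W (a l) \<omega> $ j')))"
  define m where "m = (\<lambda>k l. measure lborel ({a k<..b k} \<inter> {a l<..b l}))"
  define Q where "Q = (\<lambda>k l i j \<omega>. A k \<omega> $ i $ j * A l \<omega> $ i $ j * m k l)"
  have bd: "\<bar>A k \<omega> $ i $ j\<bar> \<le> B k" if "k \<in> J" "\<omega> \<in> space M" for k \<omega> i j
    using component_le_norm_cart[of "A k \<omega> $ i" j] Finite_Cartesian_Product.norm_nth_le[of "A k \<omega>" i]
      A(2)[OF that] by linarith
  have Am: "(\<lambda>\<omega>. A k \<omega> $ i $ j) \<in> borel_measurable (F (a k))" if "k \<in> J" "a k < b k" for k i j
    by (intro borel_measurable_vec_nth A that)
  have PI: "integrable M (P k l i j j') \<and> integral\<^sup>L M (P k l i j j')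
      = (if j = j' then (LINT \<omega>|M. A k \<omega> $ i $ j * A l \<omega> $ i $ j') * m k l else 0)"
    if "k \<in> J" "l \<in> J" for k l i j j'
    unfolding P_def m_def
    using ab that by (intro brownian_increments_cov[OF U B, where ka="B k" and kb="B l"] Am bd) auto
  have QI: "integrable M (Q k l i j) \<and> integral\<^sup>L M (Q k l i j) = (LINT \<omega>|M. A k \<omega> $ i $ j * A l \<omega> $ i $ j) * m k l"
    if kl: "k \<in> J" "l \<in> J" for k l i j
  proof (cases "a k < b k \<and> a l < b l")
    case True
    have 1: "(\<lambda>\<omega>. A k \<omega> $ i $ j) \<in> borel_measurable M" "(\<lambda>\<omega>. A l \<omega> $ i $ j) \<in> borel_measurable M"
      using usual_filtered_space_measurable(2)[OF U Am] True ab kl by (meson order_refl order_trans)+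
    have "0 \<le> B k" using bd[OF kl(1)] not_empty by force
    then have "integrable M (\<lambda>\<omega>. A k \<omega> $ i $ j * A l \<omega> $ i $ j)"
      using 1 bd[of k] bd[of l] kl
      by (intro integrable_const_bound[where B="B k * B l"]) (auto simp: abs_mult intro!: mult_mono AE_I2)
    then show ?thesis by (simp add: Q_def)
  next
    \<comment> \<open>An empty interval comes without measurability of its coefficient, but then
      \<open>m k l\<close> is 0 and \<open>Q\<close> vanishes identically.\<close>
    case False
    then have "{a k<..b k} \<inter> {a l<..b l} = {}" by auto
    then have "m k l = 0" unfolding m_def by (simp only:) simp
    then show ?thesis by (simp add: Q_def)
  qed
  have L: "(norm (\<Sum>k\<in>J. A k \<omega> *v (W (b k) \<omega> - W (a k) \<omega>)))\<^sup>2
      = (\<Sum>k\<in>J. \<Sum>l\<in>J. \<Sum>i\<in>UNIV. \<Sum>j\<in>UNIV. \<Sum>j'\<in>UNIV. P k l i j j' \<omega>)" for \<omega>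
  proof -
    have "(A k \<omega> *v (W (b k) \<omega> - W (a k) \<omega>)) \<bullet> (A l \<omega> *v (W (b l) \<omega> - W (a l) \<omega>))
        = (\<Sum>i\<in>UNIV. \<Sum>j\<in>UNIV. \<Sum>j'\<in>UNIV. P k l i j j' \<omega>)" for k l
      by (simp add: inner_vec_def matrix_vector_mult_def sum_product P_def)
    then show ?thesis
      by (subst power2_norm_eq_inner) (simp only: inner_sum_left inner_sum_right, rule sum.swap)
  qed
  have IL: "integrable M (\<lambda>\<omega>. (norm (\<Sum>k\<in>J. A k \<omega> *v (W (b k) \<omega> - W (a k) \<omega>)))\<^sup>2)"
    unfolding L using PI by auto
  have EL: "(LINT \<omega>|M. (norm (\<Sum>k\<in>J. A k \<omega> *v (W (b k) \<omega> - W (a k) \<omega>)))\<^sup>2)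
      = (\<Sum>k\<in>J. \<Sum>l\<in>J. \<Sum>i\<in>UNIV. \<Sum>j\<in>UNIV. (LINT \<omega>|M. A k \<omega> $ i $ j * A l \<omega> $ i $ j) * m k l)"
    unfolding L using PI by (simp add: Bochner_Integration.integral_sum Bochner_Integration.integrable_sum)
  have R: "(norm (\<Sum>k\<in>J. indicat_real {a k<..b k} r *\<^sub>R A k \<omega>))\<^sup>2
     = (\<Sum>k\<in>J. \<Sum>l\<in>J. (\<Sum>i\<in>UNIV. \<Sum>j\<in>UNIV. A k \<omega> $ i $ j * A l \<omega> $ i $ j) * indicator ({a k<..b k} \<inter> {a l<..b l}) r)" for r \<omega>
  proof -
    have dot: "A k \<omega> \<bullet> A l \<omega> = (\<Sum>i\<in>UNIV. \<Sum>j\<in>UNIV. A k \<omega> $ i $ j * A l \<omega> $ i $ j)" for k l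
      by (simp add: inner_vec_def)
    have "(norm (\<Sum>k\<in>J. indicat_real {a k<..b k} r *\<^sub>R A k \<omega>))\<^sup>2
      = (\<Sum>k\<in>J. \<Sum>l\<in>J. (indicat_real {a k<..b k} r *\<^sub>R A k \<omega>) \<bullet> (indicat_real {a l<..b l} r *\<^sub>R A l \<omega>))"
      by (subst power2_norm_eq_inner) (simp only: inner_sum_left inner_sum_right, rule sum.swap)
    also have "\<dots> = (\<Sum>k\<in>J. \<Sum>l\<in>J. (A k \<omega> \<bullet> A l \<omega>) * indicator ({a k<..b k} \<inter> {a l<..b l}) r)"
      by (intro sum.cong refl) (simp only: inner_scaleR_left inner_scaleR_right indicator_inter_arith mult_ac)
    finally show ?thesis by (simp only: dot)
  qed
  have fin: "emeasure lborel ({a k<..b k} \<inter> {a l<..b l}) < \<infinity>" for k l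
  proof -
    have "emeasure lborel ({a k<..b k} \<inter> {a l<..b l}) \<le> emeasure lborel {a k<..b k}"
      by (rule emeasure_mono) auto
    also have "\<dots> < \<infinity>" by (cases "a k \<le> b k") simp_all
    finally show ?thesis .
  qed
  have IR: "integrable lborel (\<lambda>r. (norm (\<Sum>k\<in>J. indicat_real {a k<..b k} r *\<^sub>R A k \<omega>))\<^sup>2)" for \<omega>
    unfolding R using fin by (intro Bochner_Integration.integrable_sum integrable_mult_right integrable_real_indicator) auto
  have ER: "(LINT r|lborel. (norm (\<Sum>k\<in>J. indicat_real {a k<..b k} r *\<^sub>R A k \<omega>))\<^sup>2)
      = (\<Sum>k\<in>J. \<Sum>l\<in>J. \<Sum>i\<in>UNIV. \<Sum>j\<in>UNIV. Q k l i j \<omega>)" for \<omega>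
  proof -
    define X where "X = (\<lambda>k l. {a k<..b k} \<inter> {a l<..b l})"
    have X: "integrable lborel (indicat_real (X k l))" for k l
      unfolding X_def using fin by (intro integrable_real_indicator) auto
    have "(LINT r|lborel. (\<Sum>k\<in>J. \<Sum>l\<in>J. q k l * indicator (X k l) r)) = (\<Sum>k\<in>J. \<Sum>l\<in>J. q k l * measure lborel (X k l))"
      for q :: "'i \<Rightarrow> 'i \<Rightarrow> real"
      using X by (simp add: Bochner_Integration.integral_sum Bochner_Integration.integrable_sum)
    from this[unfolded X_def] show ?thesis
      unfolding R Q_def m_def sum_distrib_right[symmetric] .
  qed
  have "(\<integral>\<^sup>+\<omega>. (\<integral>\<^sup>+r. ennreal ((norm (\<Sum>k\<in>J. indicat_real {a k<..b k} r *\<^sub>R A k \<omega>))\<^sup>2) \<partial>lborel) \<partial>M)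
     = (\<integral>\<^sup>+\<omega>. ennreal (\<Sum>k\<in>J. \<Sum>l\<in>J. \<Sum>i\<in>UNIV. \<Sum>j\<in>UNIV. Q k l i j \<omega>) \<partial>M)"
    by (subst nn_integral_eq_integral[OF IR]) (simp_all add: ER)
  also have "\<dots> = ennreal (LINT \<omega>|M. (\<Sum>k\<in>J. \<Sum>l\<in>J. \<Sum>i\<in>UNIV. \<Sum>j\<in>UNIV. Q k l i j \<omega>))"
  proof (rule nn_integral_eq_integral)
    show "AE \<omega> in M. 0 \<le> (\<Sum>k\<in>J. \<Sum>l\<in>J. \<Sum>i\<in>UNIV. \<Sum>j\<in>UNIV. Q k l i j \<omega>)"
      unfolding ER[symmetric] by simp
  qed (use QI in auto)
  also have "(LINT \<omega>|M. (\<Sum>k\<in>J. \<Sum>l\<in>J. \<Sum>i\<in>UNIV. \<Sum>j\<in>UNIV. Q k l i j \<omega>))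
      = (LINT \<omega>|M. (norm (\<Sum>k\<in>J. A k \<omega> *v (W (b k) \<omega> - W (a k) \<omega>)))\<^sup>2)"
    unfolding EL using QI by (simp add: Bochner_Integration.integral_sum Bochner_Integration.integrable_sum)
  also have "ennreal \<dots> = (\<integral>\<^sup>+\<omega>. ennreal ((norm (\<Sum>k\<in>J. A k \<omega> *v (W (b k) \<omega> - W (a k) \<omega>)))\<^sup>2) \<partial>M)"
    by (rule nn_integral_eq_integral[OF IL, symmetric]) simp
  finally show ?thesis by simp
qed

section \<open>Mean-square estimate for combinations of Ito integrals\<close>

lemma progressive_measurable:
  fixes H :: "real \<Rightarrow> 'w \<Rightarrow> 'a::{second_countable_topology, real_normed_vector}"
  assumes U: "usual_filtered_space M T F" and H: "progressive T F H" and T: "0 \<le> T"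
  shows "(\<lambda>(\<omega>, s). indicat_real {0..T} s *\<^sub>R H s \<omega>) \<in> borel_measurable (M \<Otimes>\<^sub>M borel)"
proof -
  have sub: "subalgebra M (F T)" using U T by (auto simp: usual_filtered_space_def)
  let ?R = "restrict_space (M \<Otimes>\<^sub>M (borel::real measure)) (space M \<times> {0..T})"
  have [measurable]: "(\<lambda>(s, \<omega>). H s \<omega>) \<in> borel_measurable (restrict_space borel {0..T} \<Otimes>\<^sub>M F T)"
    using H T by (auto simp: progressive_def)
  have idF: "(\<lambda>x. x) \<in> measurable M (F T)" by (rule measurable_from_subalg[OF sub measurable_ident_sets[OF refl]])
  have "(\<lambda>p. (snd p, fst p)) \<in> measurable ?R (restrict_space borel {0..T} \<Otimes>\<^sub>M F T)"
  proof (rule measurable_Pair)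
    show "snd \<in> measurable ?R (restrict_space borel {0..T})"
      by (intro measurable_restrict_space2 measurable_restrict_space1) (auto simp: space_restrict_space)
    show "fst \<in> measurable ?R (F T)"
      by (rule measurable_restrict_space1) (rule measurable_compose[OF measurable_fst idF])
  qed
  from measurable_compose[OF this, of "\<lambda>(s, \<omega>). H s \<omega>" borel]
  have "(\<lambda>p. H (snd p) (fst p)) \<in> borel_measurable ?R" by simp
  then have "(\<lambda>p. indicator (space M \<times> {0..T}) p *\<^sub>R H (snd p) (fst p)) \<in> borel_measurable (M \<Otimes>\<^sub>M borel)"
    by (subst (asm) borel_measurable_restrict_space_iff) (auto simp: space_pair_measure)
  then show ?thesis
    by (rule measurable_cong[THEN iffD1, rotated]) (auto simp: space_pair_measure indicator_def)
qed

lemma norm_sum_scaleR_square_le: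
  fixes z :: "'i \<Rightarrow> 'a::real_normed_vector"
  shows "(norm (\<Sum>i\<in>S. c i *\<^sub>R z i))\<^sup>2 \<le> (\<Sum>i\<in>S. (c i)\<^sup>2) * (\<Sum>i\<in>S. (norm (z i))\<^sup>2)"
proof -
  have "norm (\<Sum>i\<in>S. c i *\<^sub>R z i) \<le> (\<Sum>i\<in>S. \<bar>c i\<bar> * norm (z i))"
    by (rule sum_norm_le) simp
  then have "(norm (\<Sum>i\<in>S. c i *\<^sub>R z i))\<^sup>2 \<le> (\<Sum>i\<in>S. \<bar>c i\<bar> * norm (z i))\<^sup>2"
    by (rule power_mono) simp
  also have "\<dots> \<le> (\<Sum>i\<in>S. \<bar>c i\<bar>\<^sup>2) * (\<Sum>i\<in>S. (norm (z i))\<^sup>2)"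
    by (rule Cauchy_Schwarz_ineq_sum)
  finally show ?thesis by simp
qed

lemma norm_square_le_double:
  fixes x y :: "'a::real_normed_vector"
  shows "(norm x)\<^sup>2 \<le> 2 * (norm y)\<^sup>2 + 2 * (norm (y - x))\<^sup>2"
proof -
  have "norm x \<le> norm y + norm (y - x)" by (metis norm_minus_commute norm_triangle_sub)
  then have "(norm x)\<^sup>2 \<le> (norm y + norm (y - x))\<^sup>2" by (rule power_mono) simp
  then show ?thesis using sum_squares_bound[of "norm y" "norm (y - x)"] by (simp add: power2_sum)
qed

text \<open>Linear combinations are treated at once because \<open>ito_integral\<close> only relates
  an integrand to a process: each integral has its own approximating sums on its own grids, and the
  isometry is applied to the merged family. The factor 4 is the price of using |x|^2 \<le> 2 |y|^2 +
  2 |y - x|^2 twice, once for the integrals and once for the integrands; any constant will do for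
  Gronwall.\<close>

lemma ito_integral_lincomb_bound:
  fixes W :: "real \<Rightarrow> 'w \<Rightarrow> real^'d" and H :: "'i \<Rightarrow> real \<Rightarrow> 'w \<Rightarrow> real^'d^'n"
  assumes U: "usual_filtered_space M T F" and B: "brownian_motion M T F W"
    and S: "finite S" and ito: "\<And>i. i \<in> S \<Longrightarrow> ito_integral M T F W (H i) (I i)"
    and st: "0 \<le> s" "s \<le> t" "t \<le> T"
  shows "(\<integral>\<^sup>+\<omega>. ennreal ((norm (\<Sum>i\<in>S. c i *\<^sub>R (I i t \<omega> - I i s \<omega>)))\<^sup>2) \<partial>M)
    \<le> 4 * (\<integral>\<^sup>+\<omega>. (\<integral>\<^sup>+r\<in>{s..t}. ennreal ((norm (\<Sum>i\<in>S. c i *\<^sub>R H i r \<omega>))\<^sup>2) \<partial>lborel) \<partial>M)"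
proof -
  \<comment> \<open>The body of the existential gets a name, so that the choice of \<open>N\<close>,
    \<open>\<tau>\<close> and \<open>A\<close> for every \<open>i\<close> handles it as one
    atom.\<close>
  define P where "P = (\<lambda>i N \<tau> A. (\<forall>j. elementary_data M T F (N j) (\<tau> j) (A j)) \<and>
        (\<lambda>j::nat. \<integral>\<^sup>+\<omega>. (\<integral>\<^sup>+s\<in>{0..T}.
             ennreal ((norm (elementary_integrand (N j) (\<tau> j) (A j) s \<omega> - H i s \<omega>))\<^sup>2)
             \<partial>lborel) \<partial>M) \<longlonglongrightarrow> 0 \<and>
        (\<forall>t\<in>{0..T}. (\<lambda>j. \<integral>\<^sup>+\<omega>.
             ennreal ((norm (elementary_integral W (N j) (\<tau> j) (A j) t \<omega> - I i t \<omega>))\<^sup>2)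
             \<partial>M) \<longlonglongrightarrow> 0))"
  have "\<forall>i\<in>S. \<exists>N \<tau> A. P i N \<tau> A"
    using ito unfolding ito_integral_def P_def by blast
  then obtain N \<tau> A where P: "\<And>i. i \<in> S \<Longrightarrow> P i (N i) (\<tau> i) (A i)"
    by metis
  have data: "\<And>i j. i \<in> S \<Longrightarrow> elementary_data M T F (N i j) (\<tau> i j) (A i j)"
    and lim1: "\<And>i. i \<in> S \<Longrightarrow> (\<lambda>j::nat. \<integral>\<^sup>+\<omega>. (\<integral>\<^sup>+s\<in>{0..T}.
             ennreal ((norm (elementary_integrand (N i j) (\<tau> i j) (A i j) s \<omega> - H i s \<omega>))\<^sup>2)
             \<partial>lborel) \<partial>M) \<longlonglongrightarrow> 0"
    and lim2: "\<And>i u. i \<in> S \<Longrightarrow> u \<in> {0..T} \<Longrightarrow> (\<lambda>j. \<integral>\<^sup>+\<omega>.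
             ennreal ((norm (elementary_integral W (N i j) (\<tau> i j) (A i j) u \<omega> - I i u \<omega>))\<^sup>2)
             \<partial>M) \<longlonglongrightarrow> 0"
    using P unfolding P_def by blast+
  define e where "e = (\<lambda>i j. elementary_integrand (N i j) (\<tau> i j) (A i j))"
  define E where "E = (\<lambda>i j. elementary_integral W (N i j) (\<tau> i j) (A i j))"
  define d1 where "d1 = (\<lambda>i j. \<integral>\<^sup>+\<omega>. (\<integral>\<^sup>+s\<in>{0..T}. ennreal ((norm (e i j s \<omega> - H i s \<omega>))\<^sup>2) \<partial>lborel) \<partial>M)"
  define d2 where "d2 = (\<lambda>i j u. \<integral>\<^sup>+\<omega>. ennreal ((norm (E i j u \<omega> - I i u \<omega>))\<^sup>2) \<partial>M)"
  define K where "K = (\<Sum>i\<in>S. (c i)\<^sup>2)"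
  have K0: "0 \<le> K" by (auto simp: K_def sum_nonneg)
  have tau: "0 \<le> \<tau> i j k" "\<tau> i j k \<le> T" if "i \<in> S" "k \<le> N i j" for i j k
    using data[OF that(1), of j] that(2) by (auto simp: elementary_data_def)
  have taumono: "\<tau> i j k \<le> \<tau> i j (Suc k)" if "i \<in> S" "k < N i j" for i j k
    using data[OF that(1), of j] that(2) by (auto simp: elementary_data_def)
  have AF: "A i j k \<in> borel_measurable (F (\<tau> i j k))" if "i \<in> S" "k < N i j" for i j k
    using data[OF that(1), of j] that(2) by (auto simp: elementary_data_def)
  have AM: "A i j k \<in> borel_measurable M" if "i \<in> S" "k < N i j" for i j k
    using usual_filtered_space_measurable(2)[OF U AF[OF that]] tau[of i k j] that by auto
  have WM: "W u \<in> borel_measurable M" if "0 \<le> u" "u \<le> T" for u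
    using B that usual_filtered_space_measurable(2)[OF U, of "W u" u u]
    by (auto simp: brownian_motion_def adapted_def)
  have IM: "I i u \<in> borel_measurable M" if "i \<in> S" "0 \<le> u" "u \<le> T" for i u
    using ito[OF that(1)] that usual_filtered_space_measurable(2)[OF U, of "I i u" u u]
    by (auto simp: ito_integral_def adapted_def)
  have EM: "E i j u \<in> borel_measurable M" if "i \<in> S" "0 \<le> u" "u \<le> T" for i j u
  proof -
    have "(\<lambda>\<omega>. A i j k \<omega> *v (W (min (\<tau> i j (Suc k)) u) \<omega> - W (min (\<tau> i j k) u) \<omega>)) \<in> borel_measurable M"
      if "k < N i j" for k
    proof (rule borel_measurable_continuous_Pair[where H="\<lambda>a v. a *v v"])
      show "A i j k \<in> borel_measurable M" using AM \<open>i \<in> S\<close> that by auto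
      show "(\<lambda>\<omega>. W (min (\<tau> i j (Suc k)) u) \<omega> - W (min (\<tau> i j k) u) \<omega>) \<in> borel_measurable M"
        using tau[of i _ j] \<open>i \<in> S\<close> \<open>0 \<le> u\<close> \<open>u \<le> T\<close> that
        by (intro borel_measurable_diff WM) (auto simp: min_le_iff_disj)
      show "continuous_on UNIV (\<lambda>x. fst x *v (snd x :: real^'d) :: real^'n)"
        unfolding matrix_vector_mult_def by (intro continuous_intros)
    qed
    then show ?thesis unfolding E_def elementary_integral_def by (intro borel_measurable_sum) auto
  qed
  define H' where "H' = (\<lambda>i \<omega> r. indicat_real {0..T} r *\<^sub>R H i r \<omega>)"
  have HM: "(\<lambda>(\<omega>, r). H' i \<omega> r) \<in> borel_measurable (M \<Otimes>\<^sub>M lborel)" if "i \<in> S" for i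
    unfolding H'_def using progressive_measurable[OF U, of "H i"] ito[OF that] st
    by (auto simp: ito_integral_def)
  have eM: "(\<lambda>(\<omega>, r). e i j r \<omega>) \<in> borel_measurable (M \<Otimes>\<^sub>M lborel)" if "i \<in> S" for i j
  proof -
    have "(\<lambda>p. \<Sum>k<N i j. indicat_real {\<tau> i j k<..\<tau> i j (Suc k)} (snd p) *\<^sub>R A i j k (fst p)) \<in> borel_measurable (M \<Otimes>\<^sub>M lborel)"
      using AM[OF that]
      by (intro borel_measurable_sum borel_measurable_scaleR measurable_compose[OF measurable_fst] measurable_compose[OF measurable_snd])
        auto
    then show ?thesis by (simp add: e_def elementary_integrand_def case_prod_beta')
  qed
  \<comment> \<open>Clamping every grid point to \<open>{s..t}\<close> turns the difference of an
    elementary integral at \<open>t\<close> and \<open>s\<close> into an elementary sum over the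
    clamped cells.\<close>
  define cl where "cl = (\<lambda>x. max s (min t x))"
  \<comment> \<open>One index per pair of an integral and a cell of its grid: the merged family to
    which the isometry applies.\<close>
  define J where "J = (\<lambda>j. SIGMA i:S. {..<N i j})"
  have J: "finite (J j)" for j using S by (auto simp: J_def)
  have cl: "0 \<le> cl x" "cl x \<le> T" "x \<le> y \<Longrightarrow> cl x \<le> cl y" for x y using st by (auto simp: cl_def)
  have Wcl: "W (min x t) \<omega> - W (min x s) \<omega> = W (cl x) \<omega> - W s \<omega>" for x \<omega>
  proof (cases "s = t")
    case False
    then show ?thesis using st by (auto simp: cl_def min_def max_def)
  qed (simp add: cl_def)
  have Eid: "(\<Sum>i\<in>S. c i *\<^sub>R (E i j t \<omega> - E i j s \<omega>))
    = (\<Sum>p\<in>J j. (c (fst p) *\<^sub>R A (fst p) j (snd p) \<omega>) *v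
        (W (cl (\<tau> (fst p) j (Suc (snd p)))) \<omega> - W (cl (\<tau> (fst p) j (snd p))) \<omega>))" for j \<omega>
  proof -
    have "a *v (W (min y t) \<omega> - W (min x t) \<omega>) - a *v (W (min y s) \<omega> - W (min x s) \<omega>)
      = a *v (W (cl y) \<omega> - W (cl x) \<omega>)" for x y and a :: "real^'d^'n"
    proof -
      have "(W (min y t) \<omega> - W (min x t) \<omega>) - (W (min y s) \<omega> - W (min x s) \<omega>)
        = (W (min y t) \<omega> - W (min y s) \<omega>) - (W (min x t) \<omega> - W (min x s) \<omega>)" by simp
      also have "\<dots> = W (cl y) \<omega> - W (cl x) \<omega>" unfolding Wcl by simp
      finally show ?thesis by (simp flip: matrix_vector_mult_diff_distrib)
    qed
    then show ?thesis
      by (simp add: E_def elementary_integral_def J_def sum_subtractf[symmetric] scaleR_sum_right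
          sum.Sigma S case_prod_beta' scaleR_matrix_vector_assoc)
  qed
  have ind: "indicat_real {cl x<..cl y} r = indicat_real {s<..t} r * indicat_real {x<..y} r" for x y r
    using st by (auto simp: indicator_def cl_def max_def min_def split: if_splits)
  have eid: "(\<Sum>p\<in>J j. indicat_real {cl (\<tau> (fst p) j (snd p))<..cl (\<tau> (fst p) j (Suc (snd p)))} r
      *\<^sub>R (c (fst p) *\<^sub>R A (fst p) j (snd p) \<omega>)) = indicat_real {s<..t} r *\<^sub>R (\<Sum>i\<in>S. c i *\<^sub>R e i j r \<omega>)" for j r \<omega>
    unfolding e_def elementary_integrand_def J_def scaleR_sum_right
    by (subst sum.Sigma) (auto simp: S case_prod_beta' ind ac_simps intro!: sum.cong)
  have iso: "(\<integral>\<^sup>+\<omega>. ennreal ((norm (\<Sum>i\<in>S. c i *\<^sub>R (E i j t \<omega> - E i j s \<omega>)))\<^sup>2) \<partial>M)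
      = (\<integral>\<^sup>+\<omega>. (\<integral>\<^sup>+r. ennreal ((norm (indicat_real {s<..t} r *\<^sub>R (\<Sum>i\<in>S. c i *\<^sub>R e i j r \<omega>)))\<^sup>2) \<partial>lborel) \<partial>M)" for j
  proof -
    have "\<forall>p\<in>J j. \<exists>b. \<forall>\<omega>\<in>space M. norm (A (fst p) j (snd p) \<omega>) \<le> b"
      using data by (auto simp: J_def elementary_data_def)
    then obtain b where b: "\<And>p \<omega>. p \<in> J j \<Longrightarrow> \<omega> \<in> space M \<Longrightarrow> norm (A (fst p) j (snd p) \<omega>) \<le> b p"
      unfolding bchoice_iff by auto
    show ?thesis
      unfolding Eid eid[symmetric]
    proof (rule elementary_isometry[OF U B J])
      fix p assume p: "p \<in> J j"
      then have p': "fst p \<in> S" "snd p < N (fst p) j" by (auto simp: J_def)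
      show "0 \<le> cl (\<tau> (fst p) j (snd p)) \<and> cl (\<tau> (fst p) j (snd p)) \<le> cl (\<tau> (fst p) j (Suc (snd p))) \<and>
         cl (\<tau> (fst p) j (Suc (snd p))) \<le> T"
        using cl taumono[OF p'] by auto
      \<comment> \<open>A clamped cell that does not collapse starts no earlier than the original
        cell, hence its coefficient is still measurable there. If the original cell starts after
        \<open>t\<close>, both clamped ends are \<open>t\<close>.\<close>
      { assume "cl (\<tau> (fst p) j (snd p)) < cl (\<tau> (fst p) j (Suc (snd p)))"
        then have "\<tau> (fst p) j (snd p) \<le> cl (\<tau> (fst p) j (snd p))"
          using st by (auto simp: cl_def max_def min_def split: if_splits)
        then have [measurable]: "A (fst p) j (snd p) \<in> borel_measurable (F (cl (\<tau> (fst p) j (snd p))))"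
          using usual_filtered_space_measurable(1)[OF U AF[OF p']] tau[of "fst p" "snd p" j] p' cl by auto
        show "(\<lambda>\<omega>. c (fst p) *\<^sub>R A (fst p) j (snd p) \<omega>) \<in> borel_measurable (F (cl (\<tau> (fst p) j (snd p))))"
          by measurable }
      fix \<omega> assume "\<omega> \<in> space M"
      with b[OF p this] show "norm (c (fst p) *\<^sub>R A (fst p) j (snd p) \<omega>) \<le> \<bar>c (fst p)\<bar> * b p"
        by (simp add: mult_left_mono)
    qed
  qed
  define R where "R = (\<integral>\<^sup>+\<omega>. (\<integral>\<^sup>+r\<in>{s..t}. ennreal ((norm (\<Sum>i\<in>S. c i *\<^sub>R H i r \<omega>))\<^sup>2) \<partial>lborel) \<partial>M)"
  define L where "L = (\<integral>\<^sup>+\<omega>. ennreal ((norm (\<Sum>i\<in>S. c i *\<^sub>R (I i t \<omega> - I i s \<omega>)))\<^sup>2) \<partial>M)"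
  \<comment> \<open>Passage from \<open>I\<close> to the elementary integrals. Cauchy-Schwarz bounds
    the error by \<open>K\<close> times the summed squared errors; of the factor 4, one 2 splits the
    square and the other separates the times \<open>t\<close> and \<open>s\<close>.\<close>
  have step1: "L \<le> 2 * (\<integral>\<^sup>+\<omega>. ennreal ((norm (\<Sum>i\<in>S. c i *\<^sub>R (E i j t \<omega> - E i j s \<omega>)))\<^sup>2) \<partial>M)
      + ennreal (4 * K) * (\<Sum>i\<in>S. d2 i j t + d2 i j s)" for j
  proof -
    have pt: "ennreal ((norm (\<Sum>i\<in>S. c i *\<^sub>R (I i t \<omega> - I i s \<omega>)))\<^sup>2)
      \<le> 2 * ennreal ((norm (\<Sum>i\<in>S. c i *\<^sub>R (E i j t \<omega> - E i j s \<omega>)))\<^sup>2)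
      + ennreal (4 * K) * (\<Sum>i\<in>S. ennreal ((norm (E i j t \<omega> - I i t \<omega>))\<^sup>2) + ennreal ((norm (E i j s \<omega> - I i s \<omega>))\<^sup>2))" for \<omega>
    proof -
      let ?x = "\<Sum>i\<in>S. c i *\<^sub>R (I i t \<omega> - I i s \<omega>)" and ?y = "\<Sum>i\<in>S. c i *\<^sub>R (E i j t \<omega> - E i j s \<omega>)"
      let ?z = "\<lambda>i. (E i j t \<omega> - E i j s \<omega>) - (I i t \<omega> - I i s \<omega>)"
      let ?q = "\<lambda>i. (norm (E i j t \<omega> - I i t \<omega>))\<^sup>2 + (norm (E i j s \<omega> - I i s \<omega>))\<^sup>2"
      have "?y - ?x = (\<Sum>i\<in>S. c i *\<^sub>R ?z i)"
        by (simp add: sum_subtractf[symmetric] scaleR_diff_right[symmetric])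
      then have 1: "(norm ?x)\<^sup>2 \<le> 2 * (norm ?y)\<^sup>2 + 2 * (norm (\<Sum>i\<in>S. c i *\<^sub>R ?z i))\<^sup>2"
        using norm_square_le_double[of ?x ?y] by simp
      have 2: "(norm (\<Sum>i\<in>S. c i *\<^sub>R ?z i))\<^sup>2 \<le> K * (\<Sum>i\<in>S. (norm (?z i))\<^sup>2)"
        unfolding K_def by (rule norm_sum_scaleR_square_le)
      have 3: "K * (\<Sum>i\<in>S. (norm (?z i))\<^sup>2) \<le> K * (2 * (\<Sum>i\<in>S. ?q i))"
        unfolding sum_distrib_left[of 2]
      proof (intro mult_left_mono sum_mono K0)
        fix i show "(norm (?z i))\<^sup>2 \<le> 2 * ?q i"
          using norm_square_le_double[of "?z i" "E i j t \<omega> - I i t \<omega>"] by (simp add: algebra_simps)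
      qed
      have "(norm ?x)\<^sup>2 \<le> 2 * (norm ?y)\<^sup>2 + 4 * K * (\<Sum>i\<in>S. ?q i)"
        using 1 2 3 by linarith
      then have "ennreal ((norm ?x)\<^sup>2) \<le> ennreal (2 * (norm ?y)\<^sup>2 + 4 * K * (\<Sum>i\<in>S. ?q i))" by (rule ennreal_leI)
      also have "\<dots> = 2 * ennreal ((norm ?y)\<^sup>2)
         + ennreal (4 * K) * (\<Sum>i\<in>S. ennreal ((norm (E i j t \<omega> - I i t \<omega>))\<^sup>2) + ennreal ((norm (E i j s \<omega> - I i s \<omega>))\<^sup>2))"
        using K0 by (simp add: ennreal_plus[symmetric] ennreal_mult sum_nonneg del: ennreal_plus) (simp add: ennreal_plus sum_nonneg ennreal_mult)
      finally show ?thesis .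
    qed
    have m: "(\<lambda>\<omega>. \<Sum>i\<in>S. c i *\<^sub>R (E i j t \<omega> - E i j s \<omega>)) \<in> borel_measurable M"
      using EM st by (intro borel_measurable_sum borel_measurable_scaleR borel_measurable_diff) auto
    have m': "(\<lambda>\<omega>. ennreal ((norm (E i j u \<omega> - I i u \<omega>))\<^sup>2)) \<in> borel_measurable M" if "i \<in> S" "0 \<le> u" "u \<le> T" for i u
      using EM[OF that] IM[OF that] by measurable
    note [measurable] = m
    have "L \<le> (\<integral>\<^sup>+\<omega>. (2 * ennreal ((norm (\<Sum>i\<in>S. c i *\<^sub>R (E i j t \<omega> - E i j s \<omega>)))\<^sup>2)
      + ennreal (4 * K) * (\<Sum>i\<in>S. ennreal ((norm (E i j t \<omega> - I i t \<omega>))\<^sup>2) + ennreal ((norm (E i j s \<omega> - I i s \<omega>))\<^sup>2))) \<partial>M)"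
      unfolding L_def by (intro nn_integral_mono pt)
    also have "\<dots> = 2 * (\<integral>\<^sup>+\<omega>. ennreal ((norm (\<Sum>i\<in>S. c i *\<^sub>R (E i j t \<omega> - E i j s \<omega>)))\<^sup>2) \<partial>M)
      + ennreal (4 * K) * (\<Sum>i\<in>S. d2 i j t + d2 i j s)"
      using st m'[of _ t] m'[of _ s]
      by (subst nn_integral_add, simp, simp, subst nn_integral_cmult, simp, subst nn_integral_cmult, simp)
        (simp add: nn_integral_sum nn_integral_add d2_def)
    finally show ?thesis .
  qed
  \<comment> \<open>The reverse passage for the integrands, from the elementary ones to
    \<open>H\<close>, with error terms \<open>d1\<close>.\<close>
  have step2: "(\<integral>\<^sup>+\<omega>. (\<integral>\<^sup>+r. ennreal ((norm (indicat_real {s<..t} r *\<^sub>R (\<Sum>i\<in>S. c i *\<^sub>R e i j r \<omega>)))\<^sup>2) \<partial>lborel) \<partial>M)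
     \<le> 2 * R + ennreal (2 * K) * (\<Sum>i\<in>S. d1 i j)" for j
  proof -
    let ?f = "\<lambda>\<omega> r. ennreal ((norm (\<Sum>i\<in>S. c i *\<^sub>R H i r \<omega>))\<^sup>2) * indicator {s..t} r"
    let ?g = "\<lambda>i \<omega> r. ennreal ((norm (e i j r \<omega> - H i r \<omega>))\<^sup>2) * indicator {0..T} r"
    have pt: "ennreal ((norm (indicat_real {s<..t} r *\<^sub>R (\<Sum>i\<in>S. c i *\<^sub>R e i j r \<omega>)))\<^sup>2)
      \<le> 2 * ?f \<omega> r + ennreal (2 * K) * (\<Sum>i\<in>S. ?g i \<omega> r)" for r \<omega>
    proof (cases "r \<in> {s<..t}")
      case True
      let ?x = "\<Sum>i\<in>S. c i *\<^sub>R e i j r \<omega>" and ?y = "\<Sum>i\<in>S. c i *\<^sub>R H i r \<omega>"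
      have "?y - ?x = (\<Sum>i\<in>S. c i *\<^sub>R (H i r \<omega> - e i j r \<omega>))"
        by (simp add: sum_subtractf[symmetric] scaleR_diff_right[symmetric])
      then have 1: "(norm ?x)\<^sup>2 \<le> 2 * (norm ?y)\<^sup>2 + 2 * (norm (\<Sum>i\<in>S. c i *\<^sub>R (H i r \<omega> - e i j r \<omega>)))\<^sup>2"
        using norm_square_le_double[of ?x ?y] by simp
      have 2: "(norm (\<Sum>i\<in>S. c i *\<^sub>R (H i r \<omega> - e i j r \<omega>)))\<^sup>2 \<le> K * (\<Sum>i\<in>S. (norm (e i j r \<omega> - H i r \<omega>))\<^sup>2)"
        unfolding K_def norm_minus_commute[of "e _ _ _ _"] by (rule norm_sum_scaleR_square_le)
      have "(norm ?x)\<^sup>2 \<le> 2 * (norm ?y)\<^sup>2 + (2 * K) * (\<Sum>i\<in>S. (norm (e i j r \<omega> - H i r \<omega>))\<^sup>2)"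
        using 1 2 by linarith
      then have "ennreal ((norm ?x)\<^sup>2) \<le> ennreal (2 * (norm ?y)\<^sup>2 + (2 * K) * (\<Sum>i\<in>S. (norm (e i j r \<omega> - H i r \<omega>))\<^sup>2))"
        by (rule ennreal_leI)
      also have "\<dots> = 2 * ennreal ((norm ?y)\<^sup>2) + ennreal (2 * K) * (\<Sum>i\<in>S. ennreal ((norm (e i j r \<omega> - H i r \<omega>))\<^sup>2))"
        using K0 by (simp add: ennreal_plus sum_nonneg ennreal_mult)
      finally show ?thesis using True st by simp
    qed simp
    have fM: "(\<lambda>(\<omega>, r). ?f \<omega> r) \<in> borel_measurable (M \<Otimes>\<^sub>M lborel)"
    proof -
      have "?f \<omega> r = ennreal ((norm (\<Sum>i\<in>S. c i *\<^sub>R H' i \<omega> r))\<^sup>2) * indicator {s..t} r" for \<omega> r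
        using st by (auto simp: indicator_def H'_def)
      moreover have "(\<lambda>p. \<Sum>i\<in>S. c i *\<^sub>R H' i (fst p) (snd p)) \<in> borel_measurable (M \<Otimes>\<^sub>M lborel)"
        using HM by (intro borel_measurable_sum borel_measurable_scaleR) (auto simp: case_prod_beta')
      ultimately show ?thesis by (simp add: case_prod_beta')
    qed
    have gM: "(\<lambda>(\<omega>, r). ?g i \<omega> r) \<in> borel_measurable (M \<Otimes>\<^sub>M lborel)" if "i \<in> S" for i
    proof -
      have "?g i \<omega> r = ennreal ((norm (e i j r \<omega> - H' i \<omega> r))\<^sup>2) * indicator {0..T} r" for \<omega> r
        using st by (auto simp: indicator_def H'_def)
      then show ?thesis using HM[OF that] eM[OF that, of j] by (simp add: case_prod_beta')
    qed
    have fM1: "(\<lambda>r. ?f \<omega> r) \<in> borel_measurable lborel" if "\<omega> \<in> space M" for \<omega>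
      using measurable_compose[OF measurable_Pair1'[OF that] fM] by simp
    have gM1: "(\<lambda>r. ?g i \<omega> r) \<in> borel_measurable lborel" if "\<omega> \<in> space M" "i \<in> S" for \<omega> i
      using measurable_compose[OF measurable_Pair1'[OF that(1)] gM[OF that(2)]] by simp
    have fM2: "(\<lambda>\<omega>. \<integral>\<^sup>+r. ?f \<omega> r \<partial>lborel) \<in> borel_measurable M"
      using sigma_finite_measure.borel_measurable_nn_integral[OF sigma_finite_lborel fM] .
    have gM2: "(\<lambda>\<omega>. \<integral>\<^sup>+r. ?g i \<omega> r \<partial>lborel) \<in> borel_measurable M" if "i \<in> S" for i
      using sigma_finite_measure.borel_measurable_nn_integral[OF sigma_finite_lborel gM[OF that]] .
    have "(\<integral>\<^sup>+\<omega>. (\<integral>\<^sup>+r. ennreal ((norm (indicat_real {s<..t} r *\<^sub>R (\<Sum>i\<in>S. c i *\<^sub>R e i j r \<omega>)))\<^sup>2) \<partial>lborel) \<partial>M)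
      \<le> (\<integral>\<^sup>+\<omega>. (\<integral>\<^sup>+r. 2 * ?f \<omega> r + ennreal (2 * K) * (\<Sum>i\<in>S. ?g i \<omega> r) \<partial>lborel) \<partial>M)"
      by (intro nn_integral_mono pt)
    also have "\<dots> = (\<integral>\<^sup>+\<omega>. 2 * (\<integral>\<^sup>+r. ?f \<omega> r \<partial>lborel) + ennreal (2 * K) * (\<Sum>i\<in>S. \<integral>\<^sup>+r. ?g i \<omega> r \<partial>lborel) \<partial>M)"
    proof (rule nn_integral_cong)
      fix \<omega> assume w: "\<omega> \<in> space M"
      show "(\<integral>\<^sup>+r. 2 * ?f \<omega> r + ennreal (2 * K) * (\<Sum>i\<in>S. ?g i \<omega> r) \<partial>lborel)
        = 2 * (\<integral>\<^sup>+r. ?f \<omega> r \<partial>lborel) + ennreal (2 * K) * (\<Sum>i\<in>S. \<integral>\<^sup>+r. ?g i \<omega> r \<partial>lborel)"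
        using fM1[OF w] gM1[OF w]
        by (subst nn_integral_add) (auto simp: nn_integral_cmult nn_integral_sum)
    qed
    also have "\<dots> = 2 * R + ennreal (2 * K) * (\<Sum>i\<in>S. d1 i j)"
      using fM2 gM2 by (subst nn_integral_add) (auto simp: nn_integral_cmult nn_integral_sum R_def d1_def)
    finally show ?thesis .
  qed
  \<comment> \<open>The isometry joins the two passages for each \<open>j\<close>. As
    \<open>j\<close> grows all error terms vanish and the constant 2 times 2 remains.\<close>
  have "L \<le> 2 * (2 * R + ennreal (2 * K) * (\<Sum>i\<in>S. d1 i j)) + ennreal (4 * K) * (\<Sum>i\<in>S. d2 i j t + d2 i j s)" for j
    using step1[of j] mult_left_mono[OF step2[of j], of 2] unfolding iso by (auto intro: order_trans add_right_mono)
  moreover have "(\<lambda>j. 2 * (2 * R + ennreal (2 * K) * (\<Sum>i\<in>S. d1 i j)) + ennreal (4 * K) * (\<Sum>i\<in>S. d2 i j t + d2 i j s))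
     \<longlonglongrightarrow> 2 * (2 * R + ennreal (2 * K) * (\<Sum>i\<in>S. 0)) + ennreal (4 * K) * (\<Sum>i\<in>S. 0 + 0)"
    using lim1 lim2 st unfolding d1_def d2_def e_def E_def
    by (intro tendsto_add ennreal_tendsto_cmult tendsto_const tendsto_sum) auto
  ultimately have "L \<le> 2 * (2 * R + ennreal (2 * K) * (\<Sum>i\<in>S. 0)) + ennreal (4 * K) * (\<Sum>i\<in>S. 0 + 0)"
    by (intro LIMSEQ_le_const) auto
  then show ?thesis by (simp add: L_def R_def mult.assoc[symmetric])
qed

section \<open>Right-continuous processes and Gronwall in integrated form\<close>

text \<open>Rounding goes upwards, so that limits are taken from the right. With
  \<open>n + 1\<close> cells the mesh is defined for \<open>n = 0\<close> too, and since
  \<open>T\<close> is a grid point the rounded time never leaves \<open>{0..T}\<close>.\<close>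

definition right_grid :: "real \<Rightarrow> nat \<Rightarrow> real \<Rightarrow> real" where
  "right_grid T n t = real_of_int \<lceil>t * (real n + 1) / T\<rceil> * T / (real n + 1)"

lemma right_grid:
  assumes T: "T > 0" and t: "t \<in> {0..T}"
  shows "t \<le> right_grid T n t" "right_grid T n t \<le> T" "right_grid T n t \<le> t + T / (real n + 1)"
proof -
  let ?x = "t * (real n + 1) / T"
  have x: "?x \<le> of_int \<lceil>?x\<rceil>" "of_int \<lceil>?x\<rceil> \<le> ?x + 1" by linarith+
  have "?x \<le> real (n + 1)" using T t by (simp add: divide_simps mult.commute add.commute mult_right_mono)
  then have "\<lceil>?x\<rceil> \<le> int (n + 1)" by (intro ceiling_le) simp
  then have x2: "real_of_int \<lceil>?x\<rceil> \<le> n + 1" by linarith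
  have e: "?x * T / (real n + 1) = t" using T by simp
  have "?x * T / (real n + 1) \<le> right_grid T n t"
    unfolding right_grid_def using x(1) T by (intro divide_right_mono mult_right_mono) auto
  then show "t \<le> right_grid T n t" unfolding e .
  have "right_grid T n t \<le> (n + 1) * T / (real n + 1)"
    unfolding right_grid_def using x2 T by (intro divide_right_mono mult_right_mono) auto
  then show "right_grid T n t \<le> T" by (simp add: add.commute)
  have "right_grid T n t \<le> (?x + 1) * T / (real n + 1)"
    unfolding right_grid_def using x(2) T by (intro divide_right_mono mult_right_mono) auto
  also have "\<dots> = t + T / (real n + 1)" unfolding distrib_right add_divide_distrib e by simp
  finally show "right_grid T n t \<le> t + T / (real n + 1)" .
qed

lemma right_grid_in: "T > 0 \<Longrightarrow> t \<in> {0..T} \<Longrightarrow> right_grid T n t \<in> {0..T}"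
  using right_grid[of T t n] by auto

lemma right_grid_tendsto:
  assumes "T > 0" "t \<in> {0..T}"
  shows "(\<lambda>n. right_grid T n t) \<longlonglongrightarrow> t"
proof (rule tendsto_sandwich)
  show "\<forall>\<^sub>F n in sequentially. t \<le> right_grid T n t"
    "\<forall>\<^sub>F n in sequentially. right_grid T n t \<le> t + T * inverse (real (Suc n))"
    using right_grid[OF assms] by (auto simp: divide_inverse add.commute)
  have "(\<lambda>n. t + T * inverse (real (Suc n))) \<longlonglongrightarrow> t + T * 0"
    by (intro tendsto_intros LIMSEQ_inverse_real_of_nat)
  then show "(\<lambda>n. t + T * inverse (real (Suc n))) \<longlonglongrightarrow> t" by simp
qed simp

text \<open>At \<open>t = T\<close> the rounded time is \<open>T\<close> for every \<open>n\<close>,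
  so a right limit is asked for only before \<open>T\<close>.\<close>

lemma tendsto_right_grid:
  fixes f :: "real \<Rightarrow> 'a::topological_space"
  assumes T: "T > 0" "t \<in> {0..T}" and f: "t < T \<Longrightarrow> (f \<longlongrightarrow> f t) (at_right t)"
  shows "(\<lambda>n. f (right_grid T n t)) \<longlonglongrightarrow> f t"
proof (cases "t < T")
  case True
  show ?thesis
  proof (rule topological_tendstoI)
    fix S assume S: "open S" "f t \<in> S"
    from topological_tendstoD[OF f[OF True] S] obtain b where b: "b > t" "\<And>s. t < s \<Longrightarrow> s < b \<Longrightarrow> f s \<in> S"
      unfolding eventually_at_right[OF True] by blast
    show "\<forall>\<^sub>F n in sequentially. f (right_grid T n t) \<in> S"
      using order_tendstoD(2)[OF right_grid_tendsto[OF T] b(1)]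
    proof eventually_elim
      case (elim n)
      then show ?case using right_grid(1)[OF T, of n] b(2)[of "right_grid T n t"] S(2)
        by (cases "right_grid T n t = t") auto
    qed
  qed
next
  case False
  then have "t = T" using T by simp
  then have "right_grid T n t = t" for n using right_grid[OF T, of n] by simp
  then show ?thesis by simp
qed

text \<open>As a finite sum of indicators times values, the step function is visibly measurable and
  can be integrated cell by cell. Index 0 belongs to the single time 0: its cell reaches below 0,
  and later an atom at time 0 is caught by it.\<close>

lemma sum_right_grid:
  fixes f :: "real \<Rightarrow> 'a::real_vector"
  assumes T: "T > 0" and t: "t \<in> {0..T}"
  shows "f (right_grid T n t) = (\<Sum>i\<le>n + 1. indicat_real {(real i - 1) * T / (real n + 1)<..real i * T / (real n + 1)} t *\<^sub>R f (real i * T / (real n + 1)))"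
proof -
  let ?x = "t * (real n + 1) / T"
  define k where "k = nat \<lceil>?x\<rceil>"
  have x0: "0 \<le> ?x" using T t by simp
  then have k: "real k = of_int \<lceil>?x\<rceil>" unfolding k_def by simp
  have "?x \<le> real (n + 1)" using T t by (simp add: divide_simps mult.commute add.commute mult_right_mono)
  then have "\<lceil>?x\<rceil> \<le> int (n + 1)" by (intro ceiling_le) simp
  then have kn: "k \<le> n + 1" unfolding k_def by linarith
  have iff: "t \<in> {(real i - 1) * T / (real n + 1)<..real i * T / (real n + 1)} \<longleftrightarrow> i = k" for i :: nat
  proof -
    have "t \<in> {(real i - 1) * T / (real n + 1)<..real i * T / (real n + 1)} \<longleftrightarrow> real i - 1 < ?x \<and> ?x \<le> real i"
      using T by (simp add: field_simps)
    also have "\<dots> \<longleftrightarrow> \<lceil>?x\<rceil> = int i" by (simp add: ceiling_eq_iff)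
    also have "\<dots> \<longleftrightarrow> i = k" using k x0 by linarith
    finally show ?thesis .
  qed
  have "(\<Sum>i\<le>n + 1. indicat_real {(real i - 1) * T / (real n + 1)<..real i * T / (real n + 1)} t *\<^sub>R f (real i * T / (real n + 1)))
    = (\<Sum>i\<le>n + 1. if i = k then f (real i * T / (real n + 1)) else 0)"
    unfolding indicator_def iff by (intro sum.cong) auto
  also have "\<dots> = f (right_grid T n t)" using kn by (simp add: right_grid_def k)
  finally show ?thesis by simp
qed

text \<open>A right-continuous process is the limit of its values at the next grid point.\<close>

lemma right_continuous_process_measurable:
  fixes f :: "real \<Rightarrow> 'w \<Rightarrow> 'a::{second_countable_topology, real_normed_vector}"
  assumes T: "T > 0" and f: "\<And>t. t \<in> {0..T} \<Longrightarrow> f t \<in> borel_measurable N"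
    and rc: "\<And>t \<omega>. \<omega> \<in> space N \<Longrightarrow> 0 \<le> t \<Longrightarrow> t < T \<Longrightarrow> ((\<lambda>s. f s \<omega>) \<longlongrightarrow> f t \<omega>) (at_right t)"
  shows "(\<lambda>(\<omega>, t). indicat_real {0..T} t *\<^sub>R f t \<omega>) \<in> borel_measurable (N \<Otimes>\<^sub>M borel)"
proof -
  let ?g = "\<lambda>n. \<lambda>(\<omega>, t). indicat_real {0..T} t *\<^sub>R
    (\<Sum>i\<le>n + 1. indicat_real {(real i - 1) * T / (real n + 1)<..real i * T / (real n + 1)} t *\<^sub>R f (real i * T / (real n + 1)) \<omega>)"
  have g: "?g n \<in> borel_measurable (N \<Otimes>\<^sub>M borel)" for n
  proof -
    define lo hi where "lo = (\<lambda>i. (real i - 1) * T / (real n + 1))" and "hi = (\<lambda>i. real i * T / (real n + 1))"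
    have "f (hi i) \<in> borel_measurable N" if "i \<le> n + 1" for i
    proof (rule f)
      have "real i * T / (real n + 1) \<le> real (n + 1) * T / (real n + 1)"
        using that T by (intro divide_right_mono mult_right_mono) auto
      then show "hi i \<in> {0..T}" using T by (simp add: hi_def add.commute)
    qed
    then have "(\<lambda>p. f (hi i) (fst p)) \<in> borel_measurable (N \<Otimes>\<^sub>M (borel::real measure))" if "i \<le> n + 1" for i
      using that by (intro measurable_compose[OF measurable_fst]) auto
    then have "(\<lambda>(\<omega>, t). indicat_real {0..T} t *\<^sub>R (\<Sum>i\<le>n + 1. indicat_real {lo i<..hi i} t *\<^sub>R f (hi i) \<omega>))
        \<in> borel_measurable (N \<Otimes>\<^sub>M borel)"
      unfolding case_prod_beta'
      by (intro borel_measurable_scaleR borel_measurable_sum measurable_compose[OF measurable_snd borel_measurable_indicator]) auto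
    then show ?thesis by (simp only: lo_def hi_def)
  qed
  show ?thesis
  proof (rule borel_measurable_LIMSEQ_metric[OF g])
    fix p assume "p \<in> space (N \<Otimes>\<^sub>M (borel::real measure))"
    then obtain \<omega> t where p: "p = (\<omega>, t)" "\<omega> \<in> space N" by (auto simp: space_pair_measure)
    show "(\<lambda>n. ?g n p) \<longlonglongrightarrow> (case p of (\<omega>, t) \<Rightarrow> indicat_real {0..T} t *\<^sub>R f t \<omega>)"
    proof (cases "t \<in> {0..T}")
      case True
      have "?g n p = f (right_grid T n t) \<omega>" for n
        unfolding sum_right_grid[OF T True, of "\<lambda>t. f t \<omega>" n] p(1) prod.case indicator_simps(1)[OF True] scaleR_one by (rule refl)
      with True show ?thesis using tendsto_right_grid[OF T True, of "\<lambda>t. f t \<omega>"] rc[OF p(2)] True p by simp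
    qed (simp add: p)
  qed
qed

text \<open>Against the weight exp(-2 L t) the integral term costs only half of the weighted
  integral \<open>V\<close>, so \<open>V\<close> is at most the integral of \<open>a\<close> plus
  \<open>V / 2\<close>. Absorbing the half gives the factor 2, and removing the weight gives exp(2 L
  T). Only integrals of \<open>u\<close> are estimated, so measurability is enough.\<close>

lemma integrated_gronwall:
  fixes u a :: "real \<Rightarrow> ennreal"
  assumes [measurable]: "u \<in> borel_measurable borel" "a \<in> borel_measurable borel"
    and L: "L > 0" and T: "T \<ge> 0"
    and le: "\<And>t. t \<in> {0..T} \<Longrightarrow> u t \<le> a t + ennreal L * (\<integral>\<^sup>+s\<in>{0..t}. u s \<partial>lborel)"
    and fin: "(\<integral>\<^sup>+s\<in>{0..T}. u s \<partial>lborel) < \<infinity>"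
  shows "(\<integral>\<^sup>+s\<in>{0..T}. u s \<partial>lborel) \<le> ennreal (2 * exp (2 * L * T)) * (\<integral>\<^sup>+s\<in>{0..T}. a s \<partial>lborel)"
proof -
  define w where "w = (\<lambda>t. ennreal (exp (- (2 * L) * t)))"
  have [measurable]: "w \<in> borel_measurable borel" unfolding w_def by measurable
  have w_le: "w t * z \<le> z" if "t \<in> {0..T}" for t z
    using mult_right_mono[of "w t" 1 z] that L by (simp add: w_def)
  define V where "V = (\<integral>\<^sup>+t\<in>{0..T}. w t * u t \<partial>lborel)"
  have "V \<le> (\<integral>\<^sup>+s\<in>{0..T}. u s \<partial>lborel)"
    unfolding V_def by (intro nn_integral_mono) (auto simp: indicator_def intro: w_le)
  \<comment> \<open>Finiteness is what allows half of \<open>V\<close> to be subtracted at the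
    end.\<close>
  then have Vfin: "V < \<infinity>" using fin by (rule order_le_less_trans)
  \<comment> \<open>After the order of integration is exchanged, each time \<open>s\<close> is
    charged with the weight that lies to the right of it. The rate \<open>2 * L\<close> in the
    exponent makes this charge \<open>1 / (2 * L)\<close>, one half after multiplication by
    \<open>L\<close>.\<close>
  have tail: "(\<integral>\<^sup>+t\<in>{s..T}. w t \<partial>lborel) \<le> ennreal (1 / (2 * L)) * w s" if s: "s \<in> {0..T}" for s
  proof -
    have "(\<integral>\<^sup>+t\<in>{s..T}. w t \<partial>lborel)
        = ennreal ((- exp (- (2 * L) * T) / (2 * L)) - (- exp (- (2 * L) * s) / (2 * L)))"
      unfolding w_def
      by (rule nn_integral_FTC_Icc) (use s L in \<open>auto intro!: derivative_eq_intros\<close>)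
    also have "\<dots> \<le> ennreal (1 / (2 * L) * exp (- (2 * L) * s))"
      using L by (intro ennreal_leI) (simp add: field_simps)
    also have "\<dots> = ennreal (1 / (2 * L)) * w s" using L by (simp add: w_def ennreal_mult[symmetric])
    finally show ?thesis .
  qed
  have "V \<le> (\<integral>\<^sup>+t. (w t * a t) * indicator {0..T} t
        + ennreal L * (\<integral>\<^sup>+s. w t * indicator {0..T} t * (u s * indicator {0..t} s) \<partial>lborel) \<partial>lborel)"
    unfolding V_def
  proof (rule nn_integral_mono)
    fix t
    show "w t * u t * indicator {0..T} t \<le> w t * a t * indicator {0..T} t
        + ennreal L * (\<integral>\<^sup>+s. w t * indicator {0..T} t * (u s * indicator {0..t} s) \<partial>lborel)"
    proof (cases "t \<in> {0..T}")
      case True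
      then have "w t * u t \<le> w t * (a t + ennreal L * (\<integral>\<^sup>+s\<in>{0..t}. u s \<partial>lborel))"
        by (intro mult_left_mono le) auto
      also have "\<dots> = w t * a t + ennreal L * (\<integral>\<^sup>+s. w t * (u s * indicator {0..t} s) \<partial>lborel)"
        by (subst nn_integral_cmult) (auto simp: distrib_left ac_simps)
      finally show ?thesis using True by simp
    qed simp
  qed
  also have "\<dots> = (\<integral>\<^sup>+t\<in>{0..T}. w t * a t \<partial>lborel)
      + ennreal L * (\<integral>\<^sup>+t. \<integral>\<^sup>+s. w t * indicator {0..T} t * (u s * indicator {0..t} s) \<partial>lborel \<partial>lborel)"
    by (subst nn_integral_add) (auto simp: nn_integral_cmult indicator_def cong: if_cong)
  finally have V0: "V \<le> (\<integral>\<^sup>+t\<in>{0..T}. w t * a t \<partial>lborel)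
      + ennreal L * (\<integral>\<^sup>+t. \<integral>\<^sup>+s. w t * indicator {0..T} t * (u s * indicator {0..t} s) \<partial>lborel \<partial>lborel)" .
  have "(\<integral>\<^sup>+t. \<integral>\<^sup>+s. w t * indicator {0..T} t * (u s * indicator {0..t} s) \<partial>lborel \<partial>lborel)
      = (\<integral>\<^sup>+s. \<integral>\<^sup>+t. w t * indicator {0..T} t * (u s * indicator {0..t} s) \<partial>lborel \<partial>lborel)"
  proof (rule lborel_pair.Fubini')
    have "(\<lambda>(y, x). w x * indicator {0..T} x * (u y * (if 0 \<le> y \<and> y \<le> x then 1 else 0)))
        \<in> borel_measurable (lborel \<Otimes>\<^sub>M lborel)" by measurable
    then show "(\<lambda>(y, x). w x * indicator {0..T} x * (u y * indicator {0..x} y)) \<in> borel_measurable (lborel \<Otimes>\<^sub>M lborel)"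
      by (simp add: indicator_def cong: if_cong)
  qed
  also have "\<dots> \<le> (\<integral>\<^sup>+s. ennreal (1 / (2 * L)) * (w s * u s * indicator {0..T} s) \<partial>lborel)"
  proof (rule nn_integral_mono)
    fix s
    have "(\<integral>\<^sup>+t. w t * indicator {0..T} t * (u s * indicator {0..t} s) \<partial>lborel)
        = (\<integral>\<^sup>+t. (u s * indicator {0..T} s) * (w t * indicator {s..T} t) \<partial>lborel)"
      by (intro nn_integral_cong) (auto simp: indicator_def ac_simps)
    also have "\<dots> = (u s * indicator {0..T} s) * (\<integral>\<^sup>+t\<in>{s..T}. w t \<partial>lborel)"
      by (rule nn_integral_cmult) measurable
    also have "\<dots> \<le> (u s * indicator {0..T} s) * (ennreal (1 / (2 * L)) * w s)"
      using tail[of s] by (cases "s \<in> {0..T}") (auto intro: mult_left_mono)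
    finally show "(\<integral>\<^sup>+t. w t * indicator {0..T} t * (u s * indicator {0..t} s) \<partial>lborel)
        \<le> ennreal (1 / (2 * L)) * (w s * u s * indicator {0..T} s)"
      by (simp add: ac_simps)
  qed
  also have "\<dots> = ennreal (1 / (2 * L)) * V"
    unfolding V_def by (rule nn_integral_cmult) measurable
  finally have "V \<le> (\<integral>\<^sup>+t\<in>{0..T}. w t * a t \<partial>lborel) + ennreal L * (ennreal (1 / (2 * L)) * V)"
    by (intro order_trans[OF V0] add_left_mono mult_left_mono) auto
  moreover have "ennreal L * (ennreal (1 / (2 * L)) * V) = ennreal (1 / 2) * V"
    using L by (simp add: mult.assoc[symmetric] ennreal_mult[symmetric])
  ultimately have V1: "V \<le> (\<integral>\<^sup>+t\<in>{0..T}. w t * a t \<partial>lborel) + ennreal (1 / 2) * V" by simp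
  have wa: "(\<integral>\<^sup>+t\<in>{0..T}. w t * a t \<partial>lborel) \<le> (\<integral>\<^sup>+t\<in>{0..T}. a t \<partial>lborel)"
    by (intro nn_integral_mono) (auto simp: indicator_def intro: w_le)
  have V2: "V \<le> 2 * (\<integral>\<^sup>+t\<in>{0..T}. a t \<partial>lborel)"
  proof (cases "(\<integral>\<^sup>+t\<in>{0..T}. a t \<partial>lborel) = \<infinity>")
    case False
    then obtain A where A: "(\<integral>\<^sup>+t\<in>{0..T}. a t \<partial>lborel) = ennreal A" "A \<ge> 0" by (cases "(\<integral>\<^sup>+t\<in>{0..T}. a t \<partial>lborel)") auto
    from Vfin obtain v where v: "V = ennreal v" "v \<ge> 0" by (cases V) auto
    have "ennreal v \<le> ennreal (A + 1 / 2 * v)"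
      using order_trans[OF V1 add_right_mono[OF wa]] A v
      by (simp only: ennreal_plus[of A "1 / 2 * v"] ennreal_mult[of "1 / 2" v])
    then have "v \<le> A + 1 / 2 * v" using A v by (subst (asm) ennreal_le_iff) auto
    then have "v \<le> 2 * A" by simp
    then show ?thesis using A v by (metis ennreal_leI ennreal_mult' ennreal_numeral zero_le_numeral)
  qed (simp add: ennreal_mult_eq_top_iff)
  have "(\<integral>\<^sup>+s\<in>{0..T}. u s \<partial>lborel) \<le> (\<integral>\<^sup>+s. ennreal (exp (2 * L * T)) * (w s * u s * indicator {0..T} s) \<partial>lborel)"
  proof (rule nn_integral_mono)
    fix s
    show "u s * indicator {0..T} s \<le> ennreal (exp (2 * L * T)) * (w s * u s * indicator {0..T} s)"
    proof (cases "s \<in> {0..T}")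
      case True
      have "1 \<le> ennreal (exp (2 * L * T)) * w s"
        using True L by (simp add: w_def ennreal_mult[symmetric] mult_exp_exp)
      then have "1 * u s \<le> (ennreal (exp (2 * L * T)) * w s) * u s" by (rule mult_right_mono) simp
      then show ?thesis using True by (simp add: ac_simps)
    qed simp
  qed
  also have "\<dots> = ennreal (exp (2 * L * T)) * V"
    unfolding V_def by (rule nn_integral_cmult) measurable
  also have "\<dots> \<le> ennreal (exp (2 * L * T)) * (2 * (\<integral>\<^sup>+t\<in>{0..T}. a t \<partial>lborel))"
    by (intro mult_left_mono V2) simp
  also have "\<dots> = ennreal (2 * exp (2 * L * T)) * (\<integral>\<^sup>+t\<in>{0..T}. a t \<partial>lborel)"
    by (simp add: ennreal_mult ac_simps)
  finally show ?thesis .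
qed

section \<open>Laws, mixtures and couplings\<close>

lemma P2_iff_law:
  fixes A :: "'w \<Rightarrow> real^'n"
  assumes "prob_space M" "A \<in> borel_measurable M"
  shows "law M A \<in> P2 \<longleftrightarrow> integrable M (\<lambda>\<omega>. (norm (A \<omega>))\<^sup>2)"
  using assms by (simp add: law_def P2_def prob_space.prob_space_distr integrable_distr_eq)

lemma second_moment_law:
  fixes A :: "'w \<Rightarrow> real^'n"
  assumes "A \<in> borel_measurable M"
  shows "(LINT z|law M A. (norm z)\<^sup>2) = (LINT \<omega>|M. (norm (A \<omega>))\<^sup>2)"
  using assms by (simp add: law_def integral_distr)

text \<open>The joint law of \<open>A\<close> and \<open>B\<close> is one of the couplings over
  which the infimum runs.\<close>

lemma w2_law_le:
  fixes A B :: "'w \<Rightarrow> real^'n"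
  assumes "prob_space M" and [measurable]: "A \<in> borel_measurable M" "B \<in> borel_measurable M"
  shows "w2 (law M A) (law M B) \<le> sqrt (LINT \<omega>|M. (norm (A \<omega> - B \<omega>))\<^sup>2)"
proof -
  let ?\<pi> = "distr M borel (\<lambda>\<omega>. (A \<omega>, B \<omega>))"
  have m: "(\<lambda>\<omega>. (A \<omega>, B \<omega>)) \<in> borel_measurable M" by measurable
  have f: "(fst :: (real^'n) \<times> (real^'n) \<Rightarrow> _) \<in> borel_measurable borel" "(snd :: (real^'n) \<times> (real^'n) \<Rightarrow> _) \<in> borel_measurable borel"
    by (simp_all add: borel_measurable_continuous_onI continuous_on_fst continuous_on_snd)
  have "?\<pi> \<in> couplings (law M A) (law M B)"
    using assms m f by (simp add: couplings_def law_def prob_space.prob_space_distr distr_distr comp_def)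
  then have "(INF \<pi>\<in>couplings (law M A) (law M B). LINT z|\<pi>. (norm (fst z - snd z))\<^sup>2) \<le> (LINT z|?\<pi>. (norm (fst z - snd z))\<^sup>2)"
    by (intro cINF_lower bdd_belowI2[where m=0]) auto
  also have "\<dots> = (LINT \<omega>|M. (norm (A \<omega> - B \<omega>))\<^sup>2)"
    using f by (subst integral_distr[OF m]) (auto intro!: borel_measurable_power borel_measurable_norm borel_measurable_diff)
  finally show ?thesis by (simp add: w2_def)
qed

text \<open>Apart from constant sequences, every convergence in \<open>P2_topology\<close> used
  below arises in this way, from mean-square convergence of random variables on a common
  space.\<close>

lemma limitin_P2_law:
  fixes A :: "'a \<Rightarrow> 'w \<Rightarrow> real^'n" and B :: "'w \<Rightarrow> real^'n"
  assumes M: "prob_space M" and B: "B \<in> borel_measurable M" "integrable M (\<lambda>\<omega>. (norm (B \<omega>))\<^sup>2)"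
    and A: "\<forall>\<^sub>F k in \<F>. A k \<in> borel_measurable M \<and> integrable M (\<lambda>\<omega>. (norm (A k \<omega>))\<^sup>2)"
    and lim: "((\<lambda>k. LINT \<omega>|M. (norm (A k \<omega> - B \<omega>))\<^sup>2) \<longlongrightarrow> 0) \<F>"
  shows "limitin P2_topology (\<lambda>k. law M (A k)) (law M B) \<F>"
  unfolding limitin_def topspace_P2_topology openin_P2_topology
proof safe
  show B2: "law M B \<in> P2" using P2_iff_law M B by blast
  fix U assume U: "P2_open U" "law M B \<in> U"
  then obtain r where r: "r > 0" "\<And>\<nu>. \<nu> \<in> P2 \<Longrightarrow> w2 (law M B) \<nu> < r \<Longrightarrow> \<nu> \<in> U"
    unfolding P2_open_def by blast
  have "\<forall>\<^sub>F k in \<F>. (LINT \<omega>|M. (norm (A k \<omega> - B \<omega>))\<^sup>2) < r\<^sup>2"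
    using order_tendstoD(2)[OF lim, of "r\<^sup>2"] r by simp
  with A show "\<forall>\<^sub>F k in \<F>. law M (A k) \<in> U"
  proof eventually_elim
    case (elim k)
    then have "sqrt (LINT \<omega>|M. (norm (B \<omega> - A k \<omega>))\<^sup>2) < r"
      using r(1) by (simp add: norm_minus_commute real_less_rsqrt real_sqrt_less_iff) (metis less_eq_real_def real_sqrt_less_mono real_sqrt_unique)
    with w2_law_le[OF M B(1), of "A k"] elim have "w2 (law M B) (law M (A k)) < r" by simp
    with r(2) P2_iff_law[OF M] elim show ?case by auto
  qed
qed


lemma prob_space_uniform01: "prob_space (uniform_measure lborel {0..1::real})"
  by (rule prob_space_uniform_measure) simp_all

text \<open>An independent uniform variable decides which of the two variables is shown. Being a
  law, the mixture inherits membership in \<open>P2\<close>, moment bounds and continuity in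
  \<open>t\<close> from a random variable on the product space.\<close>

lemma mixture_eq_law:
  fixes A B :: "'w \<Rightarrow> real^'n"
  assumes "prob_space M" and [measurable]: "A \<in> borel_measurable M" "B \<in> borel_measurable M"
    and t: "0 \<le> t" "t \<le> 1"
  shows "mixture t (law M A) (law M B)
    = law (M \<Otimes>\<^sub>M uniform_measure lborel {0..1}) (\<lambda>(\<omega>, u). if u \<le> t then A \<omega> else B \<omega>)"
proof -
  let ?U = "uniform_measure lborel {0..1::real}"
  interpret M: prob_space M by fact
  interpret U: prob_space ?U by (rule prob_space_uniform01)
  interpret P: pair_prob_space M ?U ..
  define R where "R = (\<lambda>(\<omega>, u). if u \<le> t then A \<omega> else B \<omega>)"
  have R[measurable]: "R \<in> borel_measurable (M \<Otimes>\<^sub>M ?U)" unfolding R_def by measurable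
  have em: "emeasure (law (M \<Otimes>\<^sub>M ?U) R) S
    = ennreal t * emeasure (law M A) S + ennreal (1 - t) * emeasure (law M B) S"
    if S[measurable]: "S \<in> sets borel" for S
  proof -
    let ?A = "A -` S \<inter> space M" and ?B = "B -` S \<inter> space M"
    have [measurable]: "?A \<in> sets M" "?B \<in> sets M" by measurable
    have "R -` S \<inter> space (M \<Otimes>\<^sub>M ?U) = (?A \<times> {..t}) \<union> (?B \<times> {t<..})"
      by (auto simp: R_def space_pair_measure split: if_splits)
    then have "emeasure (law (M \<Otimes>\<^sub>M ?U) R) S = emeasure (M \<Otimes>\<^sub>M ?U) ((?A \<times> {..t}) \<union> (?B \<times> {t<..}))"
      by (simp add: law_def emeasure_distr)
    also have "\<dots> = emeasure (M \<Otimes>\<^sub>M ?U) (?A \<times> {..t}) + emeasure (M \<Otimes>\<^sub>M ?U) (?B \<times> {t<..})"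
      by (rule plus_emeasure[symmetric]) auto
    also have "\<dots> = emeasure M ?A * emeasure ?U {..t} + emeasure M ?B * emeasure ?U {t<..}"
      by (simp add: U.emeasure_pair_measure_Times)
    also have "emeasure ?U {..t} = ennreal t"
    proof -
      have "{0..1} \<inter> {..t} = {0..t}" using t by auto
      then show ?thesis using t by (simp add: divide_ennreal_def)
    qed
    also have "emeasure ?U {t<..} = ennreal (1 - t)"
    proof -
      have "{0..1} \<inter> {t<..} = {t<..1}" using t by auto
      then show ?thesis using t by (simp add: divide_ennreal_def)
    qed
    finally show ?thesis by (simp add: law_def emeasure_distr ac_simps)
  qed
  have "mixture t (law M A) (law M B) = measure_of UNIV (sets borel) (emeasure (law (M \<Otimes>\<^sub>M ?U) R))"
    unfolding mixture_def using em by (intro measure_of_eq) (auto simp: sets.sigma_sets_eq[of borel, simplified])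
  also have "\<dots> = law (M \<Otimes>\<^sub>M ?U) R"
    using measure_of_of_measure[of "law (M \<Otimes>\<^sub>M ?U) R"] by (simp add: law_def)
  finally show ?thesis by (simp add: R_def)
qed

lemma second_countable_euclidean: "second_countable (euclidean :: 'a::second_countable_topology topology)"
proof -
  obtain B :: "'a set set" where "countable B" "topological_basis B"
    using ex_countable_basis by blast
  then show ?thesis
    unfolding second_countable_def
    by (intro exI[of _ B]) (auto simp: topological_basis_open elim!: topological_basisE)
qed

text \<open>Coordinate \<open>0\<close> carries an independent uniform variable, which makes the space atomless.\<close>

lemma atomless_polish_coupling:
  fixes \<pi> :: "((real^'n) \<times> (real^'n)) measure"
  assumes "prob_space \<pi>" and sets_\<pi>: "sets \<pi> = sets borel"
  obtains P X X' where "atomless_polish_prob P" "X \<in> borel_measurable P" "X' \<in> borel_measurable P"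
    "distr P borel (\<lambda>s. (X s, X' s)) = \<pi>"
proof -
  let ?U = "uniform_measure lborel {0..1::real}"
  interpret pi: prob_space \<pi> by fact
  interpret U: prob_space ?U by (rule prob_space_uniform01)
  interpret PU: pair_prob_space \<pi> ?U ..
  note [measurable_cong] = sets_\<pi>
  \<comment> \<open>Past the uniform coordinate, even offsets store the components of the first
    vector and odd offsets those of the second; \<open>X\<close> and \<open>X'\<close> read them
    back. The remaining coordinates repeat components and are ignored.\<close>
  define enc :: "((real^'n) \<times> (real^'n)) \<times> real \<Rightarrow> nat \<Rightarrow> real" where
    "enc = (\<lambda>(z, u) k. case k of 0 \<Rightarrow> u
      | Suc m \<Rightarrow> (if even m then fst z else snd z) $ from_nat (m div 2))"
  define X X' :: "(nat \<Rightarrow> real) \<Rightarrow> real^'n"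
    where "X = (\<lambda>s. \<chi> i. s (Suc (2 * to_nat i)))" and "X' = (\<lambda>s. \<chi> i. s (Suc (2 * to_nat i + 1)))"
  have enc[measurable]: "enc \<in> borel_measurable (\<pi> \<Otimes>\<^sub>M ?U)"
  proof (rule measurable_coordinatewise_then_product)
    fix k
    have "(\<lambda>z::(real^'n) \<times> (real^'n). fst z $ i) \<in> borel_measurable \<pi>" "(\<lambda>z::(real^'n) \<times> (real^'n). snd z $ i) \<in> borel_measurable \<pi>" for i
      unfolding measurable_cong_sets[OF sets_\<pi> refl]
      by (auto intro!: borel_measurable_continuous_onI continuous_intros)
    then have "(\<lambda>p. fst (fst p) $ i) \<in> borel_measurable (\<pi> \<Otimes>\<^sub>M ?U)" "(\<lambda>p. snd (fst p) $ i) \<in> borel_measurable (\<pi> \<Otimes>\<^sub>M ?U)" for i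
      by (auto intro: measurable_compose[OF measurable_fst])
    then show "(\<lambda>p. enc p k) \<in> borel_measurable (\<pi> \<Otimes>\<^sub>M ?U)"
      by (cases k; cases "even (k - 1)") (auto simp: enc_def case_prod_beta' intro: measurable_compose[OF measurable_snd])
  qed
  define P where "P = distr (\<pi> \<Otimes>\<^sub>M ?U) borel enc"
  interpret P: prob_space P unfolding P_def by (rule PU.prob_space_distr) measurable
  have coord[measurable]: "(\<lambda>s::nat \<Rightarrow> real. s k) \<in> borel_measurable borel" for k
    by (intro borel_measurable_continuous_onI continuous_on_product_coordinates)
  have X[measurable]: "X \<in> borel_measurable borel" "X' \<in> borel_measurable borel"
    unfolding X_def X'_def by (auto intro!: borel_measurable_continuous_onI continuous_on_vec_lambda continuous_on_product_coordinates)
  have XX: "(\<lambda>s. (X s, X' s)) \<in> borel_measurable borel" by measurable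
  have "(X (enc p), X' (enc p)) = fst p" for p
    by (simp add: X_def X'_def enc_def case_prod_beta' vec_lambda_eta prod_eq_iff)
  then have "distr P borel (\<lambda>s. (X s, X' s)) = distr (\<pi> \<Otimes>\<^sub>M ?U) borel fst"
    unfolding P_def using XX by (subst distr_distr) (auto simp: comp_def)
  also have "\<dots> = distr (\<pi> \<Otimes>\<^sub>M ?U) \<pi> fst" by (rule distr_cong) (simp_all add: sets_\<pi>)
  also have "\<dots> = \<pi>" by (rule U.distr_pair_fst)
  finally have distr: "distr P borel (\<lambda>s. (X s, X' s)) = \<pi>" .
  have sP: "sets P = sets borel" "space P = UNIV" by (simp_all add: P_def)
  have slice: "measure P {s. r < s 0 \<and> s 0 \<le> r'} = measure ?U {r<..r'}" for r r'
  proof -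
    have "enc -` {s. r < s 0 \<and> s 0 \<le> r'} \<inter> space (\<pi> \<Otimes>\<^sub>M ?U) = space \<pi> \<times> {r<..r'}"
      by (auto simp: enc_def space_pair_measure)
    then have "measure P {s. r < s 0 \<and> s 0 \<le> r'} = measure (\<pi> \<Otimes>\<^sub>M ?U) (space \<pi> \<times> {r<..r'})"
      unfolding P_def by (subst measure_distr) auto
    also have "\<dots> = measure ?U {r<..r'}"
      by (simp add: measure_def U.emeasure_pair_measure_Times pi.emeasure_space_1)
    finally show ?thesis .
  qed
  have Uint: "measure ?U {r<..r'} \<le> r' - r" if "r \<le> r'" for r r'
  proof -
    have "emeasure ?U {r<..r'} \<le> emeasure lborel {r<..r'}"
      by (auto simp: divide_ennreal_def intro!: emeasure_mono)
    then show ?thesis using that by (simp add: U.emeasure_eq_measure)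
  qed
  have atomless: "\<exists>B\<in>sets P. B \<subseteq> A \<and> 0 < measure P B \<and> measure P B < measure P A"
    if A: "A \<in> sets P" "measure P A > 0" for A
  proof -
    \<comment> \<open>The distribution function of coordinate 0 within \<open>A\<close>. A slab of
      width r has mass at most r, which makes \<open>h\<close> Lipschitz, so it attains half the
      mass of \<open>A\<close> between 0 and 1 and the corresponding part of \<open>A\<close> is the
      required subset.\<close>
    define h where "h = (\<lambda>r. measure P (A \<inter> {s. s 0 \<le> r}))"
    have A'[measurable]: "A \<in> sets borel" using A sP by simp
    have [measurable]: "{s::nat\<Rightarrow>real. s 0 \<le> r} \<in> sets borel" "{s::nat\<Rightarrow>real. r < s 0 \<and> s 0 \<le> r'} \<in> sets borel" for r r'
      by measurable
    have hd: "h r \<le> h r'" "h r' \<le> h r + (r' - r)" if "r \<le> r'" for r r'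
    proof -
      show "h r \<le> h r'" unfolding h_def using that by (intro P.finite_measure_mono) (auto simp: sP)
      have "h r' \<le> measure P ((A \<inter> {s. s 0 \<le> r}) \<union> {s. r < s 0 \<and> s 0 \<le> r'})"
        unfolding h_def using that by (intro P.finite_measure_mono) (auto simp: sP)
      also have "\<dots> \<le> h r + measure P {s. r < s 0 \<and> s 0 \<le> r'}"
        unfolding h_def by (rule measure_Un_le) (auto simp: sP)
      finally show "h r' \<le> h r + (r' - r)" using Uint[OF that] unfolding slice by simp
    qed
    have "1-lipschitz_on {0..1} h"
    proof (rule lipschitz_onI)
      fix x y show "dist (h x) (h y) \<le> 1 * dist x y"
        using hd[of x y] hd[of y x] by (cases "x \<le> y") (auto simp: dist_real_def)
    qed simp
    then have cont: "continuous_on {0..1} h" by (rule lipschitz_on_continuous_on)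
    have zero: "measure P {s. s 0 \<le> 0} = 0" and one: "measure P {s. s 0 > 1} = 0"
    proof -
      have "enc -` {s. s 0 \<le> 0} \<inter> space (\<pi> \<Otimes>\<^sub>M ?U) = space \<pi> \<times> {..0}"
        "enc -` {s. s 0 > 1} \<inter> space (\<pi> \<Otimes>\<^sub>M ?U) = space \<pi> \<times> {1<..}"
        by (auto simp: enc_def space_pair_measure)
      moreover have "{0..1} \<inter> {..0} = {0::real}" "{0..1} \<inter> {1<..} = ({}::real set)" by auto
      ultimately show "measure P {s. s 0 \<le> 0} = 0" "measure P {s. s 0 > 1} = 0"
        unfolding P_def by (subst measure_distr; simp add: measure_def U.emeasure_pair_measure_Times)+
    qed
    have h0: "h 0 = 0"
      using P.finite_measure_mono[of "A \<inter> {s. s 0 \<le> 0}" "{s. s 0 \<le> 0}"] zero measure_nonneg[of P]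
      by (auto simp: h_def sP intro: antisym)
    have "measure P A \<le> measure P ((A \<inter> {s. s 0 \<le> 1}) \<union> {s. s 0 > 1})"
      by (intro P.finite_measure_mono) (auto simp: sP)
    also have "\<dots> \<le> h 1 + measure P {s. s 0 > 1}"
      unfolding h_def by (rule measure_Un_le) (auto simp: sP)
    finally have h1: "measure P A \<le> h 1" using one by simp
    from IVT'[of h 0 "measure P A / 2" 1, OF _ _ _ cont] h0 h1 A(2)
    obtain r where "h r = measure P A / 2" by auto
    then show ?thesis
      using A by (intro bexI[of _ "A \<inter> {s. s 0 \<le> r}"]) (auto simp: h_def sP)
  qed
  have "atomless_polish_prob P"
    unfolding atomless_polish_prob_def
  proof (intro conjI allI impI)
    show "prob_space P" by (rule P.prob_space_axioms)
    show "\<exists>S. completely_metrizable_space S \<and> second_countable S \<and>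
        space P = topspace S \<and> sets P = sigma_sets (topspace S) {U. openin S U}"
      by (rule exI[of _ euclidean])
        (simp add: completely_metrizable_space_euclidean second_countable_euclidean sP, simp add: borel_def)
  qed (use atomless in auto)
  with X distr show ?thesis by (intro that[of P X X']) (auto simp: P_def)
qed

section \<open>First-order expansion of mean-field costs\<close>

lemma tendsto_continuous_map_prod3:
  fixes h :: "'x::topological_space \<Rightarrow> 'm \<Rightarrow> 'y::topological_space \<Rightarrow> 'z::topological_space"
  assumes "continuous_map (prod_topology euclidean (prod_topology X euclidean)) euclidean (\<lambda>(x, \<mu>, y). h x \<mu> y)"
    and "(x \<longlongrightarrow> x0) \<F>" "limitin X \<nu> \<nu>0 \<F>" "(y \<longlongrightarrow> y0) \<F>"
  shows "((\<lambda>k. h (x k) (\<nu> k) (y k)) \<longlongrightarrow> h x0 \<nu>0 y0) \<F>"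
proof -
  have "limitin (prod_topology euclidean (prod_topology X euclidean)) (\<lambda>k. (x k, \<nu> k, y k)) (x0, \<nu>0, y0) \<F>"
    using assms by (simp add: limitin_pairwise comp_def)
  from continuous_map_limit[OF assms(1) this] show ?thesis by (simp add: comp_def)
qed

lemma tendsto_continuous_map_prod2:
  fixes h :: "'x::topological_space \<Rightarrow> 'm \<Rightarrow> 'z::topological_space"
  assumes "continuous_map (prod_topology euclidean X) euclidean (\<lambda>(x, \<mu>). h x \<mu>)"
    and "(x \<longlongrightarrow> x0) \<F>" "limitin X \<nu> \<nu>0 \<F>"
  shows "((\<lambda>k. h (x k) (\<nu> k)) \<longlongrightarrow> h x0 \<nu>0) \<F>"
proof -
  have "limitin (prod_topology euclidean X) (\<lambda>k. (x k, \<nu> k)) (x0, \<nu>0) \<F>"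
    using assms by (simp add: limitin_pairwise comp_def)
  from continuous_map_limit[OF assms(1) this] show ?thesis by (simp add: comp_def)
qed

lemma GDERIV_mean_value:
  fixes f :: "'a::real_inner \<Rightarrow> real"
  assumes "\<And>y. GDERIV f y :> D y" and e: "e > 0"
  obtains \<theta> where "0 < \<theta>" "\<theta> < e" "f (y + e *\<^sub>R z) - f y = e * (D (y + \<theta> *\<^sub>R z) \<bullet> z)"
proof -
  have "((\<lambda>r. f (y + r *\<^sub>R z)) has_real_derivative D (y + r *\<^sub>R z) \<bullet> z) (at r)" for r
  proof -
    have "(f has_derivative (\<lambda>h. h \<bullet> D (y + r *\<^sub>R z))) (at (y + r *\<^sub>R z))"
      using assms(1)[of "y + r *\<^sub>R z"] by (simp add: gderiv_def)
    moreover have "((\<lambda>r. y + r *\<^sub>R z) has_derivative (\<lambda>h. h *\<^sub>R z)) (at r)"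
      by (auto intro!: derivative_eq_intros)
    ultimately have "((\<lambda>r. f (y + r *\<^sub>R z)) has_derivative (\<lambda>h. (h *\<^sub>R z) \<bullet> D (y + r *\<^sub>R z))) (at r)"
      using has_derivative_compose[of "\<lambda>r. y + r *\<^sub>R z" "\<lambda>h. h *\<^sub>R z" r UNIV f "\<lambda>h. h \<bullet> D (y + r *\<^sub>R z)"] by simp
    moreover have "(\<lambda>h. (h *\<^sub>R z) \<bullet> D (y + r *\<^sub>R z)) = (*) (D (y + r *\<^sub>R z) \<bullet> z)"
      by (auto simp: fun_eq_iff inner_commute)
    ultimately show ?thesis by (simp only: has_field_derivative_def)
  qed
  then obtain \<theta> where "0 < \<theta>" "\<theta> < e" "f (y + e *\<^sub>R z) - f (y + 0 *\<^sub>R z) = (e - 0) * (D (y + \<theta> *\<^sub>R z) \<bullet> z)"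
    using MVT2[OF e, of "\<lambda>r. f (y + r *\<^sub>R z)" "\<lambda>r. D (y + r *\<^sub>R z) \<bullet> z"] by blast
  then show ?thesis using that by simp
qed

lemma GDERIV_inner_unique:
  assumes "GDERIV f x :> D" "GDERIV f x :> E"
  shows "D = E"
proof -
  have "(\<lambda>h. h \<bullet> D) = (\<lambda>h. h \<bullet> E)"
    using assms unfolding gderiv_def by (rule has_derivative_unique)
  then have "(D - E) \<bullet> D = (D - E) \<bullet> E" by metis
  then show ?thesis by (metis eq_iff_diff_eq_0 inner_diff_right inner_eq_zero_iff)
qed

lemma (in prob_space) integrable_norm_of_square:
  fixes U :: "'a \<Rightarrow> 'b::{second_countable_topology, banach}"
  assumes "U \<in> borel_measurable M" "integrable M (\<lambda>\<omega>. (norm (U \<omega>))\<^sup>2)"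
  shows "integrable M (\<lambda>\<omega>. norm (U \<omega>))"
  using square_integrable_imp_integrable[of "\<lambda>\<omega>. norm (U \<omega>)"] assms by simp

lemma integrable_norm_square_add:
  fixes U V :: "'w \<Rightarrow> 'a::{second_countable_topology, banach}"
  assumes [measurable]: "U \<in> borel_measurable M" "V \<in> borel_measurable M"
    and "integrable M (\<lambda>\<omega>. (norm (U \<omega>))\<^sup>2)" "integrable M (\<lambda>\<omega>. (norm (V \<omega>))\<^sup>2)"
  shows "integrable M (\<lambda>\<omega>. (norm (U \<omega> + r *\<^sub>R V \<omega>))\<^sup>2)"
proof (rule Bochner_Integration.integrable_bound)
  show "integrable M (\<lambda>\<omega>. 2 * (norm (U \<omega>))\<^sup>2 + 2 * r\<^sup>2 * (norm (V \<omega>))\<^sup>2)" using assms by simp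
  show "AE \<omega> in M. norm ((norm (U \<omega> + r *\<^sub>R V \<omega>))\<^sup>2) \<le> norm (2 * (norm (U \<omega>))\<^sup>2 + 2 * r\<^sup>2 * (norm (V \<omega>))\<^sup>2)"
  proof (rule AE_I2)
    fix \<omega>
    have "(norm (U \<omega> + r *\<^sub>R V \<omega>))\<^sup>2 \<le> (norm (U \<omega>) + \<bar>r\<bar> * norm (V \<omega>))\<^sup>2"
      by (rule power_mono) (auto intro: norm_triangle_le)
    also have "\<dots> \<le> 2 * (norm (U \<omega>))\<^sup>2 + 2 * r\<^sup>2 * (norm (V \<omega>))\<^sup>2"
      using sum_squares_bound[of "norm (U \<omega>)" "\<bar>r\<bar> * norm (V \<omega>)"] by (simp add: power2_sum power_mult_distrib)
    finally show "norm ((norm (U \<omega> + r *\<^sub>R V \<omega>))\<^sup>2) \<le> norm (2 * (norm (U \<omega>))\<^sup>2 + 2 * r\<^sup>2 * (norm (V \<omega>))\<^sup>2)"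
      by simp
  qed
qed measurable

text \<open>Time is frozen here: the running cost at each time and the terminal cost are both
  instances, so that the first-order analysis is carried out once.\<close>

locale mean_field_function =
  fixes \<phi> :: "real^'n \<Rightarrow> (real^'n) measure \<Rightarrow> real"
    and d\<phi> :: "real^'n \<Rightarrow> (real^'n) measure \<Rightarrow> real^'n \<Rightarrow> real"
    and Dx :: "real^'n \<Rightarrow> (real^'n) measure \<Rightarrow> real^'n"
    and Dy :: "real^'n \<Rightarrow> (real^'n) measure \<Rightarrow> real^'n \<Rightarrow> real^'n"
    and \<kappa> :: real
  assumes linear: "linear_derivative (\<phi> x) (d\<phi> x)"
    and cont: "continuous_map (prod_topology euclidean P2_topology) euclideanreal (\<lambda>(x, \<mu>). \<phi> x \<mu>)"
    and cont_d: "continuous_map (prod_topology euclidean (prod_topology P2_topology euclidean))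
         euclideanreal (\<lambda>(x, \<mu>, y). d\<phi> x \<mu> y)"
    and cont_Dx: "continuous_map (prod_topology euclidean P2_topology) euclidean (\<lambda>(x, \<mu>). Dx x \<mu>)"
    and cont_Dy: "continuous_map (prod_topology euclidean (prod_topology P2_topology euclidean))
         euclidean (\<lambda>(x, \<mu>, y). Dy x \<mu> y)"
    and deriv_x: "\<mu> \<in> P2 \<Longrightarrow> GDERIV (\<lambda>z. \<phi> z \<mu>) x :> Dx x \<mu>"
    and deriv_y: "\<mu> \<in> P2 \<Longrightarrow> GDERIV (\<lambda>z. d\<phi> x \<mu> z) y :> Dy x \<mu> y"
    and \<kappa>_nonneg: "0 \<le> \<kappa>"
    and growth: "\<mu> \<in> P2 \<Longrightarrow> \<bar>\<phi> x \<mu>\<bar> \<le> \<kappa> * (1 + (norm x)\<^sup>2 + (LINT z|\<mu>. (norm z)\<^sup>2))"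
    and growth_d: "\<mu> \<in> P2 \<Longrightarrow> \<bar>d\<phi> x \<mu> y\<bar> \<le> \<kappa> * (1 + (norm x)\<^sup>2 + (LINT z|\<mu>. (norm z)\<^sup>2) + (norm y)\<^sup>2)"
    and growth_Dx: "\<mu> \<in> P2 \<Longrightarrow> norm (Dx x \<mu>) \<le> \<kappa> * (1 + norm x + sqrt (LINT z|\<mu>. (norm z)\<^sup>2))"
    and growth_Dy: "\<mu> \<in> P2 \<Longrightarrow> norm (Dy x \<mu> y) \<le> \<kappa> * (1 + norm x + sqrt (LINT z|\<mu>. (norm z)\<^sup>2) + norm y)"
    and convex: "L_jointly_convex \<phi>"
begin

lemma limitin_const_P2: "\<mu> \<in> P2 \<Longrightarrow> limitin P2_topology (\<lambda>_. \<mu>) \<mu> \<F>"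
  by (simp add: limitin_const_iff topspace_P2_topology)

lemma continuous_slice:
  assumes "\<mu> \<in> P2"
  shows "continuous_on UNIV (\<lambda>x. \<phi> x \<mu>)" "continuous_on UNIV (\<lambda>x. Dx x \<mu>)"
    "continuous_on UNIV (\<lambda>p. d\<phi> (fst p) \<mu> (snd p))" "continuous_on UNIV (\<lambda>p. Dy (fst p) \<mu> (snd p))"
proof -
  have F: "(fst \<longlongrightarrow> fst p) (at p)" "(snd \<longlongrightarrow> snd p) (at p)" for p :: "(real^'n) \<times> (real^'n)"
    by (intro tendsto_fst tendsto_snd tendsto_ident_at)+
  note lim = limitin_const_P2[OF assms]
  show "continuous_on UNIV (\<lambda>x. \<phi> x \<mu>)" "continuous_on UNIV (\<lambda>x. Dx x \<mu>)"
    "continuous_on UNIV (\<lambda>p. d\<phi> (fst p) \<mu> (snd p))" "continuous_on UNIV (\<lambda>p. Dy (fst p) \<mu> (snd p))"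
    unfolding continuous_on_def
    by (intro ballI tendsto_continuous_map_prod2[OF cont] tendsto_continuous_map_prod2[OF cont_Dx]
      tendsto_continuous_map_prod3[OF cont_d] tendsto_continuous_map_prod3[OF cont_Dy] tendsto_ident_at F lim)+
qed

lemma measurable_slice:
  assumes "\<mu> \<in> P2" and A: "A \<in> borel_measurable N" and B: "B \<in> borel_measurable N"
  shows "(\<lambda>\<omega>. \<phi> (A \<omega>) \<mu>) \<in> borel_measurable N" "(\<lambda>\<omega>. Dx (A \<omega>) \<mu>) \<in> borel_measurable N"
    "(\<lambda>\<omega>. d\<phi> (A \<omega>) \<mu> (B \<omega>)) \<in> borel_measurable N" "(\<lambda>\<omega>. Dy (A \<omega>) \<mu> (B \<omega>)) \<in> borel_measurable N"
  using continuous_slice[OF assms(1)]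
  by (auto intro: measurable_compose[OF A borel_measurable_continuous_onI]
      borel_measurable_continuous_Pair[OF A B])

text \<open>Dominated convergence. The growth bound of \<open>d\<phi>\<close> contains the second
  moment of the measure, so a bound \<open>m\<close> common to all \<open>\<nu> k\<close> supplies
  the majorant.\<close>

lemma expectation_d_tendsto:
  assumes M: "prob_space M" and A: "A \<in> borel_measurable M" "integrable M (\<lambda>\<omega>. (norm (A \<omega>))\<^sup>2)"
    and \<nu>: "\<And>k. \<nu> k \<in> P2" "\<And>k. (LINT z|\<nu> k. (norm z)\<^sup>2) \<le> m" and lim: "limitin P2_topology \<nu> \<mu> sequentially"
  shows "(\<lambda>k. LINT \<omega>|M. d\<phi> x (\<nu> k) (A \<omega>)) \<longlonglongrightarrow> (LINT \<omega>|M. d\<phi> x \<mu> (A \<omega>))"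
proof -
  interpret prob_space M by fact
  have \<mu>: "\<mu> \<in> P2" using limitin_topspace[OF lim] by (simp add: topspace_P2_topology)
  show ?thesis
  proof (rule integral_dominated_convergence)
    show "integrable M (\<lambda>\<omega>. \<kappa> * (1 + (norm x)\<^sup>2 + m + (norm (A \<omega>))\<^sup>2))" using A by simp
    show "AE \<omega> in M. (\<lambda>k. d\<phi> x (\<nu> k) (A \<omega>)) \<longlonglongrightarrow> d\<phi> x \<mu> (A \<omega>)"
      by (intro AE_I2 tendsto_continuous_map_prod3[OF cont_d _ lim] tendsto_const)
    show "AE \<omega> in M. norm (d\<phi> x (\<nu> k) (A \<omega>)) \<le> \<kappa> * (1 + (norm x)\<^sup>2 + m + (norm (A \<omega>))\<^sup>2)" for k
    proof (rule AE_I2)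
      fix \<omega>
      show "norm (d\<phi> x (\<nu> k) (A \<omega>)) \<le> \<kappa> * (1 + (norm x)\<^sup>2 + m + (norm (A \<omega>))\<^sup>2)"
        unfolding real_norm_def
        by (rule order_trans[OF growth_d[OF \<nu>(1)]]) (use \<nu>(2)[of k] \<kappa>_nonneg in \<open>auto intro: mult_left_mono\<close>)
    qed
  qed (use measurable_slice(3)[OF \<nu>(1) _ A(1)] measurable_slice(3)[OF \<mu> _ A(1)] in auto)
qed

end

text \<open>A fixed sequence stands for the limit from above at 0, since dominated convergence works
  along sequences. Steps of size at most 1 keep the perturbed controls convex combinations, hence
  admissible.\<close>

definition step_size :: "nat \<Rightarrow> real" where "step_size k = inverse (real (Suc k))"

lemma step_pos: "0 < step_size k" and step_le_1: "step_size k \<le> 1"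
  by (simp_all add: step_size_def field_simps)

lemma step_tendsto: "step_size \<longlonglongrightarrow> 0"
  unfolding step_size_def by (rule LIMSEQ_inverse_real_of_nat)

text \<open>The mean value theorem gives the dominating function.\<close>

lemma expectation_difference_quotient:
  fixes U Z :: "'w \<Rightarrow> real^'n" and f :: "nat \<Rightarrow> 'w \<Rightarrow> real^'n \<Rightarrow> real"
    and D :: "nat \<Rightarrow> 'w \<Rightarrow> real^'n \<Rightarrow> real^'n"
  assumes [measurable]: "U \<in> borel_measurable N" "Z \<in> borel_measurable N" "c \<in> borel_measurable N"
    and sq: "integrable N (\<lambda>\<omega>. (norm (U \<omega>))\<^sup>2)" "integrable N (\<lambda>\<omega>. (norm (Z \<omega>))\<^sup>2)" "integrable N (\<lambda>\<omega>. (c \<omega>)\<^sup>2)"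
    and grad: "\<And>k \<omega> y. \<omega> \<in> space N \<Longrightarrow> GDERIV (f k \<omega>) y :> D k \<omega> y"
    and bound: "\<And>k \<omega> y. \<omega> \<in> space N \<Longrightarrow> norm (D k \<omega> y) \<le> c \<omega> + \<kappa> * norm y" and \<kappa>: "0 \<le> \<kappa>"
    and lim: "\<And>\<omega> y. \<omega> \<in> space N \<Longrightarrow> y \<longlonglongrightarrow> U \<omega> \<Longrightarrow> (\<lambda>k. D k \<omega> (y k)) \<longlonglongrightarrow> D0 \<omega>"
    and int: "\<And>k. integrable N (\<lambda>\<omega>. f k \<omega> (U \<omega>))" "\<And>k. integrable N (\<lambda>\<omega>. f k \<omega> (U \<omega> + step_size k *\<^sub>R Z \<omega>))"
  shows "integrable N (\<lambda>\<omega>. D0 \<omega> \<bullet> Z \<omega>)"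
    and "(\<lambda>k. ((LINT \<omega>|N. f k \<omega> (U \<omega> + step_size k *\<^sub>R Z \<omega>)) - (LINT \<omega>|N. f k \<omega> (U \<omega>))) / step_size k)
      \<longlonglongrightarrow> (LINT \<omega>|N. D0 \<omega> \<bullet> Z \<omega>)"
    and "\<bar>((LINT \<omega>|N. f k \<omega> (U \<omega> + step_size k *\<^sub>R Z \<omega>)) - (LINT \<omega>|N. f k \<omega> (U \<omega>))) / step_size k\<bar>
      \<le> 3 * (LINT \<omega>|N. (c \<omega>)\<^sup>2) + 3 * \<kappa>\<^sup>2 * (LINT \<omega>|N. (norm (U \<omega>))\<^sup>2) + (3 * \<kappa>\<^sup>2 + 1) * (LINT \<omega>|N. (norm (Z \<omega>))\<^sup>2)"
proof -
  define q where "q = (\<lambda>k \<omega>. (f k \<omega> (U \<omega> + step_size k *\<^sub>R Z \<omega>) - f k \<omega> (U \<omega>)) / step_size k)"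
  \<comment> \<open>With a = \<open>c\<close>, b = \<open>\<kappa>\<close> |U|, d =
    \<open>\<kappa>\<close> |Z| the quotient is at most (a + b + d) |Z|, hence at most (a + b + d)^2
    + |Z|^2, and the first square is at most 3 (a^2 + b^2 + d^2).\<close>
  define w where "w = (\<lambda>\<omega>. 3 * (c \<omega>)\<^sup>2 + 3 * \<kappa>\<^sup>2 * (norm (U \<omega>))\<^sup>2 + (3 * \<kappa>\<^sup>2 + 1) * (norm (Z \<omega>))\<^sup>2)"
  have iw: "integrable N w" unfolding w_def using sq by simp
  have iq: "integrable N (q k)" for k unfolding q_def using int by simp
  have Eq: "((LINT \<omega>|N. f k \<omega> (U \<omega> + step_size k *\<^sub>R Z \<omega>)) - (LINT \<omega>|N. f k \<omega> (U \<omega>))) / step_size k = (LINT \<omega>|N. q k \<omega>)" for k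
    unfolding q_def using int by simp
  have "\<exists>\<theta>. 0 < \<theta> \<and> \<theta> < step_size k \<and> q k \<omega> = D k \<omega> (U \<omega> + \<theta> *\<^sub>R Z \<omega>) \<bullet> Z \<omega>" if om: "\<omega> \<in> space N" for k \<omega>
  proof -
    obtain \<theta> where "0 < \<theta>" "\<theta> < step_size k"
      "f k \<omega> (U \<omega> + step_size k *\<^sub>R Z \<omega>) - f k \<omega> (U \<omega>) = step_size k * (D k \<omega> (U \<omega> + \<theta> *\<^sub>R Z \<omega>) \<bullet> Z \<omega>)"
      using GDERIV_mean_value[of "f k \<omega>" "D k \<omega>" "step_size k" "U \<omega>" "Z \<omega>"] grad[OF om] step_pos by blast
    then show ?thesis using step_pos[of k] by (intro exI[of _ \<theta>]) (simp add: q_def)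
  qed
  then have ex: "\<And>k \<omega>. \<omega> \<in> space N \<Longrightarrow> \<exists>\<theta>. 0 < \<theta> \<and> \<theta> < step_size k \<and> q k \<omega> = D k \<omega> (U \<omega> + \<theta> *\<^sub>R Z \<omega>) \<bullet> Z \<omega>"
    by blast
  \<comment> \<open>The intermediate point is chosen separately for each \<open>\<omega>\<close> and
    may fail to be measurable. It serves pointwise limits and bounds only; integrals are taken of
    \<open>q\<close>, and the limit is measurable because it is a limit of the
    \<open>q k\<close>.\<close>
  define \<theta> where "\<theta> = (\<lambda>k \<omega>. SOME \<theta>. 0 < \<theta> \<and> \<theta> < step_size k \<and> q k \<omega> = D k \<omega> (U \<omega> + \<theta> *\<^sub>R Z \<omega>) \<bullet> Z \<omega>)"
  have \<theta>: "0 < \<theta> k \<omega>" "\<theta> k \<omega> < step_size k"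
    and q\<theta>: "q k \<omega> = D k \<omega> (U \<omega> + \<theta> k \<omega> *\<^sub>R Z \<omega>) \<bullet> Z \<omega>" if "\<omega> \<in> space N" for k \<omega>
    using someI_ex[OF ex[OF that, of k]] unfolding \<theta>_def by auto
  have qlim: "(\<lambda>k. q k \<omega>) \<longlonglongrightarrow> D0 \<omega> \<bullet> Z \<omega>" if w: "\<omega> \<in> space N" for \<omega>
  proof -
    have "(\<lambda>k. \<theta> k \<omega>) \<longlonglongrightarrow> 0"
      by (rule tendsto_sandwich[OF _ _ tendsto_const step_tendsto])
        (use \<theta>[OF w] in \<open>auto intro!: eventuallyI less_imp_le\<close>)
    then have "(\<lambda>k. U \<omega> + \<theta> k \<omega> *\<^sub>R Z \<omega>) \<longlonglongrightarrow> U \<omega> + 0 *\<^sub>R Z \<omega>" by (intro tendsto_intros)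
    then show ?thesis unfolding q\<theta>[OF w] by (intro tendsto_inner tendsto_const lim[OF w]) simp
  qed
  have qw: "norm (q k \<omega>) \<le> w \<omega>" if om: "\<omega> \<in> space N" for k \<omega>
  proof -
    let ?a = "c \<omega>" and ?b = "\<kappa> * norm (U \<omega>)" and ?d = "\<kappa> * norm (Z \<omega>)" and ?z = "norm (Z \<omega>)"
    have t1: "\<theta> k \<omega> \<le> 1" using \<theta>(2)[OF om, of k] step_le_1[of k] by linarith
    have "norm (U \<omega> + \<theta> k \<omega> *\<^sub>R Z \<omega>) \<le> norm (U \<omega>) + norm (\<theta> k \<omega> *\<^sub>R Z \<omega>)" by (rule norm_triangle_ineq)
    also have "norm (\<theta> k \<omega> *\<^sub>R Z \<omega>) \<le> norm (Z \<omega>)"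
      using \<theta>(1)[OF om, of k] t1 mult_right_mono[of "\<theta> k \<omega>" 1 "norm (Z \<omega>)"] by simp
    finally have "\<kappa> * norm (U \<omega> + \<theta> k \<omega> *\<^sub>R Z \<omega>) \<le> ?b + ?d"
      using \<kappa> by (simp add: distrib_left[symmetric] mult_left_mono)
    then have n: "norm (D k \<omega> (U \<omega> + \<theta> k \<omega> *\<^sub>R Z \<omega>)) \<le> ?a + ?b + ?d"
      using bound[OF om, of k "U \<omega> + \<theta> k \<omega> *\<^sub>R Z \<omega>"] by linarith
    have "norm (q k \<omega>) \<le> norm (D k \<omega> (U \<omega> + \<theta> k \<omega> *\<^sub>R Z \<omega>)) * ?z"
      unfolding q\<theta>[OF om] real_norm_def by (rule Cauchy_Schwarz_ineq2)
    also have "\<dots> \<le> (?a + ?b + ?d) * ?z" using n by (rule mult_right_mono) simp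
    also have "\<dots> \<le> (?a + ?b + ?d)\<^sup>2 + ?z\<^sup>2"
    proof -
      have "2 * ((?a + ?b + ?d) * ?z) \<le> (?a + ?b + ?d)\<^sup>2 + ?z\<^sup>2"
        using sum_squares_bound[of "?a + ?b + ?d" ?z] by (simp only: mult.assoc)
      moreover have "0 \<le> (?a + ?b + ?d)\<^sup>2 + ?z\<^sup>2" by simp
      ultimately show ?thesis by linarith
    qed
    also have "(?a + ?b + ?d)\<^sup>2 \<le> 3 * (?a\<^sup>2 + ?b\<^sup>2 + ?d\<^sup>2)"
      using sum_squares_bound[of ?a ?b] sum_squares_bound[of ?a ?d] sum_squares_bound[of ?b ?d]
      by (simp add: power2_sum algebra_simps)
    finally show ?thesis by (simp add: w_def power_mult_distrib algebra_simps)
  qed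
  have m0: "(\<lambda>\<omega>. D0 \<omega> \<bullet> Z \<omega>) \<in> borel_measurable N"
    by (rule borel_measurable_LIMSEQ_metric[OF borel_measurable_integrable[OF iq]]) (rule qlim)
  have q0: "AE \<omega> in N. (\<lambda>k. q k \<omega>) \<longlonglongrightarrow> D0 \<omega> \<bullet> Z \<omega>" using qlim by (rule AE_I2)
  have qwAE: "AE \<omega> in N. norm (q k \<omega>) \<le> w \<omega>" for k using qw by (rule AE_I2)
  show "integrable N (\<lambda>\<omega>. D0 \<omega> \<bullet> Z \<omega>)"
    by (rule integrable_dominated_convergence[OF m0 borel_measurable_integrable[OF iq] iw q0 qwAE])
  show "(\<lambda>k. ((LINT \<omega>|N. f k \<omega> (U \<omega> + step_size k *\<^sub>R Z \<omega>)) - (LINT \<omega>|N. f k \<omega> (U \<omega>))) / step_size k)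
      \<longlonglongrightarrow> (LINT \<omega>|N. D0 \<omega> \<bullet> Z \<omega>)"
    unfolding Eq by (rule integral_dominated_convergence[OF m0 borel_measurable_integrable[OF iq] iw q0 qwAE])
  have "\<bar>LINT \<omega>|N. q k \<omega>\<bar> \<le> (LINT \<omega>|N. w \<omega>)"
  proof -
    have "\<bar>LINT \<omega>|N. q k \<omega>\<bar> \<le> (LINT \<omega>|N. \<bar>q k \<omega>\<bar>)" by (rule integral_abs_bound)
    also have "\<dots> \<le> (LINT \<omega>|N. w \<omega>)"
      using qw[of _ k] iq[of k] by (intro integral_mono iw) auto
    finally show ?thesis .
  qed
  also have "(LINT \<omega>|N. w \<omega>) = 3 * (LINT \<omega>|N. (c \<omega>)\<^sup>2) + 3 * \<kappa>\<^sup>2 * (LINT \<omega>|N. (norm (U \<omega>))\<^sup>2) + (3 * \<kappa>\<^sup>2 + 1) * (LINT \<omega>|N. (norm (Z \<omega>))\<^sup>2)"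
    unfolding w_def using sq by simp
  finally show "\<bar>((LINT \<omega>|N. f k \<omega> (U \<omega> + step_size k *\<^sub>R Z \<omega>)) - (LINT \<omega>|N. f k \<omega> (U \<omega>))) / step_size k\<bar>
      \<le> 3 * (LINT \<omega>|N. (c \<omega>)\<^sup>2) + 3 * \<kappa>\<^sup>2 * (LINT \<omega>|N. (norm (U \<omega>))\<^sup>2) + (3 * \<kappa>\<^sup>2 + 1) * (LINT \<omega>|N. (norm (Z \<omega>))\<^sup>2)"
    unfolding Eq .
qed

lemma (in prob_space)
  fixes f :: "'a \<Rightarrow> real"
  assumes f: "integrable M f" and N: "prob_space N"
  shows integrable_pair_fst: "integrable (M \<Otimes>\<^sub>M N) (\<lambda>p. f (fst p))"
    and integral_pair_fst: "(LINT p|(M \<Otimes>\<^sub>M N). f (fst p)) = (LINT \<omega>|M. f \<omega>)"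
    and integrable_pair_snd: "integrable (N \<Otimes>\<^sub>M M) (\<lambda>p. f (snd p))"
    and integral_pair_snd: "(LINT p|(N \<Otimes>\<^sub>M M). f (snd p)) = (LINT \<omega>|M. f \<omega>)"
proof -
  interpret N: prob_space N by fact
  interpret P: pair_sigma_finite M N ..
  have "integrable (distr (M \<Otimes>\<^sub>M N) M fst) f"
    unfolding N.distr_pair_fst by (rule f)
  then show 1: "integrable (M \<Otimes>\<^sub>M N) (\<lambda>p. f (fst p))"
    using integrable_distr_eq[of fst "M \<Otimes>\<^sub>M N" M f] f by simp
  have "(LINT p|(M \<Otimes>\<^sub>M N). f (fst p)) = (LINT \<omega>|distr (M \<Otimes>\<^sub>M N) M fst. f \<omega>)"
    using f by (subst integral_distr) auto
  then show 2: "(LINT p|(M \<Otimes>\<^sub>M N). f (fst p)) = (LINT \<omega>|M. f \<omega>)"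
    unfolding N.distr_pair_fst .
  show "integrable (N \<Otimes>\<^sub>M M) (\<lambda>p. f (snd p))"
    using P.integrable_product_swap[OF 1] by (simp add: case_prod_beta')
  show "(LINT p|(N \<Otimes>\<^sub>M M). f (snd p)) = (LINT \<omega>|M. f \<omega>)"
    using P.integral_product_swap[of "\<lambda>p. f (fst p)"] 1 2 by (simp add: case_prod_beta')
qed

text \<open>Both mixtures are driven by the same uniform variable, so they differ only where that
  variable falls between \<open>s\<close> and \<open>s'\<close>.\<close>

lemma mixture_second_moment_diff:
  fixes A Z :: "'w \<Rightarrow> real^'n"
  assumes M: "prob_space M" and [measurable]: "A \<in> borel_measurable M" "Z \<in> borel_measurable M"
    and Z: "integrable M (\<lambda>\<omega>. (norm (Z \<omega>))\<^sup>2)" and s: "0 \<le> s" "s \<le> 1" "0 \<le> s'" "s' \<le> 1"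
  shows "(LINT p|(M \<Otimes>\<^sub>M uniform_measure lborel {0..1::real}).
     (norm ((if snd p \<le> s then A (fst p) + Z (fst p) else A (fst p)) - (if snd p \<le> s' then A (fst p) + Z (fst p) else A (fst p))))\<^sup>2)
    \<le> \<bar>s - s'\<bar> * (LINT \<omega>|M. (norm (Z \<omega>))\<^sup>2)"
proof -
  let ?U = "uniform_measure lborel {0..1::real}"
  interpret M: prob_space M by fact
  interpret U: prob_space ?U by (rule prob_space_uniform01)
  interpret P: pair_prob_space M ?U ..
  define I where "I = {min s s'<..max s s'}"
  have e: "(norm ((if snd p \<le> s then A (fst p) + Z (fst p) else A (fst p)) - (if snd p \<le> s' then A (fst p) + Z (fst p) else A (fst p))))\<^sup>2
      = (norm (Z (fst p)))\<^sup>2 * indicator I (snd p)" for p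
    by (auto simp: I_def indicator_def)
  have int: "integrable (M \<Otimes>\<^sub>M ?U) (\<lambda>(\<omega>, u). (norm (Z \<omega>))\<^sup>2 * indicator I u)"
    by (rule Bochner_Integration.integrable_bound[OF M.integrable_pair_fst[OF Z prob_space_uniform01]])
      (auto simp: case_prod_beta' indicator_def I_def)
  have "(LINT p|(M \<Otimes>\<^sub>M ?U). (norm (Z (fst p)))\<^sup>2 * indicator I (snd p)) = (LINT \<omega>|M. LINT u|?U. (norm (Z \<omega>))\<^sup>2 * indicator I u)"
    using P.integral_fst'[OF int] by (simp add: case_prod_beta')
  also have "\<dots> = (LINT \<omega>|M. (norm (Z \<omega>))\<^sup>2) * measure ?U I"
    by (simp add: I_def)
  also have "\<dots> \<le> (LINT \<omega>|M. (norm (Z \<omega>))\<^sup>2) * \<bar>s - s'\<bar>"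
  proof (rule mult_left_mono)
    have "emeasure ?U I = emeasure lborel ({0..1} \<inter> I)"
      by (simp add: divide_ennreal_def I_def)
    also have "\<dots> \<le> emeasure lborel I" by (rule emeasure_mono) (auto simp: I_def)
    also have "\<dots> = ennreal \<bar>s - s'\<bar>" by (auto simp: I_def min_def max_def)
    finally show "measure ?U I \<le> \<bar>s - s'\<bar>" by (simp add: U.emeasure_eq_measure)
  qed simp
  finally show ?thesis unfolding e by (simp add: mult.commute)
qed

section \<open>Derivative in the law, and the tangent inequality on an arbitrary probability
  space\<close>

context mean_field_function
begin

text \<open>The linear derivative writes the increment of \<open>\<phi> x\<close> as an integral
  over \<open>s\<close> of differences of means of \<open>d\<phi> x\<close> at the mixture
  \<open>\<nu> k s\<close>. Coupling the two laws through \<open>U\<close> turns each difference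
  into a difference quotient. As \<open>k\<close> grows the mixtures collapse to
  \<open>law M U\<close>, so the limit no longer depends on \<open>s\<close> and integrates to
  itself over the unit interval.\<close>

lemma functional_derivative_tendsto:
  fixes U Z :: "'w \<Rightarrow> real^'n"
  assumes M: "prob_space M" and [measurable]: "U \<in> borel_measurable M" "Z \<in> borel_measurable M"
    and sq: "integrable M (\<lambda>\<omega>. (norm (U \<omega>))\<^sup>2)" "integrable M (\<lambda>\<omega>. (norm (Z \<omega>))\<^sup>2)"
  shows "(\<lambda>k. (\<phi> x (law M (\<lambda>\<omega>. U \<omega> + step_size k *\<^sub>R Z \<omega>)) - \<phi> x (law M U)) / step_size k)
    \<longlonglongrightarrow> (LINT \<omega>|M. Dy x (law M U) (U \<omega>) \<bullet> Z \<omega>)"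
proof -
  let ?Un = "uniform_measure lborel {0..1::real}"
  interpret M: prob_space M by fact
  interpret Un: prob_space ?Un by (rule prob_space_uniform01)
  interpret PP: pair_prob_space M ?Un ..
  let ?Q = "M \<Otimes>\<^sub>M ?Un"
  define A where "A = (\<lambda>k \<omega>. U \<omega> + step_size k *\<^sub>R Z \<omega>)"
  define \<mu> where "\<mu> = law M U"
  define \<nu> where "\<nu> = (\<lambda>k s. mixture s (law M (A k)) \<mu>)"
  define R :: "nat \<Rightarrow> real \<Rightarrow> 'w \<times> real \<Rightarrow> real^'n"
    where "R = (\<lambda>k s p. if snd p \<le> s then U (fst p) + step_size k *\<^sub>R Z (fst p) else U (fst p))"
  have Am[measurable]: "A k \<in> borel_measurable M" for k unfolding A_def by measurable
  have Asq: "integrable M (\<lambda>\<omega>. (norm (A k \<omega>))\<^sup>2)" for k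
    unfolding A_def using sq by (intro integrable_norm_square_add) auto
  have \<mu>P2: "\<mu> \<in> P2" unfolding \<mu>_def using sq by (simp_all add: P2_iff_law[OF M] assms(2,3))
  have AP2: "law M (A k) \<in> P2" for k using Asq by (simp add: P2_iff_law[OF M Am])
  have Rm[measurable]: "R k s \<in> borel_measurable ?Q" for k s unfolding R_def by measurable
  have \<nu>R: "\<nu> k s = law ?Q (R k s)" if "0 \<le> s" "s \<le> 1" for k s
  proof -
    have "R k s = (\<lambda>(\<omega>, u). if u \<le> s then A k \<omega> else U \<omega>)" by (auto simp: R_def A_def fun_eq_iff)
    then show ?thesis unfolding \<nu>_def \<mu>_def using mixture_eq_law[OF M Am assms(2) that, of k] by simp
  qed
  \<comment> \<open>A majorant of |R|^2 common to all \<open>k\<close> and \<open>s\<close>; its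
    mean \<open>m\<close> then bounds the second moments of all mixtures at once.\<close>
  define w :: "'w \<times> real \<Rightarrow> real" where "w = (\<lambda>p. 3 * (norm (U (fst p)))\<^sup>2 + 2 * (norm (Z (fst p)))\<^sup>2)"
  have iw: "integrable ?Q w" unfolding w_def
    using M.integrable_pair_fst[OF sq(1) prob_space_uniform01] M.integrable_pair_fst[OF sq(2) prob_space_uniform01] by simp
  define m where "m = (LINT p|?Q. w p)"
  have Rw: "(norm (R k s p))\<^sup>2 \<le> w p" for k s p
  proof -
    let ?u = "U (fst p)" and ?z = "Z (fst p)"
    have 1: "(norm (?u + step_size k *\<^sub>R ?z))\<^sup>2 \<le> 2 * (norm ?u)\<^sup>2 + 2 * (\<bar>step_size k\<bar> * norm ?z)\<^sup>2"
      using norm_square_le_double[of "?u + step_size k *\<^sub>R ?z" ?u] by simp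
    have 2: "(\<bar>step_size k\<bar> * norm ?z)\<^sup>2 \<le> (norm ?z)\<^sup>2"
      using step_pos[of k] step_le_1[of k] by (intro power_mono) (auto simp: mult_left_le_one_le)
    have 3: "0 \<le> (norm ?u)\<^sup>2" "0 \<le> (norm ?z)\<^sup>2" by simp_all
    show ?thesis
    proof (cases "snd p \<le> s")
      case True
      then have e: "R k s p = ?u + step_size k *\<^sub>R ?z" by (simp add: R_def)
      show ?thesis unfolding w_def e using 1 2 3 by linarith
    next
      case False
      then have e: "R k s p = ?u" by (simp add: R_def)
      show ?thesis unfolding w_def e using 3 by linarith
    qed
  qed
  have Rsq: "integrable ?Q (\<lambda>p. (norm (R k s p))\<^sup>2)" for k s
    by (rule Bochner_Integration.integrable_bound[OF iw]) (use Rw[of k s] in \<open>auto intro!: AE_I2 order_trans[OF _ abs_ge_self]\<close>)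
  have \<nu>P2: "\<nu> k s \<in> P2" if "0 \<le> s" "s \<le> 1" for k s
    unfolding \<nu>R[OF that] using P2_iff_law[OF PP.prob_space_axioms Rm] Rsq by blast
  have \<nu>m: "(LINT z|\<nu> k s. (norm z)\<^sup>2) \<le> m" if "0 \<le> s" "s \<le> 1" for k s
    unfolding \<nu>R[OF that] second_moment_law[OF Rm] m_def by (rule integral_mono[OF Rsq iw]) (rule Rw)
  have \<mu>R: "\<mu> = law ?Q (\<lambda>p. U (fst p))"
  proof -
    have "law ?Q (\<lambda>p. U (fst p)) = distr (distr ?Q M fst) borel U"
      unfolding law_def by (subst distr_distr) (auto simp: comp_def)
    then show ?thesis unfolding Un.distr_pair_fst by (simp add: \<mu>_def law_def)
  qed
  \<comment> \<open>On the product space the variable behind the mixture differs from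
    \<open>U\<close> by at most \<open>step_size k\<close> times \<open>Z\<close>, so it converges
    in mean square whatever \<open>s\<close> is.\<close>
  have \<nu>lim: "limitin P2_topology (\<lambda>k. \<nu> k s) \<mu> sequentially" if s: "0 \<le> s" "s \<le> 1" for s
    unfolding \<nu>R[OF s] \<mu>R
  proof (rule limitin_P2_law[OF PP.prob_space_axioms])
    show "(\<lambda>k. LINT p|?Q. (norm (R k s p - U (fst p)))\<^sup>2) \<longlonglongrightarrow> 0"
    proof (rule tendsto_sandwich[OF _ _ tendsto_const])
      show "(\<lambda>k. (step_size k)\<^sup>2 * (LINT \<omega>|M. (norm (Z \<omega>))\<^sup>2)) \<longlonglongrightarrow> 0"
        using step_tendsto by (auto intro!: tendsto_eq_intros)
      show "\<forall>\<^sub>F k in sequentially. (LINT p|?Q. (norm (R k s p - U (fst p)))\<^sup>2) \<le> (step_size k)\<^sup>2 * (LINT \<omega>|M. (norm (Z \<omega>))\<^sup>2)"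
      proof (rule eventuallyI)
        fix k
        have i: "integrable ?Q (\<lambda>p. (step_size k)\<^sup>2 * (norm (Z (fst p)))\<^sup>2)"
          using M.integrable_pair_fst[OF sq(2) prob_space_uniform01] by simp
        have le: "(norm (R k s p - U (fst p)))\<^sup>2 \<le> (step_size k)\<^sup>2 * (norm (Z (fst p)))\<^sup>2" for p
          by (simp add: R_def power_mult_distrib)
        have "(LINT p|?Q. (norm (R k s p - U (fst p)))\<^sup>2) \<le> (LINT p|?Q. (step_size k)\<^sup>2 * (norm (Z (fst p)))\<^sup>2)"
          by (rule integral_mono[OF _ i le], rule Bochner_Integration.integrable_bound[OF i]) (use le in \<open>auto intro!: AE_I2 order_trans[OF _ abs_ge_self]\<close>)
        also have "\<dots> = (step_size k)\<^sup>2 * (LINT \<omega>|M. (norm (Z \<omega>))\<^sup>2)"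
          using M.integral_pair_fst[OF sq(2) prob_space_uniform01] by simp
        finally show "(LINT p|?Q. (norm (R k s p - U (fst p)))\<^sup>2) \<le> (step_size k)\<^sup>2 * (LINT \<omega>|M. (norm (Z \<omega>))\<^sup>2)" .
      qed
    qed (auto intro!: eventuallyI)
    show "integrable ?Q (\<lambda>p. (norm (U (fst p)))\<^sup>2)" using M.integrable_pair_fst[OF sq(1) prob_space_uniform01] .
  qed (use Rsq in \<open>auto intro!: eventuallyI\<close>)
  have \<nu>cont: "limitin P2_topology (\<lambda>j. \<nu> k (r j)) (\<nu> k s) sequentially"
    if s: "0 \<le> s" "s \<le> 1" and r: "\<And>j. 0 \<le> r j" "\<And>j. r j \<le> 1" and lim: "r \<longlonglongrightarrow> s" for k s r
    unfolding \<nu>R[OF s] \<nu>R[OF r]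
  proof (rule limitin_P2_law[OF PP.prob_space_axioms])
    show "(\<lambda>j. LINT p|?Q. (norm (R k (r j) p - R k s p))\<^sup>2) \<longlonglongrightarrow> 0"
    proof (rule tendsto_sandwich[OF _ _ tendsto_const])
      show "(\<lambda>j. \<bar>r j - s\<bar> * (LINT \<omega>|M. (norm (step_size k *\<^sub>R Z \<omega>))\<^sup>2)) \<longlonglongrightarrow> 0"
        using lim by (auto intro!: tendsto_eq_intros)
      show "\<forall>\<^sub>F j in sequentially. (LINT p|?Q. (norm (R k (r j) p - R k s p))\<^sup>2)
          \<le> \<bar>r j - s\<bar> * (LINT \<omega>|M. (norm (step_size k *\<^sub>R Z \<omega>))\<^sup>2)"
        unfolding R_def using r s sq
        by (intro eventuallyI mixture_second_moment_diff[OF M]) (auto simp: power_mult_distrib)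
    qed (auto intro!: eventuallyI)
  qed (use Rsq in \<open>auto intro!: eventuallyI\<close>)
  define g where "g = (\<lambda>k s. ((LINT y|law M (A k). d\<phi> x (\<nu> k s) y) - (LINT y|\<mu>. d\<phi> x (\<nu> k s) y)))"
  have g: "g k s = (LINT \<omega>|M. d\<phi> x (\<nu> k s) (A k \<omega>)) - (LINT \<omega>|M. d\<phi> x (\<nu> k s) (U \<omega>))" if "0 \<le> s" "s \<le> 1" for k s
  proof -
    have "(\<lambda>y. d\<phi> x (\<nu> k s) y) \<in> borel_measurable borel"
      by (rule measurable_slice(3)[OF \<nu>P2[OF that]]) auto
    then show ?thesis unfolding g_def \<mu>_def law_def by (simp add: integral_distr)
  qed
  \<comment> \<open>Continuity in \<open>s\<close> supplies the measurability of the integrand of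
    the outer integral.\<close>
  have gcont: "continuous_on {0..1} (g k)" for k
    unfolding continuous_on_sequentially
  proof (intro allI ballI impI)
    fix r :: "nat \<Rightarrow> real" and s :: real assume "s \<in> {0..1}" "(\<forall>j. r j \<in> {0..1}) \<and> r \<longlonglongrightarrow> s"
    then have s: "0 \<le> s" "s \<le> 1" and r: "\<And>j. 0 \<le> r j" "\<And>j. r j \<le> 1" and lim: "r \<longlonglongrightarrow> s" by auto
    show "(g k \<circ> r) \<longlonglongrightarrow> g k s"
      unfolding comp_def g[OF s] g[OF r]
      by (intro tendsto_diff expectation_d_tendsto[where m=m, OF M _ _ _ _ \<nu>cont[OF s r lim]] Am Asq assms \<nu>P2[OF r] \<nu>m[OF r])
  qed
  define \<Lambda> where "\<Lambda> = (LINT \<omega>|M. Dy x \<mu> (U \<omega>) \<bullet> Z \<omega>)"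
  define c where "c = \<kappa> * (1 + norm x + sqrt m)"
  define B where "B = 3 * c\<^sup>2 + 3 * \<kappa>\<^sup>2 * (LINT \<omega>|M. (norm (U \<omega>))\<^sup>2) + (3 * \<kappa>\<^sup>2 + 1) * (LINT \<omega>|M. (norm (Z \<omega>))\<^sup>2)"
  have intd: "integrable M (\<lambda>\<omega>. d\<phi> x \<nu>' (V \<omega>))"
    if "\<nu>' \<in> P2" and V: "V \<in> borel_measurable M" "integrable M (\<lambda>\<omega>. (norm (V \<omega>))\<^sup>2)" for \<nu>' V
  proof (rule Bochner_Integration.integrable_bound)
    show "integrable M (\<lambda>\<omega>. \<kappa> * (1 + (norm x)\<^sup>2 + (LINT z|\<nu>'. (norm z)\<^sup>2) + (norm (V \<omega>))\<^sup>2))" using V by simp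
    show "(\<lambda>\<omega>. d\<phi> x \<nu>' (V \<omega>)) \<in> borel_measurable M" using measurable_slice(3)[OF that(1) _ V(1)] by simp
    show "AE \<omega> in M. norm (d\<phi> x \<nu>' (V \<omega>)) \<le> norm (\<kappa> * (1 + (norm x)\<^sup>2 + (LINT z|\<nu>'. (norm z)\<^sup>2) + (norm (V \<omega>))\<^sup>2))"
      using growth_d[OF that(1)] by (auto intro!: AE_I2 order_trans[OF _ abs_ge_self])
  qed
  have quot: "(\<lambda>k. g k s / step_size k) \<longlonglongrightarrow> \<Lambda>" "\<bar>g k s / step_size k\<bar> \<le> B" if s: "0 \<le> s" "s \<le> 1" for s k
  proof -
    have bd: "norm (Dy x (\<nu> k s) y) \<le> c + \<kappa> * norm y" for k y
    proof -
      have "norm (Dy x (\<nu> k s) y) \<le> \<kappa> * (1 + norm x + sqrt (LINT z|\<nu> k s. (norm z)\<^sup>2) + norm y)"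
        by (rule growth_Dy[OF \<nu>P2[OF s]])
      also have "\<dots> \<le> \<kappa> * (1 + norm x + sqrt m + norm y)"
        using \<nu>m[OF s, of k] \<kappa>_nonneg by (intro mult_left_mono) auto
      finally show ?thesis by (simp add: c_def algebra_simps)
    qed
    \<comment> \<open>The integrand changes with \<open>k\<close> as well, through the mixture; the
      difference-quotient lemma is therefore stated for a sequence of functions whose gradients
      converge along converging points.\<close>
    note * = expectation_difference_quotient[of U M Z "\<lambda>_. c" "\<lambda>k \<omega>. d\<phi> x (\<nu> k s)" "\<lambda>k \<omega>. Dy x (\<nu> k s)" \<kappa> "\<lambda>\<omega>. Dy x \<mu> (U \<omega>)"]
    have **: "(\<lambda>k. Dy x (\<nu> k s) (y k)) \<longlonglongrightarrow> Dy x \<mu> (U \<omega>)" if "y \<longlonglongrightarrow> U \<omega>" for y \<omega>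
      by (rule tendsto_continuous_map_prod3[OF cont_Dy tendsto_const \<nu>lim[OF s] that])
    show "(\<lambda>k. g k s / step_size k) \<longlonglongrightarrow> \<Lambda>"
      unfolding g[OF s] \<Lambda>_def A_def
      by (rule *(2)) (use assms bd ** \<kappa>_nonneg intd[OF \<nu>P2[OF s]] Am Asq deriv_y[OF \<nu>P2[OF s]] in \<open>auto simp: A_def\<close>)
    have "\<bar>((LINT \<omega>|M. d\<phi> x (\<nu> k s) (U \<omega> + step_size k *\<^sub>R Z \<omega>)) - (LINT \<omega>|M. d\<phi> x (\<nu> k s) (U \<omega>))) / step_size k\<bar>
      \<le> 3 * (LINT \<omega>|M. c\<^sup>2) + 3 * \<kappa>\<^sup>2 * (LINT \<omega>|M. (norm (U \<omega>))\<^sup>2) + (3 * \<kappa>\<^sup>2 + 1) * (LINT \<omega>|M. (norm (Z \<omega>))\<^sup>2)"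
      by (rule *(3)) (use assms bd ** \<kappa>_nonneg intd[OF \<nu>P2[OF s]] Am Asq deriv_y[OF \<nu>P2[OF s]] in \<open>auto simp: A_def\<close>)
    then show "\<bar>g k s / step_size k\<bar> \<le> B" unfolding g[OF s] A_def B_def by (simp add: M.prob_space)
  qed
  have eq: "(\<phi> x (law M (A k)) - \<phi> x \<mu>) / step_size k = (LINT s|lborel. indicator {0..1} s *\<^sub>R (g k s / step_size k))" for k
  proof -
    have "\<phi> x (law M (A k)) - \<phi> x \<mu> = (LINT s:{0..1}|lborel. g k s)"
      using linear[of x] AP2[of k] \<mu>P2 unfolding linear_derivative_def g_def \<nu>_def by blast
    then show ?thesis by (simp add: set_lebesgue_integral_def)
  qed
  have "(\<lambda>k. LINT s|lborel. indicator {0..1} s *\<^sub>R (g k s / step_size k)) \<longlonglongrightarrow> (LINT s|lborel. indicator {0..1::real} s *\<^sub>R \<Lambda>)"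
  proof (rule integral_dominated_convergence)
    show "integrable lborel (\<lambda>s. indicator {0..1::real} s * B)"
      by (intro integrable_mult_left integrable_real_indicator) auto
    show "(\<lambda>s. indicator {0..1} s *\<^sub>R (g k s / step_size k)) \<in> borel_measurable lborel" for k
    proof -
      have "continuous_on {0..1} (\<lambda>s. g k s / step_size k)"
        using gcont[of k] step_pos[of k] by (intro continuous_intros) auto
      from borel_measurable_continuous_on_indicator[OF _ this] show ?thesis by simp
    qed
    show "AE s in lborel. (\<lambda>k. indicator {0..1} s *\<^sub>R (g k s / step_size k)) \<longlonglongrightarrow> indicator {0..1} s *\<^sub>R \<Lambda>"
      using quot(1) by (auto simp: indicator_def)
    show "AE s in lborel. norm (indicator {0..1} s *\<^sub>R (g k s / step_size k)) \<le> indicator {0..1} s * B" for k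
      using quot(2) by (auto simp: indicator_def)
  qed simp
  then show ?thesis unfolding eq[symmetric] A_def \<mu>_def \<Lambda>_def by simp
qed

text \<open>The joint law of \<open>U\<close> and \<open>V\<close> is realised on an atomless Polish
  space, where the convexity condition applies with its own L-derivative. What is left is to replace
  the pairing \<open>a\<close> with that derivative by a pairing with \<open>Dy\<close>. One
  inequality suffices, and convexity yields it: along the ray from \<open>V\<close> through
  \<open>U\<close> and beyond, the tangent slope \<open>a\<close> at \<open>U\<close> lies below all
  difference quotients, whose limit is the pairing with \<open>Dy\<close>.\<close>

lemma convexity_functional:
  fixes U V :: "'w \<Rightarrow> real^'n"
  assumes M: "prob_space M" and [measurable]: "U \<in> borel_measurable M" "V \<in> borel_measurable M"
    and sq: "integrable M (\<lambda>\<omega>. (norm (U \<omega>))\<^sup>2)" "integrable M (\<lambda>\<omega>. (norm (V \<omega>))\<^sup>2)"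
  shows "\<phi> x (law M U) - \<phi> x' (law M V) \<le> Dx x (law M U) \<bullet> (x - x')
    + (LINT \<omega>|M. Dy x (law M U) (U \<omega>) \<bullet> (U \<omega> - V \<omega>))"
proof -
  let ?\<pi> = "distr M borel (\<lambda>\<omega>. (U \<omega>, V \<omega>))"
  let ?\<mu> = "law M U"
  have "prob_space ?\<pi>" using M by (intro prob_space.prob_space_distr) auto
  then obtain P X X' where P: "atomless_polish_prob P" and X[measurable]: "X \<in> borel_measurable P" "X' \<in> borel_measurable P"
    and \<pi>: "distr P borel (\<lambda>s. (X s, X' s)) = ?\<pi>"
    using atomless_polish_coupling[of ?\<pi>] by auto
  obtain Dx' D\<mu> where Dx': "\<And>x \<mu>. \<mu> \<in> P2 \<Longrightarrow> GDERIV (\<lambda>z. \<phi> z \<mu>) x :> Dx' x \<mu>"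
    and conv: "\<And>x x' \<mu> \<mu>' P X X'. \<mu> \<in> P2 \<Longrightarrow> \<mu>' \<in> P2 \<Longrightarrow> atomless_polish_prob P \<Longrightarrow>
        X \<in> borel_measurable P \<Longrightarrow> X' \<in> borel_measurable P \<Longrightarrow>
        distr P borel X = \<mu> \<Longrightarrow> distr P borel X' = \<mu>' \<Longrightarrow>
        \<phi> x \<mu> - \<phi> x' \<mu>' \<le> Dx' x \<mu> \<bullet> (x - x') + (LINT \<omega>|P. D\<mu> x \<mu> (X \<omega>) \<bullet> (X \<omega> - X' \<omega>))"
    using convex unfolding L_jointly_convex_def by blast
  have law: "distr P borel (\<lambda>s. h (X s) (X' s)) = law M (\<lambda>\<omega>. h (U \<omega>) (V \<omega>))"
    if [measurable]: "(\<lambda>p. h (fst p) (snd p)) \<in> borel_measurable borel" for h :: "real^'n \<Rightarrow> real^'n \<Rightarrow> real^'n"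
  proof -
    have "distr P borel (\<lambda>s. h (X s) (X' s)) = distr ?\<pi> borel (\<lambda>p. h (fst p) (snd p))"
      unfolding \<pi>[symmetric] by (subst distr_distr) (auto simp: comp_def that)
    also have "\<dots> = law M (\<lambda>\<omega>. h (U \<omega>) (V \<omega>))"
      unfolding law_def by (subst distr_distr) (auto simp: comp_def that)
    finally show ?thesis .
  qed
  have lawX: "distr P borel X = ?\<mu>" "distr P borel X' = law M V"
    using law[of "\<lambda>a b. a"] law[of "\<lambda>a b. b"]
    by (simp_all add: borel_measurable_continuous_onI continuous_on_fst continuous_on_snd)
  have \<mu>P2: "?\<mu> \<in> P2" "law M V \<in> P2" using sq by (simp_all add: P2_iff_law[OF M] assms(2,3))
  define a where "a = (LINT \<omega>|P. D\<mu> x ?\<mu> (X \<omega>) \<bullet> (X \<omega> - X' \<omega>))"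
  have Z: "(\<lambda>\<omega>. U \<omega> - V \<omega>) \<in> borel_measurable M" "integrable M (\<lambda>\<omega>. (norm (U \<omega> - V \<omega>))\<^sup>2)"
    using integrable_norm_square_add[of U M V "-1"] sq by auto
  \<comment> \<open>The tangent inequality at \<open>law M U\<close> is tested with a variable
    pushed away from \<open>X'\<close>; the state argument stays at \<open>x\<close>, so the
    \<open>Dx'\<close> term drops out.\<close>
  have "a \<le> (\<phi> x (law M (\<lambda>\<omega>. U \<omega> + step_size k *\<^sub>R (U \<omega> - V \<omega>))) - \<phi> x ?\<mu>) / step_size k" for k
  proof -
    let ?e = "step_size k"
    let ?\<mu>' = "law M (\<lambda>\<omega>. U \<omega> + ?e *\<^sub>R (U \<omega> - V \<omega>))"
    have l: "distr P borel (\<lambda>s. X s + ?e *\<^sub>R (X s - X' s)) = ?\<mu>'"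
      by (rule law[of "\<lambda>a b. a + ?e *\<^sub>R (a - b)"]) (intro borel_measurable_continuous_onI continuous_intros)
    have "?\<mu>' \<in> P2"
      using P2_iff_law[OF M, of "\<lambda>\<omega>. U \<omega> + ?e *\<^sub>R (U \<omega> - V \<omega>)"] integrable_norm_square_add[of U M "\<lambda>\<omega>. U \<omega> - V \<omega>" ?e] sq Z by auto
    then have "\<phi> x ?\<mu> - \<phi> x ?\<mu>' \<le> Dx' x ?\<mu> \<bullet> (x - x) + (LINT \<omega>|P. D\<mu> x ?\<mu> (X \<omega>) \<bullet> (X \<omega> - (X \<omega> + ?e *\<^sub>R (X \<omega> - X' \<omega>))))"
      using lawX by (intro conv[OF \<mu>P2(1) _ P X(1) _ _ l]) auto
    also have "\<dots> = - ?e * a" by (simp add: a_def)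
    finally show ?thesis using step_pos[of k] by (simp add: field_simps)
  qed
  then have "a \<le> (LINT \<omega>|M. Dy x ?\<mu> (U \<omega>) \<bullet> (U \<omega> - V \<omega>))"
    using LIMSEQ_le_const[OF functional_derivative_tendsto[OF M _ Z(1) sq(1) Z(2), of x]] by auto
  moreover have "\<phi> x ?\<mu> - \<phi> x' (law M V) \<le> Dx' x ?\<mu> \<bullet> (x - x') + a"
    unfolding a_def by (rule conv[OF \<mu>P2 P X lawX])
  moreover have "Dx' x ?\<mu> = Dx x ?\<mu>"
    using GDERIV_inner_unique[OF Dx'[OF \<mu>P2(1)] deriv_x[OF \<mu>P2(1)]] .
  ultimately show ?thesis by simp
qed

end

section \<open>First-order expansion of the potential cost\<close>

context mean_field_function
begin

lemma integrable_\<phi>: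
  assumes "prob_space M" "A \<in> borel_measurable M" "integrable M (\<lambda>\<omega>. (norm (A \<omega>))\<^sup>2)" "\<nu> \<in> P2"
  shows "integrable M (\<lambda>\<omega>. \<phi> (A \<omega>) \<nu>)"
proof (rule Bochner_Integration.integrable_bound)
  interpret prob_space M by fact
  show "integrable M (\<lambda>\<omega>. \<kappa> * (1 + (norm (A \<omega>))\<^sup>2 + (LINT z|\<nu>. (norm z)\<^sup>2)))" using assms by simp
  show "(\<lambda>\<omega>. \<phi> (A \<omega>) \<nu>) \<in> borel_measurable M" by (rule measurable_slice(1)[OF assms(4,2,2)])
  show "AE \<omega> in M. norm (\<phi> (A \<omega>) \<nu>) \<le> norm (\<kappa> * (1 + (norm (A \<omega>))\<^sup>2 + (LINT z|\<nu>. (norm z)\<^sup>2)))"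
    using growth[OF assms(4)] by (auto intro!: AE_I2 order_trans[OF _ abs_ge_self])
qed

lemma potential_cost_law:
  assumes "U \<in> borel_measurable M" "law M U \<in> P2"
  shows "potential_cost \<phi> d\<phi> x (law M U) = \<phi> x (law M U) + (LINT \<omega>|M. d\<phi> (U \<omega>) (law M U) x)"
proof -
  have "(\<lambda>z. d\<phi> z (law M U) x) \<in> borel_measurable borel"
    by (rule measurable_slice(3)[OF assms(2)]) auto
  then have "(LINT z|distr M borel U. d\<phi> z (law M U) x) = (LINT \<omega>|M. d\<phi> (U \<omega>) (law M U) x)"
    by (rule integral_distr[OF assms(1)])
  then show ?thesis by (simp add: potential_cost_def law_def)
qed

text \<open>The integral over \<open>law M U\<close> inside the potential cost becomes a second,
  independent copy of the randomness: in the product the first coordinate carries \<open>U\<close>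
  in the state argument and the second carries \<open>A\<close>.\<close>

lemma
  fixes U A :: "'w \<Rightarrow> real^'n"
  assumes M: "prob_space M" and U: "U \<in> borel_measurable M" "integrable M (\<lambda>\<omega>. (norm (U \<omega>))\<^sup>2)"
    and A: "A \<in> borel_measurable M" "integrable M (\<lambda>\<omega>. (norm (A \<omega>))\<^sup>2)"
  shows integrable_d_pair: "integrable (M \<Otimes>\<^sub>M M) (\<lambda>p. d\<phi> (U (fst p)) (law M U) (A (snd p)))"
    and integrable_potential_cost: "integrable M (\<lambda>\<omega>. potential_cost \<phi> d\<phi> (A \<omega>) (law M U))"
    and integral_potential_cost: "(LINT \<omega>|M. potential_cost \<phi> d\<phi> (A \<omega>) (law M U))
      = (LINT \<omega>|M. \<phi> (A \<omega>) (law M U)) + (LINT p|(M \<Otimes>\<^sub>M M). d\<phi> (U (fst p)) (law M U) (A (snd p)))"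
proof -
  interpret M: prob_space M by fact
  interpret MM: pair_prob_space M M ..
  have P2: "law M U \<in> P2" using U by (simp add: P2_iff_law[OF M])
  let ?m = "LINT z|law M U. (norm z)\<^sup>2"
  show pair: "integrable (M \<Otimes>\<^sub>M M) (\<lambda>p. d\<phi> (U (fst p)) (law M U) (A (snd p)))"
  proof (rule Bochner_Integration.integrable_bound)
    show "integrable (M \<Otimes>\<^sub>M M) (\<lambda>p. \<kappa> * (1 + (norm (U (fst p)))\<^sup>2 + ?m + (norm (A (snd p)))\<^sup>2))"
      using M.integrable_pair_fst[OF U(2) M] M.integrable_pair_snd[OF A(2) M] by simp
    show "(\<lambda>p. d\<phi> (U (fst p)) (law M U) (A (snd p))) \<in> borel_measurable (M \<Otimes>\<^sub>M M)"
      using U A by (intro measurable_slice(3)[OF P2]) auto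
    show "AE p in M \<Otimes>\<^sub>M M. norm (d\<phi> (U (fst p)) (law M U) (A (snd p)))
        \<le> norm (\<kappa> * (1 + (norm (U (fst p)))\<^sup>2 + ?m + (norm (A (snd p)))\<^sup>2))"
      using growth_d[OF P2] by (auto intro!: AE_I2 order_trans[OF _ abs_ge_self])
  qed
  then have c: "integrable (M \<Otimes>\<^sub>M M) (\<lambda>(\<omega>', \<omega>). d\<phi> (U \<omega>') (law M U) (A \<omega>))" by (simp add: case_prod_beta')
  note i = integrable_\<phi>[OF M A P2]
  have j: "integrable M (\<lambda>\<omega>. LINT \<omega>'|M. d\<phi> (U \<omega>') (law M U) (A \<omega>))" using MM.integrable_snd[OF c] .
  show "integrable M (\<lambda>\<omega>. potential_cost \<phi> d\<phi> (A \<omega>) (law M U))"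
    unfolding potential_cost_law[OF U(1) P2] using i j by simp
  show "(LINT \<omega>|M. potential_cost \<phi> d\<phi> (A \<omega>) (law M U))
      = (LINT \<omega>|M. \<phi> (A \<omega>) (law M U)) + (LINT p|(M \<Otimes>\<^sub>M M). d\<phi> (U (fst p)) (law M U) (A (snd p)))"
    unfolding potential_cost_law[OF U(1) P2] using i j MM.integral_snd[OF c] by (simp add: case_prod_beta')
qed

text \<open>The derivative \<open>l\<close> consists of the mean of \<open>Dx\<close> paired with Z
  = V - U and of a mean over two independent copies of \<open>Dy\<close> paired with Z. Integrating
  the tangent inequality with \<open>x = U \<omega>\<close> and \<open>x' = V \<omega>\<close>
  yields the same two terms, which is the potential structure of the game. The second claim, uniform
  in \<open>k\<close>, will be the majorant when the limit is taken under the integral over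
  time.\<close>

lemma potential_cost_first_order:
  fixes U V :: "'w \<Rightarrow> real^'n"
  assumes M: "prob_space M" and U: "U \<in> borel_measurable M" "integrable M (\<lambda>\<omega>. (norm (U \<omega>))\<^sup>2)"
    and V: "V \<in> borel_measurable M" "integrable M (\<lambda>\<omega>. (norm (V \<omega>))\<^sup>2)"
    and R: "(LINT \<omega>|M. (norm (U \<omega>))\<^sup>2) \<le> R" "(LINT \<omega>|M. (norm (V \<omega>))\<^sup>2) \<le> R"
  defines "h \<equiv> (\<lambda>k. ((LINT \<omega>|M. potential_cost \<phi> d\<phi> (U \<omega> + step_size k *\<^sub>R (V \<omega> - U \<omega>)) (law M U))
      - (LINT \<omega>|M. potential_cost \<phi> d\<phi> (U \<omega>) (law M U))) / step_size k)"
  shows "\<exists>l. h \<longlonglongrightarrow> l \<and> (LINT \<omega>|M. \<phi> (U \<omega>) (law M U)) - (LINT \<omega>|M. \<phi> (V \<omega>) (law M V)) \<le> - l"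
    and "\<bar>h k\<bar> \<le> 100 * (\<kappa>\<^sup>2 + 1) * (1 + R)"
proof -
  interpret M: prob_space M by fact
  interpret MM: pair_prob_space M M ..
  let ?\<mu> = "law M U" and ?N = "M \<Otimes>\<^sub>M M"
  define Z where "Z = (\<lambda>\<omega>. V \<omega> - U \<omega>)"
  define m where "m = (LINT \<omega>|M. (norm (U \<omega>))\<^sup>2)"
  have P2: "?\<mu> \<in> P2" "law M V \<in> P2" using U V by (simp_all add: P2_iff_law[OF M])
  have m: "(LINT z|?\<mu>. (norm z)\<^sup>2) = m" unfolding m_def by (rule second_moment_law[OF U(1)])
  have m0: "0 \<le> m" "m \<le> R" unfolding m_def using R(1) by auto
  have Z: "Z \<in> borel_measurable M" "integrable M (\<lambda>\<omega>. (norm (Z \<omega>))\<^sup>2)"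
    using integrable_norm_square_add[OF V(1) U(1) V(2) U(2), of "-1"] U V unfolding Z_def by auto
  have EZ: "(LINT \<omega>|M. (norm (Z \<omega>))\<^sup>2) \<le> 4 * R"
  proof -
    have "(LINT \<omega>|M. (norm (Z \<omega>))\<^sup>2) \<le> (LINT \<omega>|M. 2 * (norm (V \<omega>))\<^sup>2 + 2 * (norm (U \<omega>))\<^sup>2)"
    proof (rule integral_mono)
      show "(norm (Z \<omega>))\<^sup>2 \<le> 2 * (norm (V \<omega>))\<^sup>2 + 2 * (norm (U \<omega>))\<^sup>2" for \<omega>
        using norm_square_le_double[of "Z \<omega>" "V \<omega>"] by (simp add: Z_def)
    qed (use Z U V in auto)
    also have "\<dots> \<le> 4 * R" using U V R by simp
    finally show ?thesis .
  qed
  have step: "integrable M (\<lambda>\<omega>. (norm (U \<omega> + step_size k *\<^sub>R Z \<omega>))\<^sup>2)" "(\<lambda>\<omega>. U \<omega> + step_size k *\<^sub>R Z \<omega>) \<in> borel_measurable M" for k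
    using U Z by (auto intro!: integrable_norm_square_add)
  define h1 where "h1 = (\<lambda>k. ((LINT \<omega>|M. \<phi> (U \<omega> + step_size k *\<^sub>R Z \<omega>) ?\<mu>) - (LINT \<omega>|M. \<phi> (U \<omega>) ?\<mu>)) / step_size k)"
  define h2 where "h2 = (\<lambda>k. ((LINT p|?N. d\<phi> (U (fst p)) ?\<mu> (U (snd p) + step_size k *\<^sub>R Z (snd p)))
      - (LINT p|?N. d\<phi> (U (fst p)) ?\<mu> (U (snd p)))) / step_size k)"
  have hh: "h k = h1 k + h2 k" for k
  proof -
    have "h k = ((LINT \<omega>|M. potential_cost \<phi> d\<phi> (U \<omega> + step_size k *\<^sub>R Z \<omega>) ?\<mu>)
      - (LINT \<omega>|M. potential_cost \<phi> d\<phi> (U \<omega>) ?\<mu>)) / step_size k" by (simp add: h_def Z_def)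
    then show ?thesis
    by (simp add: h1_def h2_def integral_potential_cost[OF M U step(2,1)] integral_potential_cost[OF M U U] diff_divide_distrib add_divide_distrib)
  qed
  have c1: "norm (Dx y ?\<mu>) \<le> \<kappa> * (1 + sqrt m) + \<kappa> * norm y" for y
    using growth_Dx[OF P2(1), of y] unfolding m by (simp add: algebra_simps)
  note q1 = expectation_difference_quotient[of U M Z "\<lambda>_. \<kappa> * (1 + sqrt m)" "\<lambda>k \<omega> y. \<phi> y ?\<mu>" "\<lambda>k \<omega> y. Dx y ?\<mu>" \<kappa> "\<lambda>\<omega>. Dx (U \<omega>) ?\<mu>",
      OF U(1) Z(1) borel_measurable_const U(2) Z(2) _ deriv_x[OF P2(1)] c1 \<kappa>_nonneg
        tendsto_continuous_map_prod2[OF cont_Dx _ limitin_const_P2[OF P2(1)]]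
        integrable_\<phi>[OF M U P2(1)] integrable_\<phi>[OF M step(2,1) P2(1)], simplified]
  define c :: "'w \<times> 'w \<Rightarrow> real" where "c = (\<lambda>p. \<kappa> * (1 + norm (U (fst p)) + sqrt m))"
  have c2: "norm (Dy x ?\<mu> y) \<le> \<kappa> * (1 + norm x + sqrt m) + \<kappa> * norm y" for x y
    using growth_Dy[OF P2(1), of x y] unfolding m by (simp add: algebra_simps)
  have cm: "c \<in> borel_measurable ?N" unfolding c_def using U(1) by measurable
  have sq3: "(\<kappa> * (1 + a + sqrt m))\<^sup>2 \<le> 3 * \<kappa>\<^sup>2 * (1 + a\<^sup>2 + m)" for a
  proof -
    have "(1 + a + sqrt m)\<^sup>2 \<le> 3 * (1 + a\<^sup>2 + (sqrt m)\<^sup>2)"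
      using sum_squares_bound[of 1 a] sum_squares_bound[of 1 "sqrt m"] sum_squares_bound[of a "sqrt m"]
      by (simp add: power2_sum algebra_simps)
    then have "\<kappa>\<^sup>2 * (1 + a + sqrt m)\<^sup>2 \<le> \<kappa>\<^sup>2 * (3 * (1 + a\<^sup>2 + m))"
      using m0 by (intro mult_left_mono) auto
    moreover have "\<kappa>\<^sup>2 * (3 * (1 + a\<^sup>2 + m)) = 3 * \<kappa>\<^sup>2 * (1 + a\<^sup>2 + m)" by (simp only: mult_ac)
    ultimately show ?thesis by (simp only: power_mult_distrib)
  qed
  have ic: "integrable ?N (\<lambda>p. 3 * \<kappa>\<^sup>2 * (1 + (norm (U (fst p)))\<^sup>2 + m))"
    using M.integrable_pair_fst[OF U(2) M] by simp
  have c_sq: "integrable ?N (\<lambda>p. (c p)\<^sup>2)"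
    by (rule Bochner_Integration.integrable_bound[OF ic])
      (use cm sq3 in \<open>auto simp: c_def intro!: AE_I2 order_trans[OF _ abs_ge_self]\<close>)
  have Ec: "(LINT p|?N. (c p)\<^sup>2) \<le> 3 * \<kappa>\<^sup>2 * (1 + 2 * m)"
  proof -
    have "(LINT p|?N. (c p)\<^sup>2) \<le> (LINT p|?N. 3 * \<kappa>\<^sup>2 * (1 + (norm (U (fst p)))\<^sup>2 + m))"
      using sq3 by (intro integral_mono c_sq ic) (auto simp: c_def)
    also have "\<dots> = 3 * \<kappa>\<^sup>2 * (1 + 2 * m)"
      using M.integrable_pair_fst[OF U(2) M] by (simp add: M.integral_pair_fst[OF U(2) M] m_def MM.prob_space)
    finally show ?thesis .
  qed
  have g: "GDERIV (\<lambda>y. d\<phi> (U (fst p)) ?\<mu> y) y :> Dy (U (fst p)) ?\<mu> y" for p y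
    using deriv_y[OF P2(1)] .
  have c2': "norm (Dy (U (fst p)) ?\<mu> y) \<le> c p + \<kappa> * norm y" for p y unfolding c_def by (rule c2)
  note q2 = expectation_difference_quotient[of "\<lambda>p. U (snd p)" ?N "\<lambda>p. Z (snd p)" c "\<lambda>k p. d\<phi> (U (fst p)) ?\<mu>"
      "\<lambda>k p. Dy (U (fst p)) ?\<mu>" \<kappa> "\<lambda>p. Dy (U (fst p)) ?\<mu> (U (snd p))",
      OF measurable_compose[OF measurable_snd U(1)] measurable_compose[OF measurable_snd Z(1)] cm
        M.integrable_pair_snd[OF U(2) M] M.integrable_pair_snd[OF Z(2) M] c_sq g c2' \<kappa>_nonneg
        tendsto_continuous_map_prod3[OF cont_Dy tendsto_const limitin_const_P2[OF P2(1)]]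
        integrable_d_pair[OF M U U] integrable_d_pair[OF M U step(2,1)]]
  define l where "l = (LINT \<omega>|M. Dx (U \<omega>) ?\<mu> \<bullet> Z \<omega>) + (LINT p|?N. Dy (U (fst p)) ?\<mu> (U (snd p)) \<bullet> Z (snd p))"
  have "h \<longlonglongrightarrow> l"
    unfolding l_def hh[abs_def] using tendsto_add[OF q1(2) q2(2)] by (simp add: h1_def h2_def)
  moreover have "(LINT \<omega>|M. \<phi> (U \<omega>) ?\<mu>) - (LINT \<omega>|M. \<phi> (V \<omega>) (law M V)) \<le> - l"
  proof -
    \<comment> \<open>One copy is frozen: \<open>e\<close> is the pairing with the law derivative
      for the state \<open>U \<omega>'\<close>, as it occurs in the tangent inequality. Its mean is
      the double mean in \<open>l\<close> by Fubini.\<close>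
    define e where "e = (\<lambda>\<omega>'. LINT \<omega>|M. Dy (U \<omega>') ?\<mu> (U \<omega>) \<bullet> Z \<omega>)"
    have pe: "integrable ?N (\<lambda>(\<omega>', \<omega>). Dy (U \<omega>') ?\<mu> (U \<omega>) \<bullet> Z \<omega>)" using q2(1) by (simp add: case_prod_beta')
    have ie: "integrable M e" unfolding e_def using MM.integrable_fst[OF pe] .
    have Ee: "(LINT \<omega>'|M. e \<omega>') = (LINT p|?N. Dy (U (fst p)) ?\<mu> (U (snd p)) \<bullet> Z (snd p))"
      unfolding e_def using MM.integral_fst[OF pe] by (simp add: case_prod_beta')
    have iphi: "integrable M (\<lambda>\<omega>. \<phi> (U \<omega>) ?\<mu>)" "integrable M (\<lambda>\<omega>. \<phi> (V \<omega>) (law M V))"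
      using integrable_\<phi>[OF M U P2(1)] integrable_\<phi>[OF M V P2(2)] by auto
    have "(LINT \<omega>|M. \<phi> (U \<omega>) ?\<mu> - \<phi> (V \<omega>) (law M V)) \<le> (LINT \<omega>|M. - (Dx (U \<omega>) ?\<mu> \<bullet> Z \<omega>) - e \<omega>)"
    proof (rule integral_mono)
      fix \<omega>
      have "(LINT \<omega>'|M. Dy (U \<omega>) ?\<mu> (U \<omega>') \<bullet> (U \<omega>' - V \<omega>')) = - e \<omega>"
        unfolding e_def Z_def by (subst integral_minus[symmetric]) (simp add: inner_diff_right)
      then show "\<phi> (U \<omega>) ?\<mu> - \<phi> (V \<omega>) (law M V) \<le> - (Dx (U \<omega>) ?\<mu> \<bullet> Z \<omega>) - e \<omega>"
        using convexity_functional[OF M U(1) V(1) U(2) V(2), of "U \<omega>" "V \<omega>"]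
        by (simp add: Z_def inner_diff_right)
    qed (use iphi ie q1(1) in auto)
    also have "\<dots> = - l" unfolding l_def using ie q1(1) by (simp add: Ee)
    finally show ?thesis using iphi by simp
  qed
  ultimately show "\<exists>l. h \<longlonglongrightarrow> l \<and> (LINT \<omega>|M. \<phi> (U \<omega>) (law M U)) - (LINT \<omega>|M. \<phi> (V \<omega>) (law M V)) \<le> - l" by blast
  have b1: "\<bar>h1 k\<bar> \<le> 3 * (\<kappa> * (1 + sqrt m))\<^sup>2 + 3 * \<kappa>\<^sup>2 * m + (3 * \<kappa>\<^sup>2 + 1) * (LINT \<omega>|M. (norm (Z \<omega>))\<^sup>2)"
    using q1(3)[of k] by (simp add: h1_def m_def M.prob_space)
  have b2: "\<bar>h2 k\<bar> \<le> 3 * (LINT p|?N. (c p)\<^sup>2) + 3 * \<kappa>\<^sup>2 * m + (3 * \<kappa>\<^sup>2 + 1) * (LINT \<omega>|M. (norm (Z \<omega>))\<^sup>2)"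
    using q2(3)[of k] unfolding h2_def m_def M.integral_pair_snd[OF U(2) M] M.integral_pair_snd[OF Z(2) M] .
  have bd: "(3 * \<kappa>\<^sup>2 + 1) * (LINT \<omega>|M. (norm (Z \<omega>))\<^sup>2) \<le> (3 * \<kappa>\<^sup>2 + 1) * (4 * R)"
    "\<kappa>\<^sup>2 * m \<le> \<kappa>\<^sup>2 * R" "(\<kappa> * (1 + sqrt m))\<^sup>2 \<le> 3 * \<kappa>\<^sup>2 * (1 + m)" "0 \<le> \<kappa>\<^sup>2 * R" "0 \<le> \<kappa>\<^sup>2" "0 \<le> R"
    using m0 sq3[of 0] by (auto intro!: mult_left_mono EZ)
  \<comment> \<open>The bounds add up to at most 18 \<open>\<kappa>\<close>^2 + 57
    \<open>\<kappa>\<close>^2 R + 8 R; the factor 100 is a round number above these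
    coefficients.\<close>
  have "\<bar>h1 k\<bar> + \<bar>h2 k\<bar> \<le> 100 * (\<kappa>\<^sup>2 + 1) * (1 + R)"
  proof -
    have e: "3 * \<kappa>\<^sup>2 * (1 + m) = 3 * \<kappa>\<^sup>2 + 3 * (\<kappa>\<^sup>2 * m)" "3 * \<kappa>\<^sup>2 * (1 + 2 * m) = 3 * \<kappa>\<^sup>2 + 6 * (\<kappa>\<^sup>2 * m)"
      "3 * \<kappa>\<^sup>2 * m = 3 * (\<kappa>\<^sup>2 * m)" "(3 * \<kappa>\<^sup>2 + 1) * (4 * R) = 12 * (\<kappa>\<^sup>2 * R) + 4 * R"
      "100 * (\<kappa>\<^sup>2 + 1) * (1 + R) = 100 * \<kappa>\<^sup>2 + 100 * (\<kappa>\<^sup>2 * R) + 100 + 100 * R"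
      by (simp_all add: algebra_simps)
    show ?thesis
      using b1 b2 Ec bd unfolding e by linarith
  qed
  then show "\<bar>h k\<bar> \<le> 100 * (\<kappa>\<^sup>2 + 1) * (1 + R)" unfolding hh using abs_triangle_ineq[of "h1 k" "h2 k"] by linarith
qed

end

section \<open>Integrals against controls\<close>

definition control_cdf :: "real \<Rightarrow> (real \<Rightarrow> real^'m) \<Rightarrow> 'm \<Rightarrow> real \<Rightarrow> real" where
  "control_cdf T \<eta> j s = (if s < 0 then 0 else \<eta> (min s T) $ j)"

text \<open>The pathwise part of admissibility, detached from \<open>\<omega>\<close> so that
  Stieltjes integration deals with one deterministic path.\<close>

definition control_path :: "real \<Rightarrow> (real \<Rightarrow> real^'m) \<Rightarrow> bool" where
  "control_path T \<eta> \<longleftrightarrow> (\<forall>j. (\<forall>t\<in>{0..T}. 0 \<le> \<eta> t $ j) \<and>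
     mono_on {0..T} (\<lambda>t. \<eta> t $ j) \<and> cadlag T (\<lambda>t. \<eta> t $ j))"

lemma control_measure_eq: "control_measure T \<eta> j = interval_measure (control_cdf T \<eta> j)"
  by (simp add: control_measure_def control_cdf_def[abs_def])

context
  fixes T :: real and \<eta> :: "real \<Rightarrow> real^'m"
  assumes T: "T > 0" and path: "control_path T \<eta>"
begin

lemma control_cdf_mono: "x \<le> y \<Longrightarrow> control_cdf T \<eta> j x \<le> control_cdf T \<eta> j y"
  using path T unfolding control_path_def control_cdf_def mono_on_def
  by (auto simp: min_def)

lemma control_cdf_right_continuous: "continuous (at_right a) (control_cdf T \<eta> j)"
proof -
  consider "a < 0" | "0 \<le> a" "a < T" | "T \<le> a" by linarith
  then have "(control_cdf T \<eta> j \<longlongrightarrow> control_cdf T \<eta> j a) (at_right a)"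
  proof cases
    case 1
    then have "\<forall>\<^sub>F s in at_right a. control_cdf T \<eta> j s = control_cdf T \<eta> j a"
      unfolding eventually_at_right[OF 1] by (intro exI[of _ 0]) (simp add: control_cdf_def)
    then show ?thesis by (rule tendsto_eventually)
  next
    case 2
    have "((\<lambda>t. \<eta> t $ j) \<longlongrightarrow> \<eta> a $ j) (at_right a)"
      using path 2 unfolding control_path_def cadlag_def by auto
    moreover have "\<forall>\<^sub>F s in at_right a. \<eta> s $ j = control_cdf T \<eta> j s"
      unfolding eventually_at_right[OF 2(2)] using 2 by (intro exI[of _ T]) (simp add: control_cdf_def)
    ultimately have "(control_cdf T \<eta> j \<longlongrightarrow> \<eta> a $ j) (at_right a)" by (simp add: tendsto_cong)
    then show ?thesis using 2 by (simp add: control_cdf_def)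
  next
    case 3
    have "\<forall>\<^sub>F s in at_right a. control_cdf T \<eta> j s = control_cdf T \<eta> j a"
      unfolding eventually_at_right[OF less_add_one[of a]] using 3 T
      by (intro exI[of _ "a + 1"]) (simp add: control_cdf_def min_def)
    then show ?thesis by (rule tendsto_eventually)
  qed
  then show ?thesis by (simp add: continuous_within)
qed

lemma control_cdf_at_bot: "(control_cdf T \<eta> j \<longlongrightarrow> 0) at_bot"
  by (rule tendsto_eventually)
    (auto simp: control_cdf_def eventually_at_bot_linorder intro!: exI[of _ "-1"])

lemma finite_borel_measure_control: "finite_borel_measure (control_measure T \<eta> j)"
proof -
  have "emeasure (control_measure T \<eta> j) (\<Union>n::nat. {- real n<..real n}) = (SUP n::nat. emeasure (control_measure T \<eta> j) {- real n<..real n})"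
    by (rule SUP_emeasure_incseq[symmetric]) (auto simp: incseq_def control_measure_eq)
  also have "(\<Union>n::nat. {- real n<..real n}) = UNIV"
  proof -
    have "\<exists>n::nat. - real n < x \<and> x \<le> real n" for x
      using reals_Archimedean2[of "\<bar>x\<bar>"] by (auto simp: abs_less_iff intro!: less_imp_le) (smt (verit))
    then show ?thesis by auto
  qed
  also have "(SUP n::nat. emeasure (control_measure T \<eta> j) {- real n<..real n}) \<le> ennreal (\<eta> T $ j)"
  proof (rule SUP_least)
    fix n :: nat
    have "emeasure (control_measure T \<eta> j) {- real n<..real n} = ennreal (control_cdf T \<eta> j (real n) - control_cdf T \<eta> j (- real n))"
      unfolding control_measure_eq
      by (rule emeasure_interval_measure_Ioc) (auto intro: control_cdf_mono control_cdf_right_continuous)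
    also have "\<dots> \<le> ennreal (\<eta> T $ j)"
    proof (rule ennreal_leI)
      have "control_cdf T \<eta> j (real n) \<le> control_cdf T \<eta> j (max (real n) T)" by (rule control_cdf_mono) simp
      also have "\<dots> = \<eta> T $ j" using T by (simp add: control_cdf_def)
      moreover have "0 \<le> control_cdf T \<eta> j (- real n)"
        using path T by (auto simp: control_cdf_def control_path_def)
      ultimately show "control_cdf T \<eta> j (real n) - control_cdf T \<eta> j (- real n) \<le> \<eta> T $ j" by linarith
    qed
    finally show "emeasure (control_measure T \<eta> j) {- real n<..real n} \<le> ennreal (\<eta> T $ j)" .
  qed
  finally have "emeasure (control_measure T \<eta> j) UNIV < \<infinity>" by (rule order_le_less_trans) simp
  then have "finite_measure (control_measure T \<eta> j)"
    by (intro finite_measureI) (simp add: control_measure_eq less_top)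
  then show ?thesis
    by (simp add: finite_borel_measure_def finite_borel_measure_axioms_def control_measure_eq)
qed

lemma measure_control_Ioc:
  "a \<le> b \<Longrightarrow> measure (control_measure T \<eta> j) {a<..b} = control_cdf T \<eta> j b - control_cdf T \<eta> j a"
  unfolding control_measure_eq
  by (rule measure_interval_measure_Ioc) (auto intro: control_cdf_mono control_cdf_right_continuous)

lemma cdf_control: "cdf (control_measure T \<eta> j) = control_cdf T \<eta> j"
  unfolding control_measure_eq
  by (rule cdf_interval_measure) (auto intro: control_cdf_mono control_cdf_right_continuous control_cdf_at_bot)

lemma measure_control_Icc:
  assumes "0 \<le> t" "t \<le> T"
  shows "measure (control_measure T \<eta> j) {0..t} = \<eta> t $ j"
proof -
  interpret finite_borel_measure "control_measure T \<eta> j" by (rule finite_borel_measure_control)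
  have "measure (control_measure T \<eta> j) {..t} = measure (control_measure T \<eta> j) ({..<0} \<union> {0..t})"
    using assms by (intro arg_cong[where f="measure _"]) auto
  also have "\<dots> = measure (control_measure T \<eta> j) {..<0} + measure (control_measure T \<eta> j) {0..t}"
    by (intro finite_measure_Union) auto
  also have "measure (control_measure T \<eta> j) {..<0} = 0"
  proof -
    \<comment> \<open>The distribution function gives the mass of closed half-lines. The negative
      times are exhausted by closed half-lines ending strictly below 0, each of mass 0, which leaves
      the atom at 0 to \<open>{0..t}\<close>.\<close>
    have "{..<0} \<subseteq> (\<Union>n. {..- inverse (real (Suc n))})"
    proof
      fix x :: real assume "x \<in> {..<0}"
      then obtain n where "inverse (real (Suc n)) < - x" using reals_Archimedean[of "- x"] by auto
      then show "x \<in> (\<Union>n. {..- inverse (real (Suc n))})" by (auto intro!: exI[of _ n])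
    qed
    moreover have "(\<Union>n. {..- inverse (real (Suc n))}) \<in> null_sets (control_measure T \<eta> j)"
    proof (rule null_sets_UN)
      fix n
      have "measure (control_measure T \<eta> j) {..- inverse (real (Suc n))} = control_cdf T \<eta> j (- inverse (real (Suc n)))"
        using cdf_control[of j] by (simp add: cdf_def fun_eq_iff)
      also have "\<dots> = 0" by (simp add: control_cdf_def)
      finally have "emeasure (control_measure T \<eta> j) {..- inverse (real (Suc n))} = 0"
        by (simp only: emeasure_eq_measure) simp
      then show "{..- inverse (real (Suc n))} \<in> null_sets (control_measure T \<eta> j)"
        by (simp add: null_sets_def control_measure_eq)
    qed
    ultimately have "{..<0} \<in> null_sets (control_measure T \<eta> j)"
      by (rule null_sets_subset[rotated 2]) (simp add: control_measure_eq)
    then show ?thesis by (simp add: measure_def null_setsD1)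
  qed
  finally show ?thesis using cdf_control[of j] assms by (simp add: cdf_def fun_eq_iff control_cdf_def)
qed

lemma set_integrable_control:
  fixes f :: "real \<Rightarrow> real"
  assumes "continuous_on {0..T} f" "0 \<le> t" "t \<le> T"
  shows "set_integrable (control_measure T \<eta> j) {0..t} f"
proof -
  interpret finite_borel_measure "control_measure T \<eta> j" by (rule finite_borel_measure_control)
  have c: "continuous_on {0..t} f" using assms by (auto intro: continuous_on_subset)
  then have "bounded (f ` {0..t})" by (intro compact_imp_bounded compact_continuous_image) auto
  then obtain k where "\<forall>x\<in>f ` {0..t}. norm x \<le> k" unfolding bounded_iff by blast
  then have k: "\<And>s. s \<in> {0..t} \<Longrightarrow> norm (f s) \<le> k" by blast
  have "(\<lambda>s. indicator {0..t} s *\<^sub>R f s) \<in> borel_measurable (control_measure T \<eta> j)"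
    unfolding measurable_cong_sets[OF M_is_borel refl]
    by (rule borel_measurable_continuous_on_indicator[OF _ c]) simp
  then show ?thesis
    unfolding set_integrable_def
    by (rule integrable_const_bound[where B="\<bar>k\<bar>", rotated]) (use k in \<open>force simp: indicator_def intro!: AE_I2\<close>)
qed

end

text \<open>Stieltjes sums with right endpoints converge by dominated convergence, as
  \<open>f\<close> is uniformly approximated at rounded times and the measure is finite. The sums
  are linear in the distribution function and use the control at finitely many times, which is how
  linearity in the control and measurability in \<open>\<omega>\<close> are obtained.\<close>

lemma control_set_integral_LIMSEQ:
  fixes f :: "real \<Rightarrow> real"
  assumes T: "T > 0" and path: "control_path T \<eta>" and t: "0 < t" "t \<le> T" and f: "continuous_on {0..t} f"
  shows "(\<lambda>n. \<Sum>i\<le>n + 1. f (real i * t / (real n + 1)) *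
      (control_cdf T \<eta> j (real i * t / (real n + 1)) - control_cdf T \<eta> j ((real i - 1) * t / (real n + 1))))
    \<longlonglongrightarrow> (LINT s:{0..t}|control_measure T \<eta> j. f s)"
proof -
  let ?m = "control_measure T \<eta> j"
  interpret finite_borel_measure ?m by (rule finite_borel_measure_control[OF T path])
  let ?hi = "\<lambda>n i. real i * t / (real n + 1)" and ?lo = "\<lambda>n i. (real i - 1) * t / (real n + 1)"
  define q where "q = (\<lambda>n s. indicator {0..t} s *\<^sub>R f (right_grid t n s))"
  have "bounded (f ` {0..t})" using f by (intro compact_imp_bounded compact_continuous_image) auto
  then obtain k where "\<forall>x\<in>f ` {0..t}. norm x \<le> k" unfolding bounded_iff by blast
  then have k: "\<And>s. s \<in> {0..t} \<Longrightarrow> norm (f s) \<le> k" by blast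
  have q: "q n s = (\<Sum>i\<le>n + 1. f (?hi n i) * indicat_real ({0..t} \<inter> {?lo n i<..?hi n i}) s)" for n s
  proof (cases "s \<in> {0..t}")
    case True
    have "q n s = (\<Sum>i\<le>n + 1. indicat_real {?lo n i<..?hi n i} s *\<^sub>R f (?hi n i))"
      unfolding q_def sum_right_grid[OF t(1) True] using True by simp
    also have "\<dots> = (\<Sum>i\<le>n + 1. f (?hi n i) * indicat_real ({0..t} \<inter> {?lo n i<..?hi n i}) s)"
      using True by (intro sum.cong) (auto simp: indicator_def)
    finally show ?thesis .
  next
    case False
    then show ?thesis unfolding q_def by (subst sum.neutral) auto
  qed
  have sets: "sets ?m = sets borel" by (simp add: control_measure_eq)
  have "measure ?m ({0..t} \<inter> {?lo n i<..?hi n i}) = control_cdf T \<eta> j (?hi n i) - control_cdf T \<eta> j (?lo n i)"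
    if i: "i \<le> n + 1" for n i
  proof -
    have hi: "?hi n i \<le> t" "?lo n i \<le> ?hi n i"
    proof -
      have "real i * t \<le> (real n + 1) * t" using i t by (intro mult_right_mono) auto
      then show "?hi n i \<le> t" by (simp add: divide_le_eq mult.commute)
      show "?lo n i \<le> ?hi n i" using t by (intro divide_right_mono mult_right_mono) auto
    qed
    show ?thesis
    proof (cases i)
      \<comment> \<open>The cell of index 0 meets \<open>{0..t}\<close> only in the point 0. Its
        left end is negative, where the distribution function is 0, so the increment is the initial
        jump.\<close>
      case 0
      have "?lo n i < 0" using 0 t by (simp add: divide_less_0_iff)
      moreover have "{0..t} \<inter> {?lo n i<..?hi n i} = {0..0}" using 0 t calculation by auto
      ultimately show ?thesis
        using measure_control_Icc[OF T path, of 0 j] T 0 by (simp only:) (simp add: control_cdf_def)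
    next
      case (Suc i')
      then have "0 \<le> ?lo n i" using t by simp
      then have "{0..t} \<inter> {?lo n i<..?hi n i} = {?lo n i<..?hi n i}" using hi by auto
      then show ?thesis using measure_control_Ioc[OF T path hi(2), of j] by simp
    qed
  qed
  moreover have "integrable ?m (indicat_real ({0..t} \<inter> {?lo n i<..?hi n i}))" for n i
    by (intro integrable_real_indicator) (auto simp: sets emeasure_eq_measure)
  ultimately have "(LINT s|?m. q n s) = (\<Sum>i\<le>n + 1. f (?hi n i) * (control_cdf T \<eta> j (?hi n i) - control_cdf T \<eta> j (?lo n i)))" for n
    unfolding q by (subst Bochner_Integration.integral_sum) (simp_all add: sets)
  moreover have "(\<lambda>n. LINT s|?m. q n s) \<longlonglongrightarrow> (LINT s|?m. indicator {0..t} s *\<^sub>R f s)"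
  proof (rule integral_dominated_convergence)
    show "integrable ?m (\<lambda>_. \<bar>k\<bar>)" by simp
    show "(\<lambda>s. indicator {0..t} s *\<^sub>R f s) \<in> borel_measurable ?m"
      unfolding measurable_cong_sets[OF M_is_borel refl]
      by (rule borel_measurable_continuous_on_indicator[OF _ f]) simp
    show "q n \<in> borel_measurable ?m" for n
      unfolding measurable_cong_sets[OF M_is_borel refl] q[abs_def] by measurable
    show "AE s in ?m. (\<lambda>n. q n s) \<longlonglongrightarrow> indicator {0..t} s *\<^sub>R f s"
    proof (rule AE_I2)
      fix s
      show "(\<lambda>n. q n s) \<longlonglongrightarrow> indicator {0..t} s *\<^sub>R f s"
      proof (cases "s \<in> {0..t}")
        case True
        have "(\<lambda>n. f (right_grid t n s)) \<longlonglongrightarrow> f s"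
          using f True right_grid_in[OF t(1) True] right_grid_tendsto[OF t(1) True]
          by (auto simp: continuous_on_sequentially comp_def)
        then show ?thesis using True by (simp add: q_def)
      qed (simp add: q_def)
    qed
    show "AE s in ?m. norm (q n s) \<le> \<bar>k\<bar>" for n
      using k right_grid_in[OF t(1), of _ n] by (intro AE_I2) (force simp: q_def indicator_def)
  qed
  ultimately show ?thesis by (simp add: set_lebesgue_integral_def)
qed

text \<open>The case \<open>t = 0\<close>, where the grid on \<open>{0..t}\<close> degenerates and
  only the initial jump is integrated.\<close>

lemma control_set_integral_singleton:
  fixes f :: "real \<Rightarrow> real"
  assumes "T > 0" "control_path T \<eta>"
  shows "(LINT s:{0..0}|control_measure T \<eta> j. f s) = f 0 * \<eta> 0 $ j"
proof -
  interpret finite_borel_measure "control_measure T \<eta> j" by (rule finite_borel_measure_control[OF assms])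
  have "(LINT s:{0..0}|control_measure T \<eta> j. f s) = (LINT s:{0..0}|control_measure T \<eta> j. f 0)"
    by (rule set_lebesgue_integral_cong) (auto simp: control_measure_eq)
  also have "\<dots> = f 0 * measure (control_measure T \<eta> j) {0..0}"
    by (subst set_integral_const) (auto simp: control_measure_eq emeasure_eq_measure[unfolded control_measure_eq])
  also have "measure (control_measure T \<eta> j) {0..0} = \<eta> 0 $ j"
    using measure_control_Icc[OF assms, of 0 j] assms by simp
  finally show ?thesis .
qed

section \<open>Convex combinations, bounds and measurability of control integrals\<close>

lemma control_path_convex:
  assumes "control_path T \<eta>" "control_path T \<eta>'" "0 \<le> e" "e \<le> 1"
  shows "control_path T (\<lambda>s. (1 - e) *\<^sub>R \<eta> s + e *\<^sub>R \<eta>' s)"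
  unfolding control_path_def
proof (intro allI conjI ballI)
  fix j
  show "0 \<le> ((1 - e) *\<^sub>R \<eta> t + e *\<^sub>R \<eta>' t) $ j" if "t \<in> {0..T}" for t
    using assms that by (simp add: control_path_def)
  show "mono_on {0..T} (\<lambda>t. ((1 - e) *\<^sub>R \<eta> t + e *\<^sub>R \<eta>' t) $ j)"
    using assms by (auto simp: control_path_def mono_on_def intro!: add_mono mult_left_mono)
  show "cadlag T (\<lambda>t. ((1 - e) *\<^sub>R \<eta> t + e *\<^sub>R \<eta>' t) $ j)"
    unfolding cadlag_def
  proof (intro conjI ballI)
    show "((\<lambda>t. ((1 - e) *\<^sub>R \<eta> t + e *\<^sub>R \<eta>' t) $ j) \<longlongrightarrow> ((1 - e) *\<^sub>R \<eta> t + e *\<^sub>R \<eta>' t) $ j) (at_right t)"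
      if "t \<in> {0..<T}" for t
    proof -
      have "((\<lambda>t. \<eta> t $ j) \<longlongrightarrow> \<eta> t $ j) (at_right t)" "((\<lambda>t. \<eta>' t $ j) \<longlongrightarrow> \<eta>' t $ j) (at_right t)"
        using assms that unfolding control_path_def cadlag_def by blast+
      then show ?thesis unfolding vector_add_component vector_scaleR_component real_scaleR_def by (intro tendsto_add tendsto_mult tendsto_const)
    qed
    fix t assume "t \<in> {0<..T}"
    then obtain l l' where "((\<lambda>t. \<eta> t $ j) \<longlongrightarrow> l) (at_left t)" "((\<lambda>t. \<eta>' t $ j) \<longlongrightarrow> l') (at_left t)"
      using assms by (auto simp: control_path_def cadlag_def) (metis greaterThanAtMost_iff)
    then have "((\<lambda>t. ((1 - e) *\<^sub>R \<eta> t + e *\<^sub>R \<eta>' t) $ j) \<longlongrightarrow> (1 - e) * l + e * l') (at_left t)"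
      unfolding vector_add_component vector_scaleR_component real_scaleR_def by (intro tendsto_add tendsto_mult tendsto_const)
    then show "\<exists>l. ((\<lambda>t. ((1 - e) *\<^sub>R \<eta> t + e *\<^sub>R \<eta>' t) $ j) \<longlongrightarrow> l) (at_left t)" by blast
  qed
qed

text \<open>The Stieltjes sums of the combined path are the combinations of the sums, and limits are
  unique; the measures themselves need not be combined.\<close>

lemma control_integral_convex:
  fixes f :: "real \<Rightarrow> real^'m"
  assumes T: "T > 0" and path: "control_path T \<eta>" "control_path T \<eta>'" and e: "0 \<le> e" "e \<le> 1"
    and f: "continuous_on {0..T} f" and t: "0 \<le> t" "t \<le> T"
  shows "control_integral T f (\<lambda>s. (1 - e) *\<^sub>R \<eta> s + e *\<^sub>R \<eta>' s) t
    = (1 - e) * control_integral T f \<eta> t + e * control_integral T f \<eta>' t"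
proof -
  let ?\<eta> = "\<lambda>s. (1 - e) *\<^sub>R \<eta> s + e *\<^sub>R \<eta>' s"
  note p = control_path_convex[OF path e]
  have "(LINT s:{0..t}|control_measure T ?\<eta> j. f s $ j)
    = (1 - e) * (LINT s:{0..t}|control_measure T \<eta> j. f s $ j) + e * (LINT s:{0..t}|control_measure T \<eta>' j. f s $ j)" for j
  proof (cases "t = 0")
    case True
    then show ?thesis
      using control_set_integral_singleton[OF T p, where j=j and f="\<lambda>s. f s $ j"]
        control_set_integral_singleton[OF T path(1), where j=j and f="\<lambda>s. f s $ j"]
        control_set_integral_singleton[OF T path(2), where j=j and f="\<lambda>s. f s $ j"]
      by (simp add: algebra_simps)
  next
    case False
    then have t': "0 < t" using t by simp
    have fj: "continuous_on {0..t} (\<lambda>s. f s $ j)"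
      using continuous_on_subset[OF f, of "{0..t}"] t by (auto intro!: continuous_intros)
    let ?S = "\<lambda>\<eta> n. \<Sum>i\<le>n + 1. f (real i * t / (real n + 1)) $ j *
      (control_cdf T \<eta> j (real i * t / (real n + 1)) - control_cdf T \<eta> j ((real i - 1) * t / (real n + 1)))"
    have cdf: "control_cdf T ?\<eta> j s = (1 - e) * control_cdf T \<eta> j s + e * control_cdf T \<eta>' j s" for s
      by (simp add: control_cdf_def)
    have "?S ?\<eta> n = (1 - e) * ?S \<eta> n + e * ?S \<eta>' n" for n
      unfolding cdf sum_distrib_left sum.distrib[symmetric] by (intro sum.cong) (auto simp: algebra_simps)
    then have "(\<lambda>n. ?S ?\<eta> n) \<longlonglongrightarrow> (1 - e) * (LINT s:{0..t}|control_measure T \<eta> j. f s $ j) + e * (LINT s:{0..t}|control_measure T \<eta>' j. f s $ j)"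
      by (simp only:) (intro tendsto_intros control_set_integral_LIMSEQ T path t' t fj)
    then show ?thesis
      by (rule LIMSEQ_unique[OF control_set_integral_LIMSEQ[OF T p t' t(2) fj]])
  qed
  then show ?thesis
    by (simp add: control_integral_def sum.distrib sum_distrib_left)
qed

lemma control_integral_cong:
  assumes "0 < T" "\<And>t. t \<in> {0..T} \<Longrightarrow> \<eta> t = \<eta>' t"
  shows "control_integral T f \<eta> = control_integral T f \<eta>'"
proof -
  have "control_cdf T \<eta> j = control_cdf T \<eta>' j" for j
    using assms by (auto simp: control_cdf_def fun_eq_iff)
  then show ?thesis by (intro ext) (simp only: control_integral_def control_measure_eq)
qed

text \<open>Each component is integrated against a measure whose mass on \<open>{0..t}\<close> is
  the value of the control at \<open>t\<close>, at most its value at \<open>T\<close>; the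
  components are then added, whence the cardinality.\<close>

lemma control_integral_bound:
  fixes f :: "real \<Rightarrow> real^'m"
  assumes T: "T > 0" and path: "control_path T \<eta>" and f: "continuous_on {0..T} f"
    and k: "\<And>s. s \<in> {0..T} \<Longrightarrow> norm (f s) \<le> k" and t: "0 \<le> t" "t \<le> T"
  shows "\<bar>control_integral T f \<eta> t\<bar> \<le> real CARD('m) * k * norm (\<eta> T)"
proof -
  have k0: "0 \<le> k" using order_trans[OF norm_ge_zero k[of 0]] T by simp
  have "\<bar>LINT s:{0..t}|control_measure T \<eta> j. f s $ j\<bar> \<le> k * norm (\<eta> T)" for j
  proof -
    interpret finite_borel_measure "control_measure T \<eta> j" by (rule finite_borel_measure_control[OF T path])
    have i: "integrable (control_measure T \<eta> j) (\<lambda>s. indicat_real {0..t} s *\<^sub>R f s $ j)"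
      using set_integrable_control[OF T path, of "\<lambda>s. f s $ j" t j] f t
      by (auto simp: set_integrable_def intro!: continuous_intros)
    have i2: "integrable (control_measure T \<eta> j) (\<lambda>s. k * indicat_real {0..t} s)"
      by (intro integrable_mult_right integrable_real_indicator) (auto simp: control_measure_eq emeasure_eq_measure[unfolded control_measure_eq])
    have "\<bar>LINT s:{0..t}|control_measure T \<eta> j. f s $ j\<bar> \<le> (LINT s|control_measure T \<eta> j. \<bar>indicat_real {0..t} s *\<^sub>R f s $ j\<bar>)"
      unfolding set_lebesgue_integral_def by (rule integral_abs_bound)
    also have "\<dots> \<le> (LINT s|control_measure T \<eta> j. k * indicat_real {0..t} s)"
    proof (rule integral_mono[OF _ i2])
      fix s show "\<bar>indicat_real {0..t} s *\<^sub>R f s $ j\<bar> \<le> k * indicat_real {0..t} s"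
        using k[of s] component_le_norm_cart[of "f s" j] t by (auto simp: indicator_def)
    qed (use i in simp)
    also have "\<dots> = k * \<eta> t $ j"
      using measure_control_Icc[OF T path t, of j] by (simp add: control_measure_eq)
    also have "\<dots> \<le> k * norm (\<eta> T)"
    proof (rule mult_left_mono[OF _ k0])
      have "\<eta> t $ j \<le> \<eta> T $ j" using path t T by (auto simp: control_path_def mono_on_def)
      also have "\<dots> \<le> norm (\<eta> T)" using component_le_norm_cart[of "\<eta> T" j] by simp
      finally show "\<eta> t $ j \<le> norm (\<eta> T)" .
    qed
    finally show ?thesis .
  qed
  then have "(\<Sum>j\<in>UNIV. \<bar>LINT s:{0..t}|control_measure T \<eta> j. f s $ j\<bar>) \<le> (\<Sum>j\<in>(UNIV::'m set). k * norm (\<eta> T))"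
    by (rule sum_mono)
  then show ?thesis
    unfolding control_integral_def by (intro order_trans[OF sum_abs]) (simp add: mult.assoc)
qed

lemma admissible_path: "\<xi> \<in> admissible M T F \<Longrightarrow> \<omega> \<in> space M \<Longrightarrow> control_path T (\<lambda>t. \<xi> t \<omega>)"
  by (simp add: admissible_def control_path_def)

text \<open>The integrating measure depends on \<open>\<omega>\<close>, so measurability is
  inherited from the Stieltjes sums as a pointwise limit.\<close>

lemma control_integral_measurable:
  fixes f :: "real \<Rightarrow> real^'m" and \<xi> :: "real \<Rightarrow> 'w \<Rightarrow> real^'m"
  assumes T: "T > 0" and \<xi>: "\<And>t. t \<in> {0..T} \<Longrightarrow> \<xi> t \<in> borel_measurable M"
    and path: "\<And>\<omega>. \<omega> \<in> space M \<Longrightarrow> control_path T (\<lambda>t. \<xi> t \<omega>)" and f: "continuous_on {0..T} f"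
  shows "(\<lambda>\<omega>. control_integral T f (\<lambda>s. \<xi> s \<omega>) T) \<in> borel_measurable M"
  unfolding control_integral_def
proof (intro borel_measurable_sum)
  fix j
  have cdf: "(\<lambda>\<omega>. control_cdf T (\<lambda>s. \<xi> s \<omega>) j s) \<in> borel_measurable M" for s
    using borel_measurable_vec_nth[OF \<xi>[of "min s T"], of j] T
    by (cases "s < 0") (auto simp: control_cdf_def)
  show "(\<lambda>\<omega>. LINT s:{0..T}|control_measure T (\<lambda>s. \<xi> s \<omega>) j. f s $ j) \<in> borel_measurable M"
  proof (rule borel_measurable_LIMSEQ_metric)
    show "(\<lambda>n. \<Sum>i\<le>n + 1. f (real i * T / (real n + 1)) $ j *
        (control_cdf T (\<lambda>s. \<xi> s \<omega>) j (real i * T / (real n + 1)) - control_cdf T (\<lambda>s. \<xi> s \<omega>) j ((real i - 1) * T / (real n + 1))))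
      \<longlonglongrightarrow> (LINT s:{0..T}|control_measure T (\<lambda>s. \<xi> s \<omega>) j. f s $ j)" if "\<omega> \<in> space M" for \<omega>
      using f by (intro control_set_integral_LIMSEQ[OF T path[OF that] T order_refl]) (auto intro!: continuous_intros)
  qed (intro borel_measurable_sum borel_measurable_times borel_measurable_diff borel_measurable_const cdf)
qed

lemma admissible_convex:
  fixes \<xi> \<eta> :: "real \<Rightarrow> 'w \<Rightarrow> real^'m"
  assumes U: "usual_filtered_space M T F" and T: "T > 0" and \<xi>: "\<xi> \<in> admissible M T F" and \<eta>: "\<eta> \<in> admissible M T F"
    and e: "0 \<le> e" "e \<le> 1"
  shows "(\<lambda>t \<omega>. (1 - e) *\<^sub>R \<xi> t \<omega> + e *\<^sub>R \<eta> t \<omega>) \<in> admissible M T F"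
proof -
  have ad: "\<xi> t \<in> borel_measurable (F t)" "\<eta> t \<in> borel_measurable (F t)" if "t \<in> {0..T}" for t
    using \<xi> \<eta> that by (auto simp: admissible_def adapted_def)
  have M: "\<xi> T \<in> borel_measurable M" "\<eta> T \<in> borel_measurable M"
    using usual_filtered_space_measurable(2)[OF U ad(1), of T T] usual_filtered_space_measurable(2)[OF U ad(2), of T T] T by auto
  have sq: "integrable M (\<lambda>\<omega>. (norm (\<xi> T \<omega>))\<^sup>2)" "integrable M (\<lambda>\<omega>. (norm (\<eta> T \<omega>))\<^sup>2)"
    using \<xi> \<eta> by (auto simp: admissible_def)
  have "integrable M (\<lambda>\<omega>. (norm (\<xi> T \<omega> + e *\<^sub>R (\<eta> T \<omega> - \<xi> T \<omega>)))\<^sup>2)"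
    using integrable_norm_square_add[OF M(2,1) sq(2,1), of "-1"]
    by (intro integrable_norm_square_add M sq borel_measurable_diff) simp
  moreover have "\<xi> T \<omega> + e *\<^sub>R (\<eta> T \<omega> - \<xi> T \<omega>) = (1 - e) *\<^sub>R \<xi> T \<omega> + e *\<^sub>R \<eta> T \<omega>" for \<omega>
    by (simp add: algebra_simps)
  moreover have "control_path T (\<lambda>t. (1 - e) *\<^sub>R \<xi> t \<omega> + e *\<^sub>R \<eta> t \<omega>)" if "\<omega> \<in> space M" for \<omega>
    using control_path_convex[OF admissible_path[OF \<xi> that] admissible_path[OF \<eta> that] e] .
  moreover have "(\<lambda>\<omega>. (1 - e) *\<^sub>R \<xi> t \<omega> + e *\<^sub>R \<eta> t \<omega>) \<in> borel_measurable (F t)" if "t \<in> {0..T}" for t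
    using ad[OF that] by measurable
  ultimately show ?thesis
    by (simp add: admissible_def adapted_def control_path_def)
qed

section \<open>The controlled state equation\<close>

text \<open>The integral of (f - c)^2 is nonnegative; with \<open>c\<close> the mean of
  \<open>f\<close> over the interval, expanding it gives the claim.\<close>

lemma set_integral_square_le:
  fixes f :: "real \<Rightarrow> real"
  assumes t: "0 \<le> t" and f: "set_integrable lborel {0..t} f" and f2: "set_integrable lborel {0..t} (\<lambda>s. (f s)\<^sup>2)"
  shows "(LINT s:{0..t}|lborel. f s)\<^sup>2 \<le> t * (LINT s:{0..t}|lborel. (f s)\<^sup>2)"
proof (cases "t = 0")
  case False
  then have t': "t > 0" using t by simp
  define I where "I = (LINT s:{0..t}|lborel. f s)"
  define c where "c = I / t"
  have ic: "set_integrable lborel {0..t} (\<lambda>s. c\<^sup>2)"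
    unfolding set_integrable_def using t by (intro integrable_scaleR_left integrable_real_indicator) simp_all
  have i1: "set_integrable lborel {0..t} (\<lambda>s. 2 * c * f s)" using f by simp
  have "0 \<le> (LINT s:{0..t}|lborel. (f s - c)\<^sup>2)"
    unfolding set_lebesgue_integral_def by (rule integral_nonneg_AE) auto
  also have "(LINT s:{0..t}|lborel. (f s - c)\<^sup>2) = (LINT s:{0..t}|lborel. ((f s)\<^sup>2 - 2 * c * f s) + c\<^sup>2)"
    by (intro set_lebesgue_integral_cong) (auto simp: power2_diff)
  also have "\<dots> = ((LINT s:{0..t}|lborel. (f s)\<^sup>2) - (LINT s:{0..t}|lborel. 2 * c * f s)) + (LINT s:{0..t}|lborel. c\<^sup>2)"
    by (simp only: set_integral_add set_integral_diff set_integral_diff(1)[OF f2 i1] f2 i1 ic)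
  also have "(LINT s:{0..t}|lborel. c\<^sup>2) = t * c\<^sup>2"
    using t by (simp add: set_lebesgue_integral_def)
  also have "(LINT s:{0..t}|lborel. 2 * c * f s) = 2 * c * I" by (simp add: I_def)
  finally have "0 \<le> t * ((LINT s:{0..t}|lborel. (f s)\<^sup>2) - 2 * c * I + t * c\<^sup>2)"
    using t' by (simp add: zero_le_mult_iff)
  moreover have "t * c = I" using t' by (simp add: c_def)
  then have "t * (2 * c * I) = 2 * I\<^sup>2" "t * (t * c\<^sup>2) = I\<^sup>2"
    by (simp_all add: power2_eq_square algebra_simps)
  ultimately show ?thesis by (simp add: I_def[symmetric] algebra_simps)
next
  case True
  have "AE s in lborel. indicat_real {0..t} s *\<^sub>R f s = 0"
    using AE_lborel_singleton[of 0] by eventually_elim (simp add: True)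
  then show ?thesis using True by (simp add: set_lebesgue_integral_def integral_eq_zero_AE)
qed

text \<open>The Bochner form: integrability of \<open>u\<close> supplies the finiteness that the
  version for extended values assumes.\<close>

lemma integrated_gronwall_real:
  fixes u a :: "real \<Rightarrow> real"
  assumes u: "set_integrable lborel {0..T} u" and a: "set_integrable lborel {0..T} a"
    and L: "L > 0" and T: "T \<ge> 0"
    and nn: "\<And>t. t \<in> {0..T} \<Longrightarrow> 0 \<le> u t" "\<And>t. t \<in> {0..T} \<Longrightarrow> 0 \<le> a t"
    and le: "\<And>t. t \<in> {0..T} \<Longrightarrow> u t \<le> a t + L * (LINT s:{0..t}|lborel. u s)"
  shows "(LINT s:{0..T}|lborel. u s) \<le> 2 * exp (2 * L * T) * (LINT s:{0..T}|lborel. a s)"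
proof -
  define u' a' where "u' = (\<lambda>s. ennreal (indicator {0..T} s * u s))" and "a' = (\<lambda>s. ennreal (indicator {0..T} s * a s))"
  have m: "(\<lambda>s. indicator {0..T} s * u s) \<in> borel_measurable borel" "(\<lambda>s. indicator {0..T} s * a s) \<in> borel_measurable borel"
    using borel_measurable_integrable[OF u[unfolded set_integrable_def]] borel_measurable_integrable[OF a[unfolded set_integrable_def]] by simp_all
  have m': "u' \<in> borel_measurable borel" "a' \<in> borel_measurable borel" unfolding u'_def a'_def using m by measurable
  have conv: "(\<integral>\<^sup>+s\<in>{0..t}. ennreal (indicator {0..T} s * f s) \<partial>lborel) = ennreal (LINT s:{0..t}|lborel. f s)"
    if f: "set_integrable lborel {0..T} f" "\<And>t. t \<in> {0..T} \<Longrightarrow> 0 \<le> f t" and t: "t \<le> T" for t and f :: "real \<Rightarrow> real"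
  proof -
    have "(\<integral>\<^sup>+s\<in>{0..t}. ennreal (indicator {0..T} s * f s) \<partial>lborel) = (\<integral>\<^sup>+s. ennreal (indicator {0..t} s *\<^sub>R f s) \<partial>lborel)"
      using t by (intro nn_integral_cong) (auto simp: indicator_def)
    also have "\<dots> = ennreal (LINT s|lborel. indicator {0..t} s *\<^sub>R f s)"
      using set_integrable_subset[OF f(1), of "{0..t}"] f(2) t
      by (intro nn_integral_eq_integral) (auto simp: set_integrable_def indicator_def)
    finally show ?thesis by (simp add: set_lebesgue_integral_def)
  qed
  have nnI: "0 \<le> (LINT s:{0..t}|lborel. u s)" "0 \<le> (LINT s:{0..T}|lborel. a s)" if "t \<le> T" for t
    unfolding set_lebesgue_integral_def using nn that by (auto intro!: integral_nonneg_AE AE_I2 simp: indicator_def)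
  have "(\<integral>\<^sup>+s\<in>{0..T}. u' s \<partial>lborel) \<le> ennreal (2 * exp (2 * L * T)) * (\<integral>\<^sup>+s\<in>{0..T}. a' s \<partial>lborel)"
  proof (rule integrated_gronwall[OF m' L T])
    fix t assume t: "t \<in> {0..T}"
    have "ennreal (u t) \<le> ennreal (a t + L * (LINT s:{0..t}|lborel. u s))" using le[OF t] by (rule ennreal_leI)
    also have "\<dots> = ennreal (a t) + ennreal L * ennreal (LINT s:{0..t}|lborel. u s)"
      using nn(2)[OF t] nnI(1)[of t] t L by (simp add: ennreal_mult)
    finally show "u' t \<le> a' t + ennreal L * (\<integral>\<^sup>+s\<in>{0..t}. u' s \<partial>lborel)"
      using t conv[OF u nn(1), of t] by (simp add: u'_def a'_def)
  qed (use conv[OF u nn(1), of T] in \<open>simp add: u'_def\<close>)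
  then have "ennreal (LINT s:{0..T}|lborel. u s) \<le> ennreal (2 * exp (2 * L * T)) * ennreal (LINT s:{0..T}|lborel. a s)"
    using conv[OF u nn(1), of T] conv[OF a nn(2), of T] by (simp add: u'_def a'_def)
  then have "ennreal (LINT s:{0..T}|lborel. u s) \<le> ennreal (2 * exp (2 * L * T) * (LINT s:{0..T}|lborel. a s))"
    using nnI(2)[of T] by (subst ennreal_mult) simp_all
  then show ?thesis using nnI(2)[OF order_refl] by (subst (asm) ennreal_le_iff) simp_all
qed

text \<open>At time 0 every grid point is cut down to 0, so all elementary integrals vanish, and so
  does their mean-square limit.\<close>

lemma ito_integral_zero:
  fixes W :: "real \<Rightarrow> 'w \<Rightarrow> real^'d" and H :: "real \<Rightarrow> 'w \<Rightarrow> real^'d^'n"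
  assumes U: "usual_filtered_space M T F" and T: "0 \<le> T" and ito: "ito_integral M T F W H I"
  shows "AE \<omega> in M. I 0 \<omega> = 0"
proof -
  from ito obtain N \<tau> A where data': "\<forall>j. elementary_data M T F (N j) (\<tau> j) (A j)"
    and lim': "\<forall>t\<in>{0..T}. (\<lambda>j::nat. \<integral>\<^sup>+\<omega>. ennreal ((norm (elementary_integral W (N j) (\<tau> j) (A j) t \<omega> - I t \<omega>))\<^sup>2) \<partial>M) \<longlonglongrightarrow> 0"
    unfolding ito_integral_def by blast
  note data = data'[rule_format]
  have lim: "(\<lambda>j::nat. \<integral>\<^sup>+\<omega>. ennreal ((norm (elementary_integral W (N j) (\<tau> j) (A j) 0 \<omega> - I 0 \<omega>))\<^sup>2) \<partial>M) \<longlonglongrightarrow> 0"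
    using lim' T by auto
  have I: "I 0 \<in> borel_measurable M"
    using ito T usual_filtered_space_measurable(2)[OF U, of "I 0" 0 0] by (auto simp: ito_integral_def adapted_def)
  have "elementary_integral W (N j) (\<tau> j) (A j) 0 \<omega> = 0" for j \<omega>
  proof -
    have "min (\<tau> j k) 0 = 0" if "k \<le> N j" for k using data[of j] that by (auto simp: elementary_data_def min_def)
    then show ?thesis by (auto simp: elementary_integral_def intro!: sum.neutral)
  qed
  with lim have "(\<integral>\<^sup>+\<omega>. ennreal ((norm (I 0 \<omega>))\<^sup>2) \<partial>M) = 0"
    by (simp add: LIMSEQ_const_iff)
  then show ?thesis using I by (subst (asm) nn_integral_0_iff_AE) (auto simp: ennreal_eq_0_iff)
qed

lemma ito_integral_bound:
  fixes W :: "real \<Rightarrow> 'w \<Rightarrow> real^'d" and H :: "real \<Rightarrow> 'w \<Rightarrow> real^'d^'n"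
  assumes U: "usual_filtered_space M T F" and B: "brownian_motion M T F W"
    and ito: "ito_integral M T F W H I" and st: "0 \<le> s" "s \<le> t" "t \<le> T"
  shows "(\<integral>\<^sup>+\<omega>. ennreal ((norm (I t \<omega> - I s \<omega>))\<^sup>2) \<partial>M)
    \<le> 4 * (\<integral>\<^sup>+\<omega>. (\<integral>\<^sup>+r\<in>{s..t}. ennreal ((norm (H r \<omega>))\<^sup>2) \<partial>lborel) \<partial>M)"
  using ito_integral_lincomb_bound[OF U B, of "{()}" "\<lambda>_. H" "\<lambda>_. I" s t "\<lambda>_. 1"] ito st by simp

lemma ito_integral_second_moment:
  fixes W :: "real \<Rightarrow> 'w \<Rightarrow> real^'d" and H :: "real \<Rightarrow> 'w \<Rightarrow> real^'d^'n"
  assumes U: "usual_filtered_space M T F" and B: "brownian_motion M T F W"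
    and ito: "ito_integral M T F W H I" and T: "0 \<le> T"
  obtains r where "0 \<le> r" "\<And>t. t \<in> {0..T} \<Longrightarrow> (\<integral>\<^sup>+\<omega>. ennreal ((norm (I t \<omega>))\<^sup>2) \<partial>M) \<le> ennreal r"
proof -
  let ?E = "(\<integral>\<^sup>+\<omega>. (\<integral>\<^sup>+r\<in>{0..T}. ennreal ((norm (H r \<omega>))\<^sup>2) \<partial>lborel) \<partial>M)"
  have "?E < \<infinity>" using ito by (simp add: ito_integral_def)
  then obtain e where e: "?E = ennreal e" "0 \<le> e" by (cases ?E) auto
  show ?thesis
  proof (rule that[of "4 * e"])
    fix t assume t: "t \<in> {0..T}"
    have "(\<integral>\<^sup>+\<omega>. ennreal ((norm (I t \<omega>))\<^sup>2) \<partial>M) = (\<integral>\<^sup>+\<omega>. ennreal ((norm (I t \<omega> - I 0 \<omega>))\<^sup>2) \<partial>M)"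
      using ito_integral_zero[OF U T ito] by (intro nn_integral_cong_AE) (auto elim!: eventually_mono)
    also have "\<dots> \<le> 4 * (\<integral>\<^sup>+\<omega>. (\<integral>\<^sup>+r\<in>{0..t}. ennreal ((norm (H r \<omega>))\<^sup>2) \<partial>lborel) \<partial>M)"
      using t by (intro ito_integral_bound[OF U B ito]) auto
    also have "\<dots> \<le> 4 * ?E"
      using t by (intro mult_left_mono nn_integral_mono) (auto simp: indicator_def)
    also have "\<dots> = ennreal (4 * e)" using e by (simp add: ennreal_mult)
    finally show "(\<integral>\<^sup>+\<omega>. ennreal ((norm (I t \<omega>))\<^sup>2) \<partial>M) \<le> ennreal (4 * e)" .
  qed (use e in simp)
qed

text \<open>Joint measurability is drawn from right-continuity of every path, while Ito integrals
  are continuous only almost surely. Setting the process to 0 on one null set repairs this without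
  touching adaptedness arguments, since measurability with respect to \<open>M\<close> is all that
  is claimed.\<close>

lemma continuous_modification:
  fixes I :: "real \<Rightarrow> 'w \<Rightarrow> real^'n"
  assumes T: "T > 0" and I: "\<And>t. t \<in> {0..T} \<Longrightarrow> I t \<in> borel_measurable M"
    and cont: "AE \<omega> in M. continuous_on {0..T} (\<lambda>t. I t \<omega>)"
  obtains I' where "\<And>t. t \<in> {0..T} \<Longrightarrow> I' t \<in> borel_measurable M"
    "\<And>\<omega>. \<omega> \<in> space M \<Longrightarrow> continuous_on {0..T} (\<lambda>t. I' t \<omega>)"
    "AE \<omega> in M. \<forall>t. I' t \<omega> = I t \<omega>"
    "(\<lambda>(\<omega>, t). indicat_real {0..T} t *\<^sub>R I' t \<omega>) \<in> borel_measurable (M \<Otimes>\<^sub>M borel)"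
proof -
  obtain N where N: "{\<omega> \<in> space M. \<not> continuous_on {0..T} (\<lambda>t. I t \<omega>)} \<subseteq> N" "N \<in> null_sets M"
    using cont by (auto simp: eventually_ae_filter)
  define I' where "I' = (\<lambda>t \<omega>. indicat_real (space M - N) \<omega> *\<^sub>R I t \<omega>)"
  have m: "I' t \<in> borel_measurable M" if "t \<in> {0..T}" for t
    using I[OF that] N(2) unfolding I'_def by (intro borel_measurable_scaleR borel_measurable_indicator) auto
  have c: "continuous_on {0..T} (\<lambda>t. I' t \<omega>)" if "\<omega> \<in> space M" for \<omega>
    using N(1) that by (cases "\<omega> \<in> N") (auto simp: I'_def)
  show ?thesis
  proof (rule that[OF m c])
    show "AE \<omega> in M. \<forall>t. I' t \<omega> = I t \<omega>"
      using AE_not_in[OF N(2)] AE_space by eventually_elim (auto simp: I'_def)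
    show "(\<lambda>(\<omega>, t). indicat_real {0..T} t *\<^sub>R I' t \<omega>) \<in> borel_measurable (M \<Otimes>\<^sub>M borel)"
    proof (rule right_continuous_process_measurable[OF T m])
      fix t \<omega> assume "\<omega> \<in> space M" "0 \<le> t" "t < T"
      then have "((\<lambda>s. I' s \<omega>) \<longlongrightarrow> I' t \<omega>) (at t within {0..T})"
        using c by (auto simp: continuous_on_def)
      then have "((\<lambda>s. I' s \<omega>) \<longlongrightarrow> I' t \<omega>) (at t within {t..T})"
        by (rule tendsto_within_subset) (use \<open>0 \<le> t\<close> in auto)
      then show "((\<lambda>s. I' s \<omega>) \<longlongrightarrow> I' t \<omega>) (at_right t)"
        using \<open>t < T\<close> by (simp add: at_within_Icc_at_right)
    qed
  qed
qed

lemma set_integrable_bounded_interval: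
  fixes f :: "real \<Rightarrow> 'a::{banach, second_countable_topology}"
  assumes "(\<lambda>s. indicat_real {a..b} s *\<^sub>R f s) \<in> borel_measurable borel" "\<And>s. s \<in> {a..b} \<Longrightarrow> norm (f s) \<le> k"
  shows "set_integrable lborel {a..b} f"
  unfolding set_integrable_def
proof (rule Bochner_Integration.integrable_bound)
  show "integrable lborel (\<lambda>s. indicat_real {a..b} s * k)"
    by (intro integrable_mult_left integrable_real_indicator) (cases "a \<le> b"; simp)+
  show "AE s in lborel. norm (indicat_real {a..b} s *\<^sub>R f s) \<le> norm (indicat_real {a..b} s * k)"
    using assms(2) by (intro AE_I2) (force simp: indicator_def)
qed (use assms in simp)

lemma set_integral_Icc_mono:
  fixes f :: "real \<Rightarrow> real"
  assumes "set_integrable lborel {0..T} f" "\<And>s. s \<in> {0..T} \<Longrightarrow> 0 \<le> f s" "t \<le> T"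
  shows "(LINT s:{0..t}|lborel. f s) \<le> (LINT s:{0..T}|lborel. f s)"
proof -
  have "set_integrable lborel {0..t} f" by (rule set_integrable_subset[OF assms(1)]) (use assms(3) in auto)
  then show ?thesis
    using assms unfolding set_lebesgue_integral_def set_integrable_def
    by (intro integral_mono) (auto simp: indicator_def)
qed

locale controlled_sde =
  fixes T L :: real and M :: "'w measure" and F :: "real \<Rightarrow> 'w measure" and W :: "real \<Rightarrow> 'w \<Rightarrow> real^'d"
    and b :: "real \<Rightarrow> real^'n \<Rightarrow> real^'n" and \<sigma> :: "real \<Rightarrow> real^'n \<Rightarrow> real^'d^'n"
    and \<zeta> :: "real \<Rightarrow> real^'m^'n" and x0 :: "real^'n"
  assumes T: "T > 0" and L: "L > 0" and space: "usual_filtered_space M T F"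
    and BM: "brownian_motion M T F W"
    and b_meas: "(\<lambda>(t, x). b t x) \<in> borel_measurable (restrict_space borel {0..T} \<Otimes>\<^sub>M borel)"
    and lip_b: "\<And>t x y. t \<in> {0..T} \<Longrightarrow> norm (b t x - b t y) \<le> L * norm (x - y)"
    and lip_\<sigma>: "\<And>t x y. t \<in> {0..T} \<Longrightarrow> norm (\<sigma> t x - \<sigma> t y) \<le> L * norm (x - y)"
    and cont_\<zeta>: "continuous_on {0..T} \<zeta>"
begin

sublocale prob_space M using space by (simp add: usual_filtered_space_def)

abbreviation solves where "solves \<xi> X \<equiv> sde_solution M T F W b \<sigma> \<zeta> x0 \<xi> X"

abbreviation push where "push \<xi> t \<omega> \<equiv> (\<chi> i. control_integral T (\<lambda>s. \<zeta> s $ i) (\<lambda>s. \<xi> s \<omega>) t)"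

lemma adapted_measurable:
  assumes "adapted T F Y" "t \<in> {0..T}"
  shows "Y t \<in> borel_measurable M"
  using usual_filtered_space_measurable(2)[OF space, of "Y t" t t] assms by (auto simp: adapted_def)

lemma admissible_T:
  assumes "\<xi> \<in> admissible M T F"
  shows "\<xi> T \<in> borel_measurable M" "integrable M (\<lambda>\<omega>. (norm (\<xi> T \<omega>))\<^sup>2)"
  using assms adapted_measurable[of \<xi> T] T by (auto simp: admissible_def)

text \<open>Controls are nondecreasing, so their terminal value bounds the push at every time;
  square integrability of \<open>\<xi> T\<close> alone then governs the whole path. The constant
  combines the l1 bound for the norm of a vector with a bound \<open>z\<close> for
  \<open>\<zeta>\<close>.\<close>

lemma push_bound:
  obtains k where "0 \<le> k"
    "\<And>(\<xi> :: real \<Rightarrow> 'w \<Rightarrow> real^'m) t \<omega>. \<xi> \<in> admissible M T F \<Longrightarrow> \<omega> \<in> space M \<Longrightarrow> t \<in> {0..T} \<Longrightarrow> norm (push \<xi> t \<omega>) \<le> k * norm (\<xi> T \<omega>)"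
proof -
  have "bounded (\<zeta> ` {0..T})" using cont_\<zeta> by (intro compact_imp_bounded compact_continuous_image) auto
  then obtain z where "\<forall>x\<in>\<zeta> ` {0..T}. norm x \<le> z" unfolding bounded_iff by blast
  then have z: "norm (\<zeta> s $ i) \<le> \<bar>z\<bar>" if "s \<in> {0..T}" for s i
    using Finite_Cartesian_Product.norm_nth_le[of "\<zeta> s" i] that by force
  show ?thesis
  proof (rule that[of "real CARD('n) * (real CARD('m) * \<bar>z\<bar>)"])
    fix \<xi> :: "real \<Rightarrow> 'w \<Rightarrow> real^'m" and t \<omega> assume a: "\<xi> \<in> admissible M T F" "\<omega> \<in> space M" "t \<in> {0..T}"
    have "norm (push \<xi> t \<omega>) \<le> (\<Sum>i\<in>UNIV. \<bar>push \<xi> t \<omega> $ i\<bar>)" by (rule norm_le_l1_cart)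
    also have "\<dots> \<le> (\<Sum>i\<in>(UNIV::'n set). real CARD('m) * \<bar>z\<bar> * norm (\<xi> T \<omega>))"
      using a(3) cont_\<zeta> z
      by (intro sum_mono, simp only: vec_lambda_beta)
        (intro control_integral_bound[OF T admissible_path[OF a(1,2)]] continuous_intros, auto)
    finally show "norm (push \<xi> t \<omega>) \<le> real CARD('n) * (real CARD('m) * \<bar>z\<bar>) * norm (\<xi> T \<omega>)"
      by (simp add: mult.assoc)
  qed simp
qed

lemma path_measurable:
  assumes "solves \<xi> X"
  shows "(\<lambda>(\<omega>, t). indicat_real {0..T} t *\<^sub>R X t \<omega>) \<in> borel_measurable (M \<Otimes>\<^sub>M borel)"
proof (rule right_continuous_process_measurable[OF T])
  show "X t \<in> borel_measurable M" if "t \<in> {0..T}" for t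
    using assms that by (auto simp: sde_solution_def intro: adapted_measurable)
  show "((\<lambda>s. X s \<omega>) \<longlongrightarrow> X t \<omega>) (at_right t)" if "\<omega> \<in> space M" "0 \<le> t" "t < T" for t \<omega>
    using assms that by (auto simp: sde_solution_def cadlag_def)
qed

lemma measurable_section:
  assumes "(\<lambda>(\<omega>, t). f \<omega> t) \<in> borel_measurable (M \<Otimes>\<^sub>M (borel :: real measure))" "\<omega> \<in> space M"
  shows "(\<lambda>t. f \<omega> t) \<in> borel_measurable borel"
  using measurable_compose[OF measurable_Pair1'[OF assms(2)] assms(1)] by simp

text \<open>Gronwall applies path by path, so no maximal inequality for the stochastic integral is needed.\<close>

lemma state_minus_ito_dominated:
  assumes \<xi>: "\<xi> \<in> admissible M T F" and sol: "solves \<xi> X"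
  obtains I Y where "ito_integral M T F W (\<lambda>s \<omega>. \<sigma> s (X s \<omega>)) I"
    "Y \<in> borel_measurable M" "integrable M (\<lambda>\<omega>. (Y \<omega>)\<^sup>2)"
    "AE \<omega> in M. \<forall>t\<in>{0..T}. norm (X t \<omega> - I t \<omega>) \<le> Y \<omega>"
    "AE \<omega> in M. \<forall>t\<in>{0..T}. X t \<omega> = x0 + (LINT s:{0..t}|lborel. b s (X s \<omega>)) + I t \<omega> + push \<xi> t \<omega>"
    "AE \<omega> in M. set_integrable lborel {0..T} (\<lambda>s. b s (X s \<omega>))"
proof -
  from sol obtain I where ito: "ito_integral M T F W (\<lambda>s \<omega>. \<sigma> s (X s \<omega>)) I"
    and eq: "AE \<omega> in M. \<forall>t\<in>{0..T}. X t \<omega> = x0 + (LINT s:{0..t}|lborel. b s (X s \<omega>)) + I t \<omega> + push \<xi> t \<omega>"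
    and bint: "AE \<omega> in M. set_integrable lborel {0..T} (\<lambda>s. b s (X s \<omega>))"
    unfolding sde_solution_def by blast
  have Im: "I t \<in> borel_measurable M" if "t \<in> {0..T}" for t
    using ito that by (auto simp: ito_integral_def intro: adapted_measurable)
  have Ic: "AE \<omega> in M. continuous_on {0..T} (\<lambda>t. I t \<omega>)" using ito unfolding ito_integral_def by blast
  obtain I' where I': "\<And>t. t \<in> {0..T} \<Longrightarrow> I' t \<in> borel_measurable M"
    "\<And>\<omega>. \<omega> \<in> space M \<Longrightarrow> continuous_on {0..T} (\<lambda>t. I' t \<omega>)"
    "AE \<omega> in M. \<forall>t. I' t \<omega> = I t \<omega>"
    and I'm: "(\<lambda>(\<omega>, t). indicat_real {0..T} t *\<^sub>R I' t \<omega>) \<in> borel_measurable (M \<Otimes>\<^sub>M borel)"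
    using continuous_modification[of T I M, OF T Im Ic] by blast
  obtain r where r: "0 \<le> r" "\<And>t. t \<in> {0..T} \<Longrightarrow> (\<integral>\<^sup>+\<omega>. ennreal ((norm (I t \<omega>))\<^sup>2) \<partial>M) \<le> ennreal r"
    using ito_integral_second_moment[OF space BM ito less_imp_le[OF T]] by blast
  obtain k where k: "0 \<le> k"
    "\<And>(\<xi> :: real \<Rightarrow> 'w \<Rightarrow> real^'m) t \<omega>. \<xi> \<in> admissible M T F \<Longrightarrow> \<omega> \<in> space M \<Longrightarrow> t \<in> {0..T} \<Longrightarrow> norm (push \<xi> t \<omega>) \<le> k * norm (\<xi> T \<omega>)"
    using push_bound by blast
  define good where "good = (\<lambda>\<omega>. \<omega> \<in> space M \<and> set_integrable lborel {0..T} (\<lambda>s. b s (X s \<omega>)) \<and>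
    (\<forall>t\<in>{0..T}. X t \<omega> = x0 + (LINT s:{0..t}|lborel. b s (X s \<omega>)) + I' t \<omega> + push \<xi> t \<omega>))"
  have good: "AE \<omega> in M. good \<omega>"
    using eq bint I'(3) AE_space by eventually_elim (auto simp: good_def)
  have xm: "(\<lambda>s. indicat_real {0..T} s *\<^sub>R X s \<omega>) \<in> borel_measurable borel" if "\<omega> \<in> space M" for \<omega>
    using measurable_section[OF path_measurable[OF sol] that] .
  \<comment> \<open>A crude bound on each good path, with no moments attached. It makes the time
    integral of the norm of the state finite, which Gronwall presupposes.\<close>
  have bound: "\<exists>K. \<forall>t\<in>{0..T}. norm (X t \<omega>) \<le> K" if g: "good \<omega>" for \<omega>
  proof -
    have om: "\<omega> \<in> space M" and bi: "set_integrable lborel {0..T} (\<lambda>s. b s (X s \<omega>))" using g by (auto simp: good_def)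
    have "bounded ((\<lambda>t. I' t \<omega>) ` {0..T})" using I'(2)[OF om] by (intro compact_imp_bounded compact_continuous_image) auto
    then obtain i where i: "\<forall>x\<in>(\<lambda>t. I' t \<omega>) ` {0..T}. norm x \<le> i" unfolding bounded_iff by blast
    have "norm (X t \<omega>) \<le> norm x0 + (LINT s:{0..T}|lborel. norm (b s (X s \<omega>))) + i + k * norm (\<xi> T \<omega>)" if t: "t \<in> {0..T}" for t
    proof -
      have "norm (LINT s:{0..t}|lborel. b s (X s \<omega>)) \<le> (LINT s:{0..t}|lborel. norm (b s (X s \<omega>)))"
        unfolding set_lebesgue_integral_def by (rule order_trans[OF integral_norm_bound]) simp
      also have "\<dots> \<le> (LINT s:{0..T}|lborel. norm (b s (X s \<omega>)))"
        using t by (intro set_integral_Icc_mono set_integrable_norm[OF bi]) auto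
      finally have "norm (LINT s:{0..t}|lborel. b s (X s \<omega>)) \<le> (LINT s:{0..T}|lborel. norm (b s (X s \<omega>)))" .
      moreover have "norm (I' t \<omega>) \<le> i" using i t by auto
      moreover have "X t \<omega> = x0 + (LINT s:{0..t}|lborel. b s (X s \<omega>)) + I' t \<omega> + push \<xi> t \<omega>"
        using g t by (auto simp: good_def)
      moreover note k(2)[OF \<xi> om t]
        norm_triangle_ineq[of "x0 + (LINT s:{0..t}|lborel. b s (X s \<omega>)) + I' t \<omega>" "push \<xi> t \<omega>"]
        norm_triangle_ineq[of "x0 + (LINT s:{0..t}|lborel. b s (X s \<omega>))" "I' t \<omega>"]
        norm_triangle_ineq[of x0 "LINT s:{0..t}|lborel. b s (X s \<omega>)"]
      ultimately show ?thesis by (simp only:)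
    qed
    then show ?thesis by blast
  qed
  have b0m: "(\<lambda>s. indicat_real {0..T} s *\<^sub>R b s 0) \<in> borel_measurable borel"
  proof -
    have "(\<lambda>s. (s, 0)) \<in> measurable (restrict_space borel {0..T}) (restrict_space borel {0..T} \<Otimes>\<^sub>M (borel :: (real^'n) measure))"
      by measurable
    from measurable_compose[OF this b_meas] have "(\<lambda>s. b s 0) \<in> borel_measurable (restrict_space borel {0..T})" by simp
    then show ?thesis by (subst (asm) borel_measurable_restrict_space_iff) auto
  qed
  \<comment> \<open>Integrability of \<open>b s 0\<close> in time is extracted from the equation:
    along a single good path \<open>b s (X s \<omega>)\<close> is integrable, the state is bounded
    by some \<open>K\<close>, and the Lipschitz bound moves the argument to 0.\<close>
  have b0: "set_integrable lborel {0..T} (\<lambda>s. b s 0)"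
  proof -
    have "ae_filter M \<noteq> bot" by (simp add: ae_filter_eq_bot_iff emeasure_space_1)
    then obtain \<omega> where g: "good \<omega>" using eventually_happens'[OF _ good] by blast
    then obtain K where K: "\<And>t. t \<in> {0..T} \<Longrightarrow> norm (X t \<omega>) \<le> K" using bound by blast
    have i: "integrable lborel (\<lambda>s. norm (indicat_real {0..T} s *\<^sub>R b s (X s \<omega>)) + indicat_real {0..T} s * (L * K))"
      using g by (intro Bochner_Integration.integrable_add integrable_norm integrable_mult_left integrable_real_indicator)
        (use T in \<open>auto simp: good_def set_integrable_def\<close>)
    show ?thesis
      unfolding set_integrable_def
    proof (rule Bochner_Integration.integrable_bound[OF i])
      show "AE s in lborel. norm (indicat_real {0..T} s *\<^sub>R b s 0) \<le> norm (norm (indicat_real {0..T} s *\<^sub>R b s (X s \<omega>)) + indicat_real {0..T} s * (L * K))"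
      proof (rule AE_I2)
        fix s
        show "norm (indicat_real {0..T} s *\<^sub>R b s 0) \<le> norm (norm (indicat_real {0..T} s *\<^sub>R b s (X s \<omega>)) + indicat_real {0..T} s * (L * K))"
        proof (cases "s \<in> {0..T}")
          case True
          have "norm (b s 0) \<le> norm (b s (X s \<omega>)) + norm (b s 0 - b s (X s \<omega>))"
            using norm_triangle_ineq[of "b s (X s \<omega>)" "b s 0 - b s (X s \<omega>)"] by simp
          also have "norm (b s 0 - b s (X s \<omega>)) \<le> L * norm (0 - X s \<omega>)" by (rule lip_b[OF True])
          also have "\<dots> \<le> L * K" using K[OF True] L by simp
          finally show ?thesis using True by simp
        qed simp
      qed
    qed (use b0m in simp)
  qed
  define B0 where "B0 = (LINT s:{0..T}|lborel. norm (b s 0))"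
  define J where "J = (\<lambda>\<omega>. LINT s:{0..T}|lborel. norm (I' s \<omega>))"
  define q where "q = (\<lambda>\<omega>. norm x0 + B0 + k * norm (\<xi> T \<omega>))"
  define c where "c = 2 * exp (2 * L * T)"
  \<comment> \<open>Subtracting the stochastic integral leaves at most \<open>q\<close> plus
    \<open>L\<close> times the time integral of |X|. Gronwall with inhomogeneity q + |I'| bounds
    that integral by \<open>c\<close> times (T q + J), which gives \<open>Y\<close>.\<close>
  define Y where "Y = (\<lambda>\<omega>. q \<omega> + L * (c * (T * q \<omega> + J \<omega>)))"
  have B0: "0 \<le> B0" unfolding B0_def set_lebesgue_integral_def by (rule integral_nonneg_AE) auto
  have nI: "set_integrable lborel {0..T} (\<lambda>s. norm (I' s \<omega>))" "set_integrable lborel {0..T} (\<lambda>s. (norm (I' s \<omega>))\<^sup>2)"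
    if "\<omega> \<in> space M" for \<omega>
    using I'(2)[OF that] by (auto intro!: borel_integrable_atLeastAtMost' continuous_intros)
  have dom: "norm (X t \<omega> - I' t \<omega>) \<le> Y \<omega>" if g: "good \<omega>" and t: "t \<in> {0..T}" for t \<omega>
  proof -
    have om: "\<omega> \<in> space M" and bi: "set_integrable lborel {0..T} (\<lambda>s. b s (X s \<omega>))" using g by (auto simp: good_def)
    obtain K where K: "\<And>t. t \<in> {0..T} \<Longrightarrow> norm (X t \<omega>) \<le> K" using bound[OF g] by blast
    have ix: "set_integrable lborel {0..T} (\<lambda>s. norm (X s \<omega>))"
    proof (rule set_integrable_bounded_interval)
      have "(\<lambda>s. norm (indicat_real {0..T} s *\<^sub>R X s \<omega>)) \<in> borel_measurable borel" using xm[OF om] by measurable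
      then show "(\<lambda>s. indicat_real {0..T} s *\<^sub>R norm (X s \<omega>)) \<in> borel_measurable borel" by simp
    qed (use K in auto)
    have step: "norm (X t \<omega> - I' t \<omega>) \<le> q \<omega> + L * (LINT s:{0..t}|lborel. norm (X s \<omega>))" if t: "t \<in> {0..T}" for t
    proof -
      have bit: "set_integrable lborel {0..t} (\<lambda>s. b s (X s \<omega>))" "set_integrable lborel {0..t} (\<lambda>s. norm (b s 0))"
        "set_integrable lborel {0..t} (\<lambda>s. norm (X s \<omega>))"
        using t by (auto intro: set_integrable_subset[OF bi] set_integrable_subset[OF set_integrable_norm[OF b0]] set_integrable_subset[OF ix])
      have "norm (LINT s:{0..t}|lborel. b s (X s \<omega>)) \<le> (LINT s:{0..t}|lborel. norm (b s (X s \<omega>)))"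
        unfolding set_lebesgue_integral_def by (rule order_trans[OF integral_norm_bound]) simp
      also have "\<dots> \<le> (LINT s:{0..t}|lborel. norm (b s 0) + L * norm (X s \<omega>))"
      proof (rule set_integral_mono)
        fix s assume "s \<in> {0..t}"
        then have s: "s \<in> {0..T}" using t by auto
        have "norm (b s (X s \<omega>)) \<le> norm (b s 0) + norm (b s (X s \<omega>) - b s 0)"
          using norm_triangle_ineq[of "b s 0" "b s (X s \<omega>) - b s 0"] by simp
        also have "norm (b s (X s \<omega>) - b s 0) \<le> L * norm (X s \<omega> - 0)" by (rule lip_b[OF s])
        finally show "norm (b s (X s \<omega>)) \<le> norm (b s 0) + L * norm (X s \<omega>)" by simp
      qed (use set_integrable_norm[OF bit(1)] bit in auto)
      also have "\<dots> = (LINT s:{0..t}|lborel. norm (b s 0)) + L * (LINT s:{0..t}|lborel. norm (X s \<omega>))"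
        using bit by simp
      also have "(LINT s:{0..t}|lborel. norm (b s 0)) \<le> B0"
        unfolding B0_def using t by (intro set_integral_Icc_mono set_integrable_norm[OF b0]) auto
      finally have 1: "norm (LINT s:{0..t}|lborel. b s (X s \<omega>)) \<le> B0 + L * (LINT s:{0..t}|lborel. norm (X s \<omega>))" by simp
      have "X t \<omega> - I' t \<omega> = x0 + (LINT s:{0..t}|lborel. b s (X s \<omega>)) + push \<xi> t \<omega>"
        using g t by (auto simp: good_def)
      then show ?thesis
        using 1 k(2)[OF \<xi> om t] norm_triangle_ineq[of "x0 + (LINT s:{0..t}|lborel. b s (X s \<omega>))" "push \<xi> t \<omega>"]
          norm_triangle_ineq[of x0 "LINT s:{0..t}|lborel. b s (X s \<omega>)"]
        unfolding q_def by (simp only:)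
    qed
    have q0: "0 \<le> q \<omega>" unfolding q_def using B0 k(1) by simp
    have iq: "set_integrable lborel {0..T} (\<lambda>s. q \<omega>)"
      by (rule set_integrable_bounded_interval[where k="\<bar>q \<omega>\<bar>"]) auto
    have "(LINT s:{0..T}|lborel. norm (X s \<omega>)) \<le> c * (LINT s:{0..T}|lborel. q \<omega> + norm (I' s \<omega>))"
      unfolding c_def
    proof (rule integrated_gronwall_real[OF ix _ L])
      fix t assume t: "t \<in> {0..T}"
      have "norm (X t \<omega>) \<le> norm (X t \<omega> - I' t \<omega>) + norm (I' t \<omega>)" using norm_triangle_ineq[of "X t \<omega> - I' t \<omega>" "I' t \<omega>"] by simp
      then show "norm (X t \<omega>) \<le> q \<omega> + norm (I' t \<omega>) + L * (LINT s:{0..t}|lborel. norm (X s \<omega>))"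
        using step[OF t] by linarith
    qed (use T q0 iq nI[OF om] in auto)
    also have "(LINT s:{0..T}|lborel. q \<omega> + norm (I' s \<omega>)) = T * q \<omega> + J \<omega>"
      unfolding J_def using iq nI[OF om] T by (simp add: set_lebesgue_integral_def[of lborel "{0..T}" "\<lambda>_. q \<omega>"])
    finally have 2: "(LINT s:{0..T}|lborel. norm (X s \<omega>)) \<le> c * (T * q \<omega> + J \<omega>)" .
    have "(LINT s:{0..t}|lborel. norm (X s \<omega>)) \<le> (LINT s:{0..T}|lborel. norm (X s \<omega>))"
      using t by (intro set_integral_Icc_mono ix) auto
    then have "L * (LINT s:{0..t}|lborel. norm (X s \<omega>)) \<le> L * (c * (T * q \<omega> + J \<omega>))"
      using 2 L by (intro mult_left_mono) auto
    then show ?thesis using step[OF t] by (simp add: Y_def)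
  qed
  have q: "q \<in> borel_measurable M" "integrable M (\<lambda>\<omega>. (q \<omega>)\<^sup>2)"
  proof -
    note a = admissible_T[OF \<xi>]
    show "q \<in> borel_measurable M" unfolding q_def using a(1) by measurable
    have "integrable M (\<lambda>\<omega>. norm (\<xi> T \<omega>))" by (rule integrable_norm_of_square[OF a])
    then show "integrable M (\<lambda>\<omega>. (q \<omega>)\<^sup>2)" unfolding q_def power2_sum[of "norm x0 + B0"]
      using a(2) by (simp add: power_mult_distrib)
  qed
  have nm: "(\<lambda>(\<omega>, s). indicat_real {0..T} s * norm (I' s \<omega>)) \<in> borel_measurable (M \<Otimes>\<^sub>M lborel)"
  proof -
    have "(\<lambda>p. norm (case p of (\<omega>, t) \<Rightarrow> indicat_real {0..T} t *\<^sub>R I' t \<omega>)) \<in> borel_measurable (M \<Otimes>\<^sub>M borel)"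
      by (rule measurable_compose[OF I'm borel_measurable_norm])
    then show ?thesis by (simp add: case_prod_beta')
  qed
  have J: "J \<in> borel_measurable M" "integrable M (\<lambda>\<omega>. (J \<omega>)\<^sup>2)"
  proof -
    show Jm: "J \<in> borel_measurable M"
      unfolding J_def set_lebesgue_integral_def
      using sigma_finite_measure.borel_measurable_lebesgue_integral[OF sigma_finite_lborel nm] by simp
    \<comment> \<open>Cauchy-Schwarz in time and Fubini reduce the square of \<open>J\<close> to
      second moments of the stochastic integral at fixed times, all at most
      \<open>r\<close>.\<close>
    show "integrable M (\<lambda>\<omega>. (J \<omega>)\<^sup>2)"
    proof (rule integrableI_bounded)
      have "(\<integral>\<^sup>+\<omega>. ennreal (norm ((J \<omega>)\<^sup>2)) \<partial>M) \<le> (\<integral>\<^sup>+\<omega>. ennreal T * (\<integral>\<^sup>+s. ennreal ((indicat_real {0..T} s * norm (I' s \<omega>))\<^sup>2) \<partial>lborel) \<partial>M)"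
      proof (rule nn_integral_mono)
        fix \<omega> assume om: "\<omega> \<in> space M"
        have "(J \<omega>)\<^sup>2 \<le> T * (LINT s:{0..T}|lborel. (norm (I' s \<omega>))\<^sup>2)"
          unfolding J_def using nI[OF om] T by (intro set_integral_square_le) auto
        then have "ennreal (norm ((J \<omega>)\<^sup>2)) \<le> ennreal T * ennreal (LINT s:{0..T}|lborel. (norm (I' s \<omega>))\<^sup>2)"
          using T by (simp add: ennreal_mult'[symmetric] ennreal_leI)
        also have "ennreal (LINT s:{0..T}|lborel. (norm (I' s \<omega>))\<^sup>2) = (\<integral>\<^sup>+s. ennreal (indicat_real {0..T} s *\<^sub>R (norm (I' s \<omega>))\<^sup>2) \<partial>lborel)"
          unfolding set_lebesgue_integral_def using nI(2)[OF om]
          by (intro nn_integral_eq_integral[symmetric]) (auto simp: set_integrable_def)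
        also have "\<dots> = (\<integral>\<^sup>+s. ennreal ((indicat_real {0..T} s * norm (I' s \<omega>))\<^sup>2) \<partial>lborel)"
          by (intro nn_integral_cong) (auto simp: indicator_def)
        finally show "ennreal (norm ((J \<omega>)\<^sup>2)) \<le> ennreal T * (\<integral>\<^sup>+s. ennreal ((indicat_real {0..T} s * norm (I' s \<omega>))\<^sup>2) \<partial>lborel)" .
      qed
      also have "\<dots> = ennreal T * (\<integral>\<^sup>+\<omega>. (\<integral>\<^sup>+s. ennreal ((indicat_real {0..T} s * norm (I' s \<omega>))\<^sup>2) \<partial>lborel) \<partial>M)"
      proof (rule nn_integral_cmult)
        show "(\<lambda>\<omega>. \<integral>\<^sup>+s. ennreal ((indicat_real {0..T} s * norm (I' s \<omega>))\<^sup>2) \<partial>lborel) \<in> borel_measurable M"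
          by (rule sigma_finite_measure.borel_measurable_nn_integral[OF sigma_finite_lborel])
            (use nm in \<open>simp add: case_prod_beta'\<close>)
      qed
      also have "(\<integral>\<^sup>+\<omega>. (\<integral>\<^sup>+s. ennreal ((indicat_real {0..T} s * norm (I' s \<omega>))\<^sup>2) \<partial>lborel) \<partial>M)
          = (\<integral>\<^sup>+s. (\<integral>\<^sup>+\<omega>. ennreal ((indicat_real {0..T} s * norm (I' s \<omega>))\<^sup>2) \<partial>M) \<partial>lborel)"
      proof -
        interpret P: pair_sigma_finite M lborel ..
        show ?thesis by (rule P.Fubini'[symmetric]) (use nm in \<open>simp add: case_prod_beta'\<close>)
      qed
      also have "\<dots> \<le> (\<integral>\<^sup>+s. ennreal r * indicator {0..T} s \<partial>lborel)"
      proof (rule nn_integral_mono)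
        fix s
        show "(\<integral>\<^sup>+\<omega>. ennreal ((indicat_real {0..T} s * norm (I' s \<omega>))\<^sup>2) \<partial>M) \<le> ennreal r * indicator {0..T} s"
        proof (cases "s \<in> {0..T}")
          case True
          have "(\<integral>\<^sup>+\<omega>. ennreal ((norm (I' s \<omega>))\<^sup>2) \<partial>M) = (\<integral>\<^sup>+\<omega>. ennreal ((norm (I s \<omega>))\<^sup>2) \<partial>M)"
            using I'(3) by (intro nn_integral_cong_AE) (auto elim!: eventually_mono)
          then show ?thesis using r(2)[OF True] True by simp
        qed simp
      qed
      also have "\<dots> = ennreal (r * T)" using T r(1) by (simp add: nn_integral_cmult_indicator ennreal_mult)
      finally have "(\<integral>\<^sup>+\<omega>. ennreal (norm ((J \<omega>)\<^sup>2)) \<partial>M) \<le> ennreal T * ennreal (r * T)"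
        by (simp add: mult_left_mono)
      also have "\<dots> < \<infinity>" by (simp add: ennreal_mult_less_top)
      finally show "(\<integral>\<^sup>+\<omega>. ennreal (norm ((J \<omega>)\<^sup>2)) \<partial>M) < \<infinity>" .
    qed (use Jm in simp)
  qed
  have Y: "Y \<in> borel_measurable M" "integrable M (\<lambda>\<omega>. (Y \<omega>)\<^sup>2)"
  proof -
    have e: "Y \<omega> = (1 + L * c * T) * q \<omega> + (L * c) * J \<omega>" for \<omega> by (simp add: Y_def algebra_simps)
    show "Y \<in> borel_measurable M" unfolding Y_def using q(1) J(1) by measurable
    have "integrable M (\<lambda>\<omega>. (norm ((1 + L * c * T) *\<^sub>R q \<omega> + (L * c) *\<^sub>R J \<omega>))\<^sup>2)"
      using q J by (intro integrable_norm_square_add) (auto simp: power_mult_distrib)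
    then show "integrable M (\<lambda>\<omega>. (Y \<omega>)\<^sup>2)" by (simp add: e[abs_def])
  qed
  show ?thesis
  proof (rule that[OF ito Y _ eq bint])
    show "AE \<omega> in M. \<forall>t\<in>{0..T}. norm (X t \<omega> - I t \<omega>) \<le> Y \<omega>"
      using good I'(3) by eventually_elim (use dom in force)
  qed
qed

end

text \<open>All consequences of one application of Fubini. The bound \<open>R\<close> on the
  absolute means, uniform in time, gives integrability on the product with a finite time
  interval.\<close>

lemma (in prob_space)
  fixes f :: "real \<Rightarrow> 'a \<Rightarrow> real"
  assumes t: "0 \<le> t" and m: "(\<lambda>(\<omega>, s). indicat_real {0..t} s * f s \<omega>) \<in> borel_measurable (M \<Otimes>\<^sub>M borel)"
    and i: "\<And>s. s \<in> {0..t} \<Longrightarrow> integrable M (f s)" and R: "\<And>s. s \<in> {0..t} \<Longrightarrow> (LINT \<omega>|M. \<bar>f s \<omega>\<bar>) \<le> R"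
  shows integrable_time_mean: "set_integrable lborel {0..t} (\<lambda>s. LINT \<omega>|M. f s \<omega>)"
    and integrable_time_integral: "integrable M (\<lambda>\<omega>. LINT s:{0..t}|lborel. f s \<omega>)"
    and integral_time_integral: "(LINT \<omega>|M. (LINT s:{0..t}|lborel. f s \<omega>)) = (LINT s:{0..t}|lborel. (LINT \<omega>|M. f s \<omega>))"
    and AE_set_integrable_time: "AE \<omega> in M. set_integrable lborel {0..t} (\<lambda>s. f s \<omega>)"
    and nn_integral_time_le: "(\<integral>\<^sup>+\<omega>. (\<integral>\<^sup>+s\<in>{0..t}. ennreal \<bar>f s \<omega>\<bar> \<partial>lborel) \<partial>M) = ennreal (LINT s:{0..t}|lborel. (LINT \<omega>|M. \<bar>f s \<omega>\<bar>))"
proof -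
  interpret P: pair_sigma_finite M lborel ..
  let ?g = "\<lambda>(\<omega>, s). indicat_real {0..t} s * f s \<omega>"
  have m': "?g \<in> borel_measurable (M \<Otimes>\<^sub>M lborel)" using m by simp
  have mn: "(\<lambda>(\<omega>, s). ennreal \<bar>indicat_real {0..t} s * f s \<omega>\<bar>) \<in> borel_measurable (M \<Otimes>\<^sub>M lborel)"
    using m' by (simp add: case_prod_beta')
  have slice: "(\<integral>\<^sup>+\<omega>. ennreal \<bar>indicat_real {0..t} s * f s \<omega>\<bar> \<partial>M) = ennreal (indicat_real {0..t} s * (LINT \<omega>|M. \<bar>f s \<omega>\<bar>))" for s
    using i[of s] by (cases "s \<in> {0..t}") (simp_all add: nn_integral_eq_integral)
  have fin: "integrable (M \<Otimes>\<^sub>M lborel) ?g"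
  proof (rule integrableI_bounded[OF m'])
    have "(\<integral>\<^sup>+p. ennreal (norm (?g p)) \<partial>(M \<Otimes>\<^sub>M lborel)) = (\<integral>\<^sup>+s. (\<integral>\<^sup>+\<omega>. ennreal \<bar>indicat_real {0..t} s * f s \<omega>\<bar> \<partial>M) \<partial>lborel)"
      using P.nn_integral_snd[OF mn] by (simp add: case_prod_beta')
    also have "\<dots> \<le> (\<integral>\<^sup>+s. ennreal R * indicator {0..t} s \<partial>lborel)"
      unfolding slice using R by (intro nn_integral_mono) (auto simp: indicator_def ennreal_leI)
    also have "\<dots> < \<infinity>" using t by (simp add: nn_integral_cmult_indicator ennreal_mult_less_top)
    finally show "(\<integral>\<^sup>+p. ennreal (norm (?g p)) \<partial>(M \<Otimes>\<^sub>M lborel)) < \<infinity>" .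
  qed
  have ga: "integrable (M \<Otimes>\<^sub>M lborel) (\<lambda>(\<omega>, s). \<bar>indicat_real {0..t} s * f s \<omega>\<bar>)"
    using integrable_norm[OF fin] by (simp add: case_prod_beta')
  have "integrable lborel (\<lambda>s. LINT \<omega>|M. indicat_real {0..t} s * f s \<omega>)" using P.integrable_snd[OF fin] .
  then show "set_integrable lborel {0..t} (\<lambda>s. LINT \<omega>|M. f s \<omega>)" by (simp add: set_integrable_def)
  have "integrable M (\<lambda>\<omega>. LINT s|lborel. indicat_real {0..t} s * f s \<omega>)" using P.integrable_fst[OF fin] .
  then show "integrable M (\<lambda>\<omega>. LINT s:{0..t}|lborel. f s \<omega>)" by (simp add: set_lebesgue_integral_def)
  show "(LINT \<omega>|M. (LINT s:{0..t}|lborel. f s \<omega>)) = (LINT s:{0..t}|lborel. (LINT \<omega>|M. f s \<omega>))"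
    using P.integral_fst[OF fin] P.integral_snd[OF fin] by (simp add: set_lebesgue_integral_def)
  show "AE \<omega> in M. set_integrable lborel {0..t} (\<lambda>s. f s \<omega>)"
    using P.AE_integrable_fst[OF fin] by (simp add: set_integrable_def)
  have ab: "integrable lborel (\<lambda>s. indicat_real {0..t} s * (LINT \<omega>|M. \<bar>f s \<omega>\<bar>))"
    using P.integrable_snd[OF ga] by (simp add: abs_mult)
  have "(\<integral>\<^sup>+\<omega>. (\<integral>\<^sup>+s\<in>{0..t}. ennreal \<bar>f s \<omega>\<bar> \<partial>lborel) \<partial>M) = (\<integral>\<^sup>+\<omega>. (\<integral>\<^sup>+s. ennreal \<bar>indicat_real {0..t} s * f s \<omega>\<bar> \<partial>lborel) \<partial>M)"
    by (intro nn_integral_cong) (simp add: indicator_def)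
  also have "\<dots> = (\<integral>\<^sup>+s. (\<integral>\<^sup>+\<omega>. ennreal \<bar>indicat_real {0..t} s * f s \<omega>\<bar> \<partial>M) \<partial>lborel)"
    by (rule P.Fubini'[symmetric, OF mn])
  also have "\<dots> = ennreal (LINT s|lborel. indicat_real {0..t} s * (LINT \<omega>|M. \<bar>f s \<omega>\<bar>))"
    unfolding slice by (rule nn_integral_eq_integral[OF ab]) auto
  finally show "(\<integral>\<^sup>+\<omega>. (\<integral>\<^sup>+s\<in>{0..t}. ennreal \<bar>f s \<omega>\<bar> \<partial>lborel) \<partial>M) = ennreal (LINT s:{0..t}|lborel. (LINT \<omega>|M. \<bar>f s \<omega>\<bar>))"
    by (simp add: set_lebesgue_integral_def)
qed

lemma integrable_of_nn_integral_le:
  fixes f :: "'a \<Rightarrow> real"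
  assumes "f \<in> borel_measurable M" "\<And>x. 0 \<le> f x" "(\<integral>\<^sup>+x. ennreal (f x) \<partial>M) \<le> ennreal r" "0 \<le> r"
  shows "integrable M f" "integral\<^sup>L M f \<le> r"
proof -
  show i: "integrable M f"
    by (rule integrableI_bounded[OF assms(1)]) (use assms in \<open>auto intro: order_le_less_trans\<close>)
  have "ennreal (integral\<^sup>L M f) \<le> ennreal r" using nn_integral_eq_integral[OF i] assms by simp
  then show "integral\<^sup>L M f \<le> r" using assms(4) by (simp add: ennreal_le_iff)
qed

section \<open>Second moments of the state and right-continuity of its law\<close>

context controlled_sde
begin

lemma state_measurable: "solves \<xi> X \<Longrightarrow> t \<in> {0..T} \<Longrightarrow> X t \<in> borel_measurable M"
  by (auto simp: sde_solution_def intro: adapted_measurable)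

text \<open>The state is split into its stochastic integral, with second moments bounded uniformly
  in time, and a remainder with the square-integrable majorant \<open>Y\<close>.\<close>

lemma state_second_moment:
  assumes \<xi>: "\<xi> \<in> admissible M T F" and sol: "solves \<xi> X"
  obtains R where "\<And>t. t \<in> {0..T} \<Longrightarrow> integrable M (\<lambda>\<omega>. (norm (X t \<omega>))\<^sup>2)"
    "\<And>t. t \<in> {0..T} \<Longrightarrow> (LINT \<omega>|M. (norm (X t \<omega>))\<^sup>2) \<le> R"
proof -
  obtain I Y where ito: "ito_integral M T F W (\<lambda>s \<omega>. \<sigma> s (X s \<omega>)) I"
    and Y: "Y \<in> borel_measurable M" "integrable M (\<lambda>\<omega>. (Y \<omega>)\<^sup>2)"
    and le: "AE \<omega> in M. \<forall>t\<in>{0..T}. norm (X t \<omega> - I t \<omega>) \<le> Y \<omega>"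
    using state_minus_ito_dominated[OF assms] by blast
  obtain r where r: "0 \<le> r" "\<And>t. t \<in> {0..T} \<Longrightarrow> (\<integral>\<^sup>+\<omega>. ennreal ((norm (I t \<omega>))\<^sup>2) \<partial>M) \<le> ennreal r"
    using ito_integral_second_moment[OF space BM ito less_imp_le[OF T]] by blast
  have *: "integrable M (\<lambda>\<omega>. (norm (X t \<omega>))\<^sup>2) \<and> (LINT \<omega>|M. (norm (X t \<omega>))\<^sup>2) \<le> 2 * r + 2 * (LINT \<omega>|M. (Y \<omega>)\<^sup>2)"
    if t: "t \<in> {0..T}" for t
  proof -
    have Im: "I t \<in> borel_measurable M" using ito t by (auto simp: ito_integral_def intro: adapted_measurable)
    note I = integrable_of_nn_integral_le[of "\<lambda>\<omega>. (norm (I t \<omega>))\<^sup>2", OF _ _ r(2)[OF t] r(1)]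
    have Ii: "integrable M (\<lambda>\<omega>. (norm (I t \<omega>))\<^sup>2)" "(LINT \<omega>|M. (norm (I t \<omega>))\<^sup>2) \<le> r" using I Im by auto
    have pt: "AE \<omega> in M. (norm (X t \<omega>))\<^sup>2 \<le> 2 * (norm (I t \<omega>))\<^sup>2 + 2 * (Y \<omega>)\<^sup>2"
      using le
    proof eventually_elim
      case (elim \<omega>)
      then have "norm (I t \<omega> - X t \<omega>) \<le> Y \<omega>" using t by (auto simp: norm_minus_commute)
      then have "(norm (I t \<omega> - X t \<omega>))\<^sup>2 \<le> (Y \<omega>)\<^sup>2" by (rule power_mono) simp
      then show ?case using norm_square_le_double[of "X t \<omega>" "I t \<omega>"] by linarith
    qed
    have dom: "integrable M (\<lambda>\<omega>. 2 * (norm (I t \<omega>))\<^sup>2 + 2 * (Y \<omega>)\<^sup>2)" using Ii Y by simp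
    have i: "integrable M (\<lambda>\<omega>. (norm (X t \<omega>))\<^sup>2)"
      by (rule Bochner_Integration.integrable_bound[OF dom])
        (use state_measurable[OF sol t] pt in \<open>auto elim!: eventually_mono intro: order_trans[OF _ abs_ge_self]\<close>)
    have "(LINT \<omega>|M. (norm (X t \<omega>))\<^sup>2) \<le> (LINT \<omega>|M. 2 * (norm (I t \<omega>))\<^sup>2 + 2 * (Y \<omega>)\<^sup>2)"
      by (rule integral_mono_AE[OF i dom pt])
    also have "\<dots> = 2 * (LINT \<omega>|M. (norm (I t \<omega>))\<^sup>2) + 2 * (LINT \<omega>|M. (Y \<omega>)\<^sup>2)" using Ii Y by simp
    finally show ?thesis using i Ii by linarith
  qed
  then show ?thesis by (intro that) auto
qed

text \<open>The mean-square estimate bounds the increment by the integral of |H|^2 over an interval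
  that shrinks to the point \<open>t\<close>, a null set; dominated convergence on the product does
  the rest.\<close>

lemma ito_mean_square_right_continuous:
  assumes ito: "ito_integral M T F W H I" and t: "0 \<le> t" and S: "\<And>n. t < S n" "\<And>n. S n < T" "S \<longlonglongrightarrow> t"
  shows "(\<lambda>n. \<integral>\<^sup>+\<omega>. ennreal ((norm (I (S n) \<omega> - I t \<omega>))\<^sup>2) \<partial>M) \<longlonglongrightarrow> 0"
proof -
  interpret P: pair_sigma_finite M lborel ..
  define f where "f = (\<lambda>p. ennreal ((norm (indicat_real {0..T} (snd p) *\<^sub>R H (snd p) (fst p)))\<^sup>2))"
  have fm[measurable]: "f \<in> borel_measurable (M \<Otimes>\<^sub>M lborel)"
  proof -
    have "progressive T F H" using ito by (simp add: ito_integral_def)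
    from progressive_measurable[OF space this] T
    have [measurable]: "(\<lambda>p. indicat_real {0..T} (snd p) *\<^sub>R H (snd p) (fst p)) \<in> borel_measurable (M \<Otimes>\<^sub>M lborel)"
      by (simp add: case_prod_beta')
    show ?thesis unfolding f_def by measurable
  qed
  have nest: "(\<integral>\<^sup>+\<omega>. (\<integral>\<^sup>+r\<in>A. ennreal ((norm (H r \<omega>))\<^sup>2) \<partial>lborel) \<partial>M) = (\<integral>\<^sup>+p. f p * indicator A (snd p) \<partial>(M \<Otimes>\<^sub>M lborel))"
    if A: "A \<subseteq> {0..T}" "A \<in> sets borel" for A
  proof -
    have [measurable]: "(\<lambda>p. f p * indicator A (snd p)) \<in> borel_measurable (M \<Otimes>\<^sub>M lborel)"
      using A by (intro borel_measurable_times_ennreal fm measurable_compose[OF measurable_snd]) auto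
    have "(\<integral>\<^sup>+p. f p * indicator A (snd p) \<partial>(M \<Otimes>\<^sub>M lborel)) = (\<integral>\<^sup>+\<omega>. (\<integral>\<^sup>+r. f (\<omega>, r) * indicator A r \<partial>lborel) \<partial>M)"
      by (subst lborel.nn_integral_fst[symmetric]) auto
    also have "\<dots> = (\<integral>\<^sup>+\<omega>. (\<integral>\<^sup>+r\<in>A. ennreal ((norm (H r \<omega>))\<^sup>2) \<partial>lborel) \<partial>M)"
      using A by (intro nn_integral_cong) (auto simp: f_def indicator_def)
    finally show ?thesis by simp
  qed
  have "(\<lambda>n. \<integral>\<^sup>+p. f p * indicator {t..S n} (snd p) \<partial>(M \<Otimes>\<^sub>M lborel)) \<longlonglongrightarrow> (\<integral>\<^sup>+p. f p * indicator {t} (snd p) \<partial>(M \<Otimes>\<^sub>M lborel))"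
  proof (rule nn_integral_dominated_convergence)
    show "(\<lambda>p. f p * indicator {0..T} (snd p)) \<in> borel_measurable (M \<Otimes>\<^sub>M lborel)"
      "(\<lambda>p. f p * indicator {t} (snd p)) \<in> borel_measurable (M \<Otimes>\<^sub>M lborel)"
      "(\<lambda>p. f p * indicator {t..S n} (snd p)) \<in> borel_measurable (M \<Otimes>\<^sub>M lborel)" for n
      by (intro borel_measurable_times_ennreal fm measurable_compose[OF measurable_snd]; simp)+
    show "AE p in M \<Otimes>\<^sub>M lborel. f p * indicator {t..S n} (snd p) \<le> f p * indicator {0..T} (snd p)" for n
      using t S(2)[of n] by (intro AE_I2) (auto simp: indicator_def)
    show "(\<integral>\<^sup>+p. f p * indicator {0..T} (snd p) \<partial>(M \<Otimes>\<^sub>M lborel)) < \<infinity>"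
      using ito nest[of "{0..T}"] by (simp add: ito_integral_def)
    show "AE p in M \<Otimes>\<^sub>M lborel. (\<lambda>n. f p * indicator {t..S n} (snd p)) \<longlonglongrightarrow> f p * indicator {t} (snd p)"
    proof (rule AE_I2)
      fix p :: "'w \<times> real"
      have "\<forall>\<^sub>F n in sequentially. f p * indicator {t..S n} (snd p) = f p * indicator {t} (snd p)"
      proof (cases "snd p \<le> t")
        case True
        then show ?thesis using S(1) by (intro eventuallyI) (auto simp: indicator_def less_imp_le)
      next
        case False
        then have "\<forall>\<^sub>F n in sequentially. S n < snd p" using order_tendstoD(2)[OF S(3)] by simp
        then show ?thesis by eventually_elim (use False in \<open>auto simp: indicator_def\<close>)
      qed
      then show "(\<lambda>n. f p * indicator {t..S n} (snd p)) \<longlonglongrightarrow> f p * indicator {t} (snd p)" by (rule tendsto_eventually)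
    qed
  qed
  also have "(\<integral>\<^sup>+p. f p * indicator {t} (snd p) \<partial>(M \<Otimes>\<^sub>M lborel)) = 0"
  proof -
    have "t < T" using S(1)[of 0] S(2)[of 0] by linarith
    then have "(\<integral>\<^sup>+p. f p * indicator {t} (snd p) \<partial>(M \<Otimes>\<^sub>M lborel)) = (\<integral>\<^sup>+\<omega>. (\<integral>\<^sup>+r\<in>{t}. ennreal ((norm (H r \<omega>))\<^sup>2) \<partial>lborel) \<partial>M)"
      using t by (intro nest[symmetric]) auto
    also have "\<dots> = (\<integral>\<^sup>+\<omega>. 0 \<partial>M)"
      by (intro nn_integral_cong nn_integral_null_set) (simp add: null_sets_def)
    finally show ?thesis by simp
  qed
  finally have lim: "(\<lambda>n. 4 * (\<integral>\<^sup>+p. f p * indicator {t..S n} (snd p) \<partial>(M \<Otimes>\<^sub>M lborel))) \<longlonglongrightarrow> 4 * 0"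
    by (intro ennreal_tendsto_cmult) auto
  show ?thesis
  proof (rule tendsto_sandwich[OF _ _ tendsto_const])
    show "(\<lambda>n. 4 * (\<integral>\<^sup>+p. f p * indicator {t..S n} (snd p) \<partial>(M \<Otimes>\<^sub>M lborel))) \<longlonglongrightarrow> 0" using lim by simp
    show "\<forall>\<^sub>F n in sequentially. (\<integral>\<^sup>+\<omega>. ennreal ((norm (I (S n) \<omega> - I t \<omega>))\<^sup>2) \<partial>M)
        \<le> 4 * (\<integral>\<^sup>+p. f p * indicator {t..S n} (snd p) \<partial>(M \<Otimes>\<^sub>M lborel))"
    proof (rule eventuallyI)
      fix n
      have s: "t \<le> S n" "S n \<le> T" using S(1,2)[of n] by simp_all
      show "(\<integral>\<^sup>+\<omega>. ennreal ((norm (I (S n) \<omega> - I t \<omega>))\<^sup>2) \<partial>M)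
        \<le> 4 * (\<integral>\<^sup>+p. f p * indicator {t..S n} (snd p) \<partial>(M \<Otimes>\<^sub>M lborel))"
        using ito_integral_bound[OF space BM ito t s] nest[of "{t..S n}"] t s by auto
    qed
  qed simp
qed

text \<open>The majorant \<open>Y\<close> belongs to X - I, not to X. Hence dominated convergence
  along the right-continuous paths treats X - I, and the mean-square continuity of the integral
  treats I. Together they give convergence of the state in mean square, hence of its law; this is
  what makes costs along a flow right-continuous in time and so measurable.\<close>

lemma law_right_continuous:
  assumes \<xi>: "\<xi> \<in> admissible M T F" and sol: "solves \<xi> X" and t: "0 \<le> t" "t < T"
  shows "limitin P2_topology (\<lambda>s. law M (X s)) (law M (X t)) (at_right t)"
proof -
  obtain I Y where ito: "ito_integral M T F W (\<lambda>s \<omega>. \<sigma> s (X s \<omega>)) I"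
    and Y: "Y \<in> borel_measurable M" "integrable M (\<lambda>\<omega>. (Y \<omega>)\<^sup>2)"
    and le: "AE \<omega> in M. \<forall>t\<in>{0..T}. norm (X t \<omega> - I t \<omega>) \<le> Y \<omega>"
    using state_minus_ito_dominated[OF \<xi> sol] by blast
  obtain r where r: "0 \<le> r" "\<And>t. t \<in> {0..T} \<Longrightarrow> (\<integral>\<^sup>+\<omega>. ennreal ((norm (I t \<omega>))\<^sup>2) \<partial>M) \<le> ennreal r"
    using ito_integral_second_moment[OF space BM ito less_imp_le[OF T]] by blast
  obtain R where X2: "\<And>t. t \<in> {0..T} \<Longrightarrow> integrable M (\<lambda>\<omega>. (norm (X t \<omega>))\<^sup>2)"
    using state_second_moment[OF \<xi> sol] by metis
  have tT: "t \<in> {0..T}" using t by simp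
  have Xm: "X s \<in> borel_measurable M" if "s \<in> {0..T}" for s using state_measurable[OF sol that] .
  have Im: "I s \<in> borel_measurable M" if "s \<in> {0..T}" for s
    using ito that by (auto simp: ito_integral_def intro: adapted_measurable)
  have I2: "integrable M (\<lambda>\<omega>. (norm (I s \<omega>))\<^sup>2)" if "s \<in> {0..T}" for s
    using integrable_of_nn_integral_le(1)[of "\<lambda>\<omega>. (norm (I s \<omega>))\<^sup>2", OF _ _ r(2)[OF that] r(1)] Im[OF that] by simp
  have lim: "((\<lambda>s. LINT \<omega>|M. (norm (X s \<omega> - X t \<omega>))\<^sup>2) \<longlongrightarrow> 0) (at_right t)"
  proof (rule tendsto_at_right_sequentially[OF t(2)])
    fix S :: "nat \<Rightarrow> real" assume S: "\<And>n. t < S n" "\<And>n. S n < T" "S \<longlonglongrightarrow> t"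
    have ST: "S n \<in> {0..T}" for n using S(1,2)[of n] t by simp
    define J where "J = (\<lambda>n. LINT \<omega>|M. (norm (I (S n) \<omega> - I t \<omega>))\<^sup>2)"
    have Ji: "integrable M (\<lambda>\<omega>. (norm (I (S n) \<omega> - I t \<omega>))\<^sup>2)" for n
      using integrable_norm_square_add[OF Im[OF ST] Im[OF tT] I2[OF ST] I2[OF tT], of n "-1"] by simp
    have "(\<lambda>n. ennreal (J n)) \<longlonglongrightarrow> ennreal 0"
      using ito_mean_square_right_continuous[OF ito t(1) S] by (simp add: J_def nn_integral_eq_integral Ji)
    then have J: "J \<longlonglongrightarrow> 0"
      by (subst (asm) tendsto_ennreal_iff) (auto simp: J_def)
    \<comment> \<open>The part of the state with a square-integrable majorant.\<close>
    define G where "G = (\<lambda>s \<omega>. X s \<omega> - I s \<omega>)"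
    have Gm: "G s \<in> borel_measurable M" if "s \<in> {0..T}" for s unfolding G_def using Xm[OF that] Im[OF that] by measurable
    have path: "AE \<omega> in M. continuous_on {0..T} (\<lambda>t. I t \<omega>)" using ito by (simp add: ito_integral_def)
    have dom: "AE \<omega> in M. norm ((norm (G (S n) \<omega> - G t \<omega>))\<^sup>2) \<le> 4 * (Y \<omega>)\<^sup>2" for n
      using le
    proof eventually_elim
      case (elim \<omega>)
      have "norm (G (S n) \<omega> - G t \<omega>) \<le> norm (G (S n) \<omega>) + norm (G t \<omega>)" by (rule norm_triangle_ineq4)
      also have "\<dots> \<le> Y \<omega> + Y \<omega>" unfolding G_def by (intro add_mono bspec[OF elim] ST tT)
      finally have "(norm (G (S n) \<omega> - G t \<omega>))\<^sup>2 \<le> (Y \<omega> + Y \<omega>)\<^sup>2" by (rule power_mono) simp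
      then show ?case by (simp flip: mult_2 add: power_mult_distrib)
    qed
    have conv: "AE \<omega> in M. (\<lambda>n. (norm (G (S n) \<omega> - G t \<omega>))\<^sup>2) \<longlonglongrightarrow> 0"
      using path AE_space
    proof eventually_elim
      case (elim \<omega>)
      have "((\<lambda>s. X s \<omega>) \<longlongrightarrow> X t \<omega>) (at_right t)"
        using sol elim(2) t by (auto simp: sde_solution_def cadlag_def)
      moreover have "filterlim S (at_right t) sequentially"
        using S by (auto simp: filterlim_at intro!: eventuallyI)
      ultimately have "(\<lambda>n. X (S n) \<omega>) \<longlonglongrightarrow> X t \<omega>" by (rule filterlim_compose)
      moreover have "(\<lambda>n. I (S n) \<omega>) \<longlonglongrightarrow> I t \<omega>"
        using elim(1) ST S(3) tT by (auto simp: continuous_on_sequentially comp_def)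
      ultimately have "(\<lambda>n. (norm (G (S n) \<omega> - G t \<omega>))\<^sup>2) \<longlonglongrightarrow> (norm (G t \<omega> - G t \<omega>))\<^sup>2"
        unfolding G_def by (intro tendsto_intros)
      then show ?case by simp
    qed
    have Gi: "integrable M (\<lambda>\<omega>. (norm (G (S n) \<omega> - G t \<omega>))\<^sup>2)" for n
    proof (rule Bochner_Integration.integrable_bound)
      show "integrable M (\<lambda>\<omega>. 4 * (Y \<omega>)\<^sup>2)" using Y by simp
      show "AE \<omega> in M. norm ((norm (G (S n) \<omega> - G t \<omega>))\<^sup>2) \<le> norm (4 * (Y \<omega>)\<^sup>2)" using dom[of n] by simp
    qed (use Gm[OF ST] Gm[OF tT] in simp)
    have "(\<lambda>n. LINT \<omega>|M. (norm (G (S n) \<omega> - G t \<omega>))\<^sup>2) \<longlonglongrightarrow> (LINT \<omega>|M. 0)"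
      by (rule integral_dominated_convergence[where w="\<lambda>\<omega>. 4 * (Y \<omega>)\<^sup>2", OF _ _ _ conv dom])
        (use Y Gm[OF ST] Gm[OF tT] in auto)
    then have G: "(\<lambda>n. LINT \<omega>|M. (norm (G (S n) \<omega> - G t \<omega>))\<^sup>2) \<longlonglongrightarrow> 0" by simp
    have up: "(LINT \<omega>|M. (norm (X (S n) \<omega> - X t \<omega>))\<^sup>2) \<le> 2 * (LINT \<omega>|M. (norm (G (S n) \<omega> - G t \<omega>))\<^sup>2) + 2 * J n" for n
    proof -
      have "(LINT \<omega>|M. (norm (X (S n) \<omega> - X t \<omega>))\<^sup>2)
        \<le> (LINT \<omega>|M. 2 * (norm (G (S n) \<omega> - G t \<omega>))\<^sup>2 + 2 * (norm (I (S n) \<omega> - I t \<omega>))\<^sup>2)"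
      proof (rule integral_mono)
        show "integrable M (\<lambda>\<omega>. (norm (X (S n) \<omega> - X t \<omega>))\<^sup>2)"
          using integrable_norm_square_add[OF Xm[OF ST] Xm[OF tT] X2[OF ST] X2[OF tT], of n "-1"] by simp
        fix \<omega>
        have "G (S n) \<omega> - G t \<omega> - (X (S n) \<omega> - X t \<omega>) = - (I (S n) \<omega> - I t \<omega>)" by (simp add: G_def)
        then show "(norm (X (S n) \<omega> - X t \<omega>))\<^sup>2 \<le> 2 * (norm (G (S n) \<omega> - G t \<omega>))\<^sup>2 + 2 * (norm (I (S n) \<omega> - I t \<omega>))\<^sup>2"
          using norm_square_le_double[of "X (S n) \<omega> - X t \<omega>" "G (S n) \<omega> - G t \<omega>"] by (simp only: norm_minus_cancel)
      qed (use Gi Ji in simp)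
      also have "\<dots> = 2 * (LINT \<omega>|M. (norm (G (S n) \<omega> - G t \<omega>))\<^sup>2) + 2 * J n" using Gi Ji by (simp add: J_def)
      finally show ?thesis .
    qed
    show "(\<lambda>n. LINT \<omega>|M. (norm (X (S n) \<omega> - X t \<omega>))\<^sup>2) \<longlonglongrightarrow> 0"
    proof (rule tendsto_sandwich[OF _ _ tendsto_const])
      show "(\<lambda>n. 2 * (LINT \<omega>|M. (norm (G (S n) \<omega> - G t \<omega>))\<^sup>2) + 2 * J n) \<longlonglongrightarrow> 0"
        using tendsto_add[OF tendsto_mult_left[OF G, of 2] tendsto_mult_left[OF J, of 2]] by simp
    qed (use up in \<open>auto intro!: eventuallyI\<close>)
  qed
  show ?thesis
  proof (rule limitin_P2_law[OF prob_space_axioms Xm[OF tT] X2[OF tT] _ lim])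
    have "\<forall>\<^sub>F s in at_right t. s \<in> {0..T}"
      unfolding eventually_at_right[OF t(2)] using t by (intro exI[of _ T]) auto
    then show "\<forall>\<^sub>F s in at_right t. X s \<in> borel_measurable M \<and> integrable M (\<lambda>\<omega>. (norm (X s \<omega>))\<^sup>2)"
      by eventually_elim (use Xm X2 in auto)
  qed
qed

end

section \<open>The state depends affinely on the control and is unique\<close>

context controlled_sde
begin

text \<open>The difference of the two sides solves a linear inequality in mean square, so Gronwall applies.\<close>

lemma state_convex_unique:
  fixes \<xi>1 \<xi>2 \<xi>3 :: "real \<Rightarrow> 'w \<Rightarrow> real^'m"
  assumes adm: "\<xi>1 \<in> admissible M T F" "\<xi>2 \<in> admissible M T F" "\<xi>3 \<in> admissible M T F"
    and sol: "solves \<xi>1 X1" "solves \<xi>2 X2" "solves \<xi>3 X3"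
    and e: "0 \<le> e" "e \<le> 1"
    and conv: "AE \<omega> in M. \<forall>t\<in>{0..T}. \<xi>1 t \<omega> = (1 - e) *\<^sub>R \<xi>2 t \<omega> + e *\<^sub>R \<xi>3 t \<omega>"
    and aff_b: "\<And>t x y. t \<in> {0..T} \<Longrightarrow> b t ((1 - e) *\<^sub>R x + e *\<^sub>R y) = (1 - e) *\<^sub>R b t x + e *\<^sub>R b t y"
    and aff_\<sigma>: "\<And>t x y. t \<in> {0..T} \<Longrightarrow> \<sigma> t ((1 - e) *\<^sub>R x + e *\<^sub>R y) = (1 - e) *\<^sub>R \<sigma> t x + e *\<^sub>R \<sigma> t y"
    and t: "t \<in> {0..T}"
  shows "AE \<omega> in M. X1 t \<omega> = (1 - e) *\<^sub>R X2 t \<omega> + e *\<^sub>R X3 t \<omega>"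
proof -
  obtain I1 where I1: "ito_integral M T F W (\<lambda>s \<omega>. \<sigma> s (X1 s \<omega>)) I1"
    "AE \<omega> in M. \<forall>t\<in>{0..T}. X1 t \<omega> = x0 + (LINT s:{0..t}|lborel. b s (X1 s \<omega>)) + I1 t \<omega> + push \<xi>1 t \<omega>"
    using sol(1) unfolding sde_solution_def by blast
  obtain I2 where I2: "ito_integral M T F W (\<lambda>s \<omega>. \<sigma> s (X2 s \<omega>)) I2"
    "AE \<omega> in M. \<forall>t\<in>{0..T}. X2 t \<omega> = x0 + (LINT s:{0..t}|lborel. b s (X2 s \<omega>)) + I2 t \<omega> + push \<xi>2 t \<omega>"
    using sol(2) unfolding sde_solution_def by blast
  obtain I3 where I3: "ito_integral M T F W (\<lambda>s \<omega>. \<sigma> s (X3 s \<omega>)) I3"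
    "AE \<omega> in M. \<forall>t\<in>{0..T}. X3 t \<omega> = x0 + (LINT s:{0..t}|lborel. b s (X3 s \<omega>)) + I3 t \<omega> + push \<xi>3 t \<omega>"
    using sol(3) unfolding sde_solution_def by blast
  have bint: "AE \<omega> in M. set_integrable lborel {0..T} (\<lambda>s. b s (X1 s \<omega>))"
    "AE \<omega> in M. set_integrable lborel {0..T} (\<lambda>s. b s (X2 s \<omega>))"
    "AE \<omega> in M. set_integrable lborel {0..T} (\<lambda>s. b s (X3 s \<omega>))"
    using sol unfolding sde_solution_def by blast+
  obtain R1 where R1: "\<And>t. t \<in> {0..T} \<Longrightarrow> integrable M (\<lambda>\<omega>. (norm (X1 t \<omega>))\<^sup>2)"
    "\<And>t. t \<in> {0..T} \<Longrightarrow> (LINT \<omega>|M. (norm (X1 t \<omega>))\<^sup>2) \<le> R1" using state_second_moment[OF adm(1) sol(1)] by blast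
  obtain R2 where R2: "\<And>t. t \<in> {0..T} \<Longrightarrow> integrable M (\<lambda>\<omega>. (norm (X2 t \<omega>))\<^sup>2)"
    "\<And>t. t \<in> {0..T} \<Longrightarrow> (LINT \<omega>|M. (norm (X2 t \<omega>))\<^sup>2) \<le> R2" using state_second_moment[OF adm(2) sol(2)] by blast
  obtain R3 where R3: "\<And>t. t \<in> {0..T} \<Longrightarrow> integrable M (\<lambda>\<omega>. (norm (X3 t \<omega>))\<^sup>2)"
    "\<And>t. t \<in> {0..T} \<Longrightarrow> (LINT \<omega>|M. (norm (X3 t \<omega>))\<^sup>2) \<le> R3" using state_second_moment[OF adm(3) sol(3)] by blast
  \<comment> \<open>The three states and their stochastic integrals are combined with the same
    coefficients, in the form that the estimate for combinations of Ito integrals expects. The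
    squares of the coefficients add up to at most 3.\<close>
  define c where "c = (\<lambda>i::nat. [1, - (1 - e), - e] ! i)"
  have c2: "(\<Sum>i\<in>{0,1,2}. (c i)\<^sup>2) \<le> 3"
  proof -
    have "(1 - e)\<^sup>2 \<le> 1" "e\<^sup>2 \<le> 1" using e by (auto intro!: power_le_one)
    then show ?thesis by (simp add: c_def power2_commute)
  qed
  define D where "D = (\<lambda>t \<omega>. X1 t \<omega> - ((1 - e) *\<^sub>R X2 t \<omega> + e *\<^sub>R X3 t \<omega>))"
  define \<Delta>I where "\<Delta>I = (\<lambda>t \<omega>. I1 t \<omega> - ((1 - e) *\<^sub>R I2 t \<omega> + e *\<^sub>R I3 t \<omega>))"
  have Dm: "D t \<in> borel_measurable M" if "t \<in> {0..T}" for t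
    unfolding D_def using state_measurable[OF sol(1) that] state_measurable[OF sol(2) that] state_measurable[OF sol(3) that]
    by measurable
  have Dle: "(norm (D t \<omega>))\<^sup>2 \<le> 3 * ((norm (X1 t \<omega>))\<^sup>2 + (norm (X2 t \<omega>))\<^sup>2 + (norm (X3 t \<omega>))\<^sup>2)" for t \<omega>
  proof -
    let ?z = "\<lambda>i::nat. [X1 t \<omega>, X2 t \<omega>, X3 t \<omega>] ! i"
    have "D t \<omega> = (\<Sum>i\<in>{0,1,2}. c i *\<^sub>R ?z i)" by (simp add: D_def c_def algebra_simps)
    then have "(norm (D t \<omega>))\<^sup>2 \<le> (\<Sum>i\<in>{0,1,2}. (c i)\<^sup>2) * (\<Sum>i\<in>{0,1,2}. (norm (?z i))\<^sup>2)"
      using norm_sum_scaleR_square_le[of c ?z "{0,1,2}"] by simp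
    also have "\<dots> \<le> 3 * (\<Sum>i\<in>{0,1,2}. (norm (?z i))\<^sup>2)" using c2 by (intro mult_right_mono) (auto intro: sum_nonneg)
    finally show ?thesis by (simp add: add.assoc)
  qed
  have dom: "integrable M (\<lambda>\<omega>. 3 * ((norm (X1 t \<omega>))\<^sup>2 + (norm (X2 t \<omega>))\<^sup>2 + (norm (X3 t \<omega>))\<^sup>2))" if "t \<in> {0..T}" for t
    using R1(1)[OF that] R2(1)[OF that] R3(1)[OF that] by simp
  have D2: "integrable M (\<lambda>\<omega>. (norm (D t \<omega>))\<^sup>2)" if "t \<in> {0..T}" for t
    by (rule Bochner_Integration.integrable_bound[OF dom[OF that]])
      (use Dm[OF that] Dle in \<open>auto intro!: AE_I2 order_trans[OF _ abs_ge_self]\<close>)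
  define m where "m = (\<lambda>t. LINT \<omega>|M. (norm (D t \<omega>))\<^sup>2)"
  have mR: "m t \<le> 3 * (R1 + R2 + R3)" if "t \<in> {0..T}" for t
  proof -
    have "m t \<le> (LINT \<omega>|M. 3 * ((norm (X1 t \<omega>))\<^sup>2 + (norm (X2 t \<omega>))\<^sup>2 + (norm (X3 t \<omega>))\<^sup>2))"
      unfolding m_def by (rule integral_mono[OF D2[OF that] dom[OF that] Dle])
    also have "\<dots> \<le> 3 * (R1 + R2 + R3)" using R1[OF that] R2[OF that] R3[OF that] by simp
    finally show ?thesis .
  qed
  have joint: "(\<lambda>(\<omega>, s). indicat_real {0..t} s * (norm (D s \<omega>))\<^sup>2) \<in> borel_measurable (M \<Otimes>\<^sub>M borel)" if t: "t \<in> {0..T}" for t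
  proof -
    note [measurable] = path_measurable[OF sol(1), unfolded case_prod_beta'] path_measurable[OF sol(2), unfolded case_prod_beta'] path_measurable[OF sol(3), unfolded case_prod_beta']
    have "(\<lambda>p. indicat_real {0..t} (snd p) * (norm (indicat_real {0..T} (snd p) *\<^sub>R X1 (snd p) (fst p)
        - ((1 - e) *\<^sub>R (indicat_real {0..T} (snd p) *\<^sub>R X2 (snd p) (fst p)) + e *\<^sub>R (indicat_real {0..T} (snd p) *\<^sub>R X3 (snd p) (fst p)))))\<^sup>2)
      \<in> borel_measurable (M \<Otimes>\<^sub>M borel)" by measurable
    then show ?thesis
      by (rule measurable_cong[THEN iffD1, rotated]) (use t in \<open>auto simp: indicator_def D_def\<close>)
  qed
  have jt: "t \<in> {0..T} \<Longrightarrow> 0 \<le> t" "t \<in> {0..T} \<Longrightarrow> s \<in> {0..t} \<Longrightarrow> s \<in> {0..T}" for s t by auto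
  have absD: "(LINT \<omega>|M. \<bar>(norm (D s \<omega>))\<^sup>2\<bar>) \<le> 3 * (R1 + R2 + R3)" if "s \<in> {0..T}" for s
    using mR[OF that] by (simp add: m_def)
  have mi: "set_integrable lborel {0..t} m" if t: "t \<in> {0..T}" for t
    unfolding m_def by (rule integrable_time_mean[OF jt(1)[OF t] joint[OF t] D2[OF jt(2)[OF t]] absD[OF jt(2)[OF t]]])
  have AEi: "AE \<omega> in M. set_integrable lborel {0..T} (\<lambda>s. (norm (D s \<omega>))\<^sup>2)"
    using T by (intro AE_set_integrable_time[where R="3 * (R1 + R2 + R3)"] joint D2 absD) auto
  define N where "N = (\<lambda>t \<omega>. LINT s:{0..t}|lborel. (norm (D s \<omega>))\<^sup>2)"
  have Ni: "integrable M (N t)" "(LINT \<omega>|M. N t \<omega>) = (LINT s:{0..t}|lborel. m s)" if t: "t \<in> {0..T}" for t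
    unfolding N_def m_def
    by (rule integrable_time_integral[OF jt(1)[OF t] joint[OF t] D2[OF jt(2)[OF t]] absD[OF jt(2)[OF t]]]
        integral_time_integral[OF jt(1)[OF t] joint[OF t] D2[OF jt(2)[OF t]] absD[OF jt(2)[OF t]]], assumption+)+
  have nnN: "(\<integral>\<^sup>+\<omega>. (\<integral>\<^sup>+s\<in>{0..t}. ennreal ((norm (D s \<omega>))\<^sup>2) \<partial>lborel) \<partial>M) = ennreal (LINT s:{0..t}|lborel. m s)" if t: "t \<in> {0..T}" for t
    using nn_integral_time_le[OF jt(1)[OF t] joint[OF t] D2[OF jt(2)[OF t]] absD[OF jt(2)[OF t]]] by (simp add: m_def)
  have m0: "0 \<le> m t" for t unfolding m_def by simp
  have im0: "0 \<le> (LINT s:{0..t}|lborel. m s)" for t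
    unfolding set_lebesgue_integral_def using m0 by (intro integral_nonneg_AE) auto
  have zero: "AE \<omega> in M. \<Delta>I 0 \<omega> = 0"
    using ito_integral_zero[OF space less_imp_le[OF T] I1(1)] ito_integral_zero[OF space less_imp_le[OF T] I2(1)]
      ito_integral_zero[OF space less_imp_le[OF T] I3(1)]
    by eventually_elim (simp add: \<Delta>I_def)
  have Im: "I1 t \<in> borel_measurable M" "I2 t \<in> borel_measurable M" "I3 t \<in> borel_measurable M" if "t \<in> {0..T}" for t
    using I1(1) I2(1) I3(1) that by (auto simp: ito_integral_def intro: adapted_measurable)
  \<comment> \<open>The three stochastic integrals are estimated as a single combination: only their
    combined integrand is of the order of the difference \<open>D\<close>, not each one
    alone.\<close>
  have IB: "integrable M (\<lambda>\<omega>. (norm (\<Delta>I t \<omega>))\<^sup>2) \<and> (LINT \<omega>|M. (norm (\<Delta>I t \<omega>))\<^sup>2) \<le> 4 * L\<^sup>2 * (LINT s:{0..t}|lborel. m s)"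
    if t: "t \<in> {0..T}" for t
  proof -
    let ?H = "\<lambda>i::nat. [\<lambda>s \<omega>. \<sigma> s (X1 s \<omega>), \<lambda>s \<omega>. \<sigma> s (X2 s \<omega>), \<lambda>s \<omega>. \<sigma> s (X3 s \<omega>)] ! i"
    let ?I = "\<lambda>i::nat. [I1, I2, I3] ! i"
    have ito: "ito_integral M T F W (?H i) (?I i)" if "i \<in> {0,1,2}" for i
      using that I1(1) I2(1) I3(1) by auto
    have "(\<integral>\<^sup>+\<omega>. ennreal ((norm (\<Delta>I t \<omega>))\<^sup>2) \<partial>M) = (\<integral>\<^sup>+\<omega>. ennreal ((norm (\<Sum>i\<in>{0,1,2}. c i *\<^sub>R (?I i t \<omega> - ?I i 0 \<omega>)))\<^sup>2) \<partial>M)"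
    proof (rule nn_integral_cong_AE, use zero in eventually_elim)
      case (elim \<omega>)
      have "(\<Sum>i\<in>{0,1,2}. c i *\<^sub>R (?I i t \<omega> - ?I i 0 \<omega>)) = \<Delta>I t \<omega> - \<Delta>I 0 \<omega>"
        by (simp add: c_def \<Delta>I_def algebra_simps)
      then show ?case using elim by (simp only: diff_zero)
    qed
    also have "\<dots> \<le> 4 * (\<integral>\<^sup>+\<omega>. (\<integral>\<^sup>+r\<in>{0..t}. ennreal ((norm (\<Sum>i\<in>{0,1,2}. c i *\<^sub>R ?H i r \<omega>))\<^sup>2) \<partial>lborel) \<partial>M)"
      by (rule ito_integral_lincomb_bound[OF space BM _ ito]) (use t in auto)
    also have "\<dots> \<le> 4 * (\<integral>\<^sup>+\<omega>. (\<integral>\<^sup>+r. ennreal (L\<^sup>2) * (ennreal ((norm (D r \<omega>))\<^sup>2) * indicator {0..t} r) \<partial>lborel) \<partial>M)"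
    proof (intro mult_left_mono nn_integral_mono)
      fix r \<omega>
      show "ennreal ((norm (\<Sum>i\<in>{0,1,2}. c i *\<^sub>R ?H i r \<omega>))\<^sup>2) * indicator {0..t} r
        \<le> ennreal (L\<^sup>2) * (ennreal ((norm (D r \<omega>))\<^sup>2) * indicator {0..t} r)"
      proof (cases "r \<in> {0..t}")
        case True
        then have r: "r \<in> {0..T}" using t by auto
        \<comment> \<open>Affinity of \<open>\<sigma>\<close> collects the last two coefficients
          into one value at the convex combination, so the Lipschitz bound applies to the difference
          of two points.\<close>
        have "(\<Sum>i\<in>{0,1,2}. c i *\<^sub>R ?H i r \<omega>) = \<sigma> r (X1 r \<omega>) - \<sigma> r ((1 - e) *\<^sub>R X2 r \<omega> + e *\<^sub>R X3 r \<omega>)"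
          unfolding aff_\<sigma>[OF r] by (simp add: c_def algebra_simps)
        then have "norm (\<Sum>i\<in>{0,1,2}. c i *\<^sub>R ?H i r \<omega>) \<le> L * norm (D r \<omega>)"
          using lip_\<sigma>[OF r, of "X1 r \<omega>" "(1 - e) *\<^sub>R X2 r \<omega> + e *\<^sub>R X3 r \<omega>"] by (simp only: D_def)
        then have "(norm (\<Sum>i\<in>{0,1,2}. c i *\<^sub>R ?H i r \<omega>))\<^sup>2 \<le> (L * norm (D r \<omega>))\<^sup>2" by (rule power_mono) simp
        then have "ennreal ((norm (\<Sum>i\<in>{0,1,2}. c i *\<^sub>R ?H i r \<omega>))\<^sup>2) \<le> ennreal (L\<^sup>2 * (norm (D r \<omega>))\<^sup>2)"
          by (intro ennreal_leI) (simp only: power_mult_distrib)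
        also have "\<dots> = ennreal (L\<^sup>2) * ennreal ((norm (D r \<omega>))\<^sup>2)" by (simp add: ennreal_mult)
        finally show ?thesis using True by (simp only: indicator_simps mult_1_right)
      qed simp
    qed simp
    also have "(\<integral>\<^sup>+\<omega>. (\<integral>\<^sup>+r. ennreal (L\<^sup>2) * (ennreal ((norm (D r \<omega>))\<^sup>2) * indicator {0..t} r) \<partial>lborel) \<partial>M)
       = ennreal (L\<^sup>2) * (\<integral>\<^sup>+\<omega>. (\<integral>\<^sup>+r\<in>{0..t}. ennreal ((norm (D r \<omega>))\<^sup>2) \<partial>lborel) \<partial>M)"
    proof -
      have jm: "(\<lambda>(\<omega>, r). ennreal ((norm (D r \<omega>))\<^sup>2) * indicator {0..t} r) \<in> borel_measurable (M \<Otimes>\<^sub>M lborel)"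
      proof -
        have "(\<lambda>p. ennreal (case p of (\<omega>, s) \<Rightarrow> indicat_real {0..t} s * (norm (D s \<omega>))\<^sup>2)) \<in> borel_measurable (M \<Otimes>\<^sub>M lborel)"
          using joint[OF t] by simp
        then show ?thesis
          by (rule measurable_cong[THEN iffD1, rotated]) (auto simp: indicator_def)
      qed
      have s: "(\<lambda>r. ennreal ((norm (D r \<omega>))\<^sup>2) * indicator {0..t} r) \<in> borel_measurable lborel" if "\<omega> \<in> space M" for \<omega>
        using measurable_compose[OF measurable_Pair1'[OF that] jm] by simp
      have "(\<integral>\<^sup>+\<omega>. (\<integral>\<^sup>+r. ennreal (L\<^sup>2) * (ennreal ((norm (D r \<omega>))\<^sup>2) * indicator {0..t} r) \<partial>lborel) \<partial>M)
        = (\<integral>\<^sup>+\<omega>. ennreal (L\<^sup>2) * (\<integral>\<^sup>+r\<in>{0..t}. ennreal ((norm (D r \<omega>))\<^sup>2) \<partial>lborel) \<partial>M)"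
        by (intro nn_integral_cong nn_integral_cmult s)
      also have "\<dots> = ennreal (L\<^sup>2) * (\<integral>\<^sup>+\<omega>. (\<integral>\<^sup>+r\<in>{0..t}. ennreal ((norm (D r \<omega>))\<^sup>2) \<partial>lborel) \<partial>M)"
        by (intro nn_integral_cmult sigma_finite_measure.borel_measurable_nn_integral[OF sigma_finite_lborel] jm)
      finally show ?thesis .
    qed
    also have "4 * (ennreal (L\<^sup>2) * (\<integral>\<^sup>+\<omega>. (\<integral>\<^sup>+r\<in>{0..t}. ennreal ((norm (D r \<omega>))\<^sup>2) \<partial>lborel) \<partial>M)) = ennreal (4 * L\<^sup>2 * (LINT s:{0..t}|lborel. m s))"
      unfolding nnN[OF t] using im0[of t] by (simp add: ennreal_mult mult.assoc)
    finally have nn: "(\<integral>\<^sup>+\<omega>. ennreal ((norm (\<Delta>I t \<omega>))\<^sup>2) \<partial>M) \<le> ennreal (4 * L\<^sup>2 * (LINT s:{0..t}|lborel. m s))" .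
    have "\<Delta>I t \<in> borel_measurable M" unfolding \<Delta>I_def using Im[OF t] by measurable
    then show ?thesis
      using integrable_of_nn_integral_le[of "\<lambda>\<omega>. (norm (\<Delta>I t \<omega>))\<^sup>2", OF _ _ nn] im0[of t] by simp
  qed
  \<comment> \<open>Initial values and pushes cancel, the latter because control integrals respect
    convex combinations. What remains is the drift difference, bounded by affinity of
    \<open>b\<close> and Cauchy-Schwarz in time, and the difference of stochastic integrals.\<close>
  have path: "AE \<omega> in M. \<forall>t\<in>{0..T}. (norm (D t \<omega>))\<^sup>2 \<le> 2 * L\<^sup>2 * T * N t \<omega> + 2 * (norm (\<Delta>I t \<omega>))\<^sup>2"
    using I1(2) I2(2) I3(2) bint conv AEi AE_space
  proof eventually_elim
    case (elim \<omega>)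
    note om = elim(9) and Di = elim(8)
    show ?case
    proof
      fix t assume t: "t \<in> {0..T}"
      have sub: "{0..t} \<subseteq> {0..T}" using t by auto
      have bi: "set_integrable lborel {0..t} (\<lambda>s. b s (X1 s \<omega>))" "set_integrable lborel {0..t} (\<lambda>s. b s (X2 s \<omega>))" "set_integrable lborel {0..t} (\<lambda>s. b s (X3 s \<omega>))"
        using elim(4-6) sub by (auto intro: set_integrable_subset)
      have Dit: "set_integrable lborel {0..t} (\<lambda>s. (norm (D s \<omega>))\<^sup>2)" by (rule set_integrable_subset[OF Di]) (use sub in auto)
      have push: "push \<xi>1 t \<omega> = (1 - e) *\<^sub>R push \<xi>2 t \<omega> + e *\<^sub>R push \<xi>3 t \<omega>"
      proof -
        have p: "control_path T (\<lambda>s. \<xi>2 s \<omega>)" "control_path T (\<lambda>s. \<xi>3 s \<omega>)"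
          using admissible_path[OF adm(2) om] admissible_path[OF adm(3) om] .
        have "control_integral T (\<lambda>s. \<zeta> s $ i) (\<lambda>s. \<xi>1 s \<omega>) t
          = (1 - e) * control_integral T (\<lambda>s. \<zeta> s $ i) (\<lambda>s. \<xi>2 s \<omega>) t + e * control_integral T (\<lambda>s. \<zeta> s $ i) (\<lambda>s. \<xi>3 s \<omega>) t" for i
        proof -
          have "control_integral T (\<lambda>s. \<zeta> s $ i) (\<lambda>s. \<xi>1 s \<omega>) = control_integral T (\<lambda>s. \<zeta> s $ i) (\<lambda>s. (1 - e) *\<^sub>R \<xi>2 s \<omega> + e *\<^sub>R \<xi>3 s \<omega>)"
            by (rule control_integral_cong[OF T]) (use elim(7) in auto)
          then show ?thesis
            using control_integral_convex[OF T p e, of "\<lambda>s. \<zeta> s $ i" t] cont_\<zeta> t by (auto intro!: continuous_intros)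
        qed
        then show ?thesis by (simp add: vec_eq_iff)
      qed
      define B where "B = (\<lambda>s. b s (X1 s \<omega>) - ((1 - e) *\<^sub>R b s (X2 s \<omega>) + e *\<^sub>R b s (X3 s \<omega>)))"
      have Bi: "set_integrable lborel {0..t} B"
        unfolding B_def using bi by (intro set_integral_diff(1) set_integral_add(1)) auto
      have Beq: "(LINT s:{0..t}|lborel. B s) = (LINT s:{0..t}|lborel. b s (X1 s \<omega>)) - ((1 - e) *\<^sub>R (LINT s:{0..t}|lborel. b s (X2 s \<omega>)) + e *\<^sub>R (LINT s:{0..t}|lborel. b s (X3 s \<omega>)))"
        unfolding B_def using bi
        by (subst set_integral_diff(2)) (auto intro!: set_integral_add(1) simp: set_integral_add(2))
      have eq: "D t \<omega> = (LINT s:{0..t}|lborel. B s) + \<Delta>I t \<omega>"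
        unfolding D_def \<Delta>I_def Beq bspec[OF elim(1) t] bspec[OF elim(2) t] bspec[OF elim(3) t] push
        by (simp add: algebra_simps)
      have BD: "norm (B s) \<le> L * norm (D s \<omega>)" if "s \<in> {0..t}" for s
      proof -
        have s: "s \<in> {0..T}" using that sub by auto
        show ?thesis
          using lip_b[OF s, of "X1 s \<omega>" "(1 - e) *\<^sub>R X2 s \<omega> + e *\<^sub>R X3 s \<omega>"] by (simp add: B_def D_def aff_b[OF s])
      qed
      have BD2: "(norm (B s))\<^sup>2 \<le> L\<^sup>2 * (norm (D s \<omega>))\<^sup>2" if "s \<in> {0..t}" for s
        using power_mono[OF BD[OF that], of 2] by (simp add: power_mult_distrib)
      have B2i: "set_integrable lborel {0..t} (\<lambda>s. (norm (B s))\<^sup>2)"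
        unfolding set_integrable_def
      proof (rule Bochner_Integration.integrable_bound)
        show "integrable lborel (\<lambda>s. L\<^sup>2 * (indicat_real {0..t} s *\<^sub>R (norm (D s \<omega>))\<^sup>2))"
          using Dit by (simp add: set_integrable_def)
        have "(\<lambda>s. (norm (indicat_real {0..t} s *\<^sub>R B s))\<^sup>2) \<in> borel_measurable lborel"
          using borel_measurable_integrable[OF Bi[unfolded set_integrable_def]] by measurable
        then show "(\<lambda>s. indicat_real {0..t} s *\<^sub>R (norm (B s))\<^sup>2) \<in> borel_measurable lborel"
          by (rule measurable_cong[THEN iffD1, rotated]) (auto simp: indicator_def)
        show "AE s in lborel. norm (indicat_real {0..t} s *\<^sub>R (norm (B s))\<^sup>2) \<le> norm (L\<^sup>2 * (indicat_real {0..t} s *\<^sub>R (norm (D s \<omega>))\<^sup>2))"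
          using BD2 by (intro AE_I2) (auto simp: indicator_def)
      qed
      have "norm (LINT s:{0..t}|lborel. B s) \<le> (LINT s:{0..t}|lborel. norm (B s))"
        unfolding set_lebesgue_integral_def by (rule order_trans[OF integral_norm_bound]) simp
      then have "(norm (LINT s:{0..t}|lborel. B s))\<^sup>2 \<le> (LINT s:{0..t}|lborel. norm (B s))\<^sup>2" by (rule power_mono) simp
      also have "\<dots> \<le> t * (LINT s:{0..t}|lborel. (norm (B s))\<^sup>2)"
        using t by (intro set_integral_square_le set_integrable_norm[OF Bi] B2i) auto
      also have "\<dots> \<le> T * (LINT s:{0..t}|lborel. L\<^sup>2 * (norm (D s \<omega>))\<^sup>2)"
        using t by (intro mult_mono set_integral_mono B2i BD2)
          (auto intro!: Dit simp: set_lebesgue_integral_def intro: integral_nonneg_AE)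
      also have "\<dots> = L\<^sup>2 * T * N t \<omega>" by (simp add: N_def)
      finally have 1: "(norm (LINT s:{0..t}|lborel. B s))\<^sup>2 \<le> L\<^sup>2 * T * N t \<omega>" .
      have "(norm (D t \<omega>))\<^sup>2 \<le> 2 * (norm (LINT s:{0..t}|lborel. B s))\<^sup>2 + 2 * (norm (\<Delta>I t \<omega>))\<^sup>2"
        using norm_square_le_double[of "D t \<omega>" "LINT s:{0..t}|lborel. B s"] eq by simp
      then show "(norm (D t \<omega>))\<^sup>2 \<le> 2 * L\<^sup>2 * T * N t \<omega> + 2 * (norm (\<Delta>I t \<omega>))\<^sup>2"
        using 1 by linarith
    qed
  qed
  \<comment> \<open>The drift contributes \<open>2 * L\<^sup>2 * T\<close>; the stochastic part
    contributes 2 from splitting the square times \<open>4 * L\<^sup>2\<close> from the mean-square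
    estimate.\<close>
  define C where "C = 2 * L\<^sup>2 * T + 8 * L\<^sup>2"
  have C: "C > 0" using L T by (simp add: C_def add_pos_pos)
  have gr: "m t \<le> C * (LINT s:{0..t}|lborel. m s)" if t: "t \<in> {0..T}" for t
  proof -
    have ii: "integrable M (\<lambda>\<omega>. 2 * L\<^sup>2 * T * N t \<omega> + 2 * (norm (\<Delta>I t \<omega>))\<^sup>2)" using Ni(1)[OF t] IB[OF t] by simp
    have "m t \<le> (LINT \<omega>|M. 2 * L\<^sup>2 * T * N t \<omega> + 2 * (norm (\<Delta>I t \<omega>))\<^sup>2)"
      unfolding m_def by (rule integral_mono_AE[OF D2[OF t] ii]) (use path t in \<open>auto elim!: eventually_mono\<close>)
    also have "\<dots> = 2 * L\<^sup>2 * T * (LINT s:{0..t}|lborel. m s) + 2 * (LINT \<omega>|M. (norm (\<Delta>I t \<omega>))\<^sup>2)"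
      using Ni[OF t] IB[OF t] by simp
    also have "\<dots> \<le> C * (LINT s:{0..t}|lborel. m s)" using IB[OF t] by (simp add: C_def algebra_simps)
    finally show ?thesis .
  qed
  \<comment> \<open>Gronwall with zero inhomogeneity only says that the integral of \<open>m\<close>
    vanishes. Inserting this once more into \<open>gr\<close> gives \<open>m t = 0\<close> at the
    given time, not merely at almost every time.\<close>
  have "(LINT s:{0..T}|lborel. m s) \<le> 2 * exp (2 * C * T) * (LINT s:{0..T}|lborel. 0)"
    by (rule integrated_gronwall_real[OF mi _ C]) (use T gr m0 in \<open>auto simp: set_integrable_def\<close>)
  then have "(LINT s:{0..T}|lborel. m s) \<le> 0" by (simp add: set_lebesgue_integral_def)
  then have "(LINT s:{0..t}|lborel. m s) \<le> 0"
    using set_integral_Icc_mono[OF mi, of T t] m0 T t by auto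
  then have "C * (LINT s:{0..t}|lborel. m s) \<le> 0" using C by (simp add: mult_nonneg_nonpos)
  then have "m t = 0" using gr[OF t] m0[of t] by linarith
  then have "AE \<omega> in M. (norm (D t \<omega>))\<^sup>2 = 0"
    unfolding m_def using integral_nonneg_eq_0_iff_AE[OF D2[OF t]] by simp
  then show ?thesis by eventually_elim (simp add: D_def)
qed

end

section \<open>From equilibria to minimizers\<close>

text \<open>Using one variable in both roles cancels the law term and leaves a tangent inequality in
  \<open>x\<close> at fixed \<open>\<mu>\<close>. Weighting the tangents at the intermediate point
  makes the slopes cancel.\<close>

lemma L_jointly_convex_imp_convex:
  fixes \<phi> :: "real^'n \<Rightarrow> (real^'n) measure \<Rightarrow> real"
  assumes conv: "L_jointly_convex \<phi>" and \<mu>: "\<mu> \<in> P2" and s: "0 \<le> s" "s \<le> 1"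
  shows "\<phi> ((1 - s) *\<^sub>R x + s *\<^sub>R y) \<mu> \<le> (1 - s) * \<phi> x \<mu> + s * \<phi> y \<mu>"
proof -
  have p: "prob_space \<mu>" and sets: "sets \<mu> = sets borel" using \<mu> by (auto simp: P2_def)
  let ?\<pi> = "distr \<mu> borel (\<lambda>z. (z, z))"
  have m: "(\<lambda>z. (z, z)) \<in> borel_measurable \<mu>"
    unfolding measurable_cong_sets[OF sets refl] by (intro borel_measurable_continuous_onI continuous_intros)
  then have "prob_space ?\<pi>" by (rule prob_space.prob_space_distr[OF p])
  then obtain P X X' where P: "atomless_polish_prob P" and X: "X \<in> borel_measurable P" "X' \<in> borel_measurable P"
    and \<pi>: "distr P borel (\<lambda>s. (X s, X' s)) = ?\<pi>"
    using atomless_polish_coupling[of ?\<pi>] by auto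
  have f: "(fst :: (real^'n) \<times> (real^'n) \<Rightarrow> _) \<in> borel_measurable borel"
    by (simp add: borel_measurable_continuous_onI continuous_on_fst)
  have "distr P borel X = distr (distr P borel (\<lambda>s. (X s, X' s))) borel fst"
    using X f by (subst distr_distr) (auto simp: comp_def)
  also have "\<dots> = distr \<mu> borel (\<lambda>z. z)"
    unfolding \<pi> using m f by (subst distr_distr) (auto simp: comp_def)
  also have "\<dots> = \<mu>" using distr_id2[of borel \<mu>] sets by simp
  finally have X\<mu>: "distr P borel X = \<mu>" .
  obtain Dx where tangent: "\<And>x x'. \<phi> x \<mu> - \<phi> x' \<mu> \<le> Dx x \<bullet> (x - x')"
  proof -
    from conv obtain Dx D\<mu> where c: "\<forall>x x'. \<forall>\<mu>\<in>P2. \<forall>\<mu>'\<in>P2. \<forall>P X X'.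
        atomless_polish_prob P \<longrightarrow> X \<in> borel_measurable P \<longrightarrow> X' \<in> borel_measurable P \<longrightarrow>
        distr P borel X = \<mu> \<longrightarrow> distr P borel X' = \<mu>' \<longrightarrow>
        \<phi> x \<mu> - \<phi> x' \<mu>' \<le> Dx x \<mu> \<bullet> (x - x') + (LINT \<omega>|P. D\<mu> x \<mu> (X \<omega>) \<bullet> (X \<omega> - X' \<omega>))"
      unfolding L_jointly_convex_def by blast
    show ?thesis
    proof (rule that[of "\<lambda>x. Dx x \<mu>"])
      fix x x'
      \<comment> \<open>\<open>X\<close> takes the place of \<open>X'\<close> too, which makes the
        integrand of the law term 0.\<close>
      have "\<phi> x \<mu> - \<phi> x' \<mu> \<le> Dx x \<mu> \<bullet> (x - x') + (LINT \<omega>|P. D\<mu> x \<mu> (X \<omega>) \<bullet> (X \<omega> - X \<omega>))"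
        using c P X X\<mu> \<mu> by blast
      then show "\<phi> x \<mu> - \<phi> x' \<mu> \<le> Dx x \<mu> \<bullet> (x - x')" by simp
    qed
  qed
  let ?z = "(1 - s) *\<^sub>R x + s *\<^sub>R y"
  have "(1 - s) * (\<phi> ?z \<mu> - \<phi> x \<mu>) + s * (\<phi> ?z \<mu> - \<phi> y \<mu>)
    \<le> (1 - s) * (Dx ?z \<bullet> (?z - x)) + s * (Dx ?z \<bullet> (?z - y))"
    using s by (intro add_mono mult_left_mono tangent) auto
  also have "\<dots> = Dx ?z \<bullet> ((1 - s) *\<^sub>R (?z - x) + s *\<^sub>R (?z - y))" by (simp add: inner_add_right)
  also have "(1 - s) *\<^sub>R (?z - x) + s *\<^sub>R (?z - y) = 0" by (simp add: algebra_simps)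
  finally show ?thesis by (simp add: algebra_simps)
qed

lemma trace_transpose_mult:
  fixes A B :: "real^'d^'n"
  shows "trace (transpose A ** B) = A \<bullet> B"
proof -
  have "trace (transpose A ** B) = (\<Sum>j\<in>UNIV. \<Sum>i\<in>UNIV. A $ i $ j * B $ i $ j)"
    by (simp add: trace_def matrix_matrix_mult_def transpose_def)
  also have "\<dots> = (\<Sum>i\<in>UNIV. \<Sum>j\<in>UNIV. A $ i $ j * B $ i $ j)" by (rule sum.swap)
  finally show ?thesis by (simp add: inner_vec_def)
qed

text \<open>Convexity of the Hamiltonian for all \<open>(r p, r q)\<close>, \<open>r \<rightarrow> \<infinity>\<close>, forces affine coefficients.\<close>

lemma hamiltonian_convex_imp_affine:
  fixes b :: "real \<Rightarrow> real^'n \<Rightarrow> real^'n" and \<sigma> :: "real \<Rightarrow> real^'n \<Rightarrow> real^'d^'n"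
    and C :: "real \<Rightarrow> real^'n \<Rightarrow> (real^'n) measure \<Rightarrow> real" and \<mu> :: "(real^'n) measure"
  assumes conv: "\<And>p q. L_jointly_convex (\<lambda>x \<mu>. hamiltonian b \<sigma> C t x \<mu> p q)"
    and \<mu>: "\<mu> \<in> P2" and s: "0 \<le> s" "s \<le> 1"
  shows "b t ((1 - s) *\<^sub>R x + s *\<^sub>R y) = (1 - s) *\<^sub>R b t x + s *\<^sub>R b t y"
    and "\<sigma> t ((1 - s) *\<^sub>R x + s *\<^sub>R y) = (1 - s) *\<^sub>R \<sigma> t x + s *\<^sub>R \<sigma> t y"
proof -
  let ?z = "(1 - s) *\<^sub>R x + s *\<^sub>R y"
  define \<beta> where "\<beta> = b t ?z - ((1 - s) *\<^sub>R b t x + s *\<^sub>R b t y)"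
  define \<gamma> where "\<gamma> = \<sigma> t ?z - ((1 - s) *\<^sub>R \<sigma> t x + s *\<^sub>R \<sigma> t y)"
  define a where "a = C t ?z \<mu> - ((1 - s) * C t x \<mu> + s * C t y \<mu>)"
  have le: "\<beta> \<bullet> p + \<gamma> \<bullet> q + a \<le> 0" for p q
    using L_jointly_convex_imp_convex[OF conv \<mu> s, of x y p q]
    by (simp add: hamiltonian_def trace_transpose_mult \<beta>_def \<gamma>_def a_def inner_diff_left inner_add_left algebra_simps)
  have "\<beta> \<bullet> \<beta> + \<gamma> \<bullet> \<gamma> = 0"
  proof (rule ccontr)
    let ?k = "\<beta> \<bullet> \<beta> + \<gamma> \<bullet> \<gamma>"
    assume "?k \<noteq> 0"
    moreover have "0 \<le> ?k" by simp
    ultimately have k: "?k > 0" by linarith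
    \<comment> \<open>The common factor is chosen so that the part linear in (p, q) equals |a| + 1,
      which together with \<open>a\<close> is at least 1 and contradicts \<open>le\<close>.\<close>
    have "\<beta> \<bullet> (((\<bar>a\<bar> + 1) / ?k) *\<^sub>R \<beta>) + \<gamma> \<bullet> (((\<bar>a\<bar> + 1) / ?k) *\<^sub>R \<gamma>) = ((\<bar>a\<bar> + 1) / ?k) * ?k"
      by (simp only: inner_scaleR_right distrib_left)
    also have "\<dots> = \<bar>a\<bar> + 1" using k by simp
    finally have "\<beta> \<bullet> (((\<bar>a\<bar> + 1) / ?k) *\<^sub>R \<beta>) + \<gamma> \<bullet> (((\<bar>a\<bar> + 1) / ?k) *\<^sub>R \<gamma>) = \<bar>a\<bar> + 1" .
    then show False using le[of "((\<bar>a\<bar> + 1) / ?k) *\<^sub>R \<beta>" "((\<bar>a\<bar> + 1) / ?k) *\<^sub>R \<gamma>"] by linarith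
  qed
  then have "\<beta> = 0" "\<gamma> = 0" using inner_ge_zero[of \<beta>] inner_ge_zero[of \<gamma>] by (simp_all add: add_nonneg_eq_0_iff)
  then show "b t ?z = (1 - s) *\<^sub>R b t x + s *\<^sub>R b t y" "\<sigma> t ?z = (1 - s) *\<^sub>R \<sigma> t x + s *\<^sub>R \<sigma> t y"
    by (simp_all add: \<beta>_def \<gamma>_def)
qed

lemma tendsto_continuous_map_time:
  assumes "continuous_map (prod_topology (top_of_set {0..T}) Y) euclidean (\<lambda>(t, p). h t p)"
    and t: "0 \<le> t" "t < T" and lim: "limitin Y p p0 (at_right t)"
  shows "((\<lambda>s. h s (p s)) \<longlongrightarrow> h t p0) (at_right (t :: real))"
proof -
  have "\<forall>\<^sub>F s in at_right t. s \<in> {0..T}"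
    unfolding eventually_at_right[OF t(2)] using t by (intro exI[of _ T]) auto
  then have "limitin (top_of_set {0..T}) (\<lambda>s. s) t (at_right t)"
    using t by (simp add: limitin_subtopology)
  then have "limitin (prod_topology (top_of_set {0..T}) Y) (\<lambda>s. (s, p s)) (t, p0) (at_right t)"
    using lim by (simp add: limitin_pairwise comp_def)
  from continuous_map_limit[OF assms(1) this] show ?thesis by (simp add: comp_def)
qed

text \<open>The growth bounds of \<open>\<phi>\<close> and \<open>d\<phi>\<close> are added.
  Integrating the latter over \<open>\<mu>\<close> turns |z|^2 into a further second moment, whence
  the factor 3.\<close>

lemma (in mean_field_function) potential_cost_growth:
  assumes \<mu>: "\<mu> \<in> P2"
  shows "\<bar>potential_cost \<phi> d\<phi> x \<mu>\<bar> \<le> \<kappa> * (2 + 2 * (norm x)\<^sup>2 + 3 * (LINT z|\<mu>. (norm z)\<^sup>2))"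
proof -
  let ?m = "LINT z|\<mu>. (norm z)\<^sup>2"
  interpret prob_space \<mu> using \<mu> by (simp add: P2_def)
  have sets: "sets \<mu> = sets borel" and sq: "integrable \<mu> (\<lambda>z. (norm z)\<^sup>2)" using \<mu> by (auto simp: P2_def)
  have i: "integrable \<mu> (\<lambda>z. \<kappa> * (1 + (norm z)\<^sup>2 + ?m + (norm x)\<^sup>2))" using sq by simp
  have m: "(\<lambda>z. d\<phi> z \<mu> x) \<in> borel_measurable \<mu>"
    unfolding measurable_cong_sets[OF sets refl] by (rule measurable_slice(3)[OF \<mu>]) auto
  have id: "integrable \<mu> (\<lambda>z. d\<phi> z \<mu> x)"
    by (rule Bochner_Integration.integrable_bound[OF i m])
      (use growth_d[OF \<mu>] in \<open>auto intro!: AE_I2 order_trans[OF _ abs_ge_self]\<close>)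
  have "\<bar>LINT z|\<mu>. d\<phi> z \<mu> x\<bar> \<le> (LINT z|\<mu>. \<bar>d\<phi> z \<mu> x\<bar>)" by (rule integral_abs_bound)
  also have "\<dots> \<le> (LINT z|\<mu>. \<kappa> * (1 + (norm z)\<^sup>2 + ?m + (norm x)\<^sup>2))"
    using id growth_d[OF \<mu>] by (intro integral_mono i) auto
  also have "\<dots> = \<kappa> * (1 + ?m + ?m + (norm x)\<^sup>2)" using sq by (simp add: prob_space)
  finally show ?thesis
    using growth[OF \<mu>, of x] by (simp add: potential_cost_def algebra_simps)
qed

text \<open>The convexity condition enters in two forms: as convexity of the costs inside
  \<open>mfC\<close> and \<open>mfG\<close>, and as affinity of the coefficients. The map
  \<open>X\<close> selects a solution of the state equation for each control.\<close>

locale mean_field_control = controlled_sde T L M F W b \<sigma> \<zeta> x0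
  for T L :: real and M :: "'w measure" and F :: "real \<Rightarrow> 'w measure" and W :: "real \<Rightarrow> 'w \<Rightarrow> real^'d"
    and b :: "real \<Rightarrow> real^'n \<Rightarrow> real^'n" and \<sigma> :: "real \<Rightarrow> real^'n \<Rightarrow> real^'d^'n"
    and \<zeta> :: "real \<Rightarrow> real^'m^'n" and x0 :: "real^'n" +
  fixes \<kappa> :: real and K :: "real \<Rightarrow> real^'m"
    and C :: "real \<Rightarrow> real^'n \<Rightarrow> (real^'n) measure \<Rightarrow> real"
    and G :: "real^'n \<Rightarrow> (real^'n) measure \<Rightarrow> real"
    and dC :: "real \<Rightarrow> real^'n \<Rightarrow> (real^'n) measure \<Rightarrow> real^'n \<Rightarrow> real"
    and dG :: "real^'n \<Rightarrow> (real^'n) measure \<Rightarrow> real^'n \<Rightarrow> real"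
    and DxC :: "real \<Rightarrow> real^'n \<Rightarrow> (real^'n) measure \<Rightarrow> real^'n"
    and DxG :: "real^'n \<Rightarrow> (real^'n) measure \<Rightarrow> real^'n"
    and DyC :: "real \<Rightarrow> real^'n \<Rightarrow> (real^'n) measure \<Rightarrow> real^'n \<Rightarrow> real^'n"
    and DyG :: "real^'n \<Rightarrow> (real^'n) measure \<Rightarrow> real^'n \<Rightarrow> real^'n"
    and X :: "(real \<Rightarrow> 'w \<Rightarrow> real^'m) \<Rightarrow> real \<Rightarrow> 'w \<Rightarrow> real^'n"
  assumes cont_K: "continuous_on {0..T} K"
    and state: "\<And>\<xi>. \<xi> \<in> admissible M T F \<Longrightarrow> solves \<xi> (X \<xi>)"
    and mfC: "\<And>t. t \<in> {0..T} \<Longrightarrow> mean_field_function (C t) (dC t) (DxC t) (DyC t) \<kappa>"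
    and mfG: "mean_field_function G dG DxG DyG \<kappa>"
    and cont_C: "continuous_map (prod_topology (top_of_set {0..T}) (prod_topology euclidean P2_topology))
         euclideanreal (\<lambda>(t, x, \<mu>). C t x \<mu>)"
    and cont_dC: "continuous_map (prod_topology (top_of_set {0..T})
           (prod_topology euclidean (prod_topology P2_topology euclidean)))
         euclideanreal (\<lambda>(t, x, \<mu>, y). dC t x \<mu> y)"
    and affine_b: "\<And>t s x y. t \<in> {0..T} \<Longrightarrow> 0 \<le> s \<Longrightarrow> s \<le> 1 \<Longrightarrow>
      b t ((1 - s) *\<^sub>R x + s *\<^sub>R y) = (1 - s) *\<^sub>R b t x + s *\<^sub>R b t y"
    and affine_\<sigma>: "\<And>t s x y. t \<in> {0..T} \<Longrightarrow> 0 \<le> s \<Longrightarrow> s \<le> 1 \<Longrightarrow>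
      \<sigma> t ((1 - s) *\<^sub>R x + s *\<^sub>R y) = (1 - s) *\<^sub>R \<sigma> t x + s *\<^sub>R \<sigma> t y"
begin

abbreviation controls where "controls \<equiv> admissible M T F"
abbreviation flow where "flow \<xi> \<equiv> (\<lambda>t. law M (X \<xi> t))"
abbreviation pC where "pC t \<equiv> potential_cost (C t) (dC t)"
abbreviation pG where "pG \<equiv> potential_cost G dG"

lemma X_measurable: "\<xi> \<in> controls \<Longrightarrow> t \<in> {0..T} \<Longrightarrow> X \<xi> t \<in> borel_measurable M"
  using state_measurable[OF state] by blast

lemma X_square: "\<xi> \<in> controls \<Longrightarrow> t \<in> {0..T} \<Longrightarrow> integrable M (\<lambda>\<omega>. (norm (X \<xi> t \<omega>))\<^sup>2)"
  using state_second_moment[OF _ state] by metis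

lemma X_moment:
  assumes "\<xi> \<in> controls"
  obtains R where "0 \<le> R" "\<And>t. t \<in> {0..T} \<Longrightarrow> (LINT \<omega>|M. (norm (X \<xi> t \<omega>))\<^sup>2) \<le> R"
proof -
  obtain R where "\<And>t. t \<in> {0..T} \<Longrightarrow> (LINT \<omega>|M. (norm (X \<xi> t \<omega>))\<^sup>2) \<le> R"
    using state_second_moment[OF assms state[OF assms]] by metis
  then show ?thesis by (intro that[of "\<bar>R\<bar>"]) (auto intro: order_trans[OF _ abs_ge_self])
qed

lemma flow_P2: "\<xi> \<in> controls \<Longrightarrow> t \<in> {0..T} \<Longrightarrow> flow \<xi> t \<in> P2"
  using X_square X_measurable by (simp add: P2_iff_law[OF prob_space_axioms])

lemma flow_moment: "\<xi> \<in> controls \<Longrightarrow> t \<in> {0..T} \<Longrightarrow> (LINT z|flow \<xi> t. (norm z)\<^sup>2) = (LINT \<omega>|M. (norm (X \<xi> t \<omega>))\<^sup>2)"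
  using X_measurable by (rule second_moment_law)

lemma X_right: "\<xi> \<in> controls \<Longrightarrow> \<omega> \<in> space M \<Longrightarrow> 0 \<le> t \<Longrightarrow> t < T \<Longrightarrow> ((\<lambda>s. X \<xi> s \<omega>) \<longlongrightarrow> X \<xi> t \<omega>) (at_right t)"
  using state[of \<xi>] by (auto simp: sde_solution_def cadlag_def)

lemma flow_right: "\<xi> \<in> controls \<Longrightarrow> 0 \<le> t \<Longrightarrow> t < T \<Longrightarrow> limitin P2_topology (flow \<xi>) (flow \<xi> t) (at_right t)"
  using law_right_continuous[OF _ state] by blast

text \<open>Two controls appear because the game evaluates the state of one against the flow of the
  other. Joint continuity of \<open>C\<close> passes right-continuity of the state and of the flow
  on to the cost, and right-continuous processes are jointly measurable.\<close>

lemma C_joint: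
  assumes \<xi>: "\<xi> \<in> controls" and \<eta>: "\<eta> \<in> controls"
  shows "(\<lambda>(\<omega>, t). indicat_real {0..T} t * C t (X \<eta> t \<omega>) (flow \<xi> t)) \<in> borel_measurable (M \<Otimes>\<^sub>M borel)"
proof -
  have "(\<lambda>(\<omega>, t). indicat_real {0..T} t *\<^sub>R C t (X \<eta> t \<omega>) (flow \<xi> t)) \<in> borel_measurable (M \<Otimes>\<^sub>M borel)"
  proof (rule right_continuous_process_measurable[OF T])
    fix t assume t: "t \<in> {0..T}"
    interpret mean_field_function "C t" "dC t" "DxC t" "DyC t" \<kappa> by (rule mfC[OF t])
    show "(\<lambda>\<omega>. C t (X \<eta> t \<omega>) (flow \<xi> t)) \<in> borel_measurable M"
      by (rule measurable_slice(1)[OF flow_P2[OF \<xi> t] X_measurable[OF \<eta> t] X_measurable[OF \<eta> t]])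
  next
    fix t \<omega> assume *: "\<omega> \<in> space M" "0 \<le> t" "t < T"
    have "limitin (prod_topology euclidean P2_topology) (\<lambda>s. (X \<eta> s \<omega>, flow \<xi> s)) (X \<eta> t \<omega>, flow \<xi> t) (at_right t)"
      using X_right[OF \<eta> *] flow_right[OF \<xi> *(2,3)] by (simp add: limitin_pairwise comp_def)
    from tendsto_continuous_map_time[of T "prod_topology euclidean P2_topology" "\<lambda>t p. C t (fst p) (snd p)", OF _ *(2,3) this] cont_C
    show "((\<lambda>s. C s (X \<eta> s \<omega>) (flow \<xi> s)) \<longlongrightarrow> C t (X \<eta> t \<omega>) (flow \<xi> t)) (at_right t)"
      by (simp add: case_prod_beta')
  qed
  then show ?thesis by simp
qed

lemma dC_joint:
  assumes \<xi>: "\<xi> \<in> controls" and \<eta>: "\<eta> \<in> controls"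
  shows "(\<lambda>(p, t). indicat_real {0..T} t * dC t (X \<xi> t (fst p)) (flow \<xi> t) (X \<eta> t (snd p))) \<in> borel_measurable ((M \<Otimes>\<^sub>M M) \<Otimes>\<^sub>M borel)"
proof -
  have "(\<lambda>(p, t). indicat_real {0..T} t *\<^sub>R dC t (X \<xi> t (fst p)) (flow \<xi> t) (X \<eta> t (snd p))) \<in> borel_measurable ((M \<Otimes>\<^sub>M M) \<Otimes>\<^sub>M borel)"
  proof (rule right_continuous_process_measurable[OF T])
    fix t assume t: "t \<in> {0..T}"
    interpret mean_field_function "C t" "dC t" "DxC t" "DyC t" \<kappa> by (rule mfC[OF t])
    show "(\<lambda>p. dC t (X \<xi> t (fst p)) (flow \<xi> t) (X \<eta> t (snd p))) \<in> borel_measurable (M \<Otimes>\<^sub>M M)"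
      by (rule measurable_slice(3)[OF flow_P2[OF \<xi> t] measurable_compose[OF measurable_fst X_measurable[OF \<xi> t]]
            measurable_compose[OF measurable_snd X_measurable[OF \<eta> t]]])
  next
    fix t and p :: "'w \<times> 'w" assume p: "p \<in> space (M \<Otimes>\<^sub>M M)" and *: "0 \<le> t" "t < T"
    have "fst p \<in> space M" "snd p \<in> space M" using p by (auto simp: space_pair_measure)
    then have "limitin (prod_topology euclidean (prod_topology P2_topology euclidean)) (\<lambda>s. (X \<xi> s (fst p), flow \<xi> s, X \<eta> s (snd p)))
        (X \<xi> t (fst p), flow \<xi> t, X \<eta> t (snd p)) (at_right t)"
      using X_right[OF \<xi> _ *] X_right[OF \<eta> _ *] flow_right[OF \<xi> *] by (simp add: limitin_pairwise comp_def)
    from tendsto_continuous_map_time[of T "prod_topology euclidean (prod_topology P2_topology euclidean)" "\<lambda>t p. dC t (fst p) (fst (snd p)) (snd (snd p))", OF _ * this] cont_dC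
    show "((\<lambda>s. dC s (X \<xi> s (fst p)) (flow \<xi> s) (X \<eta> s (snd p))) \<longlongrightarrow> dC t (X \<xi> t (fst p)) (flow \<xi> t) (X \<eta> t (snd p))) (at_right t)"
      by (simp add: case_prod_beta')
  qed
  then show ?thesis by simp
qed

text \<open>Joint continuity is known for \<open>dC\<close>, not for its integral inside the
  potential cost. So \<open>dC\<close> is shown measurable in time and in two copies of the
  randomness, and the copy in the state argument is integrated out.\<close>

lemma pC_joint:
  assumes \<xi>: "\<xi> \<in> controls" and \<eta>: "\<eta> \<in> controls"
  shows "(\<lambda>(\<omega>, t). indicat_real {0..T} t * pC t (X \<eta> t \<omega>) (flow \<xi> t)) \<in> borel_measurable (M \<Otimes>\<^sub>M borel)"
proof -
  have sw: "(\<lambda>q. ((snd q, fst (fst q)), snd (fst q))) \<in> measurable ((M \<Otimes>\<^sub>M (borel::real measure)) \<Otimes>\<^sub>M M) ((M \<Otimes>\<^sub>M M) \<Otimes>\<^sub>M borel)"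
    by measurable
  have "(\<lambda>(p, \<omega>'). indicat_real {0..T} (snd p) * dC (snd p) (X \<xi> (snd p) \<omega>') (flow \<xi> (snd p)) (X \<eta> (snd p) (fst p)))
     \<in> borel_measurable ((M \<Otimes>\<^sub>M (borel::real measure)) \<Otimes>\<^sub>M M)"
    using measurable_compose[OF sw dC_joint[OF \<xi> \<eta>]] by (simp add: case_prod_beta')
  from sigma_finite_measure.borel_measurable_lebesgue_integral[OF sigma_finite_measure_axioms this]
  have "(\<lambda>p. LINT \<omega>'|M. indicat_real {0..T} (snd p) * dC (snd p) (X \<xi> (snd p) \<omega>') (flow \<xi> (snd p)) (X \<eta> (snd p) (fst p)))
     \<in> borel_measurable (M \<Otimes>\<^sub>M (borel::real measure))" by simp
  from borel_measurable_add[OF C_joint[OF \<xi> \<eta>] this]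
  show ?thesis
  proof (rule measurable_cong[THEN iffD1, rotated])
    fix p :: "'w \<times> real"
    show "(case p of (\<omega>, t) \<Rightarrow> indicat_real {0..T} t * C t (X \<eta> t \<omega>) (flow \<xi> t))
        + (LINT \<omega>'|M. indicat_real {0..T} (snd p) * dC (snd p) (X \<xi> (snd p) \<omega>') (flow \<xi> (snd p)) (X \<eta> (snd p) (fst p)))
      = (case p of (\<omega>, t) \<Rightarrow> indicat_real {0..T} t * pC t (X \<eta> t \<omega>) (flow \<xi> t))"
    proof (cases "snd p \<in> {0..T}")
      case True
      interpret mean_field_function "C (snd p)" "dC (snd p)" "DxC (snd p)" "DyC (snd p)" \<kappa> by (rule mfC[OF True])
      show ?thesis
        using potential_cost_law[OF X_measurable[OF \<xi> True] flow_P2[OF \<xi> True], of "X \<eta> (snd p) (fst p)"] True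
        by (simp add: case_prod_beta')
    qed (simp add: case_prod_beta')
  qed
qed

lemma control_cost_integrable:
  assumes "\<xi> \<in> controls"
  shows "integrable M (\<lambda>\<omega>. control_integral T K (\<lambda>s. \<xi> s \<omega>) T)"
proof -
  have "bounded (K ` {0..T})" using cont_K by (intro compact_imp_bounded compact_continuous_image) auto
  then obtain k where "\<forall>x\<in>K ` {0..T}. norm x \<le> k" unfolding bounded_iff by blast
  then have k: "\<And>s. s \<in> {0..T} \<Longrightarrow> norm (K s) \<le> k" by blast
  show ?thesis
  proof (rule Bochner_Integration.integrable_bound)
    show "integrable M (\<lambda>\<omega>. real CARD('m) * k * norm (\<xi> T \<omega>))"
      using integrable_norm_of_square[OF admissible_T[OF assms]] by simp
    show "AE \<omega> in M. norm (control_integral T K (\<lambda>s. \<xi> s \<omega>) T) \<le> norm (real CARD('m) * k * norm (\<xi> T \<omega>))"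
      using control_integral_bound[OF T admissible_path[OF assms] cont_K k, of _ T] T
      by (intro AE_I2) (auto intro: order_trans[OF _ abs_ge_self])
    show "(\<lambda>\<omega>. control_integral T K (\<lambda>s. \<xi> s \<omega>) T) \<in> borel_measurable M"
    proof (rule control_integral_measurable[OF T _ admissible_path[OF assms] cont_K])
      show "\<xi> t \<in> borel_measurable M" if "t \<in> {0..T}" for t
        using adapted_measurable[OF _ that, of \<xi>] assms by (simp add: admissible_def)
    qed
  qed
qed

definition mean_control_cost where "mean_control_cost \<xi> = (LINT \<omega>|M. control_integral T K (\<lambda>s. \<xi> s \<omega>) T)"

lemma mean_control_cost_convex:
  assumes "\<xi> \<in> controls" "\<eta> \<in> controls" "0 \<le> e" "e \<le> 1"
  shows "mean_control_cost (\<lambda>t \<omega>. (1 - e) *\<^sub>R \<xi> t \<omega> + e *\<^sub>R \<eta> t \<omega>) = (1 - e) * mean_control_cost \<xi> + e * mean_control_cost \<eta>"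
proof -
  have "mean_control_cost (\<lambda>t \<omega>. (1 - e) *\<^sub>R \<xi> t \<omega> + e *\<^sub>R \<eta> t \<omega>)
    = (LINT \<omega>|M. (1 - e) * control_integral T K (\<lambda>s. \<xi> s \<omega>) T + e * control_integral T K (\<lambda>s. \<eta> s \<omega>) T)"
    unfolding mean_control_cost_def
    by (intro Bochner_Integration.integral_cong refl control_integral_convex[OF T] admissible_path[OF assms(1)]
        admissible_path[OF assms(2)] assms(3,4) cont_K) (use T in auto)
  also have "\<dots> = (1 - e) * mean_control_cost \<xi> + e * mean_control_cost \<eta>"
    unfolding mean_control_cost_def using control_cost_integrable[OF assms(1)] control_cost_integrable[OF assms(2)] by simp
  finally show ?thesis .
qed

text \<open>The quadratic bound, uniform in time, together with the bounded second moments of the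
  state makes the three summands integrable and allows mean and time integral to be
  exchanged.\<close>

lemma cost_split:
  assumes \<eta>: "\<eta> \<in> controls"
    and m: "(\<lambda>(\<omega>, t). indicat_real {0..T} t * c t (X \<eta> t \<omega>) (\<mu> t)) \<in> borel_measurable (M \<Otimes>\<^sub>M borel)"
    and i: "\<And>t. t \<in> {0..T} \<Longrightarrow> integrable M (\<lambda>\<omega>. c t (X \<eta> t \<omega>) (\<mu> t))"
    and bd: "\<And>t x. t \<in> {0..T} \<Longrightarrow> \<bar>c t x (\<mu> t)\<bar> \<le> k * (1 + (norm x)\<^sup>2)" and k: "0 \<le> k"
    and g: "integrable M (\<lambda>\<omega>. g (X \<eta> T \<omega>) (\<mu> T))"
  shows "set_integrable lborel {0..T} (\<lambda>t. LINT \<omega>|M. c t (X \<eta> t \<omega>) (\<mu> t))"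
    and "cost M T X c g K \<eta> \<mu> = (LINT t:{0..T}|lborel. (LINT \<omega>|M. c t (X \<eta> t \<omega>) (\<mu> t))) + (LINT \<omega>|M. g (X \<eta> T \<omega>) (\<mu> T)) + mean_control_cost \<eta>"
proof -
  obtain R where R: "0 \<le> R" "\<And>t. t \<in> {0..T} \<Longrightarrow> (LINT \<omega>|M. (norm (X \<eta> t \<omega>))\<^sup>2) \<le> R"
    using X_moment[OF \<eta>] by blast
  have bound: "(LINT \<omega>|M. \<bar>c t (X \<eta> t \<omega>) (\<mu> t)\<bar>) \<le> k * (1 + R)" if t: "t \<in> {0..T}" for t
  proof -
    have "(LINT \<omega>|M. \<bar>c t (X \<eta> t \<omega>) (\<mu> t)\<bar>) \<le> (LINT \<omega>|M. k * (1 + (norm (X \<eta> t \<omega>))\<^sup>2))"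
      using i[OF t] X_square[OF \<eta> t] bd[OF t] by (intro integral_mono) auto
    also have "\<dots> = k * (1 + (LINT \<omega>|M. (norm (X \<eta> t \<omega>))\<^sup>2))" using X_square[OF \<eta> t] by (simp add: prob_space)
    also have "\<dots> \<le> k * (1 + R)" using R(2)[OF t] k by (intro mult_left_mono) auto
    finally show ?thesis .
  qed
  show "set_integrable lborel {0..T} (\<lambda>t. LINT \<omega>|M. c t (X \<eta> t \<omega>) (\<mu> t))"
    by (rule integrable_time_mean[OF less_imp_le[OF T] m i bound])
  have I: "integrable M (\<lambda>\<omega>. LINT t:{0..T}|lborel. c t (X \<eta> t \<omega>) (\<mu> t))"
    by (rule integrable_time_integral[OF less_imp_le[OF T] m i bound])
  have E: "(LINT \<omega>|M. (LINT t:{0..T}|lborel. c t (X \<eta> t \<omega>) (\<mu> t))) = (LINT t:{0..T}|lborel. (LINT \<omega>|M. c t (X \<eta> t \<omega>) (\<mu> t)))"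
    by (rule integral_time_integral[OF less_imp_le[OF T] m i bound])
  show "cost M T X c g K \<eta> \<mu> = (LINT t:{0..T}|lborel. (LINT \<omega>|M. c t (X \<eta> t \<omega>) (\<mu> t))) + (LINT \<omega>|M. g (X \<eta> T \<omega>) (\<mu> T)) + mean_control_cost \<eta>"
    unfolding cost_def mean_control_cost_def using I g control_cost_integrable[OF \<eta>]
    by (simp add: E)
qed

lemma T_in: "T \<in> {0..T}" using T by simp

lemma potential_cost_split:
  assumes \<xi>: "\<xi> \<in> controls" and \<eta>: "\<eta> \<in> controls"
  shows "set_integrable lborel {0..T} (\<lambda>t. LINT \<omega>|M. pC t (X \<eta> t \<omega>) (flow \<xi> t))"
    and "cost M T X pC pG K \<eta> (flow \<xi>) = (LINT t:{0..T}|lborel. (LINT \<omega>|M. pC t (X \<eta> t \<omega>) (flow \<xi> t)))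
      + (LINT \<omega>|M. pG (X \<eta> T \<omega>) (flow \<xi> T)) + mean_control_cost \<eta>"
proof -
  obtain R where R: "0 \<le> R" "\<And>t. t \<in> {0..T} \<Longrightarrow> (LINT \<omega>|M. (norm (X \<xi> t \<omega>))\<^sup>2) \<le> R"
    using X_moment[OF \<xi>] by blast
  have \<kappa>0: "0 \<le> \<kappa>" using mean_field_function.\<kappa>_nonneg[OF mfG] .
  have bd: "\<bar>pC t x (flow \<xi> t)\<bar> \<le> (\<kappa> * (2 + 3 * R)) * (1 + (norm x)\<^sup>2)" if t: "t \<in> {0..T}" for t x
  proof -
    interpret mean_field_function "C t" "dC t" "DxC t" "DyC t" \<kappa> by (rule mfC[OF t])
    have "\<bar>pC t x (flow \<xi> t)\<bar> \<le> \<kappa> * (2 + 2 * (norm x)\<^sup>2 + 3 * (LINT z|flow \<xi> t. (norm z)\<^sup>2))"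
      by (rule potential_cost_growth[OF flow_P2[OF \<xi> t]])
    also have "\<dots> \<le> \<kappa> * ((2 + 3 * R) * (1 + (norm x)\<^sup>2))"
    proof (rule mult_left_mono[OF _ \<kappa>0])
      have "0 \<le> R * (norm x)\<^sup>2" using R(1) by simp
      then show "2 + 2 * (norm x)\<^sup>2 + 3 * (LINT z|flow \<xi> t. (norm z)\<^sup>2) \<le> (2 + 3 * R) * (1 + (norm x)\<^sup>2)"
        using R(2)[OF t] unfolding flow_moment[OF \<xi> t] by (simp add: algebra_simps)
    qed
    finally show ?thesis by (simp add: mult.assoc)
  qed
  have i: "integrable M (\<lambda>\<omega>. pC t (X \<eta> t \<omega>) (flow \<xi> t))" if t: "t \<in> {0..T}" for t
    using mean_field_function.integrable_potential_cost[OF mfC[OF t] prob_space_axioms X_measurable[OF \<xi> t] X_square[OF \<xi> t] X_measurable[OF \<eta> t] X_square[OF \<eta> t]] .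
  have g: "integrable M (\<lambda>\<omega>. pG (X \<eta> T \<omega>) (flow \<xi> T))"
    using mean_field_function.integrable_potential_cost[OF mfG prob_space_axioms X_measurable[OF \<xi> T_in] X_square[OF \<xi> T_in] X_measurable[OF \<eta> T_in] X_square[OF \<eta> T_in]] .
  have k: "0 \<le> \<kappa> * (2 + 3 * R)" using \<kappa>0 R(1) by simp
  show "set_integrable lborel {0..T} (\<lambda>t. LINT \<omega>|M. pC t (X \<eta> t \<omega>) (flow \<xi> t))"
    and "cost M T X pC pG K \<eta> (flow \<xi>) = (LINT t:{0..T}|lborel. (LINT \<omega>|M. pC t (X \<eta> t \<omega>) (flow \<xi> t)))
      + (LINT \<omega>|M. pG (X \<eta> T \<omega>) (flow \<xi> T)) + mean_control_cost \<eta>"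
    by (rule cost_split[where c=pC and g=pG and \<mu>="flow \<xi>", OF \<eta> pC_joint[OF \<xi> \<eta>] i bd k g]; assumption)+
qed

lemma mfc_cost_split:
  assumes \<eta>: "\<eta> \<in> controls"
  shows "set_integrable lborel {0..T} (\<lambda>t. LINT \<omega>|M. C t (X \<eta> t \<omega>) (flow \<eta> t))"
    and "mfc_cost M T X C G K \<eta> = (LINT t:{0..T}|lborel. (LINT \<omega>|M. C t (X \<eta> t \<omega>) (flow \<eta> t)))
      + (LINT \<omega>|M. G (X \<eta> T \<omega>) (flow \<eta> T)) + mean_control_cost \<eta>"
proof -
  obtain R where R: "0 \<le> R" "\<And>t. t \<in> {0..T} \<Longrightarrow> (LINT \<omega>|M. (norm (X \<eta> t \<omega>))\<^sup>2) \<le> R"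
    using X_moment[OF \<eta>] by blast
  have \<kappa>0: "0 \<le> \<kappa>" using mean_field_function.\<kappa>_nonneg[OF mfG] .
  have bd: "\<bar>C t x (flow \<eta> t)\<bar> \<le> (\<kappa> * (1 + R)) * (1 + (norm x)\<^sup>2)" if t: "t \<in> {0..T}" for t x
  proof -
    interpret mean_field_function "C t" "dC t" "DxC t" "DyC t" \<kappa> by (rule mfC[OF t])
    have "\<bar>C t x (flow \<eta> t)\<bar> \<le> \<kappa> * (1 + (norm x)\<^sup>2 + (LINT z|flow \<eta> t. (norm z)\<^sup>2))"
      by (rule growth[OF flow_P2[OF \<eta> t]])
    also have "\<dots> \<le> \<kappa> * ((1 + R) * (1 + (norm x)\<^sup>2))"
    proof (rule mult_left_mono[OF _ \<kappa>0])
      have "0 \<le> R * (norm x)\<^sup>2" using R(1) by simp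
      then show "1 + (norm x)\<^sup>2 + (LINT z|flow \<eta> t. (norm z)\<^sup>2) \<le> (1 + R) * (1 + (norm x)\<^sup>2)"
        using R(2)[OF t] unfolding flow_moment[OF \<eta> t] by (simp add: algebra_simps)
    qed
    finally show ?thesis by (simp add: mult.assoc)
  qed
  have i: "integrable M (\<lambda>\<omega>. C t (X \<eta> t \<omega>) (flow \<eta> t))" if t: "t \<in> {0..T}" for t
    using mean_field_function.integrable_\<phi>[OF mfC[OF t] prob_space_axioms X_measurable[OF \<eta> t] X_square[OF \<eta> t] flow_P2[OF \<eta> t]] .
  have g: "integrable M (\<lambda>\<omega>. G (X \<eta> T \<omega>) (flow \<eta> T))"
    using mean_field_function.integrable_\<phi>[OF mfG prob_space_axioms X_measurable[OF \<eta> T_in] X_square[OF \<eta> T_in] flow_P2[OF \<eta> T_in]] .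
  have k: "0 \<le> \<kappa> * (1 + R)" using \<kappa>0 R(1) by simp
  show "set_integrable lborel {0..T} (\<lambda>t. LINT \<omega>|M. C t (X \<eta> t \<omega>) (flow \<eta> t))"
    and "mfc_cost M T X C G K \<eta> = (LINT t:{0..T}|lborel. (LINT \<omega>|M. C t (X \<eta> t \<omega>) (flow \<eta> t)))
      + (LINT \<omega>|M. G (X \<eta> T \<omega>) (flow \<eta> T)) + mean_control_cost \<eta>"
    unfolding mfc_cost_def
    by (rule cost_split[where c=C and g=G and \<mu>="flow \<eta>", OF \<eta> C_joint[OF \<eta> \<eta>] i bd k g]; assumption)+
qed

text \<open>The state is affine in the control, so the one-sided derivative of the game cost at its
  minimizer, in the direction of another control, is nonnegative; by convexity it bounds the
  difference of the control costs from below.\<close>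

lemma potential_minimizer_is_mfc_minimizer:
  assumes \<xi>: "\<xi> \<in> controls" and \<eta>: "\<eta> \<in> controls"
    and opt: "\<And>\<eta>. \<eta> \<in> controls \<Longrightarrow> cost M T X pC pG K \<xi> (flow \<xi>) \<le> cost M T X pC pG K \<eta> (flow \<xi>)"
  shows "mfc_cost M T X C G K \<xi> \<le> mfc_cost M T X C G K \<eta>"
proof -
  obtain R1 where R1: "0 \<le> R1" "\<And>t. t \<in> {0..T} \<Longrightarrow> (LINT \<omega>|M. (norm (X \<xi> t \<omega>))\<^sup>2) \<le> R1" using X_moment[OF \<xi>] by blast
  obtain R2 where R2: "0 \<le> R2" "\<And>t. t \<in> {0..T} \<Longrightarrow> (LINT \<omega>|M. (norm (X \<eta> t \<omega>))\<^sup>2) \<le> R2" using X_moment[OF \<eta>] by blast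
  define R where "R = max R1 R2"
  have R: "(LINT \<omega>|M. (norm (X \<xi> t \<omega>))\<^sup>2) \<le> R" "(LINT \<omega>|M. (norm (X \<eta> t \<omega>))\<^sup>2) \<le> R" if "t \<in> {0..T}" for t
    unfolding R_def using R1(2)[OF that] R2(2)[OF that] by linarith+
  define \<Xi> where "\<Xi> = (\<lambda>k t \<omega>. (1 - step_size k) *\<^sub>R \<xi> t \<omega> + step_size k *\<^sub>R \<eta> t \<omega>)"
  have e: "0 \<le> step_size k" "step_size k \<le> 1" for k using step_pos[of k] step_le_1[of k] by auto
  have \<Xi>: "\<Xi> k \<in> controls" for k unfolding \<Xi>_def by (rule admissible_convex[OF space T \<xi> \<eta> e])
  \<comment> \<open>The exceptional null set may depend on \<open>t\<close>. This is harmless, since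
    states enter the costs only through means at fixed times once the cost is split.\<close>
  have X\<Xi>: "AE \<omega> in M. X (\<Xi> k) t \<omega> = X \<xi> t \<omega> + step_size k *\<^sub>R (X \<eta> t \<omega> - X \<xi> t \<omega>)" if t: "t \<in> {0..T}" for k t
  proof -
    have "AE \<omega> in M. X (\<Xi> k) t \<omega> = (1 - step_size k) *\<^sub>R X \<xi> t \<omega> + step_size k *\<^sub>R X \<eta> t \<omega>"
      by (rule state_convex_unique[OF \<Xi> \<xi> \<eta> state[OF \<Xi>] state[OF \<xi>] state[OF \<eta>] e _ affine_b affine_\<sigma> t])
        (use e in \<open>auto simp: \<Xi>_def\<close>)
    then show ?thesis by eventually_elim (simp add: algebra_simps)
  qed
  define hC where "hC = (\<lambda>k t. ((LINT \<omega>|M. pC t (X \<xi> t \<omega> + step_size k *\<^sub>R (X \<eta> t \<omega> - X \<xi> t \<omega>)) (flow \<xi> t))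
      - (LINT \<omega>|M. pC t (X \<xi> t \<omega>) (flow \<xi> t))) / step_size k)"
  define hG where "hG = (\<lambda>k. ((LINT \<omega>|M. pG (X \<xi> T \<omega> + step_size k *\<^sub>R (X \<eta> T \<omega> - X \<xi> T \<omega>)) (flow \<xi> T))
      - (LINT \<omega>|M. pG (X \<xi> T \<omega>) (flow \<xi> T))) / step_size k)"
  note first = mean_field_function.potential_cost_first_order[OF _ prob_space_axioms X_measurable[OF \<xi>] X_square[OF \<xi>] X_measurable[OF \<eta>] X_square[OF \<eta>] R]
  \<comment> \<open>The derivative is known to exist time by time; \<open>lim\<close> names it as
    one function of time.\<close>
  define lC where "lC = (\<lambda>t. lim (\<lambda>k. hC k t))"
  have hC: "(\<lambda>k. hC k t) \<longlonglongrightarrow> lC t" "(LINT \<omega>|M. C t (X \<xi> t \<omega>) (flow \<xi> t)) - (LINT \<omega>|M. C t (X \<eta> t \<omega>) (flow \<eta> t)) \<le> - lC t"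
    if t: "t \<in> {0..T}" for t
  proof -
    obtain l where l: "(\<lambda>k. hC k t) \<longlonglongrightarrow> l" "(LINT \<omega>|M. C t (X \<xi> t \<omega>) (flow \<xi> t)) - (LINT \<omega>|M. C t (X \<eta> t \<omega>) (flow \<eta> t)) \<le> - l"
      using first(1)[OF mfC[OF t] t t t t t t] unfolding hC_def by blast
    moreover have "lC t = l" unfolding lC_def by (rule limI[OF l(1)])
    ultimately show "(\<lambda>k. hC k t) \<longlonglongrightarrow> lC t" "(LINT \<omega>|M. C t (X \<xi> t \<omega>) (flow \<xi> t)) - (LINT \<omega>|M. C t (X \<eta> t \<omega>) (flow \<eta> t)) \<le> - lC t" by auto
  qed
  obtain lG where hG: "hG \<longlonglongrightarrow> lG" "(LINT \<omega>|M. G (X \<xi> T \<omega>) (flow \<xi> T)) - (LINT \<omega>|M. G (X \<eta> T \<omega>) (flow \<eta> T)) \<le> - lG"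
    using first(1)[OF mfG T_in T_in T_in T_in T_in T_in] unfolding hG_def by blast
  define Bd where "Bd = 100 * (\<kappa>\<^sup>2 + 1) * (1 + R)"
  have hCb: "\<bar>hC k t\<bar> \<le> Bd" if t: "t \<in> {0..T}" for k t
    unfolding hC_def Bd_def by (rule first(2)[OF mfC[OF t] t t t t t t])
  have meanC: "(LINT \<omega>|M. pC t (X (\<Xi> k) t \<omega>) (flow \<xi> t)) = (LINT \<omega>|M. pC t (X \<xi> t \<omega>) (flow \<xi> t)) + step_size k * hC k t" if t: "t \<in> {0..T}" for t k
  proof -
    interpret mean_field_function "C t" "dC t" "DxC t" "DyC t" \<kappa> by (rule mfC[OF t])
    have m: "(\<lambda>\<omega>. X \<xi> t \<omega> + step_size k *\<^sub>R (X \<eta> t \<omega> - X \<xi> t \<omega>)) \<in> borel_measurable M"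
      using X_measurable[OF \<xi> t] X_measurable[OF \<eta> t] by measurable
    have i: "integrable M (\<lambda>\<omega>. (norm (X \<xi> t \<omega> + step_size k *\<^sub>R (X \<eta> t \<omega> - X \<xi> t \<omega>)))\<^sup>2)"
      using integrable_norm_square_add[OF X_measurable[OF \<eta> t] X_measurable[OF \<xi> t] X_square[OF \<eta> t] X_square[OF \<xi> t], of "-1"]
      by (intro integrable_norm_square_add X_measurable[OF \<xi> t] X_square[OF \<xi> t] borel_measurable_diff X_measurable[OF \<eta> t]) simp
    have "(LINT \<omega>|M. pC t (X (\<Xi> k) t \<omega>) (flow \<xi> t)) = (LINT \<omega>|M. pC t (X \<xi> t \<omega> + step_size k *\<^sub>R (X \<eta> t \<omega> - X \<xi> t \<omega>)) (flow \<xi> t))"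
    proof (rule integral_cong_AE)
      show "(\<lambda>\<omega>. pC t (X (\<Xi> k) t \<omega>) (flow \<xi> t)) \<in> borel_measurable M"
        by (rule borel_measurable_integrable[OF integrable_potential_cost[OF prob_space_axioms X_measurable[OF \<xi> t] X_square[OF \<xi> t] X_measurable[OF \<Xi> t] X_square[OF \<Xi> t]]])
      show "(\<lambda>\<omega>. pC t (X \<xi> t \<omega> + step_size k *\<^sub>R (X \<eta> t \<omega> - X \<xi> t \<omega>)) (flow \<xi> t)) \<in> borel_measurable M"
        by (rule borel_measurable_integrable[OF integrable_potential_cost[OF prob_space_axioms X_measurable[OF \<xi> t] X_square[OF \<xi> t] m i]])
      show "AE \<omega> in M. pC t (X (\<Xi> k) t \<omega>) (flow \<xi> t) = pC t (X \<xi> t \<omega> + step_size k *\<^sub>R (X \<eta> t \<omega> - X \<xi> t \<omega>)) (flow \<xi> t)"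
        using X\<Xi>[OF t, of k] by eventually_elim simp
    qed
    then show ?thesis using step_pos[of k] by (simp add: hC_def)
  qed
  have meanG: "(LINT \<omega>|M. pG (X (\<Xi> k) T \<omega>) (flow \<xi> T)) = (LINT \<omega>|M. pG (X \<xi> T \<omega>) (flow \<xi> T)) + step_size k * hG k" for k
  proof -
    interpret mean_field_function G dG DxG DyG \<kappa> by (rule mfG)
    note t = T_in
    have m: "(\<lambda>\<omega>. X \<xi> T \<omega> + step_size k *\<^sub>R (X \<eta> T \<omega> - X \<xi> T \<omega>)) \<in> borel_measurable M"
      using X_measurable[OF \<xi> t] X_measurable[OF \<eta> t] by measurable
    have i: "integrable M (\<lambda>\<omega>. (norm (X \<xi> T \<omega> + step_size k *\<^sub>R (X \<eta> T \<omega> - X \<xi> T \<omega>)))\<^sup>2)"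
      using integrable_norm_square_add[OF X_measurable[OF \<eta> t] X_measurable[OF \<xi> t] X_square[OF \<eta> t] X_square[OF \<xi> t], of "-1"]
      by (intro integrable_norm_square_add X_measurable[OF \<xi> t] X_square[OF \<xi> t] borel_measurable_diff X_measurable[OF \<eta> t]) simp
    have "(LINT \<omega>|M. pG (X (\<Xi> k) T \<omega>) (flow \<xi> T)) = (LINT \<omega>|M. pG (X \<xi> T \<omega> + step_size k *\<^sub>R (X \<eta> T \<omega> - X \<xi> T \<omega>)) (flow \<xi> T))"
    proof (rule integral_cong_AE)
      show "(\<lambda>\<omega>. pG (X (\<Xi> k) T \<omega>) (flow \<xi> T)) \<in> borel_measurable M"
        by (rule borel_measurable_integrable[OF integrable_potential_cost[OF prob_space_axioms X_measurable[OF \<xi> t] X_square[OF \<xi> t] X_measurable[OF \<Xi> t] X_square[OF \<Xi> t]]])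
      show "(\<lambda>\<omega>. pG (X \<xi> T \<omega> + step_size k *\<^sub>R (X \<eta> T \<omega> - X \<xi> T \<omega>)) (flow \<xi> T)) \<in> borel_measurable M"
        by (rule borel_measurable_integrable[OF integrable_potential_cost[OF prob_space_axioms X_measurable[OF \<xi> t] X_square[OF \<xi> t] m i]])
      show "AE \<omega> in M. pG (X (\<Xi> k) T \<omega>) (flow \<xi> T) = pG (X \<xi> T \<omega> + step_size k *\<^sub>R (X \<eta> T \<omega> - X \<xi> T \<omega>)) (flow \<xi> T)"
        using X\<Xi>[OF t, of k] by eventually_elim simp
    qed
    then show ?thesis using step_pos[of k] by (simp add: hG_def)
  qed
  define p where "p = (\<lambda>t. LINT \<omega>|M. pC t (X \<xi> t \<omega>) (flow \<xi> t))"
  have pi: "set_integrable lborel {0..T} p" unfolding p_def by (rule potential_cost_split(1)[OF \<xi> \<xi>])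
  have hCi: "set_integrable lborel {0..T} (hC k)" for k
  proof -
    have "set_integrable lborel {0..T} (\<lambda>t. ((LINT \<omega>|M. pC t (X (\<Xi> k) t \<omega>) (flow \<xi> t)) - p t) / step_size k)"
      using potential_cost_split(1)[OF \<xi> \<Xi>, of k] pi by (intro set_integrable_divide set_integral_diff(1)) auto
    moreover have "indicat_real {0..T} t *\<^sub>R (((LINT \<omega>|M. pC t (X (\<Xi> k) t \<omega>) (flow \<xi> t)) - p t) / step_size k) = indicat_real {0..T} t *\<^sub>R hC k t" for t
      using meanC[of t k] step_pos[of k] by (cases "t \<in> {0..T}") (auto simp: p_def)
    ultimately show ?thesis unfolding set_integrable_def by simp
  qed
  \<comment> \<open>Optimality against the control \<open>\<Xi> k\<close>, divided by the step. The
    control cost is exactly linear along the segment, so its quotient is the constant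
    difference.\<close>
  have pos: "0 \<le> (LINT t:{0..T}|lborel. hC k t) + hG k + (mean_control_cost \<eta> - mean_control_cost \<xi>)" for k
  proof -
    have "(LINT t:{0..T}|lborel. (LINT \<omega>|M. pC t (X (\<Xi> k) t \<omega>) (flow \<xi> t))) = (LINT t:{0..T}|lborel. p t + step_size k * hC k t)"
      by (rule set_lebesgue_integral_cong) (auto simp: meanC p_def)
    also have "\<dots> = (LINT t:{0..T}|lborel. p t) + step_size k * (LINT t:{0..T}|lborel. hC k t)"
      using pi hCi[of k] by simp
    finally have 1: "cost M T X pC pG K (\<Xi> k) (flow \<xi>) = (LINT t:{0..T}|lborel. p t) + step_size k * (LINT t:{0..T}|lborel. hC k t)
       + ((LINT \<omega>|M. pG (X \<xi> T \<omega>) (flow \<xi> T)) + step_size k * hG k) + ((1 - step_size k) * mean_control_cost \<xi> + step_size k * mean_control_cost \<eta>)"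
      unfolding potential_cost_split(2)[OF \<xi> \<Xi>] meanG using mean_control_cost_convex[OF \<xi> \<eta> e] by (simp add: \<Xi>_def)
    have 2: "cost M T X pC pG K \<xi> (flow \<xi>) = (LINT t:{0..T}|lborel. p t) + (LINT \<omega>|M. pG (X \<xi> T \<omega>) (flow \<xi> T)) + mean_control_cost \<xi>"
      unfolding potential_cost_split(2)[OF \<xi> \<xi>] p_def ..
    have "0 \<le> step_size k * ((LINT t:{0..T}|lborel. hC k t) + hG k + (mean_control_cost \<eta> - mean_control_cost \<xi>))"
      using opt[OF \<Xi>, of k] unfolding 1 2 by (simp add: algebra_simps)
    then show ?thesis using step_pos[of k] by (simp add: zero_le_mult_iff)
  qed
  \<comment> \<open>Integrability in time of the quotients was read off from the split costs; their
    limit is measurable because it is a pointwise limit, and \<open>Bd\<close> dominates uniformly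
    in time.\<close>
  have lm: "(\<lambda>t. indicat_real {0..T} t *\<^sub>R lC t) \<in> borel_measurable lborel"
  proof (rule borel_measurable_LIMSEQ_metric)
    show "(\<lambda>t. indicat_real {0..T} t *\<^sub>R hC k t) \<in> borel_measurable lborel" for k
      using borel_measurable_integrable[OF hCi[of k, unfolded set_integrable_def]] .
    show "(\<lambda>k. indicat_real {0..T} t *\<^sub>R hC k t) \<longlonglongrightarrow> indicat_real {0..T} t *\<^sub>R lC t" for t
      using hC(1)[of t] by (cases "t \<in> {0..T}") auto
  qed
  have Bi: "integrable lborel (\<lambda>t. indicat_real {0..T} t * Bd)"
    using T by (intro integrable_mult_left integrable_real_indicator) auto
  have dct: "AE t in lborel. (\<lambda>k. indicat_real {0..T} t *\<^sub>R hC k t) \<longlonglongrightarrow> indicat_real {0..T} t *\<^sub>R lC t"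
    "AE t in lborel. norm (indicat_real {0..T} t *\<^sub>R hC k t) \<le> indicat_real {0..T} t * Bd" for k
    using hC(1) hCb by (auto simp: indicator_def)
  have li: "set_integrable lborel {0..T} lC"
    unfolding set_integrable_def
    by (rule integrable_dominated_convergence[OF lm borel_measurable_integrable[OF hCi[unfolded set_integrable_def]] Bi dct])
  have "(\<lambda>k. LINT t:{0..T}|lborel. hC k t) \<longlonglongrightarrow> (LINT t:{0..T}|lborel. lC t)"
    unfolding set_lebesgue_integral_def
    by (rule integral_dominated_convergence[OF lm borel_measurable_integrable[OF hCi[unfolded set_integrable_def]] Bi dct])
  then have "(\<lambda>k. (LINT t:{0..T}|lborel. hC k t) + hG k + (mean_control_cost \<eta> - mean_control_cost \<xi>)) \<longlonglongrightarrow> (LINT t:{0..T}|lborel. lC t) + lG + (mean_control_cost \<eta> - mean_control_cost \<xi>)"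
    by (intro tendsto_intros hG(1))
  then have deriv: "0 \<le> (LINT t:{0..T}|lborel. lC t) + lG + (mean_control_cost \<eta> - mean_control_cost \<xi>)"
    by (rule LIMSEQ_le_const) (use pos in auto)
  \<comment> \<open>The tangent inequalities in \<open>hC\<close> and \<open>hG\<close> bound the
    difference of the control costs by minus the derivative just shown to be nonnegative.\<close>
  have "(LINT t:{0..T}|lborel. (LINT \<omega>|M. C t (X \<xi> t \<omega>) (flow \<xi> t)) - (LINT \<omega>|M. C t (X \<eta> t \<omega>) (flow \<eta> t))) \<le> (LINT t:{0..T}|lborel. - lC t)"
    using hC(2) li mfc_cost_split(1)[OF \<xi>] mfc_cost_split(1)[OF \<eta>]
    by (intro set_integral_mono set_integral_diff(1)) (auto simp: set_integrable_def)
  moreover have "(LINT t:{0..T}|lborel. (LINT \<omega>|M. C t (X \<xi> t \<omega>) (flow \<xi> t)) - (LINT \<omega>|M. C t (X \<eta> t \<omega>) (flow \<eta> t)))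
    = (LINT t:{0..T}|lborel. (LINT \<omega>|M. C t (X \<xi> t \<omega>) (flow \<xi> t))) - (LINT t:{0..T}|lborel. (LINT \<omega>|M. C t (X \<eta> t \<omega>) (flow \<eta> t)))"
    by (rule set_integral_diff(2)[OF mfc_cost_split(1)[OF \<xi>] mfc_cost_split(1)[OF \<eta>]])
  moreover have "(LINT t:{0..T}|lborel. - lC t) = - (LINT t:{0..T}|lborel. lC t)"
    by (simp add: set_lebesgue_integral_def)
  ultimately show ?thesis
    using hG(2) deriv unfolding mfc_cost_split(2)[OF \<xi>] mfc_cost_split(2)[OF \<eta>] by linarith
qed

end

lemma continuous_map_slice:
  assumes h: "continuous_map (prod_topology (top_of_set S) Y) Z (\<lambda>(t, p). h t p)" and t: "t \<in> S"
  shows "continuous_map Y Z (h t)"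
proof -
  have "continuous_map Y (prod_topology (top_of_set S) Y) (\<lambda>p. (t, p))"
    using t by (simp add: continuous_map_paired)
  from continuous_map_compose[OF this h] show ?thesis by (simp add: comp_def)
qed

text \<open>At zero adjoint variables the convexity condition on the Hamiltonian becomes joint
  convexity of the running cost.\<close>

lemma hamiltonian_zero: "hamiltonian b \<sigma> C t x \<mu> 0 0 = C t x \<mu>"
  by (simp add: hamiltonian_def trace_def)

section \<open>Uniqueness of the equilibrium\<close>

context mean_field_control
begin

text \<open>An equilibrium flow coincides with the flow of laws on \<open>{0..T}\<close> only;
  outside it may take any values.\<close>

lemma cost_flow_cong:
  assumes "\<And>t. t \<in> {0..T} \<Longrightarrow> \<mu> t = \<nu> t"
  shows "cost M T X c g K \<xi> \<mu> = cost M T X c g K \<xi> \<nu>"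
proof -
  have "(LINT t:{0..T}|lborel. c t (X \<xi> t \<omega>) (\<mu> t)) = (LINT t:{0..T}|lborel. c t (X \<xi> t \<omega>) (\<nu> t))" for \<omega>
    by (rule set_lebesgue_integral_cong) (auto simp: assms)
  then show ?thesis by (simp add: cost_def assms[OF T_in])
qed

lemma potential_mfg_solution_is_mfc_solution:
  assumes "potential_mfg_solution M T F X C dC G dG K \<xi> \<mu>"
  shows "mfc_solution M T F X C G K \<xi>"
proof -
  have \<xi>: "\<xi> \<in> controls" and \<mu>: "\<And>t. t \<in> {0..T} \<Longrightarrow> \<mu> t = flow \<xi> t"
    and opt: "\<And>\<eta>. \<eta> \<in> controls \<Longrightarrow> cost M T X pC pG K \<xi> \<mu> \<le> cost M T X pC pG K \<eta> \<mu>"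
    using assms by (auto simp: potential_mfg_solution_def)
  have "cost M T X pC pG K \<eta> \<mu> = cost M T X pC pG K \<eta> (flow \<xi>)" for \<eta>
    by (rule cost_flow_cong) (rule \<mu>)
  then show ?thesis
    unfolding mfc_solution_def
    using \<xi> opt potential_minimizer_is_mfc_minimizer[OF \<xi>] by auto
qed

text \<open>The affine dependence of the state on the control at parameter 0, with the second
  control repeated, is uniqueness for the state equation.\<close>

lemma indistinguishable_flow:
  assumes \<xi>: "\<xi> \<in> controls" and \<eta>: "\<eta> \<in> controls" and ind: "indistinguishable M T \<xi> \<eta>" and t: "t \<in> {0..T}"
  shows "flow \<xi> t = flow \<eta> t"
proof -
  have "AE \<omega> in M. X \<xi> t \<omega> = (1 - 0) *\<^sub>R X \<eta> t \<omega> + 0 *\<^sub>R X \<eta> t \<omega>"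
    by (rule state_convex_unique[OF \<xi> \<eta> \<eta> state[OF \<xi>] state[OF \<eta>] state[OF \<eta>] _ _ _ _ _ t])
      (use ind in \<open>auto simp: indistinguishable_def\<close>)
  then show ?thesis
    unfolding law_def using X_measurable[OF \<xi> t] X_measurable[OF \<eta> t] by (intro distr_cong_AE) auto
qed

end

theorem corollary3p2:
  fixes T \<kappa> :: real
    and M :: "'w measure" and F :: "real \<Rightarrow> 'w measure" and W :: "real \<Rightarrow> 'w \<Rightarrow> real^'d"
    and b :: "real \<Rightarrow> real^'n \<Rightarrow> real^'n" and \<sigma> :: "real \<Rightarrow> real^'n \<Rightarrow> real^'d^'n"
    and \<zeta> :: "real \<Rightarrow> real^'m^'n" and K :: "real \<Rightarrow> real^'m" and x0 :: "real^'n"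
    and C :: "real \<Rightarrow> real^'n \<Rightarrow> (real^'n) measure \<Rightarrow> real"
    and G :: "real^'n \<Rightarrow> (real^'n) measure \<Rightarrow> real"
    and dC :: "real \<Rightarrow> real^'n \<Rightarrow> (real^'n) measure \<Rightarrow> real^'n \<Rightarrow> real"
    and dG :: "real^'n \<Rightarrow> (real^'n) measure \<Rightarrow> real^'n \<Rightarrow> real"
    and DxC :: "real \<Rightarrow> real^'n \<Rightarrow> (real^'n) measure \<Rightarrow> real^'n"
    and DxG :: "real^'n \<Rightarrow> (real^'n) measure \<Rightarrow> real^'n"
    and DydC :: "real \<Rightarrow> real^'n \<Rightarrow> (real^'n) measure \<Rightarrow> real^'n \<Rightarrow> real^'n"
    and DydG :: "real^'n \<Rightarrow> (real^'n) measure \<Rightarrow> real^'n \<Rightarrow> real^'n"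
    and X :: "(real \<Rightarrow> 'w \<Rightarrow> real^'m) \<Rightarrow> real \<Rightarrow> 'w \<Rightarrow> real^'n"
  assumes T_pos: "T > 0"
    and space: "usual_filtered_space M T F"
    and BM: "brownian_motion M T F W"
    and b_meas: "(\<lambda>(t, x). b t x) \<in> borel_measurable (restrict_space borel {0..T} \<Otimes>\<^sub>M borel)"
    and \<sigma>_meas: "(\<lambda>(t, x). \<sigma> t x) \<in> borel_measurable (restrict_space borel {0..T} \<Otimes>\<^sub>M borel)"
    and \<zeta>_meas: "\<zeta> \<in> borel_measurable (restrict_space borel {0..T})"
    and C_meas: "(\<lambda>(t, x, \<mu>). C t x \<mu>)
          \<in> borel_measurable (restrict_space borel {0..T} \<Otimes>\<^sub>M borel \<Otimes>\<^sub>M P2_borel)"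
    and G_meas: "(\<lambda>(x, \<mu>). G x \<mu>) \<in> borel_measurable (borel \<Otimes>\<^sub>M P2_borel)"
    and K: "continuous_on {0..T} K" "\<forall>t\<in>{0..T}. \<forall>j. 0 \<le> K t $ j"
    and state: "\<forall>\<xi>\<in>admissible M T F. sde_solution M T F W b \<sigma> \<zeta> x0 \<xi> (X \<xi>)"
    and A1: "\<exists>L. \<forall>t\<in>{0..T}. \<forall>x y.
          norm (b t x - b t y) \<le> L * norm (x - y) \<and> norm (\<sigma> t x - \<sigma> t y) \<le> L * norm (x - y)"
    and A2: "continuous_on {0..T} \<zeta>"
    and A3: "\<forall>t\<in>{0..T}. \<forall>x. linear_derivative (C t x) (dC t x)"
      "\<forall>x. linear_derivative (G x) (dG x)"
    and \<kappa>_pos: "\<kappa> > 0"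
    and A4_cont:
      "continuous_map (prod_topology (top_of_set {0..T}) (prod_topology euclidean P2_topology))
         euclideanreal (\<lambda>(t, x, \<mu>). C t x \<mu>)"
      "continuous_map (prod_topology euclidean P2_topology) euclideanreal (\<lambda>(x, \<mu>). G x \<mu>)"
      "continuous_map (prod_topology (top_of_set {0..T})
           (prod_topology euclidean (prod_topology P2_topology euclidean)))
         euclideanreal (\<lambda>(t, x, \<mu>, y). dC t x \<mu> y)"
      "continuous_map (prod_topology euclidean (prod_topology P2_topology euclidean))
         euclideanreal (\<lambda>(x, \<mu>, y). dG x \<mu> y)"
    and A4_growth: "\<forall>t\<in>{0..T}. \<forall>x. \<forall>\<mu>\<in>P2. \<forall>y.
          \<bar>C t x \<mu>\<bar> + \<bar>G x \<mu>\<bar> + \<bar>dC t x \<mu> y\<bar> + \<bar>dG x \<mu> y\<bar>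
          \<le> \<kappa> * (1 + (norm x)\<^sup>2 + (LINT z|\<mu>. (norm z)\<^sup>2) + (norm y)\<^sup>2)"
    and A5_deriv:
      "\<forall>t\<in>{0..T}. \<forall>x. \<forall>\<mu>\<in>P2. GDERIV (\<lambda>z. C t z \<mu>) x :> DxC t x \<mu>"
      "\<forall>x. \<forall>\<mu>\<in>P2. GDERIV (\<lambda>z. G z \<mu>) x :> DxG x \<mu>"
      "\<forall>t\<in>{0..T}. \<forall>x. \<forall>\<mu>\<in>P2. \<forall>y. GDERIV (\<lambda>z. dC t x \<mu> z) y :> DydC t x \<mu> y"
      "\<forall>x. \<forall>\<mu>\<in>P2. \<forall>y. GDERIV (\<lambda>z. dG x \<mu> z) y :> DydG x \<mu> y"
    and A5_cont:
      "continuous_map (prod_topology (top_of_set {0..T}) (prod_topology euclidean P2_topology))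
         euclidean (\<lambda>(t, x, \<mu>). DxC t x \<mu>)"
      "continuous_map (prod_topology euclidean P2_topology) euclidean (\<lambda>(x, \<mu>). DxG x \<mu>)"
      "continuous_map (prod_topology (top_of_set {0..T})
           (prod_topology euclidean (prod_topology P2_topology euclidean)))
         euclidean (\<lambda>(t, x, \<mu>, y). DydC t x \<mu> y)"
      "continuous_map (prod_topology euclidean (prod_topology P2_topology euclidean))
         euclidean (\<lambda>(x, \<mu>, y). DydG x \<mu> y)"
    and A5_growth: "\<forall>t\<in>{0..T}. \<forall>x. \<forall>\<mu>\<in>P2. \<forall>y.
          norm (DxC t x \<mu>) + norm (DxG x \<mu>) + norm (DydC t x \<mu> y) + norm (DydG x \<mu> y)
          \<le> \<kappa> * (1 + norm x + sqrt (LINT z|\<mu>. (norm z)\<^sup>2) + norm y)"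
    and B: "L_jointly_convex G"
      "\<forall>t\<in>{0..T}. \<forall>p q. L_jointly_convex (\<lambda>x \<mu>. hamiltonian b \<sigma> C t x \<mu> p q)"
    and mfc_unique: "\<forall>\<xi> \<xi>'. mfc_solution M T F X C G K \<xi> \<and> mfc_solution M T F X C G K \<xi>'
          \<longrightarrow> indistinguishable M T \<xi> \<xi>'"
  shows "\<forall>\<xi> \<mu> \<xi>' \<mu>'.
          potential_mfg_solution M T F X C dC G dG K \<xi> \<mu> \<and>
          potential_mfg_solution M T F X C dC G dG K \<xi>' \<mu>'
          \<longrightarrow> indistinguishable M T \<xi> \<xi>' \<and> (\<forall>t\<in>{0..T}. \<mu> t = \<mu>' t)"
proof (intro allI impI)
  fix \<xi> \<mu> \<xi>' \<mu>'
  assume sol: "potential_mfg_solution M T F X C dC G dG K \<xi> \<mu> \<and> potential_mfg_solution M T F X C dC G dG K \<xi>' \<mu>'"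
  obtain L where L: "\<And>t x y. t \<in> {0..T} \<Longrightarrow> norm (b t x - b t y) \<le> L * norm (x - y)"
    "\<And>t x y. t \<in> {0..T} \<Longrightarrow> norm (\<sigma> t x - \<sigma> t y) \<le> L * norm (x - y)"
    using A1 by blast
  \<comment> \<open>The Lipschitz constant from the assumption may be 0 or negative; enlarging it to
    \<open>\<bar>L\<bar> + 1\<close> provides the strict positivity that Gronwall uses.\<close>
  have L': "L * norm v \<le> (\<bar>L\<bar> + 1) * norm v" for v :: "real^'n" by (intro mult_right_mono) auto
  \<comment> \<open>The joint bound controls a sum of four terms for every \<open>y\<close>. The
    choice \<open>y = 0\<close> gives bounds for \<open>C\<close> and \<open>G\<close> that are free
    of \<open>y\<close>.\<close>
  have growth: "\<bar>C t x \<mu>\<bar> \<le> \<kappa> * (1 + (norm x)\<^sup>2 + (LINT z|\<mu>. (norm z)\<^sup>2))"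
    "\<bar>G x \<mu>\<bar> \<le> \<kappa> * (1 + (norm x)\<^sup>2 + (LINT z|\<mu>. (norm z)\<^sup>2))"
    "\<bar>dC t x \<mu> y\<bar> \<le> \<kappa> * (1 + (norm x)\<^sup>2 + (LINT z|\<mu>. (norm z)\<^sup>2) + (norm y)\<^sup>2)"
    "\<bar>dG x \<mu> y\<bar> \<le> \<kappa> * (1 + (norm x)\<^sup>2 + (LINT z|\<mu>. (norm z)\<^sup>2) + (norm y)\<^sup>2)"
    if "t \<in> {0..T}" "\<mu> \<in> P2" for t x \<mu> y
    using A4_growth[rule_format, OF that, of x y] A4_growth[rule_format, OF that, of x 0] by auto
  have growth': "norm (DxC t x \<mu>) \<le> \<kappa> * (1 + norm x + sqrt (LINT z|\<mu>. (norm z)\<^sup>2))"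
    "norm (DxG x \<mu>) \<le> \<kappa> * (1 + norm x + sqrt (LINT z|\<mu>. (norm z)\<^sup>2))"
    "norm (DydC t x \<mu> y) \<le> \<kappa> * (1 + norm x + sqrt (LINT z|\<mu>. (norm z)\<^sup>2) + norm y)"
    "norm (DydG x \<mu> y) \<le> \<kappa> * (1 + norm x + sqrt (LINT z|\<mu>. (norm z)\<^sup>2) + norm y)"
    if "t \<in> {0..T}" "\<mu> \<in> P2" for t x \<mu> y
    using A5_growth[rule_format, OF that, of x y] A5_growth[rule_format, OF that, of x 0]
      norm_ge_zero[of "DxC t x \<mu>"] norm_ge_zero[of "DxG x \<mu>"] norm_ge_zero[of "DydC t x \<mu> y"]
      norm_ge_zero[of "DydG x \<mu> y"] norm_ge_zero[of "DydC t x \<mu> 0"] norm_ge_zero[of "DydG x \<mu> 0"]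
    unfolding norm_zero add_0_right by linarith+
  have T0: "T \<in> {0..T}" using T_pos by simp
  have mfG: "mean_field_function G dG DxG DydG \<kappa>"
    using A3(2) A4_cont(2,4) A5_cont(2,4) A5_deriv(2,4) \<kappa>_pos B(1) growth(2,4)[OF T0] growth'(2,4)[OF T0]
    by unfold_locales (auto simp del: prod_topology_euclidean)
  have mfC: "mean_field_function (C t) (dC t) (DxC t) (DydC t) \<kappa>" if t: "t \<in> {0..T}" for t
  proof
    show "continuous_map (prod_topology euclidean P2_topology) euclideanreal (\<lambda>(x, \<mu>). C t x \<mu>)"
      by (rule continuous_map_slice[OF A4_cont(1) t])
    show "continuous_map (prod_topology euclidean (prod_topology P2_topology euclidean)) euclideanreal (\<lambda>(x, \<mu>, y). dC t x \<mu> y)"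
      by (rule continuous_map_slice[OF A4_cont(3) t])
    show "continuous_map (prod_topology euclidean P2_topology) euclidean (\<lambda>(x, \<mu>). DxC t x \<mu>)"
      by (rule continuous_map_slice[OF A5_cont(1) t])
    show "continuous_map (prod_topology euclidean (prod_topology P2_topology euclidean)) euclidean (\<lambda>(x, \<mu>, y). DydC t x \<mu> y)"
      by (rule continuous_map_slice[OF A5_cont(3) t])
    show "L_jointly_convex (C t)"
      using B(2)[rule_format, OF t, of 0 0] by (simp add: hamiltonian_zero)
    show "0 \<le> \<kappa>" using \<kappa>_pos by simp
  qed (use t A3(1) A5_deriv(1,3) growth(1,3)[OF t] growth'(1,3)[OF t] in auto)
  \<comment> \<open>Affinity of the coefficients is derived at some fixed measure in
    \<open>P2\<close>; the point mass at 0 serves as one.\<close>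
  have P: "law M (\<lambda>_. 0 :: real^'n) \<in> P2"
    using space by (subst P2_iff_law) (auto simp: usual_filtered_space_def)
  have sde: "controlled_sde T (\<bar>L\<bar> + 1) M F W b \<sigma> \<zeta>"
  proof
    show "norm (b t x - b t y) \<le> (\<bar>L\<bar> + 1) * norm (x - y)" "norm (\<sigma> t x - \<sigma> t y) \<le> (\<bar>L\<bar> + 1) * norm (x - y)"
      if "t \<in> {0..T}" for t x y
      using L[OF that, of x y] L'[of "x - y"] by linarith+
  qed (use T_pos space BM b_meas A2 in auto)
  have affine: "b t ((1 - s) *\<^sub>R x + s *\<^sub>R y) = (1 - s) *\<^sub>R b t x + s *\<^sub>R b t y"
    "\<sigma> t ((1 - s) *\<^sub>R x + s *\<^sub>R y) = (1 - s) *\<^sub>R \<sigma> t x + s *\<^sub>R \<sigma> t y"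
    if t: "t \<in> {0..T}" "0 \<le> s" "s \<le> 1" for t s x y
    using hamiltonian_convex_imp_affine[OF B(2)[rule_format, OF t(1)] P t(2,3)] by blast+
  interpret mean_field_control T "\<bar>L\<bar> + 1" M F W b \<sigma> \<zeta> x0 \<kappa> K C G dC dG DxC DxG DydC DydG X
    by (intro mean_field_control.intro mean_field_control_axioms.intro sde K(1) mfC mfG A4_cont(1,3) affine state[rule_format])
  have ind: "indistinguishable M T \<xi> \<xi>'"
    using mfc_unique sol potential_mfg_solution_is_mfc_solution by blast
  have "\<mu> t = \<mu>' t" if t: "t \<in> {0..T}" for t
    using indistinguishable_flow[OF _ _ ind t] sol t by (simp add: potential_mfg_solution_def)
  with ind show "indistinguishable M T \<xi> \<xi>' \<and> (\<forall>t\<in>{0..T}. \<mu> t = \<mu>' t)" by blast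
qed

end
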